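(* Suppose that $B\subseteq A$ is an extension of Artin algebras such that $\mathrm{rad}^{s}(B)$ is a left ideal of $A$ and that $B/\mathrm{rad}^{s-1}(B)$ is representation-finite for some integer $s\geq 1$. If $A$ is torsionless-finite, then $\mathrm{fin.dim}(B)<\infty$.
   Context: An Artin algebra is an algebra that is finitely generated as a module over a commutative Artin ring. All modules are finitely generated left modules. An extension $B\subseteq A$ of Artin algebras means that $B$ is a subalgebra of $A$ with the same identity. $\mathrm{rad}(B)$ is the Jacobson radical of $B$, $\mathrm{rad}^s(B)$ its $s$-th power, and $\mathrm{rad}^0(B)=B$. The finitistic dimension $\mathrm{fin.dim}(B)$ is the supremum of the projective dimensions of those $B$-modules having finite projective dimension. An algebra is representation-finite if it has only finitely many non-isomorphic indecomposable modules. It is torsionless-finite if there are only finitely many non-isomorphic indecomposable modules among its torsionless modules, i.e. the modules that are either projective or direct summands of first syzygies of modules (equivalently, submodules of projective modules). *)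

theory Defs
  imports
    "HOL-Algebra.Module" "HOL-Algebra.QuotRing" "HOL-Algebra.Subrings"
    "HOL-Algebra.Ideal_Product" "HOL-Library.Extended_Nat"
begin

section \<open>Left modules over a ring that need not be commutative\<close>

text \<open>The locale \<^locale>\<open>module\<close> asks for a commutative ring of scalars; this is the same list of
  axioms over an arbitrary ring. As there, the multiplication and the unit of the record
  \<open>M\<close> are ignored.\<close>

locale left_module = R?: ring R + M?: abelian_group M
  for R :: "('r, 'x) ring_scheme" (structure) and M :: "('r, 'm, 'y) module_scheme" (structure) +
  assumes smult_closed:
      "\<lbrakk>a \<in> carrier R; x \<in> carrier M\<rbrakk> \<Longrightarrow> a \<odot>\<^bsub>M\<^esub> x \<in> carrier M"
    and smult_l_distr:
      "\<lbrakk>a \<in> carrier R; b \<in> carrier R; x \<in> carrier M\<rbrakk> \<Longrightarrow>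
        (a \<oplus>\<^bsub>R\<^esub> b) \<odot>\<^bsub>M\<^esub> x = a \<odot>\<^bsub>M\<^esub> x \<oplus>\<^bsub>M\<^esub> b \<odot>\<^bsub>M\<^esub> x"
    and smult_r_distr:
      "\<lbrakk>a \<in> carrier R; x \<in> carrier M; y \<in> carrier M\<rbrakk> \<Longrightarrow>
        a \<odot>\<^bsub>M\<^esub> (x \<oplus>\<^bsub>M\<^esub> y) = a \<odot>\<^bsub>M\<^esub> x \<oplus>\<^bsub>M\<^esub> a \<odot>\<^bsub>M\<^esub> y"
    and smult_assoc1:
      "\<lbrakk>a \<in> carrier R; b \<in> carrier R; x \<in> carrier M\<rbrakk> \<Longrightarrow>
        (a \<otimes>\<^bsub>R\<^esub> b) \<odot>\<^bsub>M\<^esub> x = a \<odot>\<^bsub>M\<^esub> (b \<odot>\<^bsub>M\<^esub> x)"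
    and smult_one: "x \<in> carrier M \<Longrightarrow> \<one>\<^bsub>R\<^esub> \<odot>\<^bsub>M\<^esub> x = x"

definition fin_gen :: "('r, 'x) ring_scheme \<Rightarrow> ('r, 'm, 'y) module_scheme \<Rightarrow> bool" where
  "fin_gen R M \<longleftrightarrow> (\<exists>S. finite S \<and> S \<subseteq> carrier M \<and>
     (\<forall>m\<in>carrier M. \<exists>c\<in>S \<rightarrow> carrier R. m = (\<Oplus>\<^bsub>M\<^esub>s\<in>S. c s \<odot>\<^bsub>M\<^esub> s)))"

definition fg_module :: "('r, 'x) ring_scheme \<Rightarrow> ('r, 'm, 'y) module_scheme \<Rightarrow> bool" where
  "fg_module R M \<longleftrightarrow> left_module R M \<and> fin_gen R M"

definition lin_maps ::
  "('r, 'x) ring_scheme \<Rightarrow> ('r, 'm, 'y) module_scheme \<Rightarrow> ('r, 'n, 'z) module_scheme \<Rightarrow> ('m \<Rightarrow> 'n) set"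
  where "lin_maps R M N = {f \<in> carrier M \<rightarrow> carrier N.
     (\<forall>x\<in>carrier M. \<forall>y\<in>carrier M. f (x \<oplus>\<^bsub>M\<^esub> y) = f x \<oplus>\<^bsub>N\<^esub> f y) \<and>
     (\<forall>r\<in>carrier R. \<forall>x\<in>carrier M. f (r \<odot>\<^bsub>M\<^esub> x) = r \<odot>\<^bsub>N\<^esub> f x)}"

definition mod_iso ::
  "('r, 'x) ring_scheme \<Rightarrow> ('r, 'm, 'y) module_scheme \<Rightarrow> ('r, 'n, 'z) module_scheme \<Rightarrow> bool"
  where "mod_iso R M N \<longleftrightarrow> (\<exists>f\<in>lin_maps R M N. bij_betw f (carrier M) (carrier N))"

text \<open>Statements about all finitely generated modules over a ring with elements of type \<open>'r\<close>
  quantify over the modules whose elements have type \<open>(nat \<Rightarrow> 'r) set\<close>. Nothing is lost: a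
  quotient of $R^n$ consists of sets of coefficient vectors, so that every finitely generated
  module, on whatever type, is isomorphic to one of these (lemma \<open>fg_module_represented\<close>).\<close>

type_synonym 'r fgmod = "('r, (nat \<Rightarrow> 'r) set) module"

lemma fg_module_represented:
  fixes R :: "('r, 'x) ring_scheme" and M :: "('r, 'm, 'y) module_scheme"
  assumes "fg_module R M"
  shows "\<exists>N :: 'r fgmod. fg_module R N \<and> mod_iso R M N"
proof -
  interpret left_module R M using assms by (simp add: fg_module_def)
  obtain S where S: "finite S" "S \<subseteq> carrier M"
    and gen: "\<And>m. m \<in> carrier M \<Longrightarrow> \<exists>c\<in>S \<rightarrow> carrier R. m = (\<Oplus>\<^bsub>M\<^esub>s\<in>S. c s \<odot>\<^bsub>M\<^esub> s)"
    using assms by (auto simp: fg_module_def fin_gen_def)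
  obtain e :: "'m \<Rightarrow> nat" where e: "inj_on e S"
    using S(1) finite_imp_inj_to_nat_seg by blast
  define \<phi> where "\<phi> m = {c :: nat \<Rightarrow> 'r. (\<forall>s\<in>S. c (e s) \<in> carrier R) \<and>
      (\<Oplus>\<^bsub>M\<^esub>s\<in>S. c (e s) \<odot>\<^bsub>M\<^esub> s) = m}" for m
  have ne: "\<phi> m \<noteq> {}" if "m \<in> carrier M" for m
  proof -
    obtain c where c: "c \<in> S \<rightarrow> carrier R" "m = (\<Oplus>\<^bsub>M\<^esub>s\<in>S. c s \<odot>\<^bsub>M\<^esub> s)"
      using gen \<open>m \<in> carrier M\<close> by blast
    have "(\<Oplus>\<^bsub>M\<^esub>s\<in>S. c (inv_into S e (e s)) \<odot>\<^bsub>M\<^esub> s) = (\<Oplus>\<^bsub>M\<^esub>s\<in>S. c s \<odot>\<^bsub>M\<^esub> s)"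
      using e c(1) S(2) by (intro M.finsum_cong') (auto intro!: smult_closed simp: Pi_iff)
    then have "c \<circ> inv_into S e \<in> \<phi> m" using c e by (auto simp: \<phi>_def)
    then show ?thesis by blast
  qed
  have inj: "inj_on \<phi> (carrier M)"
  proof (rule inj_onI)
    fix x y assume "x \<in> carrier M" "y \<in> carrier M" "\<phi> x = \<phi> y"
    with ne[of x] obtain c where "c \<in> \<phi> x" "c \<in> \<phi> y" by blast
    then show "x = y" by (simp add: \<phi>_def)
  qed
  define \<psi> where "\<psi> = inv_into (carrier M) \<phi>"
  have \<psi>: "\<psi> (\<phi> m) = m" if "m \<in> carrier M" for m
    using inj that by (simp add: \<psi>_def)
  define N :: "'r fgmod" where "N = \<lparr>carrier = \<phi> ` carrier M, mult = (\<lambda>L Y. L),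
      one = {}, zero = \<phi> \<zero>\<^bsub>M\<^esub>, add = (\<lambda>L Y. \<phi> (\<psi> L \<oplus>\<^bsub>M\<^esub> \<psi> Y)),
      smult = (\<lambda>r L. \<phi> (r \<odot>\<^bsub>M\<^esub> \<psi> L))\<rparr>"
  have N: "carrier N = \<phi> ` carrier M" "\<zero>\<^bsub>N\<^esub> = \<phi> \<zero>\<^bsub>M\<^esub>"
    "\<And>x y. x \<in> carrier M \<Longrightarrow> y \<in> carrier M \<Longrightarrow> \<phi> x \<oplus>\<^bsub>N\<^esub> \<phi> y = \<phi> (x \<oplus>\<^bsub>M\<^esub> y)"
    "\<And>r x. x \<in> carrier M \<Longrightarrow> r \<odot>\<^bsub>N\<^esub> \<phi> x = \<phi> (r \<odot>\<^bsub>M\<^esub> x)"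
    by (simp_all add: N_def \<psi>)
  have ab: "abelian_group N"
  proof (rule abelian_groupI)
    fix L assume "L \<in> carrier N"
    then obtain x where x: "x \<in> carrier M" "L = \<phi> x" by (auto simp: N)
    then show "\<exists>Y\<in>carrier N. Y \<oplus>\<^bsub>N\<^esub> L = \<zero>\<^bsub>N\<^esub>"
      by (intro bexI[of _ "\<phi> (\<ominus>\<^bsub>M\<^esub> x)"]) (auto simp: N M.l_neg)
  qed (auto simp: N M.a_ac)
  then interpret N: abelian_group N .
  have lm: "left_module R N"
    by (intro left_module.intro left_module_axioms.intro ab R.ring_axioms)
       (auto simp: N smult_closed smult_l_distr smult_r_distr smult_assoc1 smult_one)
  have sum: "\<phi> (\<Oplus>\<^bsub>M\<^esub>s\<in>T. f s) = (\<Oplus>\<^bsub>N\<^esub>s\<in>T. \<phi> (f s))"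
    if "finite T" "f \<in> T \<rightarrow> carrier M" for T :: "'m set" and f
    using that
  proof (induction T)
    case (insert t T)
    then have "f \<in> T \<rightarrow> carrier M" "f t \<in> carrier M" by auto
    moreover from this have "(\<lambda>s. \<phi> (f s)) \<in> T \<rightarrow> carrier N" "\<phi> (f t) \<in> carrier N"
      by (auto simp: N)
    ultimately show ?case using insert by (simp flip: N(3))
  qed (simp add: N)
  have "fin_gen R N"
    unfolding fin_gen_def
  proof (intro exI[of _ "\<phi> ` S"] conjI ballI)
    fix L assume "L \<in> carrier N"
    then obtain x where x: "x \<in> carrier M" "L = \<phi> x" by (auto simp: N)
    obtain c where c: "c \<in> S \<rightarrow> carrier R" "x = (\<Oplus>\<^bsub>M\<^esub>s\<in>S. c s \<odot>\<^bsub>M\<^esub> s)"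
      using gen x by blast
    have cl: "(\<lambda>s. c s \<odot>\<^bsub>M\<^esub> s) \<in> S \<rightarrow> carrier M" using c S by (auto intro!: smult_closed)
    have inj': "inj_on \<phi> S" using inj S(2) inj_on_subset by blast
    have in_N: "c (\<psi> Y) \<odot>\<^bsub>N\<^esub> Y \<in> carrier N" if "Y \<in> \<phi> ` S" for Y
      using that S c by (auto simp: N \<psi> subset_iff intro!: imageI smult_closed)
    have "L = (\<Oplus>\<^bsub>N\<^esub>s\<in>S. \<phi> (c s \<odot>\<^bsub>M\<^esub> s))" using sum[OF S(1) cl] x c by simp
    also have "\<dots> = (\<Oplus>\<^bsub>N\<^esub>s\<in>S. c (\<psi> (\<phi> s)) \<odot>\<^bsub>N\<^esub> \<phi> s)"
      using S c in_N by (intro N.finsum_cong') (auto simp: N \<psi> subset_iff)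
    also have "\<dots> = (\<Oplus>\<^bsub>N\<^esub>Y\<in>\<phi> ` S. c (\<psi> Y) \<odot>\<^bsub>N\<^esub> Y)"
      using in_N by (intro N.finsum_reindex[symmetric] inj') auto
    finally show "\<exists>c\<in>\<phi> ` S \<rightarrow> carrier R. L = (\<Oplus>\<^bsub>N\<^esub>s\<in>\<phi> ` S. c s \<odot>\<^bsub>N\<^esub> s)"
      using c S by (intro bexI[of _ "\<lambda>Y. c (\<psi> Y)"]) (auto simp: \<psi> subset_iff)
  qed (use S in \<open>auto simp: N\<close>)
  moreover have "\<phi> \<in> lin_maps R M N" "bij_betw \<phi> (carrier M) (carrier N)"
    using inj by (auto simp: lin_maps_def N bij_betw_def)
  ultimately show ?thesis using lm by (auto simp: fg_module_def mod_iso_def)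
qed

section \<open>Projective modules, projective and finitistic dimension\<close>

definition projective :: "('r, 'x) ring_scheme \<Rightarrow> 'r fgmod \<Rightarrow> bool" where
  "projective R P \<longleftrightarrow> fg_module R P \<and>
     (\<forall>(L :: 'r fgmod) (Y :: 'r fgmod). \<forall>g\<in>lin_maps R L Y. \<forall>f\<in>lin_maps R P Y.
        fg_module R L \<and> fg_module R Y \<and> g ` carrier L = carrier Y \<longrightarrow>
        (\<exists>h\<in>lin_maps R P L. \<forall>p\<in>carrier P. g (h p) = f p))"

text \<open>Exactness of $0 \to P_n \to \cdots \to P_0 \to M \to 0$ with differentials $d_0 : P_0 \to M$
  and $d_{i+1} : P_{i+1} \to P_i$; thus \<open>case_nat M P i\<close> is the target of $d_i$.\<close>

definition proj_resolution ::
  "('r, 'x) ring_scheme \<Rightarrow> 'r fgmod \<Rightarrow> nat \<Rightarrow> (nat \<Rightarrow> 'r fgmod) \<Rightarrow>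
     (nat \<Rightarrow> (nat \<Rightarrow> 'r) set \<Rightarrow> (nat \<Rightarrow> 'r) set) \<Rightarrow> bool"
  where "proj_resolution R M n P d \<longleftrightarrow>
     (\<forall>i\<le>n. projective R (P i) \<and> d i \<in> lin_maps R (P i) (case_nat M P i)) \<and>
     d 0 ` carrier (P 0) = carrier M \<and>
     (\<forall>i<n. d (Suc i) ` carrier (P (Suc i)) = a_kernel (P i) (case_nat M P i) (d i)) \<and>
     inj_on (d n) (carrier (P n))"

text \<open>The infimum of the empty set is \<open>\<infinity>\<close>.\<close>

definition proj_dim :: "('r, 'x) ring_scheme \<Rightarrow> 'r fgmod \<Rightarrow> enat" where
  "proj_dim R M = Inf {enat n | n. \<exists>P d. proj_resolution R M n P d}"

definition fin_dim :: "('r, 'x) ring_scheme \<Rightarrow> enat" where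
  "fin_dim R = Sup {proj_dim R M | M. fg_module R M \<and> proj_dim R M < \<infinity>}"

section \<open>Representation-finite and torsionless-finite rings\<close>

definition internal_direct_sum ::
  "('r, 'x) ring_scheme \<Rightarrow> ('r, 'm, 'y) module_scheme \<Rightarrow> 'm set \<Rightarrow> 'm set \<Rightarrow> bool"
  where "internal_direct_sum R M U V \<longleftrightarrow> submodule U R M \<and> submodule V R M \<and>
     U \<inter> V = {\<zero>\<^bsub>M\<^esub>} \<and> U <+>\<^bsub>M\<^esub> V = carrier M"

definition indecomposable :: "('r, 'x) ring_scheme \<Rightarrow> ('r, 'm, 'y) module_scheme \<Rightarrow> bool" where
  "indecomposable R M \<longleftrightarrow> carrier M \<noteq> {\<zero>\<^bsub>M\<^esub>} \<and>
     (\<forall>U V. internal_direct_sum R M U V \<longrightarrow> U = {\<zero>\<^bsub>M\<^esub>} \<or> V = {\<zero>\<^bsub>M\<^esub>})"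

definition finite_upto_iso :: "('r, 'x) ring_scheme \<Rightarrow> 'r fgmod set \<Rightarrow> bool" where
  "finite_upto_iso R C \<longleftrightarrow> (\<exists>S\<subseteq>C. finite S \<and> (\<forall>M\<in>C. \<exists>N\<in>S. mod_iso R M N))"

definition representation_finite :: "('r, 'x) ring_scheme \<Rightarrow> bool" where
  "representation_finite R \<longleftrightarrow> finite_upto_iso R {M. fg_module R M \<and> indecomposable R M}"

definition projective_cover ::
  "('r, 'x) ring_scheme \<Rightarrow> 'r fgmod \<Rightarrow> ((nat \<Rightarrow> 'r) set \<Rightarrow> (nat \<Rightarrow> 'r) set) \<Rightarrow> 'r fgmod \<Rightarrow> bool"
  where "projective_cover R P f L \<longleftrightarrow> projective R P \<and> f \<in> lin_maps R P L \<and>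
     f ` carrier P = carrier L \<and>
     (\<forall>U. submodule U R P \<and> U <+>\<^bsub>P\<^esub> a_kernel P L f = carrier P \<longrightarrow> U = carrier P)"

text \<open>A module is torsionless if it is projective or a direct summand, up to isomorphism, of the
  first syzygy of some module \<open>L\<close>, i.e. of the kernel of a projective cover of \<open>L\<close>.\<close>

definition torsionless :: "('r, 'x) ring_scheme \<Rightarrow> 'r fgmod \<Rightarrow> bool" where
  "torsionless R M \<longleftrightarrow> fg_module R M \<and> (projective R M \<or>
     (\<exists>L P f U V. fg_module R L \<and> projective_cover R P f L \<and>
        internal_direct_sum R (P\<lparr>carrier := a_kernel P L f\<rparr>) U V \<and>
        mod_iso R M (P\<lparr>carrier := U\<rparr>)))"

definition torsionless_finite :: "('r, 'x) ring_scheme \<Rightarrow> bool" where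
  "torsionless_finite R \<longleftrightarrow> finite_upto_iso R {M. torsionless R M \<and> indecomposable R M}"

section \<open>The Jacobson radical\<close>

definition left_ideal :: "'a set \<Rightarrow> ('a, 'x) ring_scheme \<Rightarrow> bool" where
  "left_ideal I R \<longleftrightarrow> additive_subgroup I R \<and> (\<forall>a\<in>carrier R. \<forall>x\<in>I. a \<otimes>\<^bsub>R\<^esub> x \<in> I)"

definition maximal_left_ideal :: "'a set \<Rightarrow> ('a, 'x) ring_scheme \<Rightarrow> bool" where
  "maximal_left_ideal I R \<longleftrightarrow> left_ideal I R \<and> I \<noteq> carrier R \<and>
     (\<forall>J. left_ideal J R \<and> I \<subseteq> J \<longrightarrow> J = I \<or> J = carrier R)"

definition jacobson_radical :: "('a, 'x) ring_scheme \<Rightarrow> 'a set" where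
  "jacobson_radical R = carrier R \<inter> \<Inter>{I. maximal_left_ideal I R}"

fun rad_power :: "('a, 'x) ring_scheme \<Rightarrow> nat \<Rightarrow> 'a set" where
  "rad_power R 0 = carrier R"
| "rad_power R (Suc n) = ideal_prod R (jacobson_radical R) (rad_power R n)"

section \<open>Artin algebras\<close>

definition artinian_cring :: "('k, 'x) ring_scheme \<Rightarrow> bool" where
  "artinian_cring K \<longleftrightarrow> cring K \<and>
     (\<forall>I. (\<forall>n::nat. ideal (I n) K \<and> I (Suc n) \<subseteq> I n) \<longrightarrow> (\<exists>n. \<forall>m\<ge>n. I m = I n))"

text \<open>The record \<open>A\<close> carries both the ring and the \<open>K\<close>-module structure of the algebra; the two
  equations relating them say that \<open>K\<close> acts through the centre of \<open>A\<close>.\<close>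

definition artin_algebra :: "('k, 'x) ring_scheme \<Rightarrow> ('k, 'a, 'y) module_scheme \<Rightarrow> bool" where
  "artin_algebra K A \<longleftrightarrow> artinian_cring K \<and> ring A \<and> module K A \<and>
     (\<forall>k\<in>carrier K. \<forall>x\<in>carrier A. \<forall>y\<in>carrier A.
        (k \<odot>\<^bsub>A\<^esub> x) \<otimes>\<^bsub>A\<^esub> y = k \<odot>\<^bsub>A\<^esub> (x \<otimes>\<^bsub>A\<^esub> y) \<and>
        x \<otimes>\<^bsub>A\<^esub> (k \<odot>\<^bsub>A\<^esub> y) = k \<odot>\<^bsub>A\<^esub> (x \<otimes>\<^bsub>A\<^esub> y)) \<and>
     fin_gen K A"

text \<open>\<^locale>\<open>subring\<close> includes that \<open>B\<close> contains the identity of \<open>A\<close>.\<close>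

definition artin_extension ::
  "('k, 'x) ring_scheme \<Rightarrow> 'a set \<Rightarrow> ('k, 'a, 'y) module_scheme \<Rightarrow> bool"
  where "artin_extension K B A \<longleftrightarrow> artin_algebra K A \<and> subring B A \<and> submodule B K A \<and>
     artin_algebra K (A\<lparr>carrier := B\<rparr>)"

end

(*
  Write R = B. Let X be an R-module of finite projective dimension and let Z, inside rad(R)^n, be its second
  syzygy. The elements of Z with coordinates in rad^s(R) form a submodule Z' that is cut out by maps between
  free R-modules, which are right multiplications by matrices over R. As rad^s(R) is a left ideal of A, Z' is an
  A-submodule of A^n, hence a sum of indecomposable torsionless A-modules, while Z/Z' is a module over
  R/rad^(s-1)(R). So there is an exact sequence 0 -> L -> N -> Z -> 0 in which L and N are, up to projective
  summands, sums of members of a finite family (T_j) of R-modules depending on neither X nor Z.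

  It remains to bound pd Z, as Igusa and Todorov do, but without the Krull-Schmidt theorem. Let u, v be the
  multiplicity vectors of L and N. The differences of multiplicity vectors whose n-th syzygies are stably
  isomorphic form an ascending chain of subgroups of Z^k, stable from some n0 on; the chain contains u - v because
  pd Z is finite. After passing to n0-th syzygies and adding a common summand, L and N are therefore stably
  isomorphic, and L -> N becomes an endomorphism e of L which is monic modulo the ideal of maps factoring through
  modules of finite projective dimension. By Fitting's lemma e is invertible modulo this ideal. As R is an Artin
  algebra, on the fixed family the ideal already consists of maps factoring through modules of projective
  dimension at most some n1, and an inverse of e modulo such maps bounds pd Z.
*)

theory Submission
  imports Defs
begin

section \<open>Left modules and linear maps\<close>

text \<open>The second syzygy is used because a first syzygy is a mere submodule of a free module,
  which multiplication by elements of A need not respect; a kernel of maps between free modules is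
  respected as long as the product stays in R^n. Minimality of the second cover puts Z into the
  radical, so that rad^(s-1) sends Z into rad^s; hence the exponent s-1 in the hypothesis. The
  sequence 0 -> Z' -> Z -> Q -> 0 has Z in the middle, whereas the method bounds the third term.
  Lifting a projective F -> Q to Z turns it into 0 -> syz Q -> Z' + F -> Z -> 0. The family
  therefore consists of torsionless A-modules restricted to R and of syzygies of modules over
  R/rad^(s-1). A module is not assumed to determine its multiplicities, so a vector is carried along
  with each module; that Z^k is noetherian takes the place of unique decomposition. The bound is n0
  + n1 + 1 for Z and n0 + n1 + 3 for X. Both numbers come from chain conditions on the fixed family
  and are not computed.\<close>

context left_module
begin

lemma smult_l_null [simp]: "x \<in> carrier M \<Longrightarrow> \<zero> \<odot>\<^bsub>M\<^esub> x = \<zero>\<^bsub>M\<^esub>"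
  using smult_l_distr[of \<zero> \<zero> x] smult_closed[of \<zero> x] by (metis M.add.r_cancel_one' R.l_zero R.zero_closed)

lemma smult_r_null [simp]: "a \<in> carrier R \<Longrightarrow> a \<odot>\<^bsub>M\<^esub> \<zero>\<^bsub>M\<^esub> = \<zero>\<^bsub>M\<^esub>"
  using smult_r_distr[of a "\<zero>\<^bsub>M\<^esub>" "\<zero>\<^bsub>M\<^esub>"] smult_closed[of a "\<zero>\<^bsub>M\<^esub>"] by (metis M.add.r_cancel_one' M.l_zero M.zero_closed)

lemma smult_l_minus:
  assumes "a \<in> carrier R" "x \<in> carrier M"
  shows "(\<ominus> a) \<odot>\<^bsub>M\<^esub> x = \<ominus>\<^bsub>M\<^esub> (a \<odot>\<^bsub>M\<^esub> x)"
proof -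
  have "(\<ominus> a) \<odot>\<^bsub>M\<^esub> x \<oplus>\<^bsub>M\<^esub> a \<odot>\<^bsub>M\<^esub> x = \<zero>\<^bsub>M\<^esub>"
    using smult_l_distr[of "\<ominus> a" a x] assms by (simp add: R.l_neg)
  then show ?thesis using assms by (metis M.minus_equality R.a_inv_closed smult_closed)
qed

lemma smult_minus_one: "x \<in> carrier M \<Longrightarrow> (\<ominus> \<one>) \<odot>\<^bsub>M\<^esub> x = \<ominus>\<^bsub>M\<^esub> x"
  by (simp add: smult_l_minus smult_one)

text \<open>Closure under negatives comes from the scalar minus one, so the axioms of
  \<open>submodule\<close> reduce to these four conditions; later submodule proofs go through this
  form.\<close>

lemma submodule_iff:
  "submodule U R M \<longleftrightarrow> U \<subseteq> carrier M \<and> \<zero>\<^bsub>M\<^esub> \<in> U \<and> (\<forall>x\<in>U. \<forall>y\<in>U. x \<oplus>\<^bsub>M\<^esub> y \<in> U) \<and>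
     (\<forall>r\<in>carrier R. \<forall>x\<in>U. r \<odot>\<^bsub>M\<^esub> x \<in> U)" (is "_ = ?r")
proof
  assume "submodule U R M"
  then interpret submodule U R M .
  show ?r using subset m_closed one_closed by auto
next
  assume r: ?r
  have "\<ominus>\<^bsub>M\<^esub> x \<in> U" if "x \<in> U" for x
    using r that smult_minus_one[of x] by (metis R.add.inv_closed R.one_closed subsetD)
  with r show "submodule U R M"
    by (unfold_locales) (auto simp flip: a_inv_def)
qed

lemma submodule_minus:
  assumes "submodule U R M" "x \<in> U" shows "\<ominus>\<^bsub>M\<^esub> x \<in> U"
proof -
  have "x \<in> carrier M" using assms by (auto simp: submodule_iff)
  moreover have "(\<ominus> \<one>) \<odot>\<^bsub>M\<^esub> x \<in> U" using assms by (simp add: submodule_iff)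
  ultimately show ?thesis by (simp add: smult_minus_one)
qed

lemma submodule_left_module: "submodule U R M \<Longrightarrow> left_module R (M\<lparr>carrier := U\<rparr>)"
proof -
  assume U: "submodule U R M"
  then have "U \<subseteq> carrier M" "\<zero>\<^bsub>M\<^esub> \<in> U" by (auto simp: submodule_iff)
  have neg: "\<ominus>\<^bsub>M\<^esub> x \<in> U" if "x \<in> U" for x
    using U that by (rule submodule_minus)
  have "abelian_group (M\<lparr>carrier := U\<rparr>)"
  proof (rule abelian_groupI)
    fix x assume "x \<in> carrier (M\<lparr>carrier := U\<rparr>)"
    then show "\<exists>y\<in>carrier (M\<lparr>carrier := U\<rparr>). y \<oplus>\<^bsub>M\<lparr>carrier := U\<rparr>\<^esub> x = \<zero>\<^bsub>M\<lparr>carrier := U\<rparr>\<^esub>"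
      using neg[of x] \<open>U \<subseteq> carrier M\<close> by (auto intro!: bexI[of _ "\<ominus>\<^bsub>M\<^esub> x"] M.l_neg)
  qed (use U in \<open>auto simp: submodule_iff subset_iff M.a_ac\<close>)
  then show ?thesis
    using U by (intro left_module.intro left_module_axioms.intro R.ring_axioms)
      (auto simp: submodule_iff subset_iff smult_l_distr smult_r_distr smult_assoc1 smult_one)
qed

lemma submodule_carrier: "submodule (carrier M) R M"
  by (auto simp: submodule_iff smult_closed)

lemma submodule_zero: "submodule {\<zero>\<^bsub>M\<^esub>} R M"
  by (auto simp: submodule_iff)

lemma submodule_Int: "submodule U R M \<Longrightarrow> submodule V R M \<Longrightarrow> submodule (U \<inter> V) R M"
  by (auto simp: submodule_iff)

lemma submodule_sum:
  assumes "submodule U R M" "submodule V R M" shows "submodule (U <+>\<^bsub>M\<^esub> V) R M"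
  unfolding submodule_iff set_add_def'
proof (intro conjI ballI)
  show "(\<Union>h\<in>U. \<Union>k\<in>V. {h \<oplus>\<^bsub>M\<^esub> k}) \<subseteq> carrier M" using assms by (auto simp: submodule_iff subset_iff)
  show "\<zero>\<^bsub>M\<^esub> \<in> (\<Union>h\<in>U. \<Union>k\<in>V. {h \<oplus>\<^bsub>M\<^esub> k})" using assms by (auto simp: submodule_iff intro!: bexI[of _ "\<zero>\<^bsub>M\<^esub>"])
next
  fix x y assume "x \<in> (\<Union>h\<in>U. \<Union>k\<in>V. {h \<oplus>\<^bsub>M\<^esub> k})" "y \<in> (\<Union>h\<in>U. \<Union>k\<in>V. {h \<oplus>\<^bsub>M\<^esub> k})"
  then obtain a b c d where *: "a \<in> U" "b \<in> V" "c \<in> U" "d \<in> V" "x = a \<oplus>\<^bsub>M\<^esub> b" "y = c \<oplus>\<^bsub>M\<^esub> d" by auto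
  then have "a \<in> carrier M" "b \<in> carrier M" "c \<in> carrier M" "d \<in> carrier M"
    using assms by (auto simp: submodule_iff)
  then have eq: "x \<oplus>\<^bsub>M\<^esub> y = (a \<oplus>\<^bsub>M\<^esub> c) \<oplus>\<^bsub>M\<^esub> (b \<oplus>\<^bsub>M\<^esub> d)" using * by (simp add: M.a_ac)
  have "a \<oplus>\<^bsub>M\<^esub> c \<in> U" "b \<oplus>\<^bsub>M\<^esub> d \<in> V" using * assms by (simp_all add: submodule_iff)
  then show "x \<oplus>\<^bsub>M\<^esub> y \<in> (\<Union>h\<in>U. \<Union>k\<in>V. {h \<oplus>\<^bsub>M\<^esub> k})" unfolding eq by blast
next
  fix r x assume "r \<in> carrier R" "x \<in> (\<Union>h\<in>U. \<Union>k\<in>V. {h \<oplus>\<^bsub>M\<^esub> k})"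
  then obtain a b where *: "a \<in> U" "b \<in> V" "x = a \<oplus>\<^bsub>M\<^esub> b" by auto
  then have "a \<in> carrier M" "b \<in> carrier M" using assms by (auto simp: submodule_iff)
  with * \<open>r \<in> carrier R\<close> have eq: "r \<odot>\<^bsub>M\<^esub> x = r \<odot>\<^bsub>M\<^esub> a \<oplus>\<^bsub>M\<^esub> r \<odot>\<^bsub>M\<^esub> b" by (simp add: smult_r_distr)
  have "r \<odot>\<^bsub>M\<^esub> a \<in> U" "r \<odot>\<^bsub>M\<^esub> b \<in> V" using * \<open>r \<in> carrier R\<close> assms by (simp_all add: submodule_iff)
  then show "r \<odot>\<^bsub>M\<^esub> x \<in> (\<Union>h\<in>U. \<Union>k\<in>V. {h \<oplus>\<^bsub>M\<^esub> k})" unfolding eq by blast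
qed

lemma submodule_sub_iff:
  assumes "submodule U R M"
  shows "submodule V R (M\<lparr>carrier := U\<rparr>) \<longleftrightarrow> submodule V R M \<and> V \<subseteq> U"
proof -
  interpret U: left_module R "M\<lparr>carrier := U\<rparr>" by (rule submodule_left_module[OF assms])
  show ?thesis using assms unfolding submodule_iff U.submodule_iff by auto
qed

lemma set_add_le:
  assumes "submodule U R M" "submodule V R M" shows "U \<subseteq> U <+>\<^bsub>M\<^esub> V" "V \<subseteq> U <+>\<^bsub>M\<^esub> V"
proof -
  have *: "U \<subseteq> carrier M" "\<zero>\<^bsub>M\<^esub> \<in> U" "V \<subseteq> carrier M" "\<zero>\<^bsub>M\<^esub> \<in> V" using assms by (auto simp: submodule_iff)
  have "u \<oplus>\<^bsub>M\<^esub> \<zero>\<^bsub>M\<^esub> \<in> U <+>\<^bsub>M\<^esub> V" if "u \<in> U" for u using * that unfolding set_add_def' by blast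
  with * show "U \<subseteq> U <+>\<^bsub>M\<^esub> V" by (metis M.r_zero subsetD subsetI)
  have "\<zero>\<^bsub>M\<^esub> \<oplus>\<^bsub>M\<^esub> u \<in> U <+>\<^bsub>M\<^esub> V" if "u \<in> V" for u using * that unfolding set_add_def' by blast
  with * show "V \<subseteq> U <+>\<^bsub>M\<^esub> V" by (metis M.l_zero subsetD subsetI)
qed

lemma set_add_least:
  assumes "submodule W R M" "U \<subseteq> W" "V \<subseteq> W" shows "U <+>\<^bsub>M\<^esub> V \<subseteq> W"
  using assms by (auto simp: submodule_iff set_add_def' subset_iff)

end

section \<open>Linear maps and isomorphisms\<close>

lemma lin_closed: "f \<in> lin_maps R M N \<Longrightarrow> x \<in> carrier M \<Longrightarrow> f x \<in> carrier N"
  by (auto simp: lin_maps_def)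

lemma lin_add: "f \<in> lin_maps R M N \<Longrightarrow> x \<in> carrier M \<Longrightarrow> y \<in> carrier M \<Longrightarrow> f (x \<oplus>\<^bsub>M\<^esub> y) = f x \<oplus>\<^bsub>N\<^esub> f y"
  by (auto simp: lin_maps_def)

lemma lin_smult: "f \<in> lin_maps R M N \<Longrightarrow> r \<in> carrier R \<Longrightarrow> x \<in> carrier M \<Longrightarrow> f (r \<odot>\<^bsub>M\<^esub> x) = r \<odot>\<^bsub>N\<^esub> f x"
  by (auto simp: lin_maps_def)

lemma linI:
  assumes "\<And>x. x \<in> carrier M \<Longrightarrow> f x \<in> carrier N"
    "\<And>x y. x \<in> carrier M \<Longrightarrow> y \<in> carrier M \<Longrightarrow> f (x \<oplus>\<^bsub>M\<^esub> y) = f x \<oplus>\<^bsub>N\<^esub> f y"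
    "\<And>r x. r \<in> carrier R \<Longrightarrow> x \<in> carrier M \<Longrightarrow> f (r \<odot>\<^bsub>M\<^esub> x) = r \<odot>\<^bsub>N\<^esub> f x"
  shows "f \<in> lin_maps R M N"
  using assms by (auto simp: lin_maps_def)

lemma lin_zero:
  assumes "left_module R M" "left_module R N" "f \<in> lin_maps R M N" shows "f \<zero>\<^bsub>M\<^esub> = \<zero>\<^bsub>N\<^esub>"
proof -
  interpret M: left_module R M by fact
  interpret N: left_module R N by fact
  have "f (\<zero>\<^bsub>M\<^esub>) = f (\<zero>\<^bsub>R\<^esub> \<odot>\<^bsub>M\<^esub> \<zero>\<^bsub>M\<^esub>)" by simp
  also have "\<dots> = \<zero>\<^bsub>N\<^esub>" using lin_smult[OF assms(3), of "\<zero>\<^bsub>R\<^esub>" "\<zero>\<^bsub>M\<^esub>"] lin_closed[OF assms(3), of "\<zero>\<^bsub>M\<^esub>"] by simp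
  finally show ?thesis .
qed

lemma lin_minus:
  assumes "left_module R M" "left_module R N" "f \<in> lin_maps R M N" "x \<in> carrier M"
  shows "f (\<ominus>\<^bsub>M\<^esub> x) = \<ominus>\<^bsub>N\<^esub> f x"
proof -
  interpret M: left_module R M by fact
  interpret N: left_module R N by fact
  have "f (\<ominus>\<^bsub>M\<^esub> x) = f ((\<ominus>\<^bsub>R\<^esub> \<one>\<^bsub>R\<^esub>) \<odot>\<^bsub>M\<^esub> x)" using assms by (simp add: M.smult_minus_one)
  also have "\<dots> = \<ominus>\<^bsub>N\<^esub> f x"
    using lin_smult[OF assms(3), of "\<ominus>\<^bsub>R\<^esub> \<one>\<^bsub>R\<^esub>" x] lin_closed[OF assms(3)] assms by (simp add: N.smult_minus_one)
  finally show ?thesis .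
qed

lemma lin_id: "id \<in> lin_maps R M M" by (auto simp: lin_maps_def)

lemma lin_comp: "f \<in> lin_maps R M N \<Longrightarrow> g \<in> lin_maps R N L \<Longrightarrow> (\<lambda>x. g (f x)) \<in> lin_maps R M L"
  by (auto simp: lin_maps_def Pi_iff)

lemma lin_restrict: "f \<in> lin_maps R M N \<Longrightarrow> U \<subseteq> carrier M \<Longrightarrow> f \<in> lin_maps R (M\<lparr>carrier := U\<rparr>) N"
  by (auto simp: lin_maps_def Pi_iff subset_iff)

lemma lin_corestrict: "f \<in> lin_maps R M N \<Longrightarrow> f ` carrier M \<subseteq> U \<Longrightarrow> f \<in> lin_maps R M (N\<lparr>carrier := U\<rparr>)"
  by (auto simp: lin_maps_def Pi_iff subset_iff)

lemma lin_inv_into: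
  assumes "left_module R M" "f \<in> lin_maps R M N" "inj_on f (carrier M)" "U = f ` carrier M"
  shows "inv_into (carrier M) f \<in> lin_maps R (N\<lparr>carrier := U\<rparr>) M"
proof -
  interpret M: left_module R M by fact
  have "inv_into (carrier M) f (f x \<oplus>\<^bsub>N\<^esub> f y) = x \<oplus>\<^bsub>M\<^esub> y" if "x \<in> carrier M" "y \<in> carrier M" for x y
    using that lin_add[OF assms(2), of x y] assms(3) by (metis M.a_closed inv_into_f_f)
  moreover have "inv_into (carrier M) f (r \<odot>\<^bsub>N\<^esub> f x) = r \<odot>\<^bsub>M\<^esub> x" if "r \<in> carrier R" "x \<in> carrier M" for r x
    using that lin_smult[OF assms(2), of r x] assms(3) by (metis M.smult_closed inv_into_f_f)
  ultimately show ?thesis using assms by (auto intro!: linI)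
qed

lemma mod_iso_refl: "mod_iso R M M"
  unfolding mod_iso_def using lin_id[of R M] by (auto intro!: bexI[of _ id])

lemma mod_iso_sym:
  assumes "left_module R M" "mod_iso R M N" shows "mod_iso R N M"
proof -
  obtain f where f: "f \<in> lin_maps R M N" "bij_betw f (carrier M) (carrier N)" using assms by (auto simp: mod_iso_def)
  then have "inv_into (carrier M) f \<in> lin_maps R (N\<lparr>carrier := f ` carrier M\<rparr>) M"
    by (intro lin_inv_into assms) (auto simp: bij_betw_def)
  moreover have "lin_maps R (N\<lparr>carrier := f ` carrier M\<rparr>) M = lin_maps R N M"
    using f by (auto simp: lin_maps_def bij_betw_def)
  ultimately show ?thesis using f(2) bij_betw_inv_into unfolding mod_iso_def by blast
qed

lemma mod_iso_trans:
  assumes "mod_iso R M N" "mod_iso R N L" shows "mod_iso R M L"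
proof -
  obtain f g where "f \<in> lin_maps R M N" "bij_betw f (carrier M) (carrier N)"
    "g \<in> lin_maps R N L" "bij_betw g (carrier N) (carrier L)"
    using assms by (auto simp: mod_iso_def)
  then have "g \<circ> f \<in> lin_maps R M L" "bij_betw (g \<circ> f) (carrier M) (carrier L)"
    by (auto simp: comp_def intro: lin_comp bij_betw_trans[unfolded comp_def])
  then show ?thesis unfolding mod_iso_def by blast
qed

lemma lin_image_submodule:
  assumes "left_module R M" "left_module R N" "f \<in> lin_maps R M N" "submodule U R M"
  shows "submodule (f ` U) R N"
proof -
  interpret M: left_module R M by fact
  interpret N: left_module R N by fact
  have U: "U \<subseteq> carrier M" "\<zero>\<^bsub>M\<^esub> \<in> U" "\<And>x y. x \<in> U \<Longrightarrow> y \<in> U \<Longrightarrow> x \<oplus>\<^bsub>M\<^esub> y \<in> U"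
    "\<And>r x. r \<in> carrier R \<Longrightarrow> x \<in> U \<Longrightarrow> r \<odot>\<^bsub>M\<^esub> x \<in> U" using assms(4) by (auto simp: M.submodule_iff)
  show ?thesis unfolding N.submodule_iff
  proof (intro conjI ballI)
    show "f ` U \<subseteq> carrier N" using U lin_closed[OF assms(3)] by auto
    show "\<zero>\<^bsub>N\<^esub> \<in> f ` U" using U lin_zero[OF assms(1-3)] by (auto simp: image_iff intro!: bexI[of _ "\<zero>\<^bsub>M\<^esub>"])
  next
    fix x y assume "x \<in> f ` U" "y \<in> f ` U"
    then show "x \<oplus>\<^bsub>N\<^esub> y \<in> f ` U" using U by (auto simp: lin_add[OF assms(3), symmetric] subset_iff)
  next
    fix r x assume "r \<in> carrier R" "x \<in> f ` U"
    then show "r \<odot>\<^bsub>N\<^esub> x \<in> f ` U" using U by (auto simp: lin_smult[OF assms(3), symmetric] subset_iff)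
  qed
qed

lemma lin_vimage_submodule:
  assumes "left_module R M" "left_module R N" "f \<in> lin_maps R M N" "submodule U R N"
  shows "submodule {x \<in> carrier M. f x \<in> U} R M"
proof -
  interpret M: left_module R M by fact
  interpret N: left_module R N by fact
  show ?thesis using assms(4) unfolding M.submodule_iff N.submodule_iff
    by (auto simp: lin_add[OF assms(3)] lin_smult[OF assms(3)] lin_zero[OF assms(1-3)] M.smult_closed)
qed

lemma lin_kernel_submodule:
  assumes "left_module R M" "left_module R N" "f \<in> lin_maps R M N"
  shows "submodule {x \<in> carrier M. f x = \<zero>\<^bsub>N\<^esub>} R M"
proof -
  interpret N: left_module R N by fact
  show ?thesis using lin_vimage_submodule[OF assms N.submodule_zero] by simp
qed

lemma lin_eq_diff:
  assumes "left_module R M" "left_module R N" "f \<in> lin_maps R M N" "x \<in> carrier M" "y \<in> carrier M" "f x = f y"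
  shows "f (x \<oplus>\<^bsub>M\<^esub> \<ominus>\<^bsub>M\<^esub> y) = \<zero>\<^bsub>N\<^esub>"
proof -
  interpret M: left_module R M by fact
  interpret N: left_module R N by fact
  show ?thesis using assms lin_closed[OF assms(3)] by (simp add: lin_add[OF assms(3)] lin_minus[OF assms(1-3)] N.r_neg)
qed

lemma lin_injI:
  assumes "left_module R M" "left_module R N" "f \<in> lin_maps R M N"
    and "\<And>x. x \<in> carrier M \<Longrightarrow> f x = \<zero>\<^bsub>N\<^esub> \<Longrightarrow> x = \<zero>\<^bsub>M\<^esub>"
  shows "inj_on f (carrier M)"
proof (rule inj_onI)
  interpret M: left_module R M by fact
  fix x y assume xy: "x \<in> carrier M" "y \<in> carrier M" "f x = f y"
  then have "x \<oplus>\<^bsub>M\<^esub> \<ominus>\<^bsub>M\<^esub> y = \<zero>\<^bsub>M\<^esub>" using assms(4) lin_eq_diff[OF assms(1-3)] by simp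
  then show "x = y" using xy by (metis M.add.inv_closed M.minus_equality M.minus_minus)
qed

section \<open>Modules of finite length\<close>

text \<open>A strictly monotone rank on submodules yields both chain conditions at once.\<close>

definition fin_length :: "('r, 'x) ring_scheme \<Rightarrow> ('r, 'm, 'y) module_scheme \<Rightarrow> bool" where
  "fin_length R M \<longleftrightarrow> (\<exists>l :: 'm set \<Rightarrow> nat. \<forall>U V. submodule U R M \<and> submodule V R M \<and> U \<subset> V \<longrightarrow> l U < l V)"

text \<open>A member of least rank is minimal, since a proper submodule has strictly smaller
  rank.\<close>

lemma fin_length_minimal:
  assumes "fin_length R M" "P U" "\<And>U. P U \<Longrightarrow> submodule U R M"
  obtains U where "P U" "\<And>V. P V \<Longrightarrow> V \<subseteq> U \<Longrightarrow> V = U"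
proof -
  obtain l where l: "\<And>U V. submodule U R M \<Longrightarrow> submodule V R M \<Longrightarrow> U \<subset> V \<Longrightarrow> (l U :: nat) < l V"
    using assms(1) by (auto simp: fin_length_def)
  obtain W where "P W" "\<And>V. P V \<Longrightarrow> l W \<le> l V" using assms(2) ex_has_least_nat[of P U l] by auto
  with l assms(3) that show ?thesis by (metis leD psubsetI)
qed

text \<open>Ranks are bounded by the rank of the whole module, so a member of greatest rank
  exists.\<close>

lemma fin_length_maximal:
  assumes "left_module R M" "fin_length R M" "P U" "\<And>U. P U \<Longrightarrow> submodule U R M"
  obtains U where "P U" "\<And>V. P V \<Longrightarrow> U \<subseteq> V \<Longrightarrow> V = U"
proof -
  interpret left_module R M by fact
  obtain l where l: "\<And>U V. submodule U R M \<Longrightarrow> submodule V R M \<Longrightarrow> U \<subset> V \<Longrightarrow> (l U :: nat) < l V"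
    using assms(2) by (auto simp: fin_length_def)
  have "l V \<le> l (carrier M)" if "P V" for V
    using l[of V "carrier M"] submodule_carrier assms(4)[OF that] by (cases "V = carrier M") (auto simp: submodule_iff psubset_eq)
  then have bd: "\<forall>V. P V \<longrightarrow> l V < Suc (l (carrier M))" by (simp add: le_imp_less_Suc)
  obtain W where "P W" "\<And>V. P V \<Longrightarrow> l V \<le> l W"
    using assms(3) ex_has_greatest_nat[of P U l "Suc (l (carrier M))"] bd by (meson le_eq_less_or_eq)
  with l assms(4) that show ?thesis by (metis leD psubsetI)
qed

lemma fin_length_stable:
  fixes U :: "nat \<Rightarrow> 'm set"
  assumes "left_module R M" "fin_length R M" "\<And>n. submodule (U n) R M" "\<And>n. U n \<subseteq> U (Suc n)"
  shows "\<exists>n. \<forall>m\<ge>n. U m = U n"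
proof -
  obtain W where "W \<in> range U" "\<And>V. V \<in> range U \<Longrightarrow> W \<subseteq> V \<Longrightarrow> V = W"
    using fin_length_maximal[of R M "\<lambda>W. W \<in> range U"] assms by blast
  then obtain n where "\<And>m. U n \<subseteq> U m \<Longrightarrow> U m = U n" by (metis rangeE rangeI)
  with lift_Suc_mono_le[of U, OF assms(4)] show ?thesis by blast
qed

lemma fin_length_sub:
  assumes "left_module R M" "fin_length R M" "submodule U R M"
  shows "fin_length R (M\<lparr>carrier := U\<rparr>)"
proof -
  interpret left_module R M by fact
  obtain l where "\<And>U V. submodule U R M \<Longrightarrow> submodule V R M \<Longrightarrow> U \<subset> V \<Longrightarrow> (l U :: nat) < l V"
    using assms(2) by (auto simp: fin_length_def)
  then show ?thesis unfolding fin_length_def submodule_sub_iff[OF assms(3)] by (intro exI[of _ l]) simp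
qed

text \<open>The modular law makes the sum of the two ranks strictly monotone.\<close>

lemma fin_length_ext:
  fixes l' :: "'m set \<Rightarrow> nat" and M :: "('r, 'm, 'y) module_scheme"
  assumes "left_module R M" "submodule A R M" "fin_length R (M\<lparr>carrier := A\<rparr>)"
    "\<And>U V. submodule U R M \<Longrightarrow> submodule V R M \<Longrightarrow> A \<subseteq> U \<Longrightarrow> U \<subset> V \<Longrightarrow> l' U < l' V"
  shows "fin_length R M"
proof -
  interpret left_module R M by fact
  obtain l :: "'m set \<Rightarrow> nat" where l: "\<And>U V. submodule U R M \<Longrightarrow> submodule V R M \<Longrightarrow> U \<subseteq> A \<Longrightarrow> V \<subseteq> A \<Longrightarrow> U \<subset> V \<Longrightarrow> l U < l V"
    using assms(3) unfolding fin_length_def submodule_sub_iff[OF assms(2)] by metis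
  show ?thesis unfolding fin_length_def
  proof (intro exI[of _ "\<lambda>U. l (U \<inter> A) + l' (U <+>\<^bsub>M\<^esub> A)"] allI impI, elim conjE)
    fix U V assume UV: "submodule U R M" "submodule V R M" "U \<subset> V"
    have int: "submodule (U \<inter> A) R M" "submodule (V \<inter> A) R M" "U \<inter> A \<subseteq> V \<inter> A"
      using UV assms(2) submodule_Int by auto
    have 1: "l (U \<inter> A) \<le> l (V \<inter> A)"
      using l[OF int(1,2)] int(3) by (cases "U \<inter> A = V \<inter> A") (auto simp: psubset_eq)
    have sub: "submodule (U <+>\<^bsub>M\<^esub> A) R M" "submodule (V <+>\<^bsub>M\<^esub> A) R M" "A \<subseteq> U <+>\<^bsub>M\<^esub> A"
      "U <+>\<^bsub>M\<^esub> A \<subseteq> V <+>\<^bsub>M\<^esub> A"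
      using UV submodule_sum assms(2) set_add_le by (auto simp: set_add_def')
    then have 2: "l' (U <+>\<^bsub>M\<^esub> A) \<le> l' (V <+>\<^bsub>M\<^esub> A)"
      using assms(4)[of "U <+>\<^bsub>M\<^esub> A" "V <+>\<^bsub>M\<^esub> A"] by (cases "U <+>\<^bsub>M\<^esub> A = V <+>\<^bsub>M\<^esub> A") (simp_all add: psubset_eq)
    have "U \<inter> A \<noteq> V \<inter> A \<or> U <+>\<^bsub>M\<^esub> A \<noteq> V <+>\<^bsub>M\<^esub> A"
    proof (rule ccontr)
      assume "\<not> ?thesis"
      then have eq: "U \<inter> A = V \<inter> A" "U <+>\<^bsub>M\<^esub> A = V <+>\<^bsub>M\<^esub> A" by auto
      have "V \<subseteq> U"
      proof
        fix v assume v: "v \<in> V"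
        then have "v \<in> U <+>\<^bsub>M\<^esub> A" using eq set_add_le[OF UV(2) assms(2)] by auto
        then obtain u a where ua: "u \<in> U" "a \<in> A" "v = u \<oplus>\<^bsub>M\<^esub> a" by (auto simp: set_add_def')
        have c: "u \<in> carrier M" "a \<in> carrier M" "v \<in> carrier M" "u \<in> V"
          using ua v UV assms(2) by (auto simp: submodule_iff)
        have "\<ominus>\<^bsub>M\<^esub> u \<in> V" using c UV(2) by (simp add: submodule_minus)
        then have "\<ominus>\<^bsub>M\<^esub> u \<oplus>\<^bsub>M\<^esub> v \<in> V" using v UV(2) by (auto simp: submodule_iff)
        moreover have "\<ominus>\<^bsub>M\<^esub> u \<oplus>\<^bsub>M\<^esub> v = a" using ua c by (simp add: M.r_neg1)
        ultimately have "a \<in> U" using ua eq by auto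
        then show "v \<in> U" using ua UV by (auto simp: submodule_iff)
      qed
      then show False using UV by auto
    qed
    then show "l (U \<inter> A) + l' (U <+>\<^bsub>M\<^esub> A) < l (V \<inter> A) + l' (V <+>\<^bsub>M\<^esub> A)"
    proof
      assume "U \<inter> A \<noteq> V \<inter> A"
      then have "l (U \<inter> A) < l (V \<inter> A)" using l[OF int(1,2)] int(3) by (auto simp: psubset_eq)
      then show ?thesis using 2 by simp
    next
      assume "U <+>\<^bsub>M\<^esub> A \<noteq> V <+>\<^bsub>M\<^esub> A"
      then have "l' (U <+>\<^bsub>M\<^esub> A) < l' (V <+>\<^bsub>M\<^esub> A)" using assms(4) sub by (simp add: psubset_eq)
      then show ?thesis using 1 by simp
    qed
  qed
qed

text \<open>Half of the correspondence between submodules above the kernel and submodules of the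
  image: an element of \<open>V\<close> differs from one of \<open>U\<close> by an element of the
  kernel, which lies in \<open>U\<close>.\<close>

lemma image_vimage_kernel:
  assumes "left_module R M" "left_module R N" "f \<in> lin_maps R M N"
    "submodule U R M" "submodule V R M" "{x \<in> carrier M. f x = \<zero>\<^bsub>N\<^esub>} \<subseteq> U" "U \<subseteq> V" "f ` U = f ` V"
  shows "U = V"
proof -
  interpret M: left_module R M by fact
  have "v \<in> U" if "v \<in> V" for v
  proof -
    obtain u where u: "u \<in> U" "f u = f v" using assms(8) \<open>v \<in> V\<close> by (metis imageE imageI)
    have c: "u \<in> carrier M" "v \<in> carrier M" using u that assms(4,5) by (auto simp: M.submodule_iff)
    then have "v \<oplus>\<^bsub>M\<^esub> \<ominus>\<^bsub>M\<^esub> u \<in> U" using lin_eq_diff[OF assms(1-3), of v u] u assms(6) by auto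
    then have "u \<oplus>\<^bsub>M\<^esub> (v \<oplus>\<^bsub>M\<^esub> \<ominus>\<^bsub>M\<^esub> u) \<in> U" using u assms(4) by (auto simp: M.submodule_iff)
    moreover have "u \<oplus>\<^bsub>M\<^esub> (v \<oplus>\<^bsub>M\<^esub> \<ominus>\<^bsub>M\<^esub> u) = v" using c by (metis M.a_closed M.a_comm M.a_inv_closed M.r_neg2)
    ultimately show ?thesis by simp
  qed
  then show ?thesis using assms(7) by auto
qed

text \<open>Above the kernel the rank of the image serves as \<open>l'\<close> in
  \<open>fin_length_ext\<close>; it is strictly monotone by
  \<open>image_vimage_kernel\<close>.\<close>

lemma fin_length_ext_map:
  assumes "left_module R M" "left_module R N" "f \<in> lin_maps R M N"
    "fin_length R (M\<lparr>carrier := {x \<in> carrier M. f x = \<zero>\<^bsub>N\<^esub>}\<rparr>)" "fin_length R N"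
  shows "fin_length R M"
proof -
  obtain l where l: "\<And>U V. submodule U R N \<Longrightarrow> submodule V R N \<Longrightarrow> U \<subset> V \<Longrightarrow> (l U::nat) < l V"
    using assms(5) by (auto simp: fin_length_def)
  show ?thesis
  proof (rule fin_length_ext[OF assms(1) lin_kernel_submodule[OF assms(1-3)] assms(4), of "\<lambda>U. l (f ` U)"])
    fix U V assume UV: "submodule U R M" "submodule V R M" "{x \<in> carrier M. f x = \<zero>\<^bsub>N\<^esub>} \<subseteq> U" "U \<subset> V"
    then have "f ` U \<noteq> f ` V" using image_vimage_kernel[OF assms(1-3), of U V] by auto
    then show "l (f ` U) < l (f ` V)"
      using UV by (intro l lin_image_submodule[OF assms(1-3)]) auto
  qed
qed

text \<open>The rank of the preimage works; surjectivity of \<open>f\<close> makes it strictly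
  monotone.\<close>

lemma fin_length_image:
  assumes "left_module R M" "left_module R N" "f \<in> lin_maps R M N" "f ` carrier M = carrier N" "fin_length R M"
  shows "fin_length R N"
proof -
  interpret N: left_module R N by fact
  obtain l where l: "\<And>U V. submodule U R M \<Longrightarrow> submodule V R M \<Longrightarrow> U \<subset> V \<Longrightarrow> (l U::nat) < l V"
    using assms(5) by (auto simp: fin_length_def)
  show ?thesis unfolding fin_length_def
  proof (intro exI[of _ "\<lambda>U. l {x \<in> carrier M. f x \<in> U}"] allI impI, elim conjE)
    fix U V assume UV: "submodule U R N" "submodule V R N" "U \<subset> V"
    then obtain v where "v \<in> V" "v \<notin> U" "v \<in> carrier N" by (auto simp: N.submodule_iff)
    then obtain x where "x \<in> carrier M" "f x = v" using assms(4) by (metis imageE)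
    with UV \<open>v \<in> V\<close> \<open>v \<notin> U\<close> show "l {x \<in> carrier M. f x \<in> U} < l {x \<in> carrier M. f x \<in> V}"
      by (intro l lin_vimage_submodule[OF assms(1-3)]) auto
  qed
qed

text \<open>The regular left module gets a record of its own, because an algebra already carries a
  scalar multiplication, that of its base ring.\<close>

definition self :: "('r, 'x) ring_scheme \<Rightarrow> ('r, 'r) module" where
  "self R = \<lparr>carrier = carrier R, mult = mult R, one = one R, zero = zero R, add = add R, smult = mult R\<rparr>"

text \<open>Vectors are total functions that vanish from \<open>n\<close> on. Equality of vectors is
  then equality of functions, and \<open>pow M n\<close> sits inside \<open>pow M (Suc n)\<close>
  with the same operations.\<close>

definition pow :: "('r, 'm, 'y) module_scheme \<Rightarrow> nat \<Rightarrow> ('r, nat \<Rightarrow> 'm) module" where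
  "pow M n = \<lparr>carrier = {f. (\<forall>i<n. f i \<in> carrier M) \<and> (\<forall>i\<ge>n. f i = \<zero>\<^bsub>M\<^esub>)}, mult = (\<lambda>f g. f), one = (\<lambda>_. \<zero>\<^bsub>M\<^esub>),
     zero = (\<lambda>_. \<zero>\<^bsub>M\<^esub>), add = (\<lambda>f g i. f i \<oplus>\<^bsub>M\<^esub> g i), smult = (\<lambda>r f i. r \<odot>\<^bsub>M\<^esub> f i)\<rparr>"

lemma self_simps [simp]: "carrier (self R) = carrier R" "zero (self R) = zero R" "add (self R) = add R" "smult (self R) = mult R"
  by (simp_all add: self_def)

lemma pow_simps [simp]: "zero (pow M n) = (\<lambda>_. \<zero>\<^bsub>M\<^esub>)" "add (pow M n) = (\<lambda>f g i. f i \<oplus>\<^bsub>M\<^esub> g i)"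
  "smult (pow M n) = (\<lambda>r f i. r \<odot>\<^bsub>M\<^esub> f i)"
  by (simp_all add: pow_def)

lemma carrier_pow: "carrier (pow M n) = {f. (\<forall>i<n. f i \<in> carrier M) \<and> (\<forall>i\<ge>n. f i = \<zero>\<^bsub>M\<^esub>)}"
  by (simp add: pow_def)

lemma (in left_module) carrier_powD: "f \<in> carrier (pow M n) \<Longrightarrow> f i \<in> carrier M"
  by (cases "i < n") (auto simp: carrier_pow)

lemma self_left_module:
  assumes "ring R" shows "left_module R (self R)"
proof -
  interpret ring R by fact
  show ?thesis
  proof (intro left_module.intro left_module_axioms.intro ring_axioms)
    show "abelian_group (self R)"
    proof (rule abelian_groupI)
      fix x assume "x \<in> carrier (self R)"
      then show "\<exists>y\<in>carrier (self R). y \<oplus>\<^bsub>self R\<^esub> x = \<zero>\<^bsub>self R\<^esub>"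
        using l_neg by (auto intro!: bexI[of _ "\<ominus>\<^bsub>R\<^esub> x"])
    qed (auto simp: a_ac)
  qed (auto simp: l_distr r_distr m_assoc)
qed

lemma pow_left_module:
  assumes "left_module R M" shows "left_module R (pow M n)"
proof -
  interpret left_module R M by fact
  show ?thesis
  proof (intro left_module.intro left_module_axioms.intro R.ring_axioms)
    show "abelian_group (pow M n)"
    proof (rule abelian_groupI)
      fix f assume "f \<in> carrier (pow M n)"
      then show "\<exists>y\<in>carrier (pow M n). y \<oplus>\<^bsub>pow M n\<^esub> f = \<zero>\<^bsub>pow M n\<^esub>"
        by (intro bexI[of _ "\<lambda>i. \<ominus>\<^bsub>M\<^esub> f i"]) (auto simp: M.l_neg carrier_powD, auto simp: carrier_pow)
    next
      fix f g h assume "f \<in> carrier (pow M n)" "g \<in> carrier (pow M n)" "h \<in> carrier (pow M n)"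
      then show "f \<oplus>\<^bsub>pow M n\<^esub> g \<oplus>\<^bsub>pow M n\<^esub> h = f \<oplus>\<^bsub>pow M n\<^esub> (g \<oplus>\<^bsub>pow M n\<^esub> h)"
        by (auto simp: carrier_powD M.a_assoc)
    next
      fix f g assume "f \<in> carrier (pow M n)" "g \<in> carrier (pow M n)"
      then show "f \<oplus>\<^bsub>pow M n\<^esub> g = g \<oplus>\<^bsub>pow M n\<^esub> f"
        by (auto simp: carrier_powD M.a_comm)
    qed (auto simp: carrier_powD, auto simp: carrier_pow)
  qed (auto simp: carrier_powD smult_l_distr smult_r_distr smult_assoc1 smult_one, auto simp: carrier_pow smult_closed)
qed

lemma trivial_fin_length:
  assumes "left_module R M" "carrier M = {\<zero>\<^bsub>M\<^esub>}" shows "fin_length R M"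
proof -
  interpret left_module R M by fact
  show ?thesis using assms(2) by (auto simp: fin_length_def submodule_iff)
qed

lemma fin_length_pow:
  assumes "left_module R M" "fin_length R M" shows "fin_length R (pow M n)"
proof (induction n)
  case 0
  show ?case by (rule trivial_fin_length[OF pow_left_module[OF assms(1)]]) (auto simp: carrier_pow)
next
  case (Suc n)
  interpret left_module R M by fact
  \<comment> \<open>The kernel of the last coordinate is not merely isomorphic to the shorter power,
    it is the same record.\<close>
  have eq: "pow M (Suc n)\<lparr>carrier := {x \<in> carrier (pow M (Suc n)). x n = \<zero>\<^bsub>M\<^esub>}\<rparr> = pow M n"
    by (auto simp: pow_def less_Suc_eq) (metis Suc_leI le_neq_implies_less)
  show ?case
    by (rule fin_length_ext_map[OF pow_left_module[OF assms(1)] assms(1), of "\<lambda>f. f n"])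
       (auto intro!: linI simp: assms(2) carrier_powD eq Suc)
qed

section \<open>Generators and free modules\<close>

definition gen_by :: "('r, 'x) ring_scheme \<Rightarrow> ('r, 'm, 'y) module_scheme \<Rightarrow> 'm set \<Rightarrow> 'm set" where
  "gen_by R M S = \<Inter>{U. submodule U R M \<and> S \<subseteq> U}"

context left_module
begin

lemma gen_by_submodule: "S \<subseteq> carrier M \<Longrightarrow> submodule (gen_by R M S) R M"
  using submodule_carrier unfolding gen_by_def submodule_iff by blast

lemma gen_by_least: "submodule U R M \<Longrightarrow> S \<subseteq> U \<Longrightarrow> gen_by R M S \<subseteq> U"
  by (auto simp: gen_by_def)

lemma gen_by_superset: "S \<subseteq> gen_by R M S"
  by (auto simp: gen_by_def)

lemma submodule_finsum:
  assumes "submodule U R M" "finite S" "f \<in> S \<rightarrow> U" shows "(\<Oplus>\<^bsub>M\<^esub>s\<in>S. f s) \<in> U"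
  using assms(2,3)
proof induction
  case empty then show ?case using assms(1) by (simp add: submodule_iff)
next
  case (insert x F)
  then have "f \<in> F \<rightarrow> carrier M" "f x \<in> carrier M" using assms(1) by (auto simp: submodule_iff Pi_iff)
  then show ?case using insert assms(1) by (simp add: submodule_iff)
qed

lemma finsum_smult_ldistr:
  assumes "finite S" "r \<in> carrier R" "f \<in> S \<rightarrow> carrier M"
  shows "r \<odot>\<^bsub>M\<^esub> (\<Oplus>\<^bsub>M\<^esub>s\<in>S. f s) = (\<Oplus>\<^bsub>M\<^esub>s\<in>S. r \<odot>\<^bsub>M\<^esub> f s)"
  using assms(1,3)
proof induction
  case (insert x F)
  then have "f \<in> F \<rightarrow> carrier M" "f x \<in> carrier M" by auto
  then show ?case using insert assms(2) by (simp add: smult_r_distr Pi_iff smult_closed)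
qed (use assms in simp)

lemma gen_by_finite:
  assumes S: "finite S" "S \<subseteq> carrier M"
  shows "gen_by R M S = {\<Oplus>\<^bsub>M\<^esub>s\<in>S. c s \<odot>\<^bsub>M\<^esub> s | c. c \<in> S \<rightarrow> carrier R}" (is "_ = ?C")
proof
  show "?C \<subseteq> gen_by R M S"
    using gen_by_submodule[OF S(2)] gen_by_superset[of S] S(1)
    by (auto intro!: submodule_finsum simp: submodule_iff subset_iff Pi_iff)
  have sm: "s \<in> S \<Longrightarrow> c \<in> S \<rightarrow> carrier R \<Longrightarrow> c s \<odot>\<^bsub>M\<^esub> s \<in> carrier M" for c s using S(2) smult_closed by auto
  show "gen_by R M S \<subseteq> ?C"
  proof (rule gen_by_least)
    show "submodule ?C R M" unfolding submodule_iff
    proof (intro conjI ballI)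
      show "?C \<subseteq> carrier M" using sm by (auto intro!: M.finsum_closed)
      have "(\<Oplus>\<^bsub>M\<^esub>s\<in>S. \<zero> \<odot>\<^bsub>M\<^esub> s) = \<zero>\<^bsub>M\<^esub>" using S(2) by (intro M.add.finprod_one_eqI) auto
      then show "\<zero>\<^bsub>M\<^esub> \<in> ?C" by (auto intro!: exI[of _ "\<lambda>_. \<zero>"])
    next
      fix x y assume "x \<in> ?C" "y \<in> ?C"
      then obtain c d where cd: "c \<in> S \<rightarrow> carrier R" "d \<in> S \<rightarrow> carrier R"
        "x = (\<Oplus>\<^bsub>M\<^esub>s\<in>S. c s \<odot>\<^bsub>M\<^esub> s)" "y = (\<Oplus>\<^bsub>M\<^esub>s\<in>S. d s \<odot>\<^bsub>M\<^esub> s)" by blast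
      have "x \<oplus>\<^bsub>M\<^esub> y = (\<Oplus>\<^bsub>M\<^esub>s\<in>S. c s \<odot>\<^bsub>M\<^esub> s \<oplus>\<^bsub>M\<^esub> d s \<odot>\<^bsub>M\<^esub> s)"
        unfolding cd(3,4) using sm cd by (intro M.finsum_addf[symmetric]) auto
      also have "\<dots> = (\<Oplus>\<^bsub>M\<^esub>s\<in>S. (c s \<oplus> d s) \<odot>\<^bsub>M\<^esub> s)"
        using cd S(2) sm by (intro M.finsum_cong') (auto simp: Pi_iff subset_iff smult_l_distr)
      finally show "x \<oplus>\<^bsub>M\<^esub> y \<in> ?C" using cd by (auto intro!: exI[of _ "\<lambda>s. c s \<oplus> d s"])
    next
      fix r x assume r: "r \<in> carrier R" and "x \<in> ?C"
      then obtain c where c: "c \<in> S \<rightarrow> carrier R" "x = (\<Oplus>\<^bsub>M\<^esub>s\<in>S. c s \<odot>\<^bsub>M\<^esub> s)" by blast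
      have "r \<odot>\<^bsub>M\<^esub> x = (\<Oplus>\<^bsub>M\<^esub>s\<in>S. r \<odot>\<^bsub>M\<^esub> (c s \<odot>\<^bsub>M\<^esub> s))"
        unfolding c(2) using sm c r S(1) by (intro finsum_smult_ldistr) auto
      also have "\<dots> = (\<Oplus>\<^bsub>M\<^esub>s\<in>S. (r \<otimes> c s) \<odot>\<^bsub>M\<^esub> s)"
        using c S(2) sm r by (intro M.finsum_cong') (auto simp: Pi_iff subset_iff smult_assoc1 smult_closed)
      finally show "r \<odot>\<^bsub>M\<^esub> x \<in> ?C" using c r by (auto intro!: exI[of _ "\<lambda>s. r \<otimes> c s"])
    qed
    show "S \<subseteq> ?C"
    proof
      fix t assume t: "t \<in> S"
      have "(\<Oplus>\<^bsub>M\<^esub>s\<in>S. (if s = t then \<one> else \<zero>) \<odot>\<^bsub>M\<^esub> s) = (\<Oplus>\<^bsub>M\<^esub>s\<in>S. if t = s then s else \<zero>\<^bsub>M\<^esub>)"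
        using t S(2) by (intro M.finsum_cong') (auto simp: smult_one subset_iff)
      also have "\<dots> = t" using t S M.finsum_singleton[of t S "\<lambda>s. s"] by auto
      finally show "t \<in> ?C" by (auto intro!: exI[of _ "\<lambda>s. if s = t then \<one> else \<zero>"])
    qed
  qed
qed

lemma fin_gen_iff: "fin_gen R M \<longleftrightarrow> (\<exists>S. finite S \<and> S \<subseteq> carrier M \<and> gen_by R M S = carrier M)"
proof -
  have "(\<forall>m\<in>carrier M. \<exists>c\<in>S \<rightarrow> carrier R. m = (\<Oplus>\<^bsub>M\<^esub>s\<in>S. c s \<odot>\<^bsub>M\<^esub> s)) \<longleftrightarrow> gen_by R M S = carrier M"
    if S: "finite S" "S \<subseteq> carrier M" for S
  proof -
    have "gen_by R M S \<subseteq> carrier M" using gen_by_least[OF submodule_carrier S(2)] .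
    then show ?thesis unfolding gen_by_finite[OF S] by (auto simp: set_eq_iff)
  qed
  then show ?thesis unfolding fin_gen_def by (intro ex_cong1) blast
qed

text \<open>A maximal finitely generated submodule contains every element, because adjoining one
  more generator cannot enlarge it.\<close>

lemma fin_length_fin_gen:
  assumes "fin_length R M" shows "fin_gen R M"
proof -
  let ?P = "\<lambda>U. \<exists>S. finite S \<and> S \<subseteq> carrier M \<and> U = gen_by R M S"
  have P0: "?P (gen_by R M {})" by (intro exI[of _ "{}"]) auto
  have Psub: "submodule U R M" if "?P U" for U using gen_by_submodule that by auto
  obtain U where U: "?P U" "\<And>V. ?P V \<Longrightarrow> U \<subseteq> V \<Longrightarrow> V = U"
    using fin_length_maximal[where P = ?P, OF left_module_axioms assms P0 Psub] by metis
  then obtain S where S: "finite S" "S \<subseteq> carrier M" "U = gen_by R M S" by auto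
  have "x \<in> U" if "x \<in> carrier M" for x
  proof -
    have "gen_by R M (insert x S) = U"
    proof (rule U(2))
      show "?P (gen_by R M (insert x S))" using S that by (intro exI[of _ "insert x S"]) auto
      show "U \<subseteq> gen_by R M (insert x S)" by (auto simp: S gen_by_def)
    qed
    then show "x \<in> U" using gen_by_superset[of "insert x S"] by auto
  qed
  moreover have "U \<subseteq> carrier M" using gen_by_submodule[OF S(2)] by (simp add: S submodule_iff)
  ultimately have "U = carrier M" by auto
  then show ?thesis using S fin_gen_iff by auto
qed

end

text \<open>Recursion in place of \<open>finsum\<close>: the value makes sense without closure
  conditions, so combinations in the free modules over a ring and over a subring can be identified
  by plain induction.\<close>

primrec comb :: "('r, 'm, 'y) module_scheme \<Rightarrow> (nat \<Rightarrow> 'm) \<Rightarrow> nat \<Rightarrow> (nat \<Rightarrow> 'r) \<Rightarrow> 'm" where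
  "comb M x 0 z = \<zero>\<^bsub>M\<^esub>"
| "comb M x (Suc n) z = comb M x n z \<oplus>\<^bsub>M\<^esub> z n \<odot>\<^bsub>M\<^esub> x n"

definition unit_vec :: "('r, 'x) ring_scheme \<Rightarrow> nat \<Rightarrow> nat \<Rightarrow> 'r" where
  "unit_vec R i = (\<lambda>j. if j = i then \<one>\<^bsub>R\<^esub> else \<zero>\<^bsub>R\<^esub>)"

abbreviation free :: "('r, 'x) ring_scheme \<Rightarrow> nat \<Rightarrow> ('r, nat \<Rightarrow> 'r) module" where
  "free R n \<equiv> pow (self R) n"

lemma free_left_module: "ring R \<Longrightarrow> left_module R (free R n)"
  by (intro pow_left_module self_left_module)

lemma unit_vec_carrier: "ring R \<Longrightarrow> i < n \<Longrightarrow> unit_vec R i \<in> carrier (free R n)"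
  by (auto simp: carrier_pow unit_vec_def ring.ring_simprules)

context left_module
begin

lemma comb_closed:
  "(\<And>i. i < n \<Longrightarrow> x i \<in> carrier M) \<Longrightarrow> (\<And>i. i < n \<Longrightarrow> z i \<in> carrier R) \<Longrightarrow> comb M x n z \<in> carrier M"
  by (induction n) (auto simp: smult_closed)

lemma comb_in_submodule:
  "submodule U R M \<Longrightarrow> (\<And>i. i < n \<Longrightarrow> x i \<in> U) \<Longrightarrow> (\<And>i. i < n \<Longrightarrow> z i \<in> carrier R) \<Longrightarrow> comb M x n z \<in> U"
  by (induction n) (auto simp: submodule_iff)

lemma comb_add:
  assumes "\<And>i. i < n \<Longrightarrow> x i \<in> carrier M" "\<And>i. i < n \<Longrightarrow> y i \<in> carrier R" "\<And>i. i < n \<Longrightarrow> z i \<in> carrier R"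
  shows "comb M x n (\<lambda>i. y i \<oplus> z i) = comb M x n y \<oplus>\<^bsub>M\<^esub> comb M x n z"
  using assms
proof (induction n)
  case (Suc n)
  then have "comb M x n y \<in> carrier M" "comb M x n z \<in> carrier M" "y n \<odot>\<^bsub>M\<^esub> x n \<in> carrier M" "z n \<odot>\<^bsub>M\<^esub> x n \<in> carrier M"
    by (auto intro!: comb_closed smult_closed)
  then show ?case using Suc by (simp add: smult_l_distr M.a_ac)
qed auto

lemma comb_smult:
  assumes "\<And>i. i < n \<Longrightarrow> x i \<in> carrier M" "\<And>i. i < n \<Longrightarrow> z i \<in> carrier R" "r \<in> carrier R"
  shows "comb M x n (\<lambda>i. r \<otimes> z i) = r \<odot>\<^bsub>M\<^esub> comb M x n z"
  using assms
proof (induction n)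
  case (Suc n)
  then have "comb M x n z \<in> carrier M" "z n \<odot>\<^bsub>M\<^esub> x n \<in> carrier M"
    by (auto intro!: comb_closed smult_closed)
  then show ?case using Suc by (simp add: smult_r_distr smult_assoc1)
qed auto

lemma comb_lin:
  assumes "\<And>i. i < n \<Longrightarrow> x i \<in> carrier M" shows "comb M x n \<in> lin_maps R (free R n) M"
  by (rule linI) (auto simp: carrier_pow comb_add comb_smult comb_closed assms)

lemma comb_unit_vec:
  assumes "\<And>i. i < n \<Longrightarrow> x i \<in> carrier M" "i < n" shows "comb M x n (unit_vec R i) = x i"
proof -
  have "comb M x m (unit_vec R i) = (if i < m then x i else \<zero>\<^bsub>M\<^esub>)" if "m \<le> n" for m
    using that by (induction m) (auto simp: unit_vec_def assms smult_one less_Suc_eq)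
  then show ?thesis using assms(2) by simp
qed

lemma lin_comb:
  assumes "left_module R N" "g \<in> lin_maps R M N" "\<And>i. i < n \<Longrightarrow> x i \<in> carrier M" "\<And>i. i < n \<Longrightarrow> z i \<in> carrier R"
  shows "g (comb M x n z) = comb N (\<lambda>i. g (x i)) n z"
  using assms(3,4)
proof (induction n)
  case 0 show ?case using lin_zero[OF left_module_axioms assms(1,2)] by simp
next
  case (Suc n)
  then show ?case by (simp add: lin_add[OF assms(2)] lin_smult[OF assms(2)] comb_closed smult_closed)
qed

end

lemma comb_free:
  assumes "ring R" "z \<in> carrier (free R n)" shows "comb (free R n) (unit_vec R) n z = z"
proof -
  interpret ring R by fact
  have z: "z i \<in> carrier R" for i using left_module.carrier_powD[OF self_left_module[OF assms(1)] assms(2)] by simp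
  have "comb (free R n) (unit_vec R) m z = (\<lambda>i. if i < m then z i else \<zero>\<^bsub>R\<^esub>)" if "m \<le> n" for m
    using that by (induction m) (auto simp: unit_vec_def z less_Suc_eq)
  then show ?thesis using assms(2) by (auto simp: carrier_pow)
qed

lemma lin_free_eq_comb:
  assumes "ring R" "left_module R M" "f \<in> lin_maps R (free R n) M" "z \<in> carrier (free R n)"
  shows "f z = comb M (\<lambda>i. f (unit_vec R i)) n z"
proof -
  interpret F: left_module R "free R n" using free_left_module[OF assms(1)] .
  have "z i \<in> carrier R" for i using left_module.carrier_powD[OF self_left_module[OF assms(1)] assms(4)] by simp
  then have "f (comb (free R n) (unit_vec R) n z) = comb M (\<lambda>i. f (unit_vec R i)) n z"
    by (intro F.lin_comb assms unit_vec_carrier)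
  then show ?thesis using comb_free[OF assms(1,4)] by simp
qed

text \<open>Preimages of the unit vectors are chosen and extended linearly. The modules may live on
  any types, whereas \<open>projective\<close> speaks only of modules of type
  \<open>'r fgmod\<close>.\<close>

lemma free_lift:
  assumes "ring R" "left_module R L" "left_module R N" "f \<in> lin_maps R (free R n) N"
    "g \<in> lin_maps R L N" "f ` carrier (free R n) \<subseteq> g ` carrier L"
  obtains h where "h \<in> lin_maps R (free R n) L" "\<And>z. z \<in> carrier (free R n) \<Longrightarrow> g (h z) = f z"
proof -
  interpret L: left_module R L by fact
  have "\<exists>l. i < n \<longrightarrow> l \<in> carrier L \<and> g l = f (unit_vec R i)" for i
    using assms(6) unit_vec_carrier[OF assms(1)] by (metis image_subset_iff imageE)
  then obtain x where x: "\<And>i. i < n \<Longrightarrow> x i \<in> carrier L" "\<And>i. i < n \<Longrightarrow> g (x i) = f (unit_vec R i)" by metis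
  have "g (comb L x n z) = f z" if z: "z \<in> carrier (free R n)" for z
  proof -
    have zc: "z i \<in> carrier R" for i using left_module.carrier_powD[OF self_left_module[OF assms(1)] z] by simp
    have cong: "(\<And>i. i < m \<Longrightarrow> u i = v i) \<Longrightarrow> comb N u m z = comb N v m z" for u v m by (induction m) auto
    have "g (comb L x n z) = comb N (\<lambda>i. g (x i)) n z"
      by (rule L.lin_comb[OF assms(3,5)]) (use x zc in auto)
    also have "\<dots> = comb N (\<lambda>i. f (unit_vec R i)) n z" by (rule cong) (use x in auto)
    also have "\<dots> = f z" using lin_free_eq_comb[OF assms(1,3,4) z] by simp
    finally show ?thesis .
  qed
  then show ?thesis using L.comb_lin[of n x] x that by blast
qed

lemma free_cover:
  assumes "fg_module R M"
  obtains n f where "f \<in> lin_maps R (free R n) M" "f ` carrier (free R n) = carrier M"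
proof -
  interpret left_module R M using assms by (simp add: fg_module_def)
  obtain S where S: "finite S" "S \<subseteq> carrier M" "gen_by R M S = carrier M"
    using assms by (auto simp: fg_module_def fin_gen_iff)
  obtain n :: nat and x where x: "S = x ` {i. i < n}" using S(1) finite_imp_nat_seg_image_inj_on by metis
  have xc: "x i \<in> carrier M" if "i < n" for i using that S x by auto
  have im: "submodule (comb M x n ` carrier (free R n)) R M"
    using lin_image_submodule[OF free_left_module[OF R.ring_axioms] left_module_axioms comb_lin[of n x]]
      left_module.submodule_carrier[OF free_left_module[OF R.ring_axioms]] xc by blast
  have "S \<subseteq> comb M x n ` carrier (free R n)"
    using comb_unit_vec[of n x] xc unit_vec_carrier[OF R.ring_axioms] unfolding x by (force simp: image_iff)
  then have "carrier M \<subseteq> comb M x n ` carrier (free R n)" using gen_by_least[OF im, of S] S(3) by simp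
  then show ?thesis using comb_lin[of n x] xc im that[of "comb M x n" n] by (auto simp: submodule_iff)
qed

lemma free_fg: assumes "ring R" shows "fg_module R (free R n)"
proof -
  interpret F: left_module R "free R n" using free_left_module[OF assms] .
  let ?S = "unit_vec R ` {..<n}"
  have S: "?S \<subseteq> carrier (free R n)" using unit_vec_carrier[OF assms] by auto
  have "z \<in> gen_by R (free R n) ?S" if z: "z \<in> carrier (free R n)" for z
  proof -
    have "z i \<in> carrier R" for i using left_module.carrier_powD[OF self_left_module[OF assms] z] by simp
    then have "comb (free R n) (unit_vec R) n z \<in> gen_by R (free R n) ?S"
      using F.gen_by_superset[of ?S] by (intro F.comb_in_submodule F.gen_by_submodule S) auto
    then show ?thesis using comb_free[OF assms z] by simp
  qed
  then have "gen_by R (free R n) ?S = carrier (free R n)"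
    using F.gen_by_submodule[OF S] by (auto simp: F.submodule_iff)
  then show ?thesis using S F.fin_gen_iff F.left_module_axioms unfolding fg_module_def by blast
qed

section \<open>Quotients\<close>

definition mcoset :: "('r, 'm, 'y) module_scheme \<Rightarrow> 'm set \<Rightarrow> 'm \<Rightarrow> 'm set" where
  "mcoset M U x = (\<lambda>u. x \<oplus>\<^bsub>M\<^esub> u) ` U"

text \<open>Both operations act through chosen representatives; \<open>quot_add\<close> and
  \<open>quot_smult\<close> show that the choice is immaterial.\<close>

definition quot :: "('r, 'm, 'y) module_scheme \<Rightarrow> 'm set \<Rightarrow> ('r, 'm set) module" where
  "quot M U = \<lparr>carrier = mcoset M U ` carrier M, mult = (\<lambda>X Y. X), one = {}, zero = mcoset M U \<zero>\<^bsub>M\<^esub>,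
     add = (\<lambda>X Y. mcoset M U ((SOME x. x \<in> X) \<oplus>\<^bsub>M\<^esub> (SOME y. y \<in> Y))),
     smult = (\<lambda>r X. mcoset M U (r \<odot>\<^bsub>M\<^esub> (SOME x. x \<in> X)))\<rparr>"

context left_module
begin

lemma mcoset_eqI:
  assumes U: "submodule U R M" and "x \<in> carrier M" "u \<in> U"
  shows "mcoset M U (x \<oplus>\<^bsub>M\<^esub> u) = mcoset M U x"
proof -
  have Uc: "v \<in> carrier M" if "v \<in> U" for v using U that by (auto simp: submodule_iff)
  have "x \<oplus>\<^bsub>M\<^esub> u \<oplus>\<^bsub>M\<^esub> v = x \<oplus>\<^bsub>M\<^esub> (u \<oplus>\<^bsub>M\<^esub> v)" if "v \<in> U" for v using that Uc assms by (simp add: M.a_assoc)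
  moreover have "x \<oplus>\<^bsub>M\<^esub> v = x \<oplus>\<^bsub>M\<^esub> u \<oplus>\<^bsub>M\<^esub> (\<ominus>\<^bsub>M\<^esub> u \<oplus>\<^bsub>M\<^esub> v)" if "v \<in> U" for v
    using that Uc assms by (simp add: M.a_assoc M.r_neg2)
  moreover have "u \<oplus>\<^bsub>M\<^esub> v \<in> U" "\<ominus>\<^bsub>M\<^esub> u \<oplus>\<^bsub>M\<^esub> v \<in> U" if "v \<in> U" for v
    using that U submodule_minus[OF U assms(3)] assms(3) by (simp_all add: submodule_iff)
  ultimately show ?thesis unfolding mcoset_def by (auto simp: image_iff) metis
qed

lemma mcoset_self: "submodule U R M \<Longrightarrow> x \<in> carrier M \<Longrightarrow> x \<in> mcoset M U x"
  by (auto simp: mcoset_def submodule_iff image_iff intro!: bexI[of _ "\<zero>\<^bsub>M\<^esub>"])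

lemma mcoset_some:
  assumes U: "submodule U R M" and "x \<in> carrier M"
  obtains u where "u \<in> U" "(SOME y. y \<in> mcoset M U x) = x \<oplus>\<^bsub>M\<^esub> u"
  using someI[of "\<lambda>y. y \<in> mcoset M U x", OF mcoset_self[OF assms]] by (auto simp: mcoset_def)

lemma quot_add:
  assumes U: "submodule U R M" and x: "x \<in> carrier M" and y: "y \<in> carrier M"
  shows "mcoset M U x \<oplus>\<^bsub>quot M U\<^esub> mcoset M U y = mcoset M U (x \<oplus>\<^bsub>M\<^esub> y)"
proof -
  obtain u v where uv: "u \<in> U" "v \<in> U" "(SOME z. z \<in> mcoset M U x) = x \<oplus>\<^bsub>M\<^esub> u" "(SOME z. z \<in> mcoset M U y) = y \<oplus>\<^bsub>M\<^esub> v"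
    using mcoset_some[OF U x] mcoset_some[OF U y] by metis
  have c: "u \<in> carrier M" "v \<in> carrier M" "u \<oplus>\<^bsub>M\<^esub> v \<in> U" using uv U by (auto simp: submodule_iff)
  have "x \<oplus>\<^bsub>M\<^esub> u \<oplus>\<^bsub>M\<^esub> (y \<oplus>\<^bsub>M\<^esub> v) = x \<oplus>\<^bsub>M\<^esub> y \<oplus>\<^bsub>M\<^esub> (u \<oplus>\<^bsub>M\<^esub> v)" using c x y by (simp add: M.a_ac)
  then show ?thesis using uv c x y by (simp add: quot_def mcoset_eqI[OF U])
qed

lemma quot_smult:
  assumes U: "submodule U R M" and x: "x \<in> carrier M" and r: "r \<in> carrier R"
  shows "r \<odot>\<^bsub>quot M U\<^esub> mcoset M U x = mcoset M U (r \<odot>\<^bsub>M\<^esub> x)"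
proof -
  obtain u where u: "u \<in> U" "(SOME z. z \<in> mcoset M U x) = x \<oplus>\<^bsub>M\<^esub> u"
    using mcoset_some[OF U x] by metis
  have c: "u \<in> carrier M" "r \<odot>\<^bsub>M\<^esub> u \<in> U" using u U r by (auto simp: submodule_iff)
  have "r \<odot>\<^bsub>M\<^esub> (x \<oplus>\<^bsub>M\<^esub> u) = r \<odot>\<^bsub>M\<^esub> x \<oplus>\<^bsub>M\<^esub> r \<odot>\<^bsub>M\<^esub> u" using c x r by (simp add: smult_r_distr)
  then show ?thesis using u c x r by (simp add: quot_def mcoset_eqI[OF U] smult_closed)
qed

lemma quot_left_module:
  assumes U: "submodule U R M" shows "left_module R (quot M U)"
proof -
  have c: "carrier (quot M U) = mcoset M U ` carrier M" "\<zero>\<^bsub>quot M U\<^esub> = mcoset M U \<zero>\<^bsub>M\<^esub>" by (simp_all add: quot_def)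
  show ?thesis
  proof (intro left_module.intro left_module_axioms.intro R.ring_axioms)
    show "abelian_group (quot M U)"
    proof (rule abelian_groupI)
      fix X assume "X \<in> carrier (quot M U)"
      then obtain x where "x \<in> carrier M" "X = mcoset M U x" by (auto simp: c)
      then show "\<exists>Y\<in>carrier (quot M U). Y \<oplus>\<^bsub>quot M U\<^esub> X = \<zero>\<^bsub>quot M U\<^esub>"
        by (intro bexI[of _ "mcoset M U (\<ominus>\<^bsub>M\<^esub> x)"]) (simp_all add: quot_add[OF U] M.l_neg c)
    qed (auto simp: c quot_add[OF U] M.a_ac)
  qed (auto simp: c quot_add[OF U] quot_smult[OF U] smult_l_distr smult_r_distr smult_assoc1 smult_one smult_closed)
qed

lemma quot_proj:
  assumes U: "submodule U R M"
  shows "mcoset M U \<in> lin_maps R M (quot M U)" "mcoset M U ` carrier M = carrier (quot M U)"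
    "{x \<in> carrier M. mcoset M U x = \<zero>\<^bsub>quot M U\<^esub>} = U"
proof -
  show "mcoset M U \<in> lin_maps R M (quot M U)" by (rule linI) (auto simp: quot_add[OF U] quot_smult[OF U], auto simp: quot_def)
  show "mcoset M U ` carrier M = carrier (quot M U)" by (simp add: quot_def)
  have z: "\<zero>\<^bsub>quot M U\<^esub> = U"
  proof -
    have "(\<lambda>u. \<zero>\<^bsub>M\<^esub> \<oplus>\<^bsub>M\<^esub> u) ` U = (\<lambda>u. u) ` U" using U by (intro image_cong refl M.l_zero) (auto simp: submodule_iff)
    then show ?thesis by (simp add: quot_def mcoset_def)
  qed
  have Uc: "U \<subseteq> carrier M" using U by (simp add: submodule_iff)
  have "mcoset M U u = U" if "u \<in> U" for u
    using mcoset_eqI[OF U M.zero_closed that] z Uc that by (auto simp: quot_def)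
  then show "{x \<in> carrier M. mcoset M U x = \<zero>\<^bsub>quot M U\<^esub>} = U" unfolding z using mcoset_self[OF U] Uc by auto
qed

end

section \<open>Rings of finite length\<close>

text \<open>By the Hopkins-Levitzki theorem these are the left artinian rings; finite length is
  taken as the definition because both chain conditions are used throughout.\<close>

locale fl_ring =
  fixes R :: "('r, 'x) ring_scheme"
  assumes ring: "ring R" and fl_self: "fin_length R (self R)"
begin

text \<open>Module arithmetic with \<open>left_module\<close> as a premise instead of an
  interpretation: later proofs handle up to seven modules at once, and one set of rewrite rules
  serves them all. In the same way \<open>lin_rules\<close> is instantiated once per map.\<close>

lemma lm_simps [simp]:
  assumes "left_module R M"
  shows "\<zero>\<^bsub>M\<^esub> \<in> carrier M"
    "x \<in> carrier M \<Longrightarrow> y \<in> carrier M \<Longrightarrow> x \<oplus>\<^bsub>M\<^esub> y \<in> carrier M"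
    "x \<in> carrier M \<Longrightarrow> \<ominus>\<^bsub>M\<^esub> x \<in> carrier M"
    "r \<in> carrier R \<Longrightarrow> x \<in> carrier M \<Longrightarrow> r \<odot>\<^bsub>M\<^esub> x \<in> carrier M"
    "x \<in> carrier M \<Longrightarrow> \<zero>\<^bsub>M\<^esub> \<oplus>\<^bsub>M\<^esub> x = x"
    "x \<in> carrier M \<Longrightarrow> x \<oplus>\<^bsub>M\<^esub> \<zero>\<^bsub>M\<^esub> = x"
    "x \<in> carrier M \<Longrightarrow> \<ominus>\<^bsub>M\<^esub> x \<oplus>\<^bsub>M\<^esub> x = \<zero>\<^bsub>M\<^esub>"
    "x \<in> carrier M \<Longrightarrow> x \<oplus>\<^bsub>M\<^esub> \<ominus>\<^bsub>M\<^esub> x = \<zero>\<^bsub>M\<^esub>"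
    "\<ominus>\<^bsub>M\<^esub> \<zero>\<^bsub>M\<^esub> = \<zero>\<^bsub>M\<^esub>"
    "x \<in> carrier M \<Longrightarrow> \<ominus>\<^bsub>M\<^esub> (\<ominus>\<^bsub>M\<^esub> x) = x"
    "x \<in> carrier M \<Longrightarrow> y \<in> carrier M \<Longrightarrow> x \<oplus>\<^bsub>M\<^esub> (\<ominus>\<^bsub>M\<^esub> x \<oplus>\<^bsub>M\<^esub> y) = y"
    "x \<in> carrier M \<Longrightarrow> y \<in> carrier M \<Longrightarrow> \<ominus>\<^bsub>M\<^esub> x \<oplus>\<^bsub>M\<^esub> (x \<oplus>\<^bsub>M\<^esub> y) = y"
    "r \<in> carrier R \<Longrightarrow> r \<odot>\<^bsub>M\<^esub> \<zero>\<^bsub>M\<^esub> = \<zero>\<^bsub>M\<^esub>"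
proof -
  interpret left_module R M by fact
  show "\<zero>\<^bsub>M\<^esub> \<in> carrier M"
    "x \<in> carrier M \<Longrightarrow> y \<in> carrier M \<Longrightarrow> x \<oplus>\<^bsub>M\<^esub> y \<in> carrier M"
    "x \<in> carrier M \<Longrightarrow> \<ominus>\<^bsub>M\<^esub> x \<in> carrier M"
    "r \<in> carrier R \<Longrightarrow> x \<in> carrier M \<Longrightarrow> r \<odot>\<^bsub>M\<^esub> x \<in> carrier M"
    "x \<in> carrier M \<Longrightarrow> \<zero>\<^bsub>M\<^esub> \<oplus>\<^bsub>M\<^esub> x = x"
    "x \<in> carrier M \<Longrightarrow> x \<oplus>\<^bsub>M\<^esub> \<zero>\<^bsub>M\<^esub> = x"
    "x \<in> carrier M \<Longrightarrow> \<ominus>\<^bsub>M\<^esub> x \<oplus>\<^bsub>M\<^esub> x = \<zero>\<^bsub>M\<^esub>"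
    "x \<in> carrier M \<Longrightarrow> x \<oplus>\<^bsub>M\<^esub> \<ominus>\<^bsub>M\<^esub> x = \<zero>\<^bsub>M\<^esub>"
    "\<ominus>\<^bsub>M\<^esub> \<zero>\<^bsub>M\<^esub> = \<zero>\<^bsub>M\<^esub>"
    "x \<in> carrier M \<Longrightarrow> \<ominus>\<^bsub>M\<^esub> (\<ominus>\<^bsub>M\<^esub> x) = x"
    "x \<in> carrier M \<Longrightarrow> y \<in> carrier M \<Longrightarrow> x \<oplus>\<^bsub>M\<^esub> (\<ominus>\<^bsub>M\<^esub> x \<oplus>\<^bsub>M\<^esub> y) = y"
    "x \<in> carrier M \<Longrightarrow> y \<in> carrier M \<Longrightarrow> \<ominus>\<^bsub>M\<^esub> x \<oplus>\<^bsub>M\<^esub> (x \<oplus>\<^bsub>M\<^esub> y) = y"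
    "r \<in> carrier R \<Longrightarrow> r \<odot>\<^bsub>M\<^esub> \<zero>\<^bsub>M\<^esub> = \<zero>\<^bsub>M\<^esub>"
    by (simp_all add: smult_closed M.l_neg M.r_neg M.r_neg1 M.r_neg2)
qed

lemma lm_ac:
  assumes "left_module R M"
  shows "x \<in> carrier M \<Longrightarrow> y \<in> carrier M \<Longrightarrow> z \<in> carrier M \<Longrightarrow> x \<oplus>\<^bsub>M\<^esub> y \<oplus>\<^bsub>M\<^esub> z = x \<oplus>\<^bsub>M\<^esub> (y \<oplus>\<^bsub>M\<^esub> z)"
    "x \<in> carrier M \<Longrightarrow> y \<in> carrier M \<Longrightarrow> x \<oplus>\<^bsub>M\<^esub> y = y \<oplus>\<^bsub>M\<^esub> x"
    "x \<in> carrier M \<Longrightarrow> y \<in> carrier M \<Longrightarrow> z \<in> carrier M \<Longrightarrow> x \<oplus>\<^bsub>M\<^esub> (y \<oplus>\<^bsub>M\<^esub> z) = y \<oplus>\<^bsub>M\<^esub> (x \<oplus>\<^bsub>M\<^esub> z)"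
proof -
  interpret left_module R M by fact
  show "x \<in> carrier M \<Longrightarrow> y \<in> carrier M \<Longrightarrow> z \<in> carrier M \<Longrightarrow> x \<oplus>\<^bsub>M\<^esub> y \<oplus>\<^bsub>M\<^esub> z = x \<oplus>\<^bsub>M\<^esub> (y \<oplus>\<^bsub>M\<^esub> z)"
    "x \<in> carrier M \<Longrightarrow> y \<in> carrier M \<Longrightarrow> x \<oplus>\<^bsub>M\<^esub> y = y \<oplus>\<^bsub>M\<^esub> x"
    "x \<in> carrier M \<Longrightarrow> y \<in> carrier M \<Longrightarrow> z \<in> carrier M \<Longrightarrow> x \<oplus>\<^bsub>M\<^esub> (y \<oplus>\<^bsub>M\<^esub> z) = y \<oplus>\<^bsub>M\<^esub> (x \<oplus>\<^bsub>M\<^esub> z)"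
    by (simp_all add: M.a_ac)
qed

lemma lm_distr:
  assumes "left_module R M"
  shows "r \<in> carrier R \<Longrightarrow> x \<in> carrier M \<Longrightarrow> y \<in> carrier M \<Longrightarrow> r \<odot>\<^bsub>M\<^esub> (x \<oplus>\<^bsub>M\<^esub> y) = r \<odot>\<^bsub>M\<^esub> x \<oplus>\<^bsub>M\<^esub> r \<odot>\<^bsub>M\<^esub> y"
    "r \<in> carrier R \<Longrightarrow> x \<in> carrier M \<Longrightarrow> r \<odot>\<^bsub>M\<^esub> (\<ominus>\<^bsub>M\<^esub> x) = \<ominus>\<^bsub>M\<^esub> (r \<odot>\<^bsub>M\<^esub> x)"
    "x \<in> carrier M \<Longrightarrow> y \<in> carrier M \<Longrightarrow> \<ominus>\<^bsub>M\<^esub> (x \<oplus>\<^bsub>M\<^esub> y) = \<ominus>\<^bsub>M\<^esub> x \<oplus>\<^bsub>M\<^esub> \<ominus>\<^bsub>M\<^esub> y"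
proof -
  interpret left_module R M by fact
  show "r \<in> carrier R \<Longrightarrow> x \<in> carrier M \<Longrightarrow> y \<in> carrier M \<Longrightarrow> r \<odot>\<^bsub>M\<^esub> (x \<oplus>\<^bsub>M\<^esub> y) = r \<odot>\<^bsub>M\<^esub> x \<oplus>\<^bsub>M\<^esub> r \<odot>\<^bsub>M\<^esub> y"
    "x \<in> carrier M \<Longrightarrow> y \<in> carrier M \<Longrightarrow> \<ominus>\<^bsub>M\<^esub> (x \<oplus>\<^bsub>M\<^esub> y) = \<ominus>\<^bsub>M\<^esub> x \<oplus>\<^bsub>M\<^esub> \<ominus>\<^bsub>M\<^esub> y"
    by (simp_all add: smult_r_distr M.minus_add)
  assume r: "r \<in> carrier R" "x \<in> carrier M"
  have "r \<odot>\<^bsub>M\<^esub> (\<ominus>\<^bsub>M\<^esub> x) \<oplus>\<^bsub>M\<^esub> r \<odot>\<^bsub>M\<^esub> x = \<zero>\<^bsub>M\<^esub>"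
    using r by (simp flip: smult_r_distr add: M.l_neg)
  then show "r \<odot>\<^bsub>M\<^esub> (\<ominus>\<^bsub>M\<^esub> x) = \<ominus>\<^bsub>M\<^esub> (r \<odot>\<^bsub>M\<^esub> x)" using r by (simp add: M.minus_equality smult_closed)
qed

lemma lm_move:
  assumes "left_module R M" "x \<in> carrier M" "y \<in> carrier M" "x \<oplus>\<^bsub>M\<^esub> y = \<zero>\<^bsub>M\<^esub>"
  shows "y = \<ominus>\<^bsub>M\<^esub> x"
proof -
  interpret left_module R M by fact
  show ?thesis using assms M.minus_equality[of y x] by (simp add: M.a_comm)
qed

lemma lin_rules:
  assumes "left_module R M" "left_module R N" "f \<in> lin_maps R M N"
  shows "x \<in> carrier M \<Longrightarrow> f x \<in> carrier N"
    "x \<in> carrier M \<Longrightarrow> y \<in> carrier M \<Longrightarrow> f (x \<oplus>\<^bsub>M\<^esub> y) = f x \<oplus>\<^bsub>N\<^esub> f y"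
    "r \<in> carrier R \<Longrightarrow> x \<in> carrier M \<Longrightarrow> f (r \<odot>\<^bsub>M\<^esub> x) = r \<odot>\<^bsub>N\<^esub> f x"
    "f \<zero>\<^bsub>M\<^esub> = \<zero>\<^bsub>N\<^esub>"
    "x \<in> carrier M \<Longrightarrow> f (\<ominus>\<^bsub>M\<^esub> x) = \<ominus>\<^bsub>N\<^esub> f x"
  using lin_closed[OF assms(3)] lin_add[OF assms(3)] lin_smult[OF assms(3)] lin_zero[OF assms] lin_minus[OF assms] by blast+

lemma fg_lm [simp, dest]: "fg_module R M \<Longrightarrow> left_module R M"
  by (simp add: fg_module_def)

text \<open>Finite generation is turned into finite length, which passes to submodules; kernels and
  syzygies of finitely generated modules thus stay finitely generated.\<close>

lemma fg_iff: "fg_module R M \<longleftrightarrow> left_module R M \<and> fin_length R M"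
proof
  assume M: "fg_module R M"
  obtain n f where f: "f \<in> lin_maps R (free R n) M" "f ` carrier (free R n) = carrier M"
    using free_cover[OF M] by metis
  have "fin_length R M"
    by (rule fin_length_image[OF free_left_module[OF ring] fg_lm[OF M] f fin_length_pow[OF self_left_module[OF ring] fl_self]])
  with M show "left_module R M \<and> fin_length R M" by auto
next
  assume "left_module R M \<and> fin_length R M"
  then show "fg_module R M" using left_module.fin_length_fin_gen by (auto simp: fg_module_def)
qed

lemma fg_sub: "fg_module R M \<Longrightarrow> submodule U R M \<Longrightarrow> fg_module R (M\<lparr>carrier := U\<rparr>)"
  by (auto simp: fg_iff intro: fin_length_sub left_module.submodule_left_module)

lemma fg_image: "fg_module R M \<Longrightarrow> left_module R N \<Longrightarrow> f \<in> lin_maps R M N \<Longrightarrow> f ` carrier M = carrier N \<Longrightarrow> fg_module R N"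
  using fin_length_image by (auto simp: fg_iff)

lemma lin_padd:
  assumes "left_module R M" "left_module R N" "f \<in> lin_maps R M N" "g \<in> lin_maps R M N"
  shows "(\<lambda>x. f x \<oplus>\<^bsub>N\<^esub> g x) \<in> lin_maps R M N"
  using lin_rules[OF assms(1,2,3)] lin_rules[OF assms(1,2,4)] assms(1,2)
  by (intro linI) (simp_all add: lm_ac lm_distr)

lemma lin_neg:
  assumes "left_module R M" "left_module R N" "f \<in> lin_maps R M N"
  shows "(\<lambda>x. \<ominus>\<^bsub>N\<^esub> f x) \<in> lin_maps R M N"
  using lin_rules[OF assms(1,2,3)] assms(1,2) by (intro linI) (simp_all add: lm_distr)

lemma lin_null:
  assumes "left_module R N" shows "(\<lambda>x. \<zero>\<^bsub>N\<^esub>) \<in> lin_maps R M N"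
  using assms by (intro linI) simp_all

end

text \<open>Injections and projections as data rather than a fixed construction: a sum can then be
  found inside the type \<open>'r fgmod\<close>, and submodules of a sum are often biproducts along
  the very same maps, as in \<open>biprod_kern\<close>.\<close>

definition biprod where
  "biprod R M N S i1 i2 p1 p2 \<longleftrightarrow> i1 \<in> lin_maps R M S \<and> i2 \<in> lin_maps R N S \<and> p1 \<in> lin_maps R S M \<and> p2 \<in> lin_maps R S N \<and>
     (\<forall>x\<in>carrier M. p1 (i1 x) = x \<and> p2 (i1 x) = \<zero>\<^bsub>N\<^esub>) \<and> (\<forall>x\<in>carrier N. p1 (i2 x) = \<zero>\<^bsub>M\<^esub> \<and> p2 (i2 x) = x) \<and>
     (\<forall>s\<in>carrier S. i1 (p1 s) \<oplus>\<^bsub>S\<^esub> i2 (p2 s) = s)"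

definition prodm :: "('r, 'm, 'y) module_scheme \<Rightarrow> ('r, 'n, 'z) module_scheme \<Rightarrow> ('r, 'm \<times> 'n) module" where
  "prodm M N = \<lparr>carrier = carrier M \<times> carrier N, mult = (\<lambda>x y. x), one = (\<zero>\<^bsub>M\<^esub>, \<zero>\<^bsub>N\<^esub>), zero = (\<zero>\<^bsub>M\<^esub>, \<zero>\<^bsub>N\<^esub>),
     add = (\<lambda>x y. (fst x \<oplus>\<^bsub>M\<^esub> fst y, snd x \<oplus>\<^bsub>N\<^esub> snd y)), smult = (\<lambda>r x. (r \<odot>\<^bsub>M\<^esub> fst x, r \<odot>\<^bsub>N\<^esub> snd x))\<rparr>"

lemma prodm_simps [simp]: "carrier (prodm M N) = carrier M \<times> carrier N" "\<zero>\<^bsub>prodm M N\<^esub> = (\<zero>\<^bsub>M\<^esub>, \<zero>\<^bsub>N\<^esub>)"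
  "x \<oplus>\<^bsub>prodm M N\<^esub> y = (fst x \<oplus>\<^bsub>M\<^esub> fst y, snd x \<oplus>\<^bsub>N\<^esub> snd y)" "r \<odot>\<^bsub>prodm M N\<^esub> x = (r \<odot>\<^bsub>M\<^esub> fst x, r \<odot>\<^bsub>N\<^esub> snd x)"
  by (simp_all add: prodm_def)

lemma prodm_left_module:
  assumes "left_module R M" "left_module R N" shows "left_module R (prodm M N)"
proof -
  interpret M: left_module R M by fact
  interpret N: left_module R N by fact
  show ?thesis
  proof (intro left_module.intro left_module_axioms.intro M.R.ring_axioms)
    show "abelian_group (prodm M N)"
    proof (rule abelian_groupI)
      fix x assume "x \<in> carrier (prodm M N)"
      then show "\<exists>y\<in>carrier (prodm M N). y \<oplus>\<^bsub>prodm M N\<^esub> x = \<zero>\<^bsub>prodm M N\<^esub>"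
        by (intro bexI[of _ "(\<ominus>\<^bsub>M\<^esub> fst x, \<ominus>\<^bsub>N\<^esub> snd x)"]) (auto simp: M.l_neg N.l_neg)
    qed (auto simp: M.a_ac N.a_ac)
  qed (auto simp: M.smult_closed N.smult_closed M.smult_l_distr N.smult_l_distr M.smult_r_distr N.smult_r_distr
      M.smult_assoc1 N.smult_assoc1 M.smult_one N.smult_one)
qed

context fl_ring
begin

lemma prodm_fg:
  assumes "fg_module R M" "fg_module R N" shows "fg_module R (prodm M N)"
proof -
  have lm: "left_module R M" "left_module R N" "left_module R (prodm M N)" using assms by (auto intro!: prodm_left_module)
  let ?K = "prodm M N\<lparr>carrier := {x \<in> carrier (prodm M N). snd x = \<zero>\<^bsub>N\<^esub>}\<rparr>"
  have snd: "snd \<in> lin_maps R (prodm M N) N" by (intro linI) auto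
  have K: "left_module R ?K"
    using left_module.submodule_left_module[OF lm(3) lin_kernel_submodule[OF lm(3,2) snd]] .
  have "(\<lambda>x. (x, \<zero>\<^bsub>N\<^esub>)) \<in> lin_maps R M ?K" using lm by (intro linI) auto
  moreover have "(\<lambda>x. (x, \<zero>\<^bsub>N\<^esub>)) ` carrier M = carrier ?K" using lm by auto
  ultimately have "fin_length R ?K"
    by (rule fin_length_image[OF lm(1) K]) (use assms in \<open>simp add: fg_iff\<close>)
  then have "fin_length R (prodm M N)"
    by (rule fin_length_ext_map[OF lm(3,2) snd]) (use assms in \<open>simp add: fg_iff\<close>)
  then show ?thesis using lm by (simp add: fg_iff)
qed

lemma represent:
  assumes "fg_module R M"
  obtains N :: "'r fgmod" and f g where "fg_module R N" "f \<in> lin_maps R M N" "g \<in> lin_maps R N M"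
    "\<And>x. x \<in> carrier M \<Longrightarrow> g (f x) = x" "\<And>x. x \<in> carrier N \<Longrightarrow> f (g x) = x"
proof -
  obtain N :: "'r fgmod" where N: "fg_module R N" "mod_iso R M N" using fg_module_represented[OF assms] by metis
  then obtain f where f: "f \<in> lin_maps R M N" "inj_on f (carrier M)" "f ` carrier M = carrier N"
    by (auto simp: mod_iso_def bij_betw_def)
  have "inv_into (carrier M) f \<in> lin_maps R (N\<lparr>carrier := carrier N\<rparr>) M"
    using lin_inv_into[OF fg_lm[OF assms] f(1,2)] f(3) by simp
  then have "inv_into (carrier M) f \<in> lin_maps R N M" by (simp add: lin_maps_def)
  moreover have "\<And>x. x \<in> carrier M \<Longrightarrow> inv_into (carrier M) f (f x) = x" using f by simp
  moreover have "\<And>x. x \<in> carrier N \<Longrightarrow> f (inv_into (carrier M) f x) = x" using f f_inv_into_f by metis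
  ultimately show ?thesis using that N(1) f(1) by blast
qed

text \<open>The product on pairs is carried over to \<open>'r fgmod\<close> by
  \<open>represent\<close>, since projectivity and resolutions refer to that type only.\<close>

lemma biprod_exists:
  assumes "fg_module R M" "fg_module R N"
  obtains S :: "'r fgmod" and i1 i2 p1 p2 where "fg_module R S" "biprod R M N S i1 i2 p1 p2"
proof -
  have lm [simp]: "left_module R M" "left_module R N" "left_module R (prodm M N)" using assms by (auto intro!: prodm_left_module)
  obtain S :: "'r fgmod" and f g where S: "fg_module R S" "f \<in> lin_maps R (prodm M N) S" "g \<in> lin_maps R S (prodm M N)"
    "\<And>x. x \<in> carrier (prodm M N) \<Longrightarrow> g (f x) = x" "\<And>x. x \<in> carrier S \<Longrightarrow> f (g x) = x"
    using represent[OF prodm_fg[OF assms]] by metis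
  have lS [simp]: "left_module R S" using S(1) by simp
  note f = lin_rules[OF lm(3) lS S(2)] and g = lin_rules[OF lS lm(3) S(3)]
  have i: "(\<lambda>x. f (x, \<zero>\<^bsub>N\<^esub>)) \<in> lin_maps R M S" "(\<lambda>x. f (\<zero>\<^bsub>M\<^esub>, x)) \<in> lin_maps R N S"
    by (rule lin_comp[OF _ S(2)], rule linI; simp)+
  have p: "(\<lambda>x. fst (g x)) \<in> lin_maps R S M" "(\<lambda>x. snd (g x)) \<in> lin_maps R S N"
    by (rule lin_comp[OF S(3)], rule linI; auto)+
  have "f (fst (g s), \<zero>\<^bsub>N\<^esub>) \<oplus>\<^bsub>S\<^esub> f (\<zero>\<^bsub>M\<^esub>, snd (g s)) = s" if "s \<in> carrier S" for s
  proof -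
    have gs: "fst (g s) \<in> carrier M" "snd (g s) \<in> carrier N" using g(1)[OF that] by auto
    have "f (fst (g s), \<zero>\<^bsub>N\<^esub>) \<oplus>\<^bsub>S\<^esub> f (\<zero>\<^bsub>M\<^esub>, snd (g s)) = f (g s)"
      using f(2)[of "(fst (g s), \<zero>\<^bsub>N\<^esub>)" "(\<zero>\<^bsub>M\<^esub>, snd (g s))"] gs by simp
    then show ?thesis using S that by simp
  qed
  then have "biprod R M N S (\<lambda>x. f (x, \<zero>\<^bsub>N\<^esub>)) (\<lambda>x. f (\<zero>\<^bsub>M\<^esub>, x)) (\<lambda>x. fst (g x)) (\<lambda>x. snd (g x))"
    using i p S(4) by (simp add: biprod_def)
  with S(1) that show ?thesis by blast
qed

lemma biprod_rules:
  assumes "biprod R M N S i1 i2 p1 p2"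
  shows "x \<in> carrier M \<Longrightarrow> p1 (i1 x) = x" "x \<in> carrier M \<Longrightarrow> p2 (i1 x) = \<zero>\<^bsub>N\<^esub>"
    "y \<in> carrier N \<Longrightarrow> p1 (i2 y) = \<zero>\<^bsub>M\<^esub>" "y \<in> carrier N \<Longrightarrow> p2 (i2 y) = y"
    "s \<in> carrier S \<Longrightarrow> i1 (p1 s) \<oplus>\<^bsub>S\<^esub> i2 (p2 s) = s"
  using assms by (auto simp: biprod_def)

lemma biprod_maps:
  assumes "biprod R M N S i1 i2 p1 p2"
  shows "i1 \<in> lin_maps R M S" "i2 \<in> lin_maps R N S" "p1 \<in> lin_maps R S M" "p2 \<in> lin_maps R S N"
  using assms by (auto simp: biprod_def)

lemma biprod_swap: "left_module R S \<Longrightarrow> biprod R M N S i1 i2 p1 p2 \<Longrightarrow> biprod R N M S i2 i1 p2 p1"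
  by (auto simp: biprod_def lm_ac(2) lin_closed)

end

section \<open>Projective dimension\<close>

definition kern :: "('r, 'm, 'y) module_scheme \<Rightarrow> ('r, 'n, 'z) module_scheme \<Rightarrow> ('m \<Rightarrow> 'n) \<Rightarrow> ('r, 'm, 'y) module_scheme" where
  "kern M N f = M\<lparr>carrier := {x \<in> carrier M. f x = \<zero>\<^bsub>N\<^esub>}\<rparr>"

lemma kern_simps [simp]: "carrier (kern M N f) = {x \<in> carrier M. f x = \<zero>\<^bsub>N\<^esub>}" "zero (kern M N f) = zero M"
  "add (kern M N f) = add M" "smult (kern M N f) = smult M"
  by (simp_all add: kern_def)

definition epi :: "('r, 'x) ring_scheme \<Rightarrow> ('r, 'm, 'y) module_scheme \<Rightarrow> ('r, 'n, 'z) module_scheme \<Rightarrow> ('m \<Rightarrow> 'n) \<Rightarrow> bool" where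
  "epi R M N f \<longleftrightarrow> f \<in> lin_maps R M N \<and> f ` carrier M = carrier N"

text \<open>All projective presentations are quantified over; by Schanuel's lemma a single one suffices
  (\<open>pd_le_SucI\<close>).\<close>

primrec pd_le :: "('r, 'x) ring_scheme \<Rightarrow> nat \<Rightarrow> 'r fgmod \<Rightarrow> bool" where
  "pd_le R 0 M = projective R M"
| "pd_le R (Suc n) M = (fg_module R M \<and> (\<forall>P f. projective R P \<and> epi R P M f \<longrightarrow> pd_le R n (kern P M f)))"

context fl_ring
begin

lemma kern_fg: "fg_module R M \<Longrightarrow> left_module R N \<Longrightarrow> f \<in> lin_maps R M N \<Longrightarrow> fg_module R (kern M N f)"
  unfolding kern_def by (intro fg_sub lin_kernel_submodule) auto

lemma projective_fg: "projective R P \<Longrightarrow> fg_module R P"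
  by (simp add: projective_def)

lemma projective_lift:
  fixes P L Y :: "'r fgmod"
  assumes "projective R P" "fg_module R L" "fg_module R Y" "f \<in> lin_maps R P Y" "epi R L Y g"
  obtains h where "h \<in> lin_maps R P L" "\<And>p. p \<in> carrier P \<Longrightarrow> g (h p) = f p"
proof -
  have "\<exists>h\<in>lin_maps R P L. \<forall>p\<in>carrier P. g (h p) = f p"
    using assms unfolding projective_def epi_def by blast
  then show ?thesis using that by blast
qed

lemma projective_retract:
  fixes M X :: "'r fgmod"
  assumes "projective R X" "fg_module R M" "i \<in> lin_maps R M X" "r \<in> lin_maps R X M"
    "\<And>x. x \<in> carrier M \<Longrightarrow> r (i x) = x"
  shows "projective R M"
  unfolding projective_def
proof (intro conjI allI ballI impI)
  fix L Y :: "'r fgmod" and g f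
  assume *: "g \<in> lin_maps R L Y" "f \<in> lin_maps R M Y" "fg_module R L \<and> fg_module R Y \<and> g ` carrier L = carrier Y"
  have fr: "(\<lambda>x. f (r x)) \<in> lin_maps R X Y" using lin_comp[OF assms(4) *(2)] .
  obtain h where h: "h \<in> lin_maps R X L" "\<And>x. x \<in> carrier X \<Longrightarrow> g (h x) = f (r x)"
    by (rule projective_lift[OF assms(1) _ _ fr, of L g]) (use * in \<open>auto simp: epi_def\<close>)
  have "(\<lambda>x. h (i x)) \<in> lin_maps R M L" using lin_comp[OF assms(3) h(1)] .
  then show "\<exists>h\<in>lin_maps R M L. \<forall>p\<in>carrier M. g (h p) = f p"
    by (rule bexI[rotated]) (use h(2) assms(5) lin_closed[OF assms(3)] in auto)
qed (fact assms(2))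

text \<open>The free module consists of coefficient vectors and so does not have the type that
  \<open>projective\<close> speaks of; the lifting therefore goes through
  \<open>free_lift\<close>.\<close>

lemma projective_free_retract:
  fixes M :: "'r fgmod"
  assumes "fg_module R M" "i \<in> lin_maps R M (free R n)" "r \<in> lin_maps R (free R n) M"
    "\<And>x. x \<in> carrier M \<Longrightarrow> r (i x) = x"
  shows "projective R M"
  unfolding projective_def
proof (intro conjI allI ballI impI)
  fix L Y :: "'r fgmod" and g f
  assume *: "g \<in> lin_maps R L Y" "f \<in> lin_maps R M Y" "fg_module R L \<and> fg_module R Y \<and> g ` carrier L = carrier Y"
  have fr: "(\<lambda>x. f (r x)) \<in> lin_maps R (free R n) Y" using lin_comp[OF assms(3) *(2)] .
  have im: "(\<lambda>x. f (r x)) ` carrier (free R n) \<subseteq> g ` carrier L" using * lin_closed[OF fr] by auto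
  obtain h where h: "h \<in> lin_maps R (free R n) L" "\<And>x. x \<in> carrier (free R n) \<Longrightarrow> g (h x) = f (r x)"
    by (rule free_lift[OF ring _ _ fr *(1) im]) (use * in auto)
  have "(\<lambda>x. h (i x)) \<in> lin_maps R M L" using lin_comp[OF assms(2) h(1)] .
  then show "\<exists>h\<in>lin_maps R M L. \<forall>p\<in>carrier M. g (h p) = f p"
    by (rule bexI[rotated]) (use h(2) assms(4) lin_closed[OF assms(2)] in auto)
qed (fact assms(1))

text \<open>Only an epimorphism from a projective module, namely a free module carried over to
  \<open>'r fgmod\<close>. Minimality in the sense of \<open>projective_cover\<close> is not
  asserted.\<close>

lemma projective_cover_exists:
  fixes M :: "'r fgmod"
  assumes "fg_module R M"
  obtains P :: "'r fgmod" and f where "projective R P" "epi R P M f"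
proof -
  obtain n f where f: "f \<in> lin_maps R (free R n) M" "f ` carrier (free R n) = carrier M" using free_cover[OF assms] by metis
  obtain P :: "'r fgmod" and h k where P: "fg_module R P" "h \<in> lin_maps R (free R n) P" "k \<in> lin_maps R P (free R n)"
    "\<And>x. x \<in> carrier (free R n) \<Longrightarrow> k (h x) = x" "\<And>x. x \<in> carrier P \<Longrightarrow> h (k x) = x"
    using represent[OF free_fg[OF ring]] by metis
  have "projective R P" using projective_free_retract P by blast
  moreover have "(\<lambda>x. f (k x)) \<in> lin_maps R P M" using lin_comp P(3) f(1) by blast
  moreover have "y \<in> (\<lambda>x. f (k x)) ` carrier P" if "y \<in> carrier M" for y
  proof -
    obtain z where "z \<in> carrier (free R n)" "y = f z" using \<open>y \<in> carrier M\<close> f(2) by (metis imageE)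
    then show ?thesis using P(4) lin_closed[OF P(2)] by (intro image_eqI[of _ _ "h z"]) auto
  qed
  ultimately have "epi R P M (\<lambda>x. f (k x))" using lin_closed[of "\<lambda>x. f (k x)" R P M] unfolding epi_def by auto
  then show ?thesis using that \<open>projective R P\<close> by blast
qed

lemma projective_sum:
  fixes M N S :: "'r fgmod"
  assumes "projective R M" "projective R N" "fg_module R S" "biprod R M N S i1 i2 p1 p2"
  shows "projective R S"
  unfolding projective_def
proof (intro conjI allI ballI impI)
  note b = biprod_maps[OF assms(4)]
  fix L Y :: "'r fgmod" and g f
  assume *: "g \<in> lin_maps R L Y" "f \<in> lin_maps R S Y" "fg_module R L \<and> fg_module R Y \<and> g ` carrier L = carrier Y"
  then have e: "epi R L Y g" and [simp]: "fg_module R L" "fg_module R Y" by (auto simp: epi_def)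
  have [simp]: "left_module R S" "left_module R M" "left_module R N" using assms projective_fg by auto
  obtain h1 where h1: "h1 \<in> lin_maps R M L" "\<And>x. x \<in> carrier M \<Longrightarrow> g (h1 x) = f (i1 x)"
    by (rule projective_lift[OF assms(1) _ _ lin_comp[OF b(1) *(2)] e]) auto
  obtain h2 where h2: "h2 \<in> lin_maps R N L" "\<And>x. x \<in> carrier N \<Longrightarrow> g (h2 x) = f (i2 x)"
    by (rule projective_lift[OF assms(2) _ _ lin_comp[OF b(2) *(2)] e]) auto
  have "(\<lambda>s. h1 (p1 s) \<oplus>\<^bsub>L\<^esub> h2 (p2 s)) \<in> lin_maps R S L"
    by (intro lin_padd lin_comp[OF b(3) h1(1)] lin_comp[OF b(4) h2(1)]) auto
  moreover have "g (h1 (p1 s) \<oplus>\<^bsub>L\<^esub> h2 (p2 s)) = f s" if s: "s \<in> carrier S" for s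
  proof -
    have c: "p1 s \<in> carrier M" "p2 s \<in> carrier N" using s b lin_closed by metis+
    then have "g (h1 (p1 s) \<oplus>\<^bsub>L\<^esub> h2 (p2 s)) = f (i1 (p1 s)) \<oplus>\<^bsub>Y\<^esub> f (i2 (p2 s))"
      using h1 h2 lin_closed[OF h1(1)] lin_closed[OF h2(1)] by (simp add: lin_add[OF *(1)])
    also have "\<dots> = f (i1 (p1 s) \<oplus>\<^bsub>S\<^esub> i2 (p2 s))" using c b by (simp add: lin_add[OF *(2)] lin_closed)
    finally show ?thesis using biprod_rules(5)[OF assms(4) s] by simp
  qed
  ultimately show "\<exists>h\<in>lin_maps R S L. \<forall>p\<in>carrier S. g (h p) = f p"
    by (intro bexI[of _ "\<lambda>s. h1 (p1 s) \<oplus>\<^bsub>L\<^esub> h2 (p2 s)"]) auto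
qed (fact assms(3))

lemma pd_le_fg: "pd_le R n M \<Longrightarrow> fg_module R M"
  by (cases n) (auto simp: projective_fg)

lemma biprod_epi:
  fixes M N S :: "'r fgmod"
  assumes "left_module R S" "left_module R X" "biprod R M N S i1 i2 p1 p2" "f \<in> lin_maps R M X" "g \<in> lin_maps R N X"
  shows "(\<lambda>s. f (p1 s) \<oplus>\<^bsub>X\<^esub> g (p2 s)) \<in> lin_maps R S X"
  using biprod_maps[OF assms(3)] assms by (intro lin_padd lin_comp[of p1 R S M f X] lin_comp[of p2 R S N g X]) auto

text \<open>Presentations \<open>f\<close> of \<open>M\<close> and \<open>g\<close> of
  \<open>X\<close> combine into the presentation \<open>h\<close> of \<open>X\<close> by the sum of
  \<open>F\<close> and \<open>G\<close>. The kernel of \<open>f\<close> is a retract of the kernel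
  of \<open>h\<close>, which gives the induction step without forming a complement of
  \<open>M\<close> in \<open>X\<close>.\<close>

lemma pd_le_retract:
  fixes M X :: "'r fgmod"
  assumes "pd_le R n X" "fg_module R M" "i \<in> lin_maps R M X" "r \<in> lin_maps R X M"
    "\<And>x. x \<in> carrier M \<Longrightarrow> r (i x) = x"
  shows "pd_le R n M"
  using assms
proof (induction n arbitrary: M X i r)
  case 0
  then show ?case using projective_retract by simp
next
  case (Suc n)
  have X: "fg_module R X" using Suc.prems pd_le_fg by blast
  have "pd_le R n (kern F M f)" if F: "projective R F" and f: "epi R F M f" for F f
  proof -
    obtain G :: "'r fgmod" and g where G: "projective R G" "epi R G X g" using projective_cover_exists[OF X] by metis
    have FG: "fg_module R F" "fg_module R G" using F G projective_fg by auto
    obtain H :: "'r fgmod" and i1 i2 p1 p2 where H: "fg_module R H" "biprod R F G H i1 i2 p1 p2"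
      using biprod_exists[OF FG] by metis
    have H': "projective R H" using projective_sum[OF F G(1) H] .
    have lm [simp]: "left_module R M" "left_module R X" "left_module R F" "left_module R G" "left_module R H"
      using FG H X Suc.prems by auto
    have fl: "f \<in> lin_maps R F M" "g \<in> lin_maps R G X" using f G by (auto simp: epi_def)
    note b = biprod_maps[OF H(2)]
    note R = lin_rules[OF lm(3,5) b(1)] lin_rules[OF lm(4,5) b(2)] lin_rules[OF lm(5,3) b(3)] lin_rules[OF lm(5,4) b(4)]
      lin_rules[OF lm(1,2) Suc.prems(3)] lin_rules[OF lm(2,1) Suc.prems(4)] lin_rules[OF lm(3,1) fl(1)] lin_rules[OF lm(4,2) fl(2)]
      biprod_rules[OF H(2)]
    obtain l where l: "l \<in> lin_maps R G F" "\<And>x. x \<in> carrier G \<Longrightarrow> f (l x) = r (g x)"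
      using projective_lift[OF G(1) FG(1) Suc.prems(2) lin_comp[OF fl(2) Suc.prems(4)] f] by metis
    note Rl = lin_rules[OF lm(4,3) l(1)]
    define h where "h s = i (f (p1 s)) \<oplus>\<^bsub>X\<^esub> g (p2 s)" for s
    have hl: "h \<in> lin_maps R H X" unfolding h_def
      by (rule biprod_epi[OF _ _ H(2) lin_comp[OF fl(1) Suc.prems(3)] fl(2)]) auto
    have "y \<in> h ` carrier H" if y: "y \<in> carrier X" for y
    proof -
      obtain z where "z \<in> carrier G" "y = g z" using y G(2) by (auto simp: epi_def)
      then show ?thesis by (intro image_eqI[of _ _ "i2 z"]) (simp_all add: h_def R)
    qed
    then have eh: "epi R H X h" using hl lin_closed[OF hl] by (auto simp: epi_def)
    then have K: "pd_le R n (kern H X h)" using Suc.prems(1) H' by simp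
    have 1: "i1 \<in> lin_maps R (kern F M f) (kern H X h)"
      using b(1) by (intro linI) (auto simp: R h_def)
    \<comment> \<open>This identity is the reason for choosing \<open>l\<close> as a lift of
      \<open>r g\<close> through \<open>f\<close>: the map \<open>p1 + l p2\<close> sends the kernel
      of \<open>h\<close> into the kernel of \<open>f\<close>.\<close>
    have rr: "f (p1 s \<oplus>\<^bsub>F\<^esub> l (p2 s)) = r (h s)" if "s \<in> carrier H" for s
      using that Suc.prems(5) by (simp add: R Rl l(2) h_def)
    have 2: "(\<lambda>s. p1 s \<oplus>\<^bsub>F\<^esub> l (p2 s)) \<in> lin_maps R (kern H X h) (kern F M f)"
      using rr by (intro linI) (auto simp: R Rl lm_ac lm_distr)
    show ?thesis
      by (rule Suc.IH[OF K kern_fg[OF FG(1) lm(1) fl(1)] 1 2]) (simp add: R Rl)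
  qed
  then show ?case using Suc.prems by simp
qed

end

section \<open>Short exact sequences and projective dimension\<close>

definition ses :: "('r, 'x) ring_scheme \<Rightarrow> ('r, 'l, 'u) module_scheme \<Rightarrow> ('r, 'm, 'y) module_scheme \<Rightarrow> ('r, 'n, 'z) module_scheme \<Rightarrow>
    ('l \<Rightarrow> 'm) \<Rightarrow> ('m \<Rightarrow> 'n) \<Rightarrow> bool" where
  "ses R A B C f g \<longleftrightarrow> fg_module R A \<and> fg_module R B \<and> fg_module R C \<and> f \<in> lin_maps R A B \<and> inj_on f (carrier A) \<and>
     epi R B C g \<and> f ` carrier A = {x \<in> carrier B. g x = \<zero>\<^bsub>C\<^esub>}"

context fl_ring
begin

lemma epiI: "f \<in> lin_maps R M N \<Longrightarrow> (\<And>y. y \<in> carrier N \<Longrightarrow> \<exists>x\<in>carrier M. f x = y) \<Longrightarrow> epi R M N f"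
  unfolding epi_def using lin_closed[of f R M N] by (auto simp: image_iff)

lemma epi_comp: "epi R L M f \<Longrightarrow> epi R M N g \<Longrightarrow> epi R L N (\<lambda>x. g (f x))"
  unfolding epi_def using lin_comp[of f R L M g N] by (auto simp flip: image_image)

lemma projective_split:
  fixes P M :: "'r fgmod"
  assumes "projective R M" "fg_module R P" "epi R P M f"
  obtains s where "s \<in> lin_maps R M P" "\<And>x. x \<in> carrier M \<Longrightarrow> f (s x) = x"
  using projective_lift[OF assms(1,2) projective_fg[OF assms(1)] _ assms(3), of "\<lambda>x. x"] lin_id[of R M]
  by (auto simp: id_def)

text \<open>An epimorphism onto a projective module splits, so its kernel is a retract of a
  projective module.\<close>

lemma pd_le_Suc:
  fixes M :: "'r fgmod"
  assumes "pd_le R n M" shows "pd_le R (Suc n) M"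
  using assms
proof (induction n arbitrary: M)
  case 0
  have M: "projective R M" "fg_module R M" using 0 projective_fg by auto
  have "projective R (kern P M f)" if P: "projective R P" and f: "epi R P M f" for P f
  proof -
    have fl: "f \<in> lin_maps R P M" using f by (auto simp: epi_def)
    have lm [simp]: "left_module R P" "left_module R M" using M P projective_fg by auto
    obtain s where s: "s \<in> lin_maps R M P" "\<And>x. x \<in> carrier M \<Longrightarrow> f (s x) = x"
      using projective_split[OF M(1) projective_fg[OF P] f] by metis
    note R = lin_rules[OF lm(1,2) fl] lin_rules[OF lm(2,1) s(1)] s(2)
    have 1: "(\<lambda>x. x) \<in> lin_maps R (kern P M f) P" by (intro linI) auto
    have 2: "(\<lambda>x. x \<oplus>\<^bsub>P\<^esub> \<ominus>\<^bsub>P\<^esub> s (f x)) \<in> lin_maps R P (kern P M f)"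
      by (intro linI) (auto simp: R lm_ac lm_distr)
    show ?thesis
      by (rule projective_retract[OF P kern_fg[OF projective_fg[OF P] lm(2) fl] 1 2]) (simp add: R)
  qed
  then show ?case using M by simp
qed simp

lemma pd_le_mono: fixes M :: "'r fgmod" assumes "pd_le R m M" "m \<le> n" shows "pd_le R n M"
  using assms(2,1) by (induction rule: dec_induct) (auto intro: pd_le_Suc simp del: pd_le.simps)

lemma projective_pd_le: "projective R P \<Longrightarrow> pd_le R n P"
  using pd_le_mono[of 0 P n] by simp

text \<open>A sum of elements from the two summands vanishes only componentwise; so the kernel of a
  direct sum of maps is a biproduct along the original injections and projections.\<close>

lemma biprod_kern:
  assumes P: "biprod R P Q T j1 j2 q1 q2" and M: "biprod R M N S i1 i2 p1 p2"
    and f: "f \<in> lin_maps R P M" and g: "g \<in> lin_maps R Q N"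
    and lm [simp]: "left_module R P" "left_module R Q" "left_module R T" "left_module R M" "left_module R N" "left_module R S"
  defines "h \<equiv> \<lambda>t. i1 (f (q1 t)) \<oplus>\<^bsub>S\<^esub> i2 (g (q2 t))"
  shows "h \<in> lin_maps R T S" "biprod R (kern P M f) (kern Q N g) (kern T S h) j1 j2 q1 q2"
    "epi R P M f \<Longrightarrow> epi R Q N g \<Longrightarrow> epi R T S h"
proof -
  note b = biprod_maps[OF P] and c = biprod_maps[OF M]
  note R = lin_rules[OF lm(1,3) b(1)] lin_rules[OF lm(2,3) b(2)] lin_rules[OF lm(3,1) b(3)] lin_rules[OF lm(3,2) b(4)]
    lin_rules[OF lm(4,6) c(1)] lin_rules[OF lm(5,6) c(2)] lin_rules[OF lm(6,4) c(3)] lin_rules[OF lm(6,5) c(4)]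
    lin_rules[OF lm(1,4) f] lin_rules[OF lm(2,5) g] biprod_rules[OF P] biprod_rules[OF M]
  show hl: "h \<in> lin_maps R T S" unfolding h_def by (intro linI) (simp_all add: R lm_ac lm_distr)
  have h: "h t = \<zero>\<^bsub>S\<^esub> \<longleftrightarrow> f (q1 t) = \<zero>\<^bsub>M\<^esub> \<and> g (q2 t) = \<zero>\<^bsub>N\<^esub>" if t: "t \<in> carrier T" for t
  proof
    assume "h t = \<zero>\<^bsub>S\<^esub>"
    then have "p1 (h t) = \<zero>\<^bsub>M\<^esub>" "p2 (h t) = \<zero>\<^bsub>N\<^esub>" by (simp_all add: R)
    then show "f (q1 t) = \<zero>\<^bsub>M\<^esub> \<and> g (q2 t) = \<zero>\<^bsub>N\<^esub>" using t by (simp add: R h_def)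
  qed (simp add: R h_def)
  have "carrier (kern T S h) = {t \<in> carrier T. f (q1 t) = \<zero>\<^bsub>M\<^esub> \<and> g (q2 t) = \<zero>\<^bsub>N\<^esub>}" using h by auto
  then show "biprod R (kern P M f) (kern Q N g) (kern T S h) j1 j2 q1 q2"
    using b unfolding biprod_def by (auto intro!: linI simp: R)
  assume e: "epi R P M f" "epi R Q N g"
  show "epi R T S h"
  proof (rule epiI[OF hl])
    fix y assume y: "y \<in> carrier S"
    obtain u v where uv: "u \<in> carrier P" "v \<in> carrier Q" "f u = p1 y" "g v = p2 y"
      using e R(31,36)[OF y] unfolding epi_def by (metis imageE)
    then show "\<exists>x\<in>carrier T. h x = y" using y by (intro bexI[of _ "j1 u \<oplus>\<^bsub>T\<^esub> j2 v"]) (simp_all add: h_def R)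
  qed
qed

text \<open>Schanuel's lemma in the form needed here: the kernel \<open>K'\<close> of \<open>P' \<rightarrow> M\<close> is a retract of \<open>K \<oplus> P'\<close>.\<close>

lemma pd_le_kern_swap:
  fixes M :: "'r fgmod"
  assumes sum: "\<And>(M :: 'r fgmod) N S i1 i2 p1 p2. pd_le R n M \<Longrightarrow> pd_le R n N \<Longrightarrow> fg_module R S \<Longrightarrow>
      biprod R M N S i1 i2 p1 p2 \<Longrightarrow> pd_le R n (S :: 'r fgmod)"
    and "fg_module R M" "projective R P" "epi R P M f" "projective R P'" "epi R P' M f'" "pd_le R n (kern P M f)"
  shows "pd_le R n (kern P' M f')"
proof -
  let ?K = "kern P M f" and ?K' = "kern P' M f'"
  have fl: "f \<in> lin_maps R P M" "f' \<in> lin_maps R P' M" using assms by (auto simp: epi_def)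
  have fg: "fg_module R P" "fg_module R P'" using assms projective_fg by auto
  have K: "fg_module R ?K" "fg_module R ?K'" using fg assms fl by (auto intro: kern_fg)
  obtain l where l: "l \<in> lin_maps R P' P" "\<And>x. x \<in> carrier P' \<Longrightarrow> f (l x) = f' x"
    using projective_lift[OF assms(5) fg(1) assms(2) fl(2) assms(4)] by metis
  obtain l' where l': "l' \<in> lin_maps R P P'" "\<And>x. x \<in> carrier P \<Longrightarrow> f' (l' x) = f x"
    using projective_lift[OF assms(3) fg(2) assms(2) fl(1) assms(6)] by metis
  obtain S :: "'r fgmod" and i1 i2 p1 p2 where S: "fg_module R S" "biprod R ?K P' S i1 i2 p1 p2"
    using biprod_exists[OF K(1) fg(2)] by metis
  have pS: "pd_le R n S" using sum[OF assms(7) projective_pd_le[OF assms(5)] S] .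
  note b = biprod_maps[OF S(2)]
  have lm [simp]: "left_module R P" "left_module R P'" "left_module R S" "left_module R ?K" "left_module R ?K'" "left_module R M"
    using fg S K assms by auto
  note R = lin_rules[OF lm(4,3) b(1), simplified] lin_rules[OF lm(2,3) b(2)] lin_rules[OF lm(3,4) b(3), simplified] lin_rules[OF lm(3,2) b(4)]
    lin_rules[OF lm(1,6) fl(1)] lin_rules[OF lm(2,6) fl(2)] lin_rules[OF lm(2,1) l(1)] lin_rules[OF lm(1,2) l'(1)]
    biprod_rules[OF S(2), simplified] l(2) l'(2)
  have c: "s \<in> carrier S \<Longrightarrow> p1 s \<in> carrier P" "s \<in> carrier S \<Longrightarrow> f (p1 s) = \<zero>\<^bsub>M\<^esub>" for s using lin_closed[OF b(3), of s] by auto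
  \<comment> \<open>An element \<open>k\<close> of \<open>?K'\<close> goes to the pair of
    \<open>l k\<close> and \<open>k\<close>, where \<open>l k\<close> lies in \<open>?K\<close>
    because \<open>f l = f'\<close>. The map back returns
    \<open>l' (l k) + (k - l' (l k)) = k\<close>.\<close>
  have 1: "(\<lambda>k. i1 (l k) \<oplus>\<^bsub>S\<^esub> i2 k) \<in> lin_maps R ?K' S"
    by (intro linI) (auto simp: R lm_ac lm_distr)
  have 2: "(\<lambda>s. l' (p1 s) \<oplus>\<^bsub>P'\<^esub> (p2 s \<oplus>\<^bsub>P'\<^esub> \<ominus>\<^bsub>P'\<^esub> l' (l (p2 s)))) \<in> lin_maps R S ?K'"
    by (intro linI) (auto simp: R c lm_ac lm_distr)
  show ?thesis
    by (rule pd_le_retract[OF pS K(2) 1 2]) (auto simp: R lm_ac)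
qed

lemma pd_le_SucD: "pd_le R (Suc n) M \<Longrightarrow> projective R P \<Longrightarrow> epi R P M f \<Longrightarrow> pd_le R n (kern P M f)"
  by simp

declare pd_le.simps(2) [simp del]

text \<open>Exchanging one presentation for another requires additivity for the kernels, one level
  down. This is why \<open>pd_le_kern_swap\<close> takes additivity as a premise; here it is the
  induction hypothesis.\<close>

lemma pd_le_sum:
  fixes M N S :: "'r fgmod"
  assumes "pd_le R n M" "pd_le R n N" "fg_module R S" "biprod R M N S i1 i2 p1 p2"
  shows "pd_le R n S"
  using assms
proof (induction n arbitrary: M N S i1 i2 p1 p2)
  case 0
  then show ?case using projective_sum[OF _ _ 0(3,4)] by simp
next
  case (Suc n)
  have fg: "fg_module R M" "fg_module R N" using Suc.prems(1,2) by (auto dest: pd_le_fg)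
  obtain P :: "'r fgmod" and f where P: "projective R P" "epi R P M f" using projective_cover_exists[OF fg(1)] by metis
  obtain Q :: "'r fgmod" and g where Q: "projective R Q" "epi R Q N g" using projective_cover_exists[OF fg(2)] by metis
  have PQ: "fg_module R P" "fg_module R Q" using P Q projective_fg by auto
  obtain T :: "'r fgmod" and j1 j2 q1 q2 where T: "fg_module R T" "biprod R P Q T j1 j2 q1 q2"
    using biprod_exists[OF PQ] by metis
  have Tp: "projective R T" using projective_sum[OF P(1) Q(1) T] .
  have lm: "left_module R P" "left_module R Q" "left_module R T" "left_module R M" "left_module R N" "left_module R S"
    using PQ T fg Suc.prems by auto
  define h where "h = (\<lambda>t. i1 (f (q1 t)) \<oplus>\<^bsub>S\<^esub> i2 (g (q2 t)))"
  have fl: "f \<in> lin_maps R P M" "g \<in> lin_maps R Q N" using P Q by (auto simp: epi_def)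
  note bk = biprod_kern[OF T(2) Suc.prems(4) fl lm, folded h_def]
  have K: "pd_le R n (kern P M f)" "pd_le R n (kern Q N g)" using pd_le_SucD Suc.prems(1,2) P Q by blast+
  have e: "epi R T S h" by (rule bk(3)[OF P(2) Q(2)])
  have hK: "pd_le R n (kern T S h)"
    by (rule Suc.IH[OF K kern_fg[OF T(1) lm(6) bk(1)] bk(2)])
  have "pd_le R n (kern P' S f')" if "projective R P'" "epi R P' S f'" for P' f'
    by (rule pd_le_kern_swap[OF _ Suc.prems(3) Tp e that hK]) (rule Suc.IH)
  then show ?case using Suc.prems(3) by (simp add: pd_le.simps(2))
qed

lemma pd_le_SucI:
  fixes M :: "'r fgmod"
  assumes "fg_module R M" "projective R P" "epi R P M f" "pd_le R n (kern P M f)"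
  shows "pd_le R (Suc n) M"
  unfolding pd_le.simps(2)
proof (intro conjI allI impI)
  fix P' f' assume "projective R P' \<and> epi R P' M f'"
  then show "pd_le R n (kern P' M f')"
    using pd_le_kern_swap[OF _ assms(1-3) _ _ assms(4)] pd_le_sum by metis
qed (fact assms(1))

text \<open>The kernel of the composite from \<open>F\<close> to \<open>C\<close> maps onto
  \<open>A\<close> with kernel that of \<open>b\<close>. Adjoining \<open>G\<close> gives 0 -> syz A
  -> G + syz B -> syz C -> 0, in which the presentations of \<open>A\<close> and \<open>B\<close>
  are prescribed and that of \<open>C\<close> is the one induced through \<open>B\<close>.\<close>

lemma ses_rotate:
  fixes A B C F G :: "'r fgmod"
  assumes s: "ses R A B C f g" and G: "projective R G" "epi R G A a" and F: "projective R F" "epi R F B b"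
    and S: "fg_module R S" "biprod R G (kern F B b) S i1 i2 p1 p2"
  shows "\<exists>f' g'. ses R (kern G A a) S (kern F C (\<lambda>x. g (b x))) f' g'"
proof -
  let ?A = "kern G A a" and ?B = "kern F B b" and ?C = "kern F C (\<lambda>x. g (b x))"
  have fg: "fg_module R A" "fg_module R B" "fg_module R C" "fg_module R F" "fg_module R G"
    using s F G projective_fg by (auto simp: ses_def)
  have lin: "f \<in> lin_maps R A B" "g \<in> lin_maps R B C" "a \<in> lin_maps R G A" "b \<in> lin_maps R F B"
    using s F G by (auto simp: ses_def epi_def)
  obtain l where l: "l \<in> lin_maps R G F" "\<And>x. x \<in> carrier G \<Longrightarrow> b (l x) = f (a x)"
    using projective_lift[OF G(1) fg(4,2) lin_comp[OF lin(3,1)] F(2)] by metis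
  have K: "fg_module R ?A" "fg_module R ?B" "fg_module R ?C"
    using fg lin by (auto intro!: kern_fg lin_comp[OF lin(4,2)])
  have lm [simp]: "left_module R A" "left_module R B" "left_module R C" "left_module R F" "left_module R G"
    "left_module R ?A" "left_module R ?B" "left_module R ?C" "left_module R S" using fg K S by auto
  note m = biprod_maps[OF S(2)]
  note R = lin_rules[OF lm(1,2) lin(1)] lin_rules[OF lm(2,3) lin(2)] lin_rules[OF lm(5,1) lin(3)] lin_rules[OF lm(4,2) lin(4)]
    lin_rules[OF lm(5,4) l(1)] lin_rules[OF lm(5,9) m(1)] lin_rules[OF lm(7,9) m(2), simplified] lin_rules[OF lm(9,5) m(3)]
    lin_rules[OF lm(9,7) m(4), simplified] biprod_rules[OF S(2), simplified] l(2)
  have c: "s \<in> carrier S \<Longrightarrow> p2 s \<in> carrier F" "s \<in> carrier S \<Longrightarrow> b (p2 s) = \<zero>\<^bsub>B\<^esub>" for s using lin_closed[OF m(4), of s] by auto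
  have gf: "x \<in> carrier A \<Longrightarrow> g (f x) = \<zero>\<^bsub>C\<^esub>" for x using s by (auto simp: ses_def)
  have inj: "x \<in> carrier A \<Longrightarrow> f x = \<zero>\<^bsub>B\<^esub> \<Longrightarrow> x = \<zero>\<^bsub>A\<^esub>" for x
    using s R(4) inj_onD[of f "carrier A" x "\<zero>\<^bsub>A\<^esub>"] by (auto simp: ses_def)
  let ?neg = "\<lambda>x. \<ominus>\<^bsub>F\<^esub> l x"
  have nB: "?neg x \<in> carrier F" "b (?neg x) = \<zero>\<^bsub>B\<^esub>" if "x \<in> carrier ?A" for x using that by (auto simp: R)
  define f' where "f' x = i1 x \<oplus>\<^bsub>S\<^esub> i2 (?neg x)" for x
  define g' where "g' s = l (p1 s) \<oplus>\<^bsub>F\<^esub> p2 s" for s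
  have f': "f' \<in> lin_maps R ?A S"
    unfolding f'_def
  proof (rule lin_padd)
    show "i1 \<in> lin_maps R ?A S" by (intro linI) (auto simp: R)
    have "?neg \<in> lin_maps R ?A ?B" by (intro linI) (auto simp: R lm_ac lm_distr)
    then show "(\<lambda>x. i2 (?neg x)) \<in> lin_maps R ?A S" using m(2) by (rule lin_comp)
  qed auto
  have g': "g' \<in> lin_maps R S ?C"
    unfolding g'_def by (intro linI) (auto simp: R c gf lm_ac lm_distr)
  have p: "p1 (f' x) = x" "p2 (f' x) = ?neg x" if "x \<in> carrier ?A" for x
    using nB[OF that] that by (auto simp: f'_def R lin_add[OF m(3)] lin_add[OF m(4), simplified])
  have "inj_on f' (carrier ?A)" using p(1) by (metis inj_onI)
  moreover have "epi R S ?C g'"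
  proof (rule epiI[OF g'])
    fix y assume y: "y \<in> carrier ?C"
    then have "b y \<in> f ` carrier A" using s by (auto simp: ses_def R)
    then obtain z where z: "z \<in> carrier A" "b y = f z" by auto
    then have "z \<in> a ` carrier G" using G(2) by (simp add: epi_def)
    with z(2) obtain x where x: "x \<in> carrier G" "f (a x) = b y" by auto
    let ?d = "y \<oplus>\<^bsub>F\<^esub> \<ominus>\<^bsub>F\<^esub> l x"
    have d: "?d \<in> carrier F" "b ?d = \<zero>\<^bsub>B\<^esub>" using x y by (auto simp: R)
    have "g' (i1 x \<oplus>\<^bsub>S\<^esub> i2 ?d) = y"
      using d x y by (simp add: g'_def R lin_add[OF m(3)] lin_add[OF m(4), simplified] lm_ac)
    then show "\<exists>s\<in>carrier S. g' s = y" using d x by (intro bexI[of _ "i1 x \<oplus>\<^bsub>S\<^esub> i2 ?d"]) (simp_all add: R)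
  qed
  moreover have "f' ` carrier ?A = {s \<in> carrier S. g' s = \<zero>\<^bsub>?C\<^esub>}"
  proof
    show "f' ` carrier ?A \<subseteq> {s \<in> carrier S. g' s = \<zero>\<^bsub>?C\<^esub>}"
      using p lin_closed[OF f'] by (auto simp: g'_def R)
    show "{s \<in> carrier S. g' s = \<zero>\<^bsub>?C\<^esub>} \<subseteq> f' ` carrier ?A"
    proof
      fix s assume "s \<in> {s \<in> carrier S. g' s = \<zero>\<^bsub>?C\<^esub>}"
      then have s': "s \<in> carrier S" "l (p1 s) \<oplus>\<^bsub>F\<^esub> p2 s = \<zero>\<^bsub>F\<^esub>" by (auto simp: g'_def)
      have e: "p2 s = ?neg (p1 s)" using lm_move[OF lm(4) _ _ s'(2)] s'(1) by (simp add: R c)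
      have "b (l (p1 s) \<oplus>\<^bsub>F\<^esub> p2 s) = \<zero>\<^bsub>B\<^esub>" using s' by (simp add: R)
      then have "f (a (p1 s)) = \<zero>\<^bsub>B\<^esub>" using s'(1) by (simp add: R c)
      then have "a (p1 s) = \<zero>\<^bsub>A\<^esub>" using inj s' by (simp add: R)
      moreover have "f' (p1 s) = s" using e biprod_rules(5)[OF S(2) s'(1)] by (simp add: f'_def)
      ultimately show "s \<in> f' ` carrier ?A" using s'(1) by (intro image_eqI[of _ _ "p1 s"]) (auto simp: R)
    qed
  qed
  ultimately show ?thesis using f' K S(1) unfolding ses_def by blast
qed

lemma ses_kern_pd_le:
  fixes A B C :: "'r fgmod"
  assumes "ses R A B C f g" "pd_le R n A" shows "pd_le R n (kern B C g)"
proof -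
  have s: "fg_module R A" "fg_module R B" "left_module R C" "g \<in> lin_maps R B C" "f \<in> lin_maps R A B" "inj_on f (carrier A)"
    and k: "carrier (kern B C g) = f ` carrier A"
    using assms(1) by (auto simp: ses_def epi_def)
  have "inv_into (carrier A) f \<in> lin_maps R (kern B C g) A"
    using lin_inv_into[OF fg_lm[OF s(1)] s(5,6) k] by (simp add: kern_def)
  moreover have "f \<in> lin_maps R A (kern B C g)"
    using lin_corestrict[OF s(5), of "carrier (kern B C g)"] k by (simp add: kern_def)
  moreover have "f (inv_into (carrier A) f x) = x" if "x \<in> carrier (kern B C g)" for x
    using that unfolding k by (rule f_inv_into_f)
  ultimately show ?thesis using pd_le_retract[OF assms(2) kern_fg[OF s(2-4)]] by metis
qed

text \<open>At level 0 the sequence is itself a presentation of \<open>C\<close> with kernel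
  \<open>A\<close>; otherwise \<open>ses_rotate\<close> lowers the first two terms by one
  level.\<close>

lemma pd_le_cokernel:
  fixes A B C :: "'r fgmod"
  assumes "ses R A B C f g" "pd_le R n A" "pd_le R n B" shows "pd_le R (Suc n) C"
  using assms
proof (induction n arbitrary: A B C f g)
  case 0
  have "epi R B C g" "fg_module R C" using 0 by (auto simp: ses_def)
  then show ?case using pd_le_SucI[OF _ _ _ ses_kern_pd_le[OF 0(1,2)]] 0 by simp
next
  case (Suc n)
  have fg: "fg_module R A" "fg_module R B" "fg_module R C" using Suc.prems by (auto simp: ses_def)
  obtain G :: "'r fgmod" and a where G: "projective R G" "epi R G A a" using projective_cover_exists[OF fg(1)] by metis
  obtain F :: "'r fgmod" and b where F: "projective R F" "epi R F B b" using projective_cover_exists[OF fg(2)] by metis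
  have K: "pd_le R n (kern G A a)" "pd_le R n (kern F B b)" using pd_le_SucD Suc.prems(2,3) G F by blast+
  obtain S :: "'r fgmod" and i1 i2 p1 p2 where S: "fg_module R S" "biprod R G (kern F B b) S i1 i2 p1 p2"
    using biprod_exists[OF projective_fg[OF G(1)] pd_le_fg[OF K(2)]] by metis
  obtain f' g' where s': "ses R (kern G A a) S (kern F C (\<lambda>x. g (b x))) f' g'"
    using ses_rotate[OF Suc.prems(1) G F S] by metis
  have "pd_le R n S" using pd_le_sum[OF projective_pd_le[OF G(1)] K(2) S] .
  then have "pd_le R (Suc n) (kern F C (\<lambda>x. g (b x)))" using Suc.IH[OF s' K(1)] by simp
  moreover have "epi R F C (\<lambda>x. g (b x))" by (rule epi_comp[OF F(2)]) (use Suc.prems(1) in \<open>simp add: ses_def\<close>)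
  ultimately show ?case using pd_le_SucI[OF fg(3) F(1)] by simp
qed

text \<open>At level 0 the sequence splits. Otherwise \<open>A\<close> is the third term of 0 -> syz
  B -> syz C -> A -> 0, whose first two terms lie one level lower, so \<open>pd_le_cokernel\<close>
  applies.\<close>

lemma pd_le_kernel:
  fixes A B C :: "'r fgmod"
  assumes s: "ses R A B C f g" "pd_le R n B" "pd_le R n C" shows "pd_le R n A"
proof -
  have fg: "fg_module R A" "fg_module R B" "fg_module R C" and g: "epi R B C g"
    and lin: "f \<in> lin_maps R A B" "g \<in> lin_maps R B C" and inj: "inj_on f (carrier A)"
    and im: "f ` carrier A = {x \<in> carrier B. g x = \<zero>\<^bsub>C\<^esub>}" using s by (auto simp: ses_def epi_def)
  have lm [simp]: "left_module R A" "left_module R B" "left_module R C" using fg by auto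
  note R = lin_rules[OF lm(1,2) lin(1)] lin_rules[OF lm(2,3) lin(2)]
  define v where "v = inv_into (carrier A) f"
  have v: "v \<in> lin_maps R (B\<lparr>carrier := f ` carrier A\<rparr>) A" "\<And>x. x \<in> carrier A \<Longrightarrow> v (f x) = x"
    "\<And>x. x \<in> f ` carrier A \<Longrightarrow> f (v x) = x"
    using lin_inv_into[OF lm(1) lin(1) inj refl] inj unfolding v_def by (auto simp: f_inv_into_f)
  show ?thesis
  proof (cases n)
    case 0
    then have pr: "projective R B" "projective R C" using s by auto
    obtain t where t: "t \<in> lin_maps R C B" "\<And>x. x \<in> carrier C \<Longrightarrow> g (t x) = x"
      using projective_split[OF pr(2) fg(2) g] by metis
    note T = lin_rules[OF lm(3,2) t(1)] t(2)
    let ?q = "\<lambda>x. x \<oplus>\<^bsub>B\<^esub> \<ominus>\<^bsub>B\<^esub> t (g x)"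
    have "?q \<in> lin_maps R B (B\<lparr>carrier := f ` carrier A\<rparr>)"
      unfolding im by (intro linI) (auto simp: R T lm_ac lm_distr)
    then have "(\<lambda>x. v (?q x)) \<in> lin_maps R B A" using v(1) by (rule lin_comp)
    moreover have "v (?q (f x)) = x" if "x \<in> carrier A" for x
    proof -
      have "g (f x) = \<zero>\<^bsub>C\<^esub>" using that im by auto
      then show ?thesis using that v(2) by (simp add: R T)
    qed
    ultimately show ?thesis using projective_retract[OF pr(1) fg(1) lin(1)] 0 by simp
  next
    case (Suc m)
    obtain F :: "'r fgmod" and b where F: "projective R F" "epi R F B b" using projective_cover_exists[OF fg(2)] by metis
    have e: "epi R F C (\<lambda>x. g (b x))" using epi_comp[OF F(2) g] .
    let ?B = "kern F B b" and ?C = "kern F C (\<lambda>x. g (b x))"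
    have pd: "pd_le R m ?B" "pd_le R m ?C" using pd_le_SucD[of m] s(2,3) Suc F e by blast+
    have bl: "b \<in> lin_maps R F B" and lF [simp]: "left_module R F" using F projective_fg by (auto simp: epi_def)
    note RF = lin_rules[OF lF lm(2) bl]
    have bC: "b \<in> lin_maps R ?C (B\<lparr>carrier := f ` carrier A\<rparr>)" unfolding im by (intro linI) (auto simp: RF)
    have q: "(\<lambda>x. v (b x)) \<in> lin_maps R ?C A" using lin_comp[OF bC v(1)] .
    have bim: "b x \<in> f ` carrier A" if "x \<in> carrier ?C" for x using lin_closed[OF bC that] by simp
    have "epi R ?C A (\<lambda>x. v (b x))"
    proof (rule epiI[OF q])
      fix y assume y: "y \<in> carrier A"
      obtain x where "x \<in> carrier F" "b x = f y" using F(2) y by (metis R(1) epi_def imageE)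
      moreover have "g (f y) = \<zero>\<^bsub>C\<^esub>" using y im by auto
      ultimately show "\<exists>x\<in>carrier ?C. v (b x) = y" using y v(2) by (intro bexI[of _ x]) auto
    qed
    moreover have "(\<lambda>x. x) ` carrier ?B = {x \<in> carrier ?C. v (b x) = \<zero>\<^bsub>A\<^esub>}"
    proof -
      have v0: "v \<zero>\<^bsub>B\<^esub> = \<zero>\<^bsub>A\<^esub>" using v(2)[of "\<zero>\<^bsub>A\<^esub>"] R(4) by simp
      have "v (b x) = \<zero>\<^bsub>A\<^esub> \<Longrightarrow> b x = \<zero>\<^bsub>B\<^esub>" if "x \<in> carrier ?C" for x
        using v(3)[OF bim[OF that]] R(4) by simp
      then show ?thesis using v0 by (auto simp: R)
    qed
    moreover have "(\<lambda>x. x) \<in> lin_maps R ?B ?C" by (intro linI) (auto simp: R)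
    ultimately have "ses R ?B ?C A (\<lambda>x. x) (\<lambda>x. v (b x))"
      using pd pd_le_fg fg(1) unfolding ses_def by (auto simp: inj_on_def)
    then show ?thesis using pd_le_cokernel pd Suc by blast
  qed
qed

end

section \<open>Maps factoring through modules of finite projective dimension\<close>

text \<open>For \<open>n = 0\<close> these are the maps that vanish in the stable category. The
  level is kept as a parameter because it is the quantity to be bounded.\<close>

definition null_map :: "('r, 'x) ring_scheme \<Rightarrow> nat \<Rightarrow> 'r fgmod \<Rightarrow> 'r fgmod \<Rightarrow> ((nat \<Rightarrow> 'r) set \<Rightarrow> (nat \<Rightarrow> 'r) set) \<Rightarrow> bool" where
  "null_map R n M N h \<longleftrightarrow> (\<exists>D a b. pd_le R n D \<and> a \<in> lin_maps R M D \<and> b \<in> lin_maps R D N \<and> (\<forall>x\<in>carrier M. h x = b (a x)))"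

context fl_ring
begin

lemma lin_cong:
  assumes "left_module R M" "f \<in> lin_maps R M N" "\<And>x. x \<in> carrier M \<Longrightarrow> g x = f x" shows "g \<in> lin_maps R M N"
  using assms by (auto intro!: linI simp: lin_closed lin_add lin_smult)

lemma null_map_lin:
  assumes "left_module R M" "null_map R n M N h" shows "h \<in> lin_maps R M N"
proof -
  obtain D :: "'r fgmod" and a b where "a \<in> lin_maps R M D" "b \<in> lin_maps R D N" "\<And>x. x \<in> carrier M \<Longrightarrow> h x = b (a x)"
    using assms(2) unfolding null_map_def by metis
  then show ?thesis using lin_cong[OF assms(1) lin_comp] by metis
qed

lemma null_map_cong: "null_map R n M N h \<Longrightarrow> (\<And>x. x \<in> carrier M \<Longrightarrow> h' x = h x) \<Longrightarrow> null_map R n M N h'"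
  unfolding null_map_def by metis

lemma null_map_left:
  assumes "null_map R n M N h" "g \<in> lin_maps R N L" shows "null_map R n M L (\<lambda>x. g (h x))"
proof -
  obtain D :: "'r fgmod" and a b where D: "pd_le R n D" "a \<in> lin_maps R M D" "b \<in> lin_maps R D N" "\<And>x. x \<in> carrier M \<Longrightarrow> h x = b (a x)"
    using assms(1) unfolding null_map_def by metis
  then show ?thesis unfolding null_map_def
    by (intro exI[of _ D] exI[of _ a] exI[of _ "\<lambda>x. g (b x)"]) (auto intro: lin_comp[OF _ assms(2)])
qed

lemma null_map_right:
  assumes "null_map R n M N h" "f \<in> lin_maps R L M" shows "null_map R n L N (\<lambda>x. h (f x))"
proof -
  obtain D :: "'r fgmod" and a b where D: "pd_le R n D" "a \<in> lin_maps R M D" "b \<in> lin_maps R D N" "\<And>x. x \<in> carrier M \<Longrightarrow> h x = b (a x)"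
    using assms(1) unfolding null_map_def by metis
  then show ?thesis unfolding null_map_def
    by (intro exI[of _ D] exI[of _ "\<lambda>x. a (f x)"] exI[of _ b]) (auto intro: lin_comp[OF assms(2)] simp: lin_closed[OF assms(2)])
qed

lemma null_map_mono:
  assumes "null_map R m M N h" "m \<le> n" shows "null_map R n M N h"
proof -
  obtain D :: "'r fgmod" and a b where D: "pd_le R m D" "a \<in> lin_maps R M D" "b \<in> lin_maps R D N" "\<And>x. x \<in> carrier M \<Longrightarrow> h x = b (a x)"
    using assms(1) unfolding null_map_def by metis
  then show ?thesis unfolding null_map_def
    using pd_le_mono[OF D(1) assms(2)] by (intro exI[of _ D] exI[of _ a] exI[of _ b]) simp
qed

text \<open>Two factorisations combine into one through the direct sum of the intermediate
  modules.\<close>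

lemma null_map_add:
  assumes "null_map R n M N h" "null_map R n M N k" "left_module R M" "left_module R N"
  shows "null_map R n M N (\<lambda>x. h x \<oplus>\<^bsub>N\<^esub> k x)"
proof -
  obtain D :: "'r fgmod" and a b where D: "pd_le R n D" "a \<in> lin_maps R M D" "b \<in> lin_maps R D N" "\<And>x. x \<in> carrier M \<Longrightarrow> h x = b (a x)"
    using assms(1) unfolding null_map_def by metis
  obtain D' :: "'r fgmod" and a' b' where D': "pd_le R n D'" "a' \<in> lin_maps R M D'" "b' \<in> lin_maps R D' N" "\<And>x. x \<in> carrier M \<Longrightarrow> k x = b' (a' x)"
    using assms(2) unfolding null_map_def by metis
  obtain S :: "'r fgmod" and i1 i2 p1 p2 where S: "fg_module R S" "biprod R D D' S i1 i2 p1 p2"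
    using biprod_exists[OF pd_le_fg[OF D(1)] pd_le_fg[OF D'(1)]] by metis
  note m = biprod_maps[OF S(2)]
  have lm [simp]: "left_module R D" "left_module R D'" "left_module R S" using D D' S pd_le_fg by auto
  note R = lin_rules[OF assms(3) lm(1) D(2)] lin_rules[OF assms(3) lm(2) D'(2)] lin_rules[OF lm(1,3) m(1)] lin_rules[OF lm(2,3) m(2)]
    lin_rules[OF lm(3,1) m(3)] lin_rules[OF lm(3,2) m(4)] biprod_rules[OF S(2)]
  show ?thesis unfolding null_map_def
  proof (rule exI[of _ S], rule exI[of _ "\<lambda>x. i1 (a x) \<oplus>\<^bsub>S\<^esub> i2 (a' x)"],
      rule exI[of _ "\<lambda>s. b (p1 s) \<oplus>\<^bsub>N\<^esub> b' (p2 s)"], intro conjI ballI)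
    show "pd_le R n S" using pd_le_sum[OF D(1) D'(1) S] .
    show "(\<lambda>x. i1 (a x) \<oplus>\<^bsub>S\<^esub> i2 (a' x)) \<in> lin_maps R M S"
      by (intro lin_padd assms lin_comp[OF D(2) m(1)] lin_comp[OF D'(2) m(2)]) simp
    show "(\<lambda>s. b (p1 s) \<oplus>\<^bsub>N\<^esub> b' (p2 s)) \<in> lin_maps R S N"
      by (intro lin_padd assms lin_comp[OF m(3) D(3)] lin_comp[OF m(4) D'(3)]) simp
    fix x assume "x \<in> carrier M"
    then show "h x \<oplus>\<^bsub>N\<^esub> k x = b (p1 (i1 (a x) \<oplus>\<^bsub>S\<^esub> i2 (a' x))) \<oplus>\<^bsub>N\<^esub> b' (p2 (i1 (a x) \<oplus>\<^bsub>S\<^esub> i2 (a' x)))"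
      using D(4) D'(4) by (simp add: R)
  qed
qed

lemma null_map_projective_dom: "projective R M \<Longrightarrow> h \<in> lin_maps R M N \<Longrightarrow> null_map R n M N h"
  unfolding null_map_def using projective_pd_le lin_id[of R M]
  by (intro exI[of _ M] exI[of _ id] exI[of _ h]) auto

lemma null_map_projective_cod: "projective R N \<Longrightarrow> h \<in> lin_maps R M N \<Longrightarrow> null_map R n M N h"
  unfolding null_map_def using projective_pd_le lin_id[of R N]
  by (intro exI[of _ N] exI[of _ h] exI[of _ id]) auto

lemma trivial_projective:
  fixes M :: "'r fgmod"
  assumes "left_module R M" "carrier M = {\<zero>\<^bsub>M\<^esub>}" shows "projective R M"
proof -
  have "fg_module R M" using assms trivial_fin_length fg_iff by blast
  then show ?thesis
    by (rule projective_free_retract[of M "\<lambda>_ _. \<zero>\<^bsub>R\<^esub>" 0 "\<lambda>_. \<zero>\<^bsub>M\<^esub>"])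
       (use assms ring in \<open>auto intro!: linI simp: carrier_pow lm_simps ring.ring_simprules\<close>)
qed

lemma null_map_zero:
  assumes "fg_module R M" "fg_module R N" "\<And>x. x \<in> carrier M \<Longrightarrow> h x = \<zero>\<^bsub>N\<^esub>"
  shows "null_map R n M N h"
proof -
  let ?Z = "N\<lparr>carrier := {\<zero>\<^bsub>N\<^esub>}\<rparr>"
  have N: "left_module R N" using assms by simp
  have Z: "left_module R ?Z"
    using left_module.submodule_left_module[OF N left_module.submodule_zero[OF N]] .
  have "projective R ?Z" using trivial_projective[OF Z] by simp
  moreover have "(\<lambda>x. \<zero>\<^bsub>N\<^esub>) \<in> lin_maps R M ?Z" using N by (intro linI) auto
  moreover have "(\<lambda>x. x) \<in> lin_maps R ?Z N" using N by (intro linI) auto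
  ultimately show ?thesis unfolding null_map_def using assms(3) projective_pd_le
    by (intro exI[of _ ?Z] exI[of _ "\<lambda>x. \<zero>\<^bsub>N\<^esub>"] exI[of _ "\<lambda>x. x"]) auto
qed

lemma ses_inv:
  assumes "ses R A B C f g"
  shows "\<exists>v\<in>lin_maps R (B\<lparr>carrier := {x \<in> carrier B. g x = \<zero>\<^bsub>C\<^esub>}\<rparr>) A. \<forall>x\<in>carrier A. v (f x) = x"
proof -
  have s: "left_module R A" "f \<in> lin_maps R A B" "inj_on f (carrier A)" "f ` carrier A = {x \<in> carrier B. g x = \<zero>\<^bsub>C\<^esub>}"
    using assms by (auto simp: ses_def)
  then have "inv_into (carrier A) f \<in> lin_maps R (B\<lparr>carrier := {x \<in> carrier B. g x = \<zero>\<^bsub>C\<^esub>}\<rparr>) A"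
    using lin_inv_into[OF s(1-3) refl] by simp
  then show ?thesis using s(3) by (intro bexI[of _ "inv_into (carrier A) f"]) auto
qed

lemma sesD:
  assumes "ses R A B C f g"
  shows "fg_module R A" "fg_module R B" "fg_module R C" "f \<in> lin_maps R A B" "g \<in> lin_maps R B C" "epi R B C g"
    "x \<in> carrier A \<Longrightarrow> g (f x) = \<zero>\<^bsub>C\<^esub>"
    "x \<in> carrier A \<Longrightarrow> f x = \<zero>\<^bsub>B\<^esub> \<Longrightarrow> x = \<zero>\<^bsub>A\<^esub>"
    "z \<in> carrier C \<Longrightarrow> \<exists>y\<in>carrier B. g y = z"
    "y \<in> carrier B \<Longrightarrow> g y = \<zero>\<^bsub>C\<^esub> \<Longrightarrow> \<exists>x\<in>carrier A. f x = y"
proof -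
  have s: "inj_on f (carrier A)" "f ` carrier A = {x \<in> carrier B. g x = \<zero>\<^bsub>C\<^esub>}" "epi R B C g"
    using assms by (auto simp: ses_def)
  show fg: "fg_module R A" "fg_module R B" "fg_module R C" "f \<in> lin_maps R A B" "g \<in> lin_maps R B C" "epi R B C g"
    using assms by (auto simp: ses_def epi_def)
  show "x \<in> carrier A \<Longrightarrow> g (f x) = \<zero>\<^bsub>C\<^esub>" using s(2) by auto
  have "f \<zero>\<^bsub>A\<^esub> = \<zero>\<^bsub>B\<^esub>" using lin_zero[OF fg_lm[OF fg(1)] fg_lm[OF fg(2)] fg(4)] .
  then show "x \<in> carrier A \<Longrightarrow> f x = \<zero>\<^bsub>B\<^esub> \<Longrightarrow> x = \<zero>\<^bsub>A\<^esub>" using s(1) fg(1) inj_onD[of f "carrier A" x "\<zero>\<^bsub>A\<^esub>"] by auto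
  show "z \<in> carrier C \<Longrightarrow> \<exists>y\<in>carrier B. g y = z" using s(3) unfolding epi_def by (metis imageE)
  show "y \<in> carrier B \<Longrightarrow> g y = \<zero>\<^bsub>C\<^esub> \<Longrightarrow> \<exists>x\<in>carrier A. f x = y" using s(2) by (metis (mono_tags, lifting) imageE mem_Collect_eq)
qed

text \<open>In effect \<open>h\<close> factors through the pullback of \<open>D\<close> and
  \<open>L\<close> over \<open>N\<close>. Its projective dimension is finite because, up to a
  projective summand, it is the kernel of a map onto \<open>Y\<close>. Thus a monomorphism with
  cokernel of finite projective dimension is monic modulo null maps of all levels.\<close>

lemma null_map_cancel:
  assumes s: "ses R L N Y f p" and Y: "pd_le R r Y" and Z: "fg_module R Z" "h \<in> lin_maps R Z L"
    and n: "null_map R n Z N (\<lambda>z. f (h z))"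
  shows "\<exists>m. null_map R m Z L h"
proof -
  note S = sesD[OF s]
  obtain D :: "'r fgmod" and a b where D: "pd_le R n D" "a \<in> lin_maps R Z D" "b \<in> lin_maps R D N" "\<And>x. x \<in> carrier Z \<Longrightarrow> f (h x) = b (a x)"
    using n unfolding null_map_def by metis
  \<comment> \<open>The map from \<open>D\<close> to \<open>Y\<close> need not be onto;
    \<open>G\<close> is added to make it so, and the kernel \<open>?E\<close> then plays the part of
    the pullback.\<close>
  obtain G :: "'r fgmod" and q where G: "projective R G" "epi R G Y q" using projective_cover_exists[OF S(3)] by metis
  have ql: "q \<in> lin_maps R G Y" using G by (simp add: epi_def)
  obtain l where l: "l \<in> lin_maps R G N" "\<And>x. x \<in> carrier G \<Longrightarrow> p (l x) = q x"
    using projective_lift[OF G(1) S(2,3) ql S(6)] by metis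
  obtain T :: "'r fgmod" and i1 i2 p1 p2 where T: "fg_module R T" "biprod R D G T i1 i2 p1 p2"
    using biprod_exists[OF pd_le_fg[OF D(1)] projective_fg[OF G(1)]] by metis
  note m = biprod_maps[OF T(2)]
  have lm [simp]: "left_module R L" "left_module R N" "left_module R Y" "left_module R Z" "left_module R D" "left_module R G" "left_module R T"
    using S Z D(1) G(1) T pd_le_fg projective_fg by auto
  note R = lin_rules[OF lm(1,2) S(4)] lin_rules[OF lm(2,3) S(5)] lin_rules[OF lm(4,1) Z(2)] lin_rules[OF lm(4,5) D(2)]
    lin_rules[OF lm(5,2) D(3)] lin_rules[OF lm(6,3) ql] lin_rules[OF lm(6,2) l(1)]
    lin_rules[OF lm(5,7) m(1)] lin_rules[OF lm(6,7) m(2)] lin_rules[OF lm(7,5) m(3)] lin_rules[OF lm(7,6) m(4)] biprod_rules[OF T(2)]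
  define t where "t = (\<lambda>s. p (b (p1 s) \<oplus>\<^bsub>N\<^esub> l (p2 s)))"
  let ?E = "kern T Y t"
  have tl: "t \<in> lin_maps R T Y" unfolding t_def by (intro linI) (simp_all add: R lm_ac lm_distr)
  have "epi R T Y t"
  proof (rule epiI[OF tl])
    fix y assume "y \<in> carrier Y"
    then obtain z where "z \<in> carrier G" "q z = y" using G(2) unfolding epi_def by (metis imageE)
    then show "\<exists>x\<in>carrier T. t x = y" by (intro bexI[of _ "i2 z"]) (simp_all add: t_def R l(2))
  qed
  then have "ses R ?E T Y (\<lambda>x. x) t"
    using kern_fg[OF T(1) lm(3) tl] T(1) S(3) unfolding ses_def by (auto intro!: linI simp: inj_on_def R)
  moreover have "pd_le R (max n r) T"
    by (rule pd_le_sum[OF pd_le_mono[OF D(1)] projective_pd_le[OF G(1)] T]) simp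
  ultimately have E: "pd_le R (max n r) ?E"
    by (rule pd_le_kernel) (rule pd_le_mono[OF Y], simp)
  obtain v where v: "v \<in> lin_maps R (N\<lparr>carrier := {x \<in> carrier N. p x = \<zero>\<^bsub>Y\<^esub>}\<rparr>) L" "\<And>x. x \<in> carrier L \<Longrightarrow> v (f x) = x"
    using ses_inv[OF s] by blast
  have "(\<lambda>s. b (p1 s) \<oplus>\<^bsub>N\<^esub> l (p2 s)) \<in> lin_maps R ?E (N\<lparr>carrier := {x \<in> carrier N. p x = \<zero>\<^bsub>Y\<^esub>}\<rparr>)"
    by (intro linI) (simp_all add: t_def R lm_ac lm_distr)
  then have be: "(\<lambda>s. v (b (p1 s) \<oplus>\<^bsub>N\<^esub> l (p2 s))) \<in> lin_maps R ?E L" using v(1) by (rule lin_comp)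
  have "(\<lambda>z. i1 (a z)) \<in> lin_maps R Z ?E"
    by (intro linI) (simp_all add: t_def R D(4)[symmetric] S(7))
  then have "null_map R (max n r) Z L h" unfolding null_map_def
    using E be by (intro exI[of _ ?E] exI[of _ "\<lambda>z. i1 (a z)"] exI[of _ "\<lambda>s. v (b (p1 s) \<oplus>\<^bsub>N\<^esub> l (p2 s))"])
      (simp add: R D(4)[symmetric] v(2))
  then show ?thesis ..
qed

section \<open>Fitting's lemma and inverses modulo null maps\<close>

lemma lin_funpow: "f \<in> lin_maps R M M \<Longrightarrow> f ^^ n \<in> lin_maps R M M"
proof (induction n)
  case 0 show ?case using lin_id by (simp add: id_def)
next
  case (Suc n) then show ?case using lin_comp[of "f ^^ n" R M M f M] by (simp add: comp_def)
qed

text \<open>Let the kernels of the powers be constant from \<open>n\<close> on and write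
  \<open>x = f^n y\<close>. If \<open>f x = 0\<close>, then \<open>y\<close> lies in the kernel of
  \<open>f^(n+1)\<close>, hence in that of \<open>f^n\<close>, and \<open>x = 0\<close>.\<close>

lemma fin_length_surj_inj:
  assumes M: "left_module R M" "fin_length R M" and f: "f \<in> lin_maps R M M" "f ` carrier M = carrier M"
  shows "inj_on f (carrier M)"
proof (rule lin_injI[OF M(1) M(1) f(1)])
  note [simp] = M(1)
  note F = lin_rules[OF M(1) M(1) f(1)] lin_rules[OF M(1) M(1) lin_funpow[OF f(1)]]
  let ?K = "\<lambda>n. {x \<in> carrier M. (f ^^ n) x = \<zero>\<^bsub>M\<^esub>}"
  have K1: "submodule (?K n) R M" for n using lin_kernel_submodule[OF M(1) M(1) lin_funpow[OF f(1)]] .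
  have K2: "?K n \<subseteq> ?K (Suc n)" for n by (auto simp: F)
  obtain n where "\<forall>m\<ge>n. ?K m = ?K n" using fin_length_stable[where U = ?K, OF M K1 K2] by blast
  then have n: "?K (Suc n) = ?K n" by (meson le_SucI le_refl)
  fix x assume x: "x \<in> carrier M" "f x = \<zero>\<^bsub>M\<^esub>"
  have "(f ^^ n) ` carrier M = carrier M"
  proof (induction n)
    case (Suc n)
    have "(f ^^ Suc n) ` carrier M = f ` ((f ^^ n) ` carrier M)" by (simp add: image_image)
    then show ?case using Suc f(2) by simp
  qed simp
  then obtain y where y: "y \<in> carrier M" "x = (f ^^ n) y" using x by (metis imageE)
  then have "y \<in> ?K (Suc n)" using x by simp
  then have "y \<in> ?K n" unfolding n .
  then show "x = \<zero>\<^bsub>M\<^esub>" using y by simp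
qed

text \<open>On the smallest image of a power, \<open>e\<close> is bijective, and inverting it there
  gives \<open>x\<close>. This form avoids splitting \<open>M\<close> into an image and a kernel,
  and it still inverts \<open>e\<close> as soon as \<open>e\<close> can be cancelled on the
  left.\<close>

lemma fitting:
  assumes M: "left_module R M" "fin_length R M" and e: "e \<in> lin_maps R M M"
  obtains m x where "x \<in> lin_maps R M M" "\<And>a. a \<in> carrier M \<Longrightarrow> (e ^^ m) a = (e ^^ Suc m) (x a)"
proof -
  interpret left_module R M by fact
  let ?I = "\<lambda>n. (e ^^ n) ` carrier M"
  have Isub: "submodule (?I n) R M" for n using lin_image_submodule[OF M(1) M(1) lin_funpow[OF e] submodule_carrier] .
  obtain m where m: "\<And>k. ?I k \<subseteq> ?I m \<Longrightarrow> ?I k = ?I m"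
    using fin_length_minimal[OF M(2), of "\<lambda>U. \<exists>n. U = ?I n" "?I 0"] Isub by metis
  let ?J = "?I m" and ?N = "M\<lparr>carrier := ?I m\<rparr>"
  have "?I (Suc m) \<subseteq> ?J" using lin_closed[OF e] by (auto simp: funpow_swap1)
  then have eJ: "e ` ?J = ?J" using m[of "Suc m"] by (simp add: image_image)
  have Jc: "?J \<subseteq> carrier M" using Isub[of m] by (simp add: submodule_iff)
  have N: "left_module R ?N" using submodule_left_module[OF Isub] .
  have eN: "e \<in> lin_maps R ?N ?N" using lin_corestrict[OF lin_restrict[OF e Jc], of ?J] eJ by simp
  have inj: "inj_on e (carrier ?N)"
    using fin_length_surj_inj[OF N fin_length_sub[OF M Isub] eN] eJ by simp
  define w where "w = inv_into ?J e"
  have w: "w \<in> lin_maps R ?N ?N" using lin_inv_into[OF N eN inj] eJ by (simp add: w_def)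
  have ew: "e (w y) = y" if "y \<in> ?J" for y unfolding w_def by (rule f_inv_into_f) (use that eJ in simp)
  have eew: "(e ^^ k) ((w ^^ k) y) = y" if "y \<in> ?J" for k y
    using that
  proof (induction k arbitrary: y)
    case (Suc k)
    have wy: "(w ^^ k) y \<in> ?J" using lin_closed[OF lin_funpow[OF w, of k]] Suc.prems by simp
    have "(e ^^ Suc k) ((w ^^ Suc k) y) = e ((e ^^ k) (w ((w ^^ k) y)))" by simp
    also have "\<dots> = (e ^^ k) (e (w ((w ^^ k) y)))" by (rule funpow_swap1)
    also have "e (w ((w ^^ k) y)) = (w ^^ k) y" by (rule ew[OF wy])
    finally show ?case using Suc by simp
  qed simp
  have "(\<lambda>a. (w ^^ Suc m) ((e ^^ m) a)) \<in> lin_maps R M ?N"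
  proof (rule lin_comp[OF _ lin_funpow[OF w]])
    show "e ^^ m \<in> lin_maps R M ?N" by (rule lin_corestrict[OF lin_funpow[OF e]]) simp
  qed
  then have "(\<lambda>a. (w ^^ Suc m) ((e ^^ m) a)) \<in> lin_maps R M M" using Jc by (auto simp: lin_maps_def Pi_iff)
  moreover have "(e ^^ m) a = (e ^^ Suc m) ((w ^^ Suc m) ((e ^^ m) a))" if "a \<in> carrier M" for a
    using eew[of "(e ^^ m) a" "Suc m"] that by simp
  ultimately show ?thesis using that by blast
qed

text \<open>Let \<open>h2 = b a\<close> through \<open>D\<close>. The map from the sum of
  \<open>L\<close> and \<open>D\<close> to \<open>N\<close> given by \<open>f\<close> and
  \<open>b\<close> is onto, split by \<sigma>. Its kernel embeds into \<open>D\<close> with cokernel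
  \<open>Y\<close>, and it is a retract of the sum of \<open>D\<close> and \<open>D'\<close>. So
  \<open>Y\<close> is the cokernel of a monomorphism between modules of dimension at most
  \<open>n\<close>.\<close>

lemma pd_le_of_quasi_inverse:
  assumes s: "ses R L N Y f p" and y: "y \<in> lin_maps R N L"
    and h1: "null_map R n L L h1" "\<And>x. x \<in> carrier L \<Longrightarrow> x = y (f x) \<oplus>\<^bsub>L\<^esub> h1 x"
    and h2: "null_map R n N N h2" "\<And>x. x \<in> carrier N \<Longrightarrow> x = f (y x) \<oplus>\<^bsub>N\<^esub> h2 x"
  shows "pd_le R (Suc n) Y"
proof -
  note S = sesD[OF s]
  obtain D :: "'r fgmod" and a b where D: "pd_le R n D" "a \<in> lin_maps R N D" "b \<in> lin_maps R D N" "\<And>x. x \<in> carrier N \<Longrightarrow> h2 x = b (a x)"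
    using h2(1) unfolding null_map_def by metis
  obtain D' :: "'r fgmod" and a' b' where D': "pd_le R n D'" "a' \<in> lin_maps R L D'" "b' \<in> lin_maps R D' L" "\<And>x. x \<in> carrier L \<Longrightarrow> h1 x = b' (a' x)"
    using h1(1) unfolding null_map_def by metis
  obtain T :: "'r fgmod" and i1 i2 p1 p2 where T: "fg_module R T" "biprod R L D T i1 i2 p1 p2"
    using biprod_exists[OF S(1) pd_le_fg[OF D(1)]] by metis
  obtain W :: "'r fgmod" and j1 j2 q1 q2 where W: "fg_module R W" "biprod R D D' W j1 j2 q1 q2"
    using biprod_exists[OF pd_le_fg[OF D(1)] pd_le_fg[OF D'(1)]] by metis
  note m = biprod_maps[OF T(2)] and m' = biprod_maps[OF W(2)]
  have lm [simp]: "left_module R L" "left_module R N" "left_module R Y" "left_module R D" "left_module R D'" "left_module R T" "left_module R W"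
    using S D(1) D'(1) T W pd_le_fg by auto
  note R = lin_rules[OF lm(1,2) S(4)] lin_rules[OF lm(2,3) S(5)] lin_rules[OF lm(2,1) y] lin_rules[OF lm(2,4) D(2)]
    lin_rules[OF lm(4,2) D(3)] lin_rules[OF lm(1,5) D'(2)] lin_rules[OF lm(5,1) D'(3)]
    lin_rules[OF lm(1,6) m(1)] lin_rules[OF lm(4,6) m(2)] lin_rules[OF lm(6,1) m(3)] lin_rules[OF lm(6,4) m(4)] biprod_rules[OF T(2)]
    lin_rules[OF lm(4,7) m'(1)] lin_rules[OF lm(5,7) m'(2)] lin_rules[OF lm(7,4) m'(3)] lin_rules[OF lm(7,5) m'(4)] biprod_rules[OF W(2)]
  define t where "t s = f (p1 s) \<oplus>\<^bsub>N\<^esub> b (p2 s)" for s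
  have tl: "t \<in> lin_maps R T N" unfolding t_def by (intro linI) (simp_all add: R lm_ac lm_distr)
  define \<sigma> where "\<sigma> x = i1 (y x) \<oplus>\<^bsub>T\<^esub> i2 (a x)" for x
  have sl: "\<sigma> \<in> lin_maps R N T" unfolding \<sigma>_def by (intro linI) (simp_all add: R lm_ac lm_distr)
  have ts: "t (\<sigma> x) = x" if "x \<in> carrier N" for x
    using that h2(2)[OF that] D(4)[OF that] by (simp add: t_def \<sigma>_def R)
  note TR = lin_rules[OF lm(6,2) tl] lin_rules[OF lm(2,6) sl] ts
  let ?K = "kern T N t"
  have K: "fg_module R ?K" using kern_fg[OF T(1) lm(2) tl] .
  \<comment> \<open>In the kernel, \<open>f (p1 s) = - b (p2 s)\<close>. Hence
    \<open>p1 s = y (f (p1 s)) + h1 (p1 s)\<close> can be recovered from \<open>p2 s\<close> and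
    \<open>a' (p1 s)\<close>, which is what \<open>u\<close> does; subtracting
    \<open>\<sigma> (t (u w))\<close> afterwards makes the values lie in the kernel.\<close>
  define u where "u w = i1 (y (\<ominus>\<^bsub>N\<^esub> b (q1 w)) \<oplus>\<^bsub>L\<^esub> b' (q2 w)) \<oplus>\<^bsub>T\<^esub> i2 (q1 w)" for w
  have ul: "u \<in> lin_maps R W T" unfolding u_def by (intro linI) (simp_all add: R lm_ac lm_distr)
  have "(\<lambda>s. s \<oplus>\<^bsub>T\<^esub> \<ominus>\<^bsub>T\<^esub> \<sigma> (t s)) \<in> lin_maps R T ?K"
    by (intro linI) (simp_all add: TR lm_ac lm_distr)
  then have bk: "(\<lambda>w. u w \<oplus>\<^bsub>T\<^esub> \<ominus>\<^bsub>T\<^esub> \<sigma> (t (u w))) \<in> lin_maps R W ?K" by (rule lin_comp[OF ul])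
  have forth: "(\<lambda>s. j1 (p2 s) \<oplus>\<^bsub>W\<^esub> j2 (a' (p1 s))) \<in> lin_maps R ?K W"
    by (intro linI) (simp_all add: R lm_ac lm_distr)
  have fp: "f (p1 s) = \<ominus>\<^bsub>N\<^esub> b (p2 s)" if "s \<in> carrier ?K" for s
  proof -
    have c: "s \<in> carrier T" "f (p1 s) \<oplus>\<^bsub>N\<^esub> b (p2 s) = \<zero>\<^bsub>N\<^esub>" using that by (simp_all add: t_def)
    have "b (p2 s) \<oplus>\<^bsub>N\<^esub> f (p1 s) = f (p1 s) \<oplus>\<^bsub>N\<^esub> b (p2 s)"
      by (rule lm_ac(2)[OF lm(2)]) (simp_all add: R c(1))
    then have "b (p2 s) \<oplus>\<^bsub>N\<^esub> f (p1 s) = \<zero>\<^bsub>N\<^esub>" using c by simp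
    then show ?thesis using that lm_move[OF lm(2), of "b (p2 s)" "f (p1 s)"] by (simp add: R)
  qed
  have us: "u (j1 (p2 s) \<oplus>\<^bsub>W\<^esub> j2 (a' (p1 s))) = s" if s: "s \<in> carrier ?K" for s
  proof -
    have c: "s \<in> carrier T" "p1 s \<in> carrier L" using s by (auto simp: R)
    have "y (\<ominus>\<^bsub>N\<^esub> b (p2 s)) \<oplus>\<^bsub>L\<^esub> b' (a' (p1 s)) = p1 s"
      using h1(2)[OF c(2)] D'(4)[OF c(2)] fp[OF s] by simp
    then show ?thesis using c by (simp add: u_def R del: R(15))
  qed
  have pdK: "pd_le R n ?K"
    by (rule pd_le_retract[OF pd_le_sum[OF D(1) D'(1) W] K forth bk]) (simp add: us TR)
  \<comment> \<open>The map from \<open>D\<close> is onto because \<open>p f = 0\<close> leaves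
    \<open>p (h2 x) = p x\<close>; an element of \<open>D\<close> dies in \<open>Y\<close> exactly
    when \<open>b\<close> sends it into the image of \<open>f\<close>, that is, when it extends to
    an element of the kernel.\<close>
  have "ses R ?K D Y p2 (\<lambda>d. p (b d))"
    unfolding ses_def
  proof (intro conjI)
    have lK: "left_module R ?K" using K by simp
    have p2: "p2 \<in> lin_maps R ?K D" by (intro linI) (simp_all add: R)
    then show "p2 \<in> lin_maps R ?K D" .
    show "inj_on p2 (carrier ?K)"
    proof (rule lin_injI[OF lK lm(4) p2])
      fix s assume s: "s \<in> carrier ?K" "p2 s = \<zero>\<^bsub>D\<^esub>"
      then have "f (p1 s) = \<zero>\<^bsub>N\<^esub>" using fp[OF s(1)] by (simp add: R)
      then have "p1 s = \<zero>\<^bsub>L\<^esub>" using S(8)[of "p1 s"] s by (simp add: R)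
      then have "i1 (p1 s) \<oplus>\<^bsub>T\<^esub> i2 (p2 s) = \<zero>\<^bsub>T\<^esub>" using s(2) by (simp add: R)
      then show "s = \<zero>\<^bsub>?K\<^esub>" using biprod_rules(5)[OF T(2)] s(1) by simp
    qed
    have pb: "(\<lambda>d. p (b d)) \<in> lin_maps R D Y" using lin_comp[OF D(3) S(5)] .
    show "epi R D Y (\<lambda>d. p (b d))"
    proof (rule epiI[OF pb])
      fix z assume "z \<in> carrier Y"
      then obtain x where x: "x \<in> carrier N" "p x = z" using S(9) by blast
      have "p (f (y x) \<oplus>\<^bsub>N\<^esub> h2 x) = p (b (a x))" using x D(4) S(7) by (simp add: R)
      then have "p (b (a x)) = z" using h2(2)[OF x(1)] x(2) by simp
      then show "\<exists>d\<in>carrier D. p (b d) = z" using x by (intro bexI[of _ "a x"]) (simp_all add: R)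
    qed
    show "p2 ` carrier ?K = {d \<in> carrier D. p (b d) = \<zero>\<^bsub>Y\<^esub>}"
    proof (intro equalityI subsetI)
      fix d assume "d \<in> p2 ` carrier ?K"
      then obtain s where s: "s \<in> carrier ?K" "d = p2 s" by blast
      have "p (f (p1 s) \<oplus>\<^bsub>N\<^esub> b (p2 s)) = \<zero>\<^bsub>Y\<^esub>" using s(1) by (simp add: t_def R)
      then show "d \<in> {d \<in> carrier D. p (b d) = \<zero>\<^bsub>Y\<^esub>}" using s S(7) by (simp add: R)
    next
      fix d assume d: "d \<in> {d \<in> carrier D. p (b d) = \<zero>\<^bsub>Y\<^esub>}"
      then obtain c where c: "c \<in> carrier L" "f c = b d" using S(10)[of "b d"] by (auto simp: R)
      have "i1 (\<ominus>\<^bsub>L\<^esub> c) \<oplus>\<^bsub>T\<^esub> i2 d \<in> carrier ?K" using c d by (simp add: t_def R)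
      moreover have "p2 (i1 (\<ominus>\<^bsub>L\<^esub> c) \<oplus>\<^bsub>T\<^esub> i2 d) = d" using c d by (simp add: R)
      ultimately show "d \<in> p2 ` carrier ?K" by (metis imageI)
    qed
  qed (use K D(1) S(3) pd_le_fg in auto)
  then show ?thesis by (rule pd_le_cokernel[OF _ pdK D(1)])
qed

text \<open>Isomorphism in the stable category, in which maps factoring through projective modules
  are zero.\<close>

definition stab_iso :: "'r fgmod \<Rightarrow> 'r fgmod \<Rightarrow> bool" where
  "stab_iso M N \<longleftrightarrow> (\<exists>a\<in>lin_maps R M N. \<exists>b\<in>lin_maps R N M. \<exists>h k. null_map R 0 M M h \<and> null_map R 0 N N k \<and>
     (\<forall>x\<in>carrier M. x = b (a x) \<oplus>\<^bsub>M\<^esub> h x) \<and> (\<forall>x\<in>carrier N. x = a (b x) \<oplus>\<^bsub>N\<^esub> k x))"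

text \<open>Modulo maps of finite projective dimension, \<open>e = a f\<close> is monic, hence by Fitting's lemma invertible.\<close>

lemma pd_le_of_stab_iso:
  assumes s: "ses R L N Y f p" and Y: "pd_le R r Y" and iso: "stab_iso N L"
    and uL: "\<And>m h. null_map R m L L h \<Longrightarrow> null_map R n L L h"
    and uN: "\<And>m h. null_map R m N N h \<Longrightarrow> null_map R n N N h"
  shows "pd_le R (Suc n) Y"
proof -
  note S = sesD[OF s]
  obtain a b h k where a: "a \<in> lin_maps R N L" and b: "b \<in> lin_maps R L N" and nk: "null_map R 0 N N h" "null_map R 0 L L k"
    and ab: "\<And>x. x \<in> carrier N \<Longrightarrow> x = b (a x) \<oplus>\<^bsub>N\<^esub> h x"
    using iso unfolding stab_iso_def by metis
  have lm [simp]: "left_module R L" "left_module R N" "left_module R Y" using S by auto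
  have hl: "h \<in> lin_maps R N N" using null_map_lin[OF lm(2) nk(1)] .
  note Rf = lin_rules[OF lm(1,2) S(4)] and Ra = lin_rules[OF lm(2,1) a] and Rb = lin_rules[OF lm(1,2) b] and Rh = lin_rules[OF lm(2,2) hl]
  define e where "e x = a (f x)" for x
  have e: "e \<in> lin_maps R L L" unfolding e_def using lin_comp[OF S(4) a] .
  note Re = lin_rules[OF lm(1,1) e]
  \<comment> \<open>Up to a map through a projective, \<open>b\<close> is a left inverse of
    \<open>a\<close>; so \<open>a\<close> can be cancelled on the left. Together with
    \<open>null_map_cancel\<close> for \<open>f\<close> this cancels \<open>e\<close>.\<close>
  have cancel_a: "\<exists>m. null_map R m Z N g" if Z: "fg_module R Z" and g: "g \<in> lin_maps R Z N" and n: "null_map R m Z L (\<lambda>z. a (g z))" for Z :: "'r fgmod" and g m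
  proof -
    have "null_map R m Z N (\<lambda>z. b (a (g z)))" using null_map_left[OF n b] .
    moreover have "null_map R m Z N (\<lambda>z. h (g z))" using null_map_right[OF null_map_mono[OF nk(1)] g] by simp
    ultimately have "null_map R m Z N (\<lambda>z. b (a (g z)) \<oplus>\<^bsub>N\<^esub> h (g z))" using null_map_add Z by simp
    then have "null_map R m Z N g" by (rule null_map_cong) (rule ab[OF lin_closed[OF g]])
    then show ?thesis ..
  qed
  have cancel_e: "\<exists>m. null_map R m Z L g" if Z: "fg_module R Z" and g: "g \<in> lin_maps R Z L" and n: "null_map R m Z L (\<lambda>z. e (g z))" for Z :: "'r fgmod" and g m
  proof -
    obtain m' where "null_map R m' Z N (\<lambda>z. f (g z))"
      using cancel_a[OF Z lin_comp[OF g S(4)]] n unfolding e_def by blast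
    then show ?thesis using null_map_cancel[OF s Y Z g] by blast
  qed
  have cancel_en: "\<exists>m. null_map R m Z L g" if "fg_module R Z" "g \<in> lin_maps R Z L" "null_map R m Z L (\<lambda>z. (e ^^ i) (g z))" for Z :: "'r fgmod" and g m i
    using that(3)
  proof (induction i arbitrary: m)
    case 0 then show ?case by auto
  next
    case (Suc i)
    have "(\<lambda>z. (e ^^ i) (g z)) \<in> lin_maps R Z L" using lin_comp[OF that(2) lin_funpow[OF e]] .
    then have "\<exists>m. null_map R m Z L (\<lambda>z. (e ^^ i) (g z))" using cancel_e[OF that(1)] Suc.prems by simp
    then show ?case using Suc.IH by blast
  qed
  have "fin_length R L" using S(1) fg_iff by blast
  then obtain m x where x: "x \<in> lin_maps R L L" "\<And>c. c \<in> carrier L \<Longrightarrow> (e ^^ m) c = (e ^^ Suc m) (x c)"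
    using fitting[OF lm(1) _ e] by metis
  note Rx = lin_rules[OF lm(1,1) x(1)]
  \<comment> \<open>\<open>g = 1 - e x\<close> is killed by \<open>e^m\<close>, hence null after
    cancelling \<open>e\<close> repeatedly: \<open>x\<close> is a right inverse of \<open>e\<close>
    modulo null maps.\<close>
  define g where "g c = c \<oplus>\<^bsub>L\<^esub> \<ominus>\<^bsub>L\<^esub> e (x c)" for c
  have g: "g \<in> lin_maps R L L" unfolding g_def by (intro linI) (simp_all add: Re Rx lm_ac lm_distr)
  have "null_map R 0 L L (\<lambda>c. (e ^^ m) (g c))"
  proof (rule null_map_zero[OF S(1,1)])
    fix c assume c: "c \<in> carrier L"
    note Rm = lin_rules[OF lm(1,1) lin_funpow[OF e, of m]]
    have "(e ^^ m) (e (x c)) = (e ^^ m) c" using x(2)[OF c] by (simp add: funpow_swap1)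
    then show "(e ^^ m) (g c) = \<zero>\<^bsub>L\<^esub>" using c by (simp add: g_def Rm Re Rx)
  qed
  then have ng: "null_map R n L L g" using cancel_en[OF S(1) g] uL by blast
  \<comment> \<open>\<open>e g' = g e\<close> is null, and cancelling \<open>e\<close> once shows
    that \<open>x\<close> is a left inverse as well.\<close>
  define g' where "g' c = c \<oplus>\<^bsub>L\<^esub> \<ominus>\<^bsub>L\<^esub> x (e c)" for c
  have g': "g' \<in> lin_maps R L L" unfolding g'_def by (intro linI) (simp_all add: Re Rx lm_ac lm_distr)
  have "null_map R n L L (\<lambda>c. e (g' c))"
    using null_map_right[OF ng e] by (rule null_map_cong) (simp add: g_def g'_def Re Rx)
  then have ng': "null_map R n L L g'" using cancel_e[OF S(1) g'] uL by blast
  \<comment> \<open>Since \<open>y f = x e\<close> and \<open>a (1 - f y) = (1 - e x) a\<close>, the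
    map \<open>y\<close> is inverse to \<open>f\<close> modulo null maps once \<open>a\<close> is
    cancelled.\<close>
  define y where "y c = x (a c)" for c
  have y: "y \<in> lin_maps R N L" unfolding y_def using lin_comp[OF a x(1)] .
  define w where "w c = c \<oplus>\<^bsub>N\<^esub> \<ominus>\<^bsub>N\<^esub> f (y c)" for c
  have w: "w \<in> lin_maps R N N" unfolding w_def y_def by (intro linI) (simp_all add: Ra Rx Rf lm_ac lm_distr)
  have "null_map R n N L (\<lambda>c. a (w c))"
    using null_map_right[OF ng a] by (rule null_map_cong) (simp add: g_def w_def y_def e_def Ra Rx Rf)
  then have nw: "null_map R n N N w" using cancel_a[OF S(2) w] uN by blast
  show ?thesis
  proof (rule pd_le_of_quasi_inverse[OF s y ng' _ nw])
    show "c = y (f c) \<oplus>\<^bsub>L\<^esub> g' c" if "c \<in> carrier L" for c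
      using that Re(1)[OF that] Rx(1)[of "e c"] lm_ac[OF lm(1)] by (simp add: y_def g'_def e_def[symmetric])
    show "c = f (y c) \<oplus>\<^bsub>N\<^esub> w c" if "c \<in> carrier N" for c
      using that Rf(1)[of "y c"] lin_closed[OF y that] lm_ac[OF lm(2)] by (simp add: w_def)
  qed
qed

section \<open>Direct sums with multiplicities\<close>

lemma biprod_assoc:
  assumes N: "biprod R N' X N a1 a2 r1 r2" and S: "biprod R M N S i1 i2 p1 p2" and S': "biprod R M N' S' k1 k2 l1 l2"
    and lm [simp]: "left_module R N'" "left_module R X" "left_module R N" "left_module R M" "left_module R S" "left_module R S'"
  shows "biprod R S' X S (\<lambda>s. i1 (l1 s) \<oplus>\<^bsub>S\<^esub> i2 (a1 (l2 s))) (\<lambda>x. i2 (a2 x)) (\<lambda>s. k1 (p1 s) \<oplus>\<^bsub>S'\<^esub> k2 (r1 (p2 s))) (\<lambda>s. r2 (p2 s))"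
proof -
  note m = biprod_maps[OF N] biprod_maps[OF S] biprod_maps[OF S']
  note R = lin_rules[OF lm(1,3) m(1)] lin_rules[OF lm(2,3) m(2)] lin_rules[OF lm(3,1) m(3)] lin_rules[OF lm(3,2) m(4)]
    lin_rules[OF lm(4,5) m(5)] lin_rules[OF lm(3,5) m(6)] lin_rules[OF lm(5,4) m(7)] lin_rules[OF lm(5,3) m(8)]
    lin_rules[OF lm(4,6) m(9)] lin_rules[OF lm(1,6) m(10)] lin_rules[OF lm(6,4) m(11)] lin_rules[OF lm(6,1) m(12)]
    biprod_rules[OF N] biprod_rules[OF S] biprod_rules[OF S']
  have "i1 (p1 s) \<oplus>\<^bsub>S\<^esub> i2 (a1 (r1 (p2 s))) \<oplus>\<^bsub>S\<^esub> i2 (a2 (r2 (p2 s))) = s" if s: "s \<in> carrier S" for s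
  proof -
    have c: "p2 s \<in> carrier N" using s by (simp add: R)
    have "i2 (a1 (r1 (p2 s)) \<oplus>\<^bsub>N\<^esub> a2 (r2 (p2 s))) = i2 (p2 s)" using biprod_rules(5)[OF N c] by simp
    then have "i2 (a1 (r1 (p2 s))) \<oplus>\<^bsub>S\<^esub> i2 (a2 (r2 (p2 s))) = i2 (p2 s)" using c by (simp add: R del: R(65))
    then show ?thesis using s biprod_rules(5)[OF S s] by (simp add: R(1,6,11,16,21,26,31,36) lm_ac(1)[OF lm(5)])
  qed
  then show ?thesis unfolding biprod_def
    by (auto intro!: linI simp: R lm_ac lm_distr)
qed

end

text \<open>\<open>M\<close> is the direct sum of a projective module and of \<open>u j\<close> copies of \<open>X j\<close> for each \<open>j\<close>.\<close>

inductive addp :: "('r, 'x) ring_scheme \<Rightarrow> 'i set \<Rightarrow> ('i \<Rightarrow> 'r fgmod) \<Rightarrow> ('i \<Rightarrow> nat) \<Rightarrow> 'r fgmod \<Rightarrow> bool" for R I X where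
  proj: "projective R M \<Longrightarrow> addp R I X (\<lambda>_. 0) M"
| step: "addp R I X u N \<Longrightarrow> j \<in> I \<Longrightarrow> fg_module R M \<Longrightarrow> biprod R N (X j) M i1 i2 p1 p2 \<Longrightarrow> addp R I X (u(j := Suc (u j))) M"

context fl_ring
begin

lemma addp_fg: "addp R I X u M \<Longrightarrow> fg_module R M"
  by (erule addp.cases) (auto simp: projective_fg)

lemma addp_zero: "addp R I X (\<lambda>_. 0) M \<Longrightarrow> projective R M"
proof (erule addp.cases)
  fix u N j M' i1 i2 p1 p2 assume "(\<lambda>_. 0) = u(j := Suc (u j))"
  then show ?thesis by (metis fun_upd_same nat.distinct(1))
qed simp

lemma addp_sum:
  assumes X: "\<And>j. j \<in> I \<Longrightarrow> fg_module R (X j)" and M: "addp R I X u M" and N: "addp R I X v N"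
    and S: "fg_module R S" "biprod R M N S i1 i2 p1 p2"
  shows "addp R I X (\<lambda>i. u i + v i) S"
  using N S
proof (induction v N arbitrary: S i1 i2 p1 p2 rule: addp.induct)
  case (proj N)
  show ?case using M proj(2,3)
  proof (induction u M arbitrary: S i1 i2 p1 p2 rule: addp.induct)
    case (proj M)
    then have "projective R S" using projective_sum \<open>projective R N\<close> by metis
    then show ?case using addp.proj by simp
  next
    case (step u M' j M a1 a2 r1 r2)
    have fg: "fg_module R M'" "fg_module R N" using addp_fg[OF step.hyps(1)] projective_fg[OF proj(1)] by auto
    obtain S' :: "'r fgmod" and k1 k2 l1 l2 where S': "fg_module R S'" "biprod R M' N S' k1 k2 l1 l2"
      using biprod_exists[OF fg] by metis
    note b = biprod_assoc[OF step.hyps(4) biprod_swap[OF fg_lm[OF step.prems(1)] step.prems(2)] biprod_swap[OF fg_lm[OF S'(1)] S'(2)]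
      fg_lm[OF fg(1)] fg_lm[OF X[OF step.hyps(2)]] fg_lm[OF step.hyps(3)] fg_lm[OF fg(2)] fg_lm[OF step.prems(1)] fg_lm[OF S'(1)]]
    have eq: "(\<lambda>i. (u(j := Suc (u j))) i + 0) = (\<lambda>i. u i + 0)(j := Suc (u j + 0))" by auto
    show ?case unfolding eq by (rule addp.step[OF step.IH[OF S'] step.hyps(2) step.prems(1) b])
  qed
next
  case (step v N' j N a1 a2 r1 r2)
  have fg: "fg_module R M" "fg_module R N'" using addp_fg[OF step.hyps(1)] addp_fg[OF M] by auto
  obtain S' :: "'r fgmod" and k1 k2 l1 l2 where S': "fg_module R S'" "biprod R M N' S' k1 k2 l1 l2"
    using biprod_exists[OF fg] by metis
  note b = biprod_assoc[OF step.hyps(4) step.prems(2) S'(2)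
    fg_lm[OF fg(2)] fg_lm[OF X[OF step.hyps(2)]] fg_lm[OF step.hyps(3)] fg_lm[OF fg(1)] fg_lm[OF step.prems(1)] fg_lm[OF S'(1)]]
  have "(\<lambda>i. u i + (v(j := Suc (v j))) i) = (\<lambda>i. u i + v i)(j := Suc (u j + v j))" by auto
  then show ?case using addp.step[OF step.IH[OF S'] step.hyps(2) step.prems(1) b] by simp
qed

text \<open>The summand may have been adjoined early; exchanging it with the later ones brings it to
  the last place. The vector \<open>u\<close> is part of the data, since the same module may be
  described by several vectors.\<close>

lemma addp_extract:
  assumes X: "\<And>j. j \<in> I \<Longrightarrow> fg_module R (X j)" and "addp R I X u M" "u j > 0"
  shows "j \<in> I \<and> (\<exists>N i1 i2 p1 p2. addp R I X (u(j := u j - 1)) N \<and> biprod R N (X j) M i1 i2 p1 p2)"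
  using assms(2,3)
proof (induction u M rule: addp.induct)
  case (proj M)
  then show ?case by simp
next
  case (step u N l M i1 i2 p1 p2)
  show ?case
  proof (cases "l = j")
    case True
    have eq: "(u(j := Suc (u j)))(j := (u(j := Suc (u j))) j - 1) = u" by auto
    show ?thesis unfolding True eq using step.hyps(1,2,4) unfolding True by blast
  next
    case False
    then have "u j > 0" using step.prems by auto
    then obtain N' a1 a2 r1 r2 where j: "j \<in> I" and N': "addp R I X (u(j := u j - 1)) N'" "biprod R N' (X j) N a1 a2 r1 r2"
      using step.IH by blast
    note fg = addp_fg[OF N'(1)] addp_fg[OF step.hyps(1)]
    obtain S' :: "'r fgmod" and k1 k2 l1 l2 where S': "fg_module R S'" "biprod R N' (X l) S' k1 k2 l1 l2"
      using biprod_exists[OF fg(1) X[OF step.hyps(2)]] by metis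
    note b = biprod_assoc[OF N'(2) biprod_swap[OF fg_lm[OF step.hyps(3)] step.hyps(4)] biprod_swap[OF fg_lm[OF S'(1)] S'(2)]
      fg_lm[OF fg(1)] fg_lm[OF X[OF j]] fg_lm[OF fg(2)] fg_lm[OF X[OF step.hyps(2)]] fg_lm[OF step.hyps(3)] fg_lm[OF S'(1)]]
    have eq: "(u(j := u j - 1))(l := Suc ((u(j := u j - 1)) l)) = (u(l := Suc (u l)))(j := (u(l := Suc (u l))) j - 1)"
      using False by auto
    show ?thesis using addp.step[OF N'(1) step.hyps(2) S', unfolded eq] b j by blast
  qed
qed

text \<open>Equal multiplicities leave only the projective parts to differ, and these vanish modulo
  maps through projectives. The copies of each \<open>X j\<close> are matched one at a time, so that
  no cancellation of summands enters.\<close>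

lemma addp_stab_iso:
  assumes X: "\<And>j. j \<in> I \<Longrightarrow> fg_module R (X j)" and "addp R I X u M" "addp R I X u N"
  shows "stab_iso M N"
  using assms(2,3)
proof (induction u M arbitrary: N rule: addp.induct)
  case (proj M)
  have p: "projective R M" "projective R N" using proj addp_zero by auto
  then have [simp]: "left_module R M" "left_module R N" using projective_fg by auto
  have id: "(\<lambda>x. x) \<in> lin_maps R M M" "(\<lambda>x. x) \<in> lin_maps R N N" using lin_id by (auto simp: id_def)
  show ?case unfolding stab_iso_def
    using null_map_projective_dom[OF p(1) id(1), of 0] null_map_projective_dom[OF p(2) id(2), of 0]
      lin_null[of N M] lin_null[of M N]
    by (intro bexI[of _ "\<lambda>x. \<zero>\<^bsub>N\<^esub>"] bexI[of _ "\<lambda>x. \<zero>\<^bsub>M\<^esub>"] exI[of _ "\<lambda>x. x"]) auto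
next
  case (step u M' j M i1 i2 p1 p2)
  have eq: "(u(j := Suc (u j)))(j := (u(j := Suc (u j))) j - 1) = u" by auto
  have "(u(j := Suc (u j))) j > 0" by simp
  then obtain N' k1 k2 q1 q2 where N': "addp R I X u N'" and b: "biprod R N' (X j) N k1 k2 q1 q2"
    using addp_extract[OF X step.prems, of j, unfolded eq] by blast
  obtain a c h k where ac: "a \<in> lin_maps R M' N'" "c \<in> lin_maps R N' M'" "null_map R 0 M' M' h" "null_map R 0 N' N' k"
    and e: "\<And>x. x \<in> carrier M' \<Longrightarrow> c (a x) \<oplus>\<^bsub>M'\<^esub> h x = x" "\<And>x. x \<in> carrier N' \<Longrightarrow> a (c x) \<oplus>\<^bsub>N'\<^esub> k x = x"
    using step.IH[OF N'] unfolding stab_iso_def by metis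
  have lm [simp]: "left_module R M'" "left_module R N'" "left_module R M" "left_module R N" "left_module R (X j)"
    using addp_fg[OF step.hyps(1)] addp_fg[OF N'] step.hyps addp_fg[OF step.prems] X by auto
  note m = biprod_maps[OF step.hyps(4)] biprod_maps[OF b]
  note hk = null_map_lin[OF lm(1) ac(3)] null_map_lin[OF lm(2) ac(4)]
  note R = lin_rules[OF lm(1,3) m(1)] lin_rules[OF lm(5,3) m(2)] lin_rules[OF lm(3,1) m(3)] lin_rules[OF lm(3,5) m(4)]
    lin_rules[OF lm(2,4) m(5)] lin_rules[OF lm(5,4) m(6)] lin_rules[OF lm(4,2) m(7)] lin_rules[OF lm(4,5) m(8)]
    lin_rules[OF lm(1,2) ac(1)] lin_rules[OF lm(2,1) ac(2)] lin_rules[OF lm(1,1) hk(1)] lin_rules[OF lm(2,2) hk(2)]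
    biprod_rules(1-4)[OF step.hyps(4)] biprod_rules(1-4)[OF b]
  let ?a = "\<lambda>x. k1 (a (p1 x)) \<oplus>\<^bsub>N\<^esub> k2 (p2 x)" and ?c = "\<lambda>x. i1 (c (q1 x)) \<oplus>\<^bsub>M\<^esub> i2 (q2 x)"
  let ?h = "\<lambda>x. i1 (h (p1 x))" and ?k = "\<lambda>x. k1 (k (q1 x))"
  have "?a \<in> lin_maps R M N" "?c \<in> lin_maps R N M" by (intro linI; simp add: R lm_ac lm_distr)+
  moreover have "null_map R 0 M M ?h" "null_map R 0 N N ?k"
    using null_map_left[OF null_map_right[OF ac(3) m(3)] m(1)] null_map_left[OF null_map_right[OF ac(4) m(7)] m(5)] .
  moreover have "x = ?c (?a x) \<oplus>\<^bsub>M\<^esub> ?h x" if x: "x \<in> carrier M" for x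
  proof -
    have "i1 (c (a (p1 x)) \<oplus>\<^bsub>M'\<^esub> h (p1 x)) \<oplus>\<^bsub>M\<^esub> i2 (p2 x) = x"
      using e(1)[of "p1 x"] x biprod_rules(5)[OF step.hyps(4) x] by (simp add: R(11))
    then show ?thesis using x by (simp add: R lm_ac)
  qed
  moreover have "x = ?a (?c x) \<oplus>\<^bsub>N\<^esub> ?k x" if x: "x \<in> carrier N" for x
  proof -
    have "k1 (a (c (q1 x)) \<oplus>\<^bsub>N'\<^esub> k (q1 x)) \<oplus>\<^bsub>N\<^esub> k2 (q2 x) = x"
      using e(2)[of "q1 x"] x biprod_rules(5)[OF b x] by (simp add: R(31))
    then show ?thesis using x by (simp add: R lm_ac)
  qed
  ultimately show ?case unfolding stab_iso_def
    by (intro bexI[of _ ?a] bexI[of _ ?c] exI[of _ ?h] exI[of _ ?k]) auto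
qed

text \<open>A map between direct sums is the sum of its matrix entries. Entries between members of
  the family are lowered to level \<open>n\<close> by \<open>U\<close>; entries that touch a
  projective part factor through a projective module.\<close>

lemma addp_null_map:
  assumes X: "\<And>j. j \<in> I \<Longrightarrow> fg_module R (X j)"
    and U: "\<And>i j m h. i \<in> I \<Longrightarrow> j \<in> I \<Longrightarrow> null_map R m (X i) (X j) h \<Longrightarrow> null_map R n (X i) (X j) h"
    and M: "addp R I X u M" and N: "addp R I X v N" and h: "null_map R m M N h"
  shows "null_map R n M N h"
proof -
  have 1: "null_map R n (X i) N h" if i: "i \<in> I" and h: "null_map R m (X i) N h" for i h
    using N h
  proof (induction v N arbitrary: h rule: addp.induct)
    case (proj N)
    show ?case by (rule null_map_projective_cod[OF proj(1) null_map_lin[OF fg_lm[OF X[OF i]] proj(2)]])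
  next
    case (step v N' j N i1 i2 p1 p2)
    note b = biprod_maps[OF step.hyps(4)]
    have lN: "left_module R N" using step.hyps by simp
    have "null_map R n (X i) N (\<lambda>x. i1 (p1 (h x)))"
      by (rule null_map_left[OF step.IH[OF null_map_left[OF step.prems b(3)]] b(1)])
    moreover have "null_map R n (X i) N (\<lambda>x. i2 (p2 (h x)))"
      by (rule null_map_left[OF U[OF i step.hyps(2) null_map_left[OF step.prems b(4)]] b(2)])
    ultimately have "null_map R n (X i) N (\<lambda>x. i1 (p1 (h x)) \<oplus>\<^bsub>N\<^esub> i2 (p2 (h x)))"
      by (rule null_map_add[OF _ _ fg_lm[OF X[OF i]] lN])
    then show ?case
      by (rule null_map_cong) (simp add: biprod_rules(5)[OF step.hyps(4)] lin_closed[OF null_map_lin[OF fg_lm[OF X[OF i]] step.prems]])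
  qed
  show ?thesis using M h
  proof (induction u M arbitrary: h rule: addp.induct)
    case (proj M)
    show ?case by (rule null_map_projective_dom[OF proj(1) null_map_lin[OF fg_lm[OF projective_fg[OF proj(1)]] proj(2)]])
  next
    case (step u M' j M i1 i2 p1 p2)
    note b = biprod_maps[OF step.hyps(4)]
    have lm: "left_module R M" "left_module R N" "left_module R M'" "left_module R (X j)"
      using step.hyps(2,3) addp_fg[OF N] addp_fg[OF step.hyps(1)] X by auto
    have hl: "h \<in> lin_maps R M N" using null_map_lin[OF lm(1) step.prems] .
    have "null_map R n M N (\<lambda>x. h (i1 (p1 x)))"
      by (rule null_map_right[OF step.IH[OF null_map_right[OF step.prems b(1)]] b(3)])
    moreover have "null_map R n M N (\<lambda>x. h (i2 (p2 x)))"
      by (rule null_map_right[OF 1[OF step.hyps(2) null_map_right[OF step.prems b(2)]] b(4)])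
    ultimately have "null_map R n M N (\<lambda>x. h (i1 (p1 x)) \<oplus>\<^bsub>N\<^esub> h (i2 (p2 x)))"
      by (rule null_map_add[OF _ _ lm(1,2)])
    then show ?case
    proof (rule null_map_cong)
      fix x assume x: "x \<in> carrier M"
      have "h (i1 (p1 x) \<oplus>\<^bsub>M\<^esub> i2 (p2 x)) = h (i1 (p1 x)) \<oplus>\<^bsub>N\<^esub> h (i2 (p2 x))"
        by (intro lin_add[OF hl] lin_closed[OF b(1)] lin_closed[OF b(2)] lin_closed[OF b(3)] lin_closed[OF b(4)] x)
      then show "h x = h (i1 (p1 x)) \<oplus>\<^bsub>N\<^esub> h (i2 (p2 x))" using biprod_rules(5)[OF step.hyps(4) x] by simp
    qed
  qed
qed

text \<open>The given presentations of the summands are added up. The projective part is covered by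
  itself with kernel zero, so the multiplicities carry over unchanged.\<close>

lemma addp_cover:
  assumes X: "\<And>j. j \<in> I \<Longrightarrow> fg_module R (X j)"
    and P: "\<And>j. j \<in> I \<Longrightarrow> projective R (P j)" "\<And>j. j \<in> I \<Longrightarrow> epi R (P j) (X j) (c j)"
    and M: "addp R I X u M"
  shows "\<exists>F f. projective R F \<and> epi R F M f \<and> addp R I (\<lambda>j. kern (P j) (X j) (c j)) u (kern F M f)"
  using M
proof (induction u M rule: addp.induct)
  case (proj M)
  have lM: "left_module R M" using projective_fg[OF proj] by simp
  have e: "epi R M M (\<lambda>x. x)" using lin_id[of R M] by (simp add: epi_def id_def)
  have "projective R (kern M M (\<lambda>x. x))"
    by (rule trivial_projective[OF fg_lm[OF kern_fg[OF projective_fg[OF proj] lM]]]) (use e lM in \<open>auto simp: epi_def\<close>)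
  then show ?case using proj e by (intro exI[of _ M] exI[of _ "\<lambda>x. x"] conjI addp.proj)
next
  case (step u N j M i1 i2 p1 p2)
  obtain F f where F: "projective R F" "epi R F N f" "addp R I (\<lambda>j. kern (P j) (X j) (c j)) u (kern F N f)"
    using step.IH by blast
  obtain T :: "'r fgmod" and j1 j2 q1 q2 where T: "fg_module R T" "biprod R F (P j) T j1 j2 q1 q2"
    using biprod_exists[OF projective_fg[OF F(1)] projective_fg[OF P(1)[OF step.hyps(2)]]] by metis
  have lm: "left_module R F" "left_module R (P j)" "left_module R T" "left_module R N" "left_module R (X j)" "left_module R M"
    using projective_fg[OF F(1)] projective_fg[OF P(1)[OF step.hyps(2)]] step.hyps(2,3) T(1) X addp_fg[OF step.hyps(1)] by auto
  have fl: "f \<in> lin_maps R F N" "c j \<in> lin_maps R (P j) (X j)" using F P(2)[OF step.hyps(2)] by (auto simp: epi_def)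
  define h where "h = (\<lambda>t. i1 (f (q1 t)) \<oplus>\<^bsub>M\<^esub> i2 (c j (q2 t)))"
  note k = biprod_kern[OF T(2) step.hyps(4) fl lm, folded h_def]
  have "epi R T M h" by (rule k(3)[OF F(2) P(2)[OF step.hyps(2)]])
  moreover have "projective R T" by (rule projective_sum[OF F(1) P(1)[OF step.hyps(2)] T])
  moreover have "addp R I (\<lambda>j. kern (P j) (X j) (c j)) (u(j := Suc (u j))) (kern T M h)"
    by (rule addp.step[OF F(3) step.hyps(2) kern_fg[OF T(1) lm(6) k(1)] k(2)])
  ultimately show ?case by (intro exI[of _ T] exI[of _ h] conjI)
qed

text \<open>\<open>E\<close> is the pullback of the two presentations, and both of its projections
  split because \<open>F\<close> and \<open>F'\<close> are projective. The argument
  \<open>aux\<close> is used twice on the same carrier with the roles exchanged.\<close>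

lemma schanuel:
  fixes F F' M :: "'r fgmod"
  assumes M: "fg_module R M" and F: "projective R F" "epi R F M f" "projective R F'" "epi R F' M f'"
  obtains E :: "'r fgmod" and i1 i2 p1 p2 k1 k2 q1 q2 where "fg_module R E"
    "biprod R (kern F M f) F' E i1 i2 p1 p2" "biprod R (kern F' M f') F E k1 k2 q1 q2"
proof -
  have aux: "\<exists>i1 i2 p1 p2. biprod R (kern F M f) F' (T\<lparr>carrier := {s \<in> carrier T. f (q1 s) = f' (q2 s)}\<rparr>) i1 i2 p1 p2"
    if F: "projective R F" "epi R F M f" "projective R F'" "epi R F' M f'" and T: "fg_module R T" "biprod R F F' T j1 j2 q1 q2"
    for F F' T :: "'r fgmod" and f f' j1 j2 q1 q2
  proof -
    note fg = projective_fg[OF F(1)] projective_fg[OF F(3)]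
    have fl: "f \<in> lin_maps R F M" "f' \<in> lin_maps R F' M" using F by (auto simp: epi_def)
    obtain l where l: "l \<in> lin_maps R F' F" "\<And>x. x \<in> carrier F' \<Longrightarrow> f (l x) = f' x"
      using projective_lift[OF F(3) fg(1) M fl(2) F(2)] by metis
    have lm [simp]: "left_module R F" "left_module R F'" "left_module R T" "left_module R M" using fg T M by auto
    note m = biprod_maps[OF T(2)]
    note R = lin_rules[OF lm(1,3) m(1)] lin_rules[OF lm(2,3) m(2)] lin_rules[OF lm(3,1) m(3)] lin_rules[OF lm(3,2) m(4)]
      lin_rules[OF lm(1,4) fl(1)] lin_rules[OF lm(2,4) fl(2)] lin_rules[OF lm(2,1) l(1)] biprod_rules(1-4)[OF T(2)] l(2)
    have "j1 (q1 s \<oplus>\<^bsub>F\<^esub> \<ominus>\<^bsub>F\<^esub> l (q2 s)) \<oplus>\<^bsub>T\<^esub> (j1 (l (q2 s)) \<oplus>\<^bsub>T\<^esub> j2 (q2 s)) = s" if "s \<in> carrier T" for s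
    proof -
      have "j1 (q1 s \<oplus>\<^bsub>F\<^esub> \<ominus>\<^bsub>F\<^esub> l (q2 s)) \<oplus>\<^bsub>T\<^esub> (j1 (l (q2 s)) \<oplus>\<^bsub>T\<^esub> j2 (q2 s)) = j1 (q1 s) \<oplus>\<^bsub>T\<^esub> j2 (q2 s)"
        using that by (simp add: R lm_ac(1)[OF lm(3)])
      then show ?thesis using biprod_rules(5)[OF T(2) that] by simp
    qed
    then have "biprod R (kern F M f) F' (T\<lparr>carrier := {s \<in> carrier T. f (q1 s) = f' (q2 s)}\<rparr>) j1 (\<lambda>x. j1 (l x) \<oplus>\<^bsub>T\<^esub> j2 x)
        (\<lambda>s. q1 s \<oplus>\<^bsub>F\<^esub> \<ominus>\<^bsub>F\<^esub> l (q2 s)) q2"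
      unfolding biprod_def by (auto intro!: linI simp: R lm_ac lm_distr)
    then show ?thesis by metis
  qed
  obtain T :: "'r fgmod" and j1 j2 q1 q2 where T: "fg_module R T" "biprod R F F' T j1 j2 q1 q2"
    using biprod_exists[OF projective_fg[OF F(1)] projective_fg[OF F(3)]] by metis
  let ?E = "T\<lparr>carrier := {s \<in> carrier T. f (q1 s) = f' (q2 s)}\<rparr>"
  have sw: "biprod R F' F T j2 j1 q2 q1" using biprod_swap[OF fg_lm[OF T(1)] T(2)] .
  have eq: "{s \<in> carrier T. f (q1 s) = f' (q2 s)} = {s \<in> carrier T. f' (q2 s) = f (q1 s)}" by auto
  note m = biprod_maps[OF T(2)]
  have lm [simp]: "left_module R T" "left_module R F" "left_module R F'" "left_module R M"
    using T M F projective_fg by auto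
  have fl: "f \<in> lin_maps R F M" "f' \<in> lin_maps R F' M" using F by (auto simp: epi_def)
  note R = lin_rules[OF lm(1,2) m(3)] lin_rules[OF lm(1,3) m(4)] lin_rules[OF lm(2,4) fl(1)] lin_rules[OF lm(3,4) fl(2)]
  have "submodule {s \<in> carrier T. f (q1 s) = f' (q2 s)} R T"
    unfolding left_module.submodule_iff[OF lm(1)] by (simp add: R)
  then have E: "fg_module R ?E" by (rule fg_sub[OF T(1)])
  obtain a1 a2 a3 a4 where 1: "biprod R (kern F M f) F' ?E a1 a2 a3 a4" using aux[OF F T] by blast
  have "\<exists>i1 i2 p1 p2. biprod R (kern F' M f') F ?E i1 i2 p1 p2"
    unfolding eq by (rule aux[OF F(3,4,1,2) T(1) sw])
  then obtain b1 b2 b3 b4 where "biprod R (kern F' M f') F ?E b1 b2 b3 b4" by blast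
  then show ?thesis by (rule that[OF E 1])
qed

text \<open>The identity of \<open>M\<close> is added to the first map, which leaves the cokernel as
  it was.\<close>

lemma ses_add:
  fixes L N Y M S S' :: "'r fgmod"
  assumes s: "ses R L N Y f p" and M: "fg_module R M"
    and S: "fg_module R S" "biprod R L M S i1 i2 p1 p2" and S': "fg_module R S'" "biprod R N M S' k1 k2 q1 q2"
  shows "ses R S S' Y (\<lambda>s. k1 (f (p1 s)) \<oplus>\<^bsub>S'\<^esub> k2 (p2 s)) (\<lambda>s. p (q1 s))"
proof -
  note D = sesD[OF s]
  have lm [simp]: "left_module R L" "left_module R N" "left_module R Y" "left_module R M" "left_module R S" "left_module R S'"
    using D S S' M by auto
  note m = biprod_maps[OF S(2)] biprod_maps[OF S'(2)]
  note R = lin_rules[OF lm(1,2) D(4)] lin_rules[OF lm(2,3) D(5)] lin_rules[OF lm(1,5) m(1)] lin_rules[OF lm(4,5) m(2)]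
    lin_rules[OF lm(5,1) m(3)] lin_rules[OF lm(5,4) m(4)] lin_rules[OF lm(2,6) m(5)] lin_rules[OF lm(4,6) m(6)]
    lin_rules[OF lm(6,2) m(7)] lin_rules[OF lm(6,4) m(8)] biprod_rules(1-4)[OF S(2)] biprod_rules(1-4)[OF S'(2)]
  let ?f = "\<lambda>s. k1 (f (p1 s)) \<oplus>\<^bsub>S'\<^esub> k2 (p2 s)" and ?p = "\<lambda>s. p (q1 s)"
  have fl: "?f \<in> lin_maps R S S'" by (intro linI) (simp_all add: R lm_ac lm_distr)
  have pl: "?p \<in> lin_maps R S' Y" using lin_comp[OF m(7) D(5)] .
  show ?thesis unfolding ses_def
  proof (intro conjI)
    show "inj_on ?f (carrier S)"
    proof (rule lin_injI[OF lm(5,6) fl])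
      fix s assume s: "s \<in> carrier S" "?f s = \<zero>\<^bsub>S'\<^esub>"
      have "q1 (?f s) = \<zero>\<^bsub>N\<^esub>" "q2 (?f s) = \<zero>\<^bsub>M\<^esub>" unfolding s(2) by (simp_all add: R)
      then have "f (p1 s) = \<zero>\<^bsub>N\<^esub>" "p2 s = \<zero>\<^bsub>M\<^esub>" using s(1) by (simp_all add: R)
      then have "p1 s = \<zero>\<^bsub>L\<^esub>" "p2 s = \<zero>\<^bsub>M\<^esub>" using D(8)[of "p1 s"] s(1) by (simp_all add: R)
      then have "i1 (p1 s) \<oplus>\<^bsub>S\<^esub> i2 (p2 s) = \<zero>\<^bsub>S\<^esub>" by (simp add: R)
      then show "s = \<zero>\<^bsub>S\<^esub>" using biprod_rules(5)[OF S(2) s(1)] by simp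
    qed
    show "epi R S' Y ?p"
    proof (rule epiI[OF pl])
      fix y assume "y \<in> carrier Y"
      then obtain x where "x \<in> carrier N" "p x = y" using D(9) by blast
      then show "\<exists>s\<in>carrier S'. ?p s = y" by (intro bexI[of _ "k1 x"]) (simp_all add: R)
    qed
    show "?f ` carrier S = {s \<in> carrier S'. ?p s = \<zero>\<^bsub>Y\<^esub>}"
    proof (intro equalityI subsetI)
      fix t assume "t \<in> ?f ` carrier S"
      then show "t \<in> {s \<in> carrier S'. ?p s = \<zero>\<^bsub>Y\<^esub>}" using D(7) by (auto simp: R)
    next
      fix t assume t: "t \<in> {s \<in> carrier S'. ?p s = \<zero>\<^bsub>Y\<^esub>}"
      then obtain x where x: "x \<in> carrier L" "f x = q1 t" using D(10)[of "q1 t"] by (auto simp: R)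
      have "?f (i1 x \<oplus>\<^bsub>S\<^esub> i2 (q2 t)) = t" using t x biprod_rules(5)[OF S'(2), of t] by (simp add: R)
      moreover have "i1 x \<oplus>\<^bsub>S\<^esub> i2 (q2 t) \<in> carrier S" using t x by (simp add: R)
      ultimately show "t \<in> ?f ` carrier S" by (metis (no_types, lifting) imageI)
    qed
  qed (use D S S' fl in auto)
qed

end

section \<open>Stabilisation\<close>

text \<open>Unless all groups are zero, the least positive element \<open>e\<close> of the union
  generates it, by division with remainder; an index at which \<open>e\<close> occurs bounds the
  chain.\<close>

lemma int_subgroup_chain:
  fixes V :: "nat \<Rightarrow> int set"
  assumes z: "\<And>n. 0 \<in> V n" and d: "\<And>n x y. x \<in> V n \<Longrightarrow> y \<in> V n \<Longrightarrow> x - y \<in> V n" and m: "\<And>n. V n \<subseteq> V (Suc n)"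
  shows "\<exists>n0. \<forall>n. V n \<subseteq> V n0"
proof (cases "\<exists>n x. x \<in> V n \<and> x \<noteq> 0")
  case False
  then show ?thesis using z by (intro exI[of _ 0] allI subsetI) metis
next
  case True
  have neg: "- x \<in> V n" if "x \<in> V n" for x n using d[OF z that] by simp
  have add: "x + y \<in> V n" if "x \<in> V n" "y \<in> V n" for x y n using d[OF that(1) neg[OF that(2)]] by simp
  have mult_nat: "x * int q \<in> V n" if "x \<in> V n" for x q n
    by (induction q) (auto simp: z add that algebra_simps)
  have mult: "x * q \<in> V n" if "x \<in> V n" for x q n
  proof (cases "q \<ge> 0")
    case True then show ?thesis using mult_nat[OF that, of "nat q"] by simp
  next
    case False then show ?thesis using neg[OF mult_nat[OF that, of "nat (- q)"]] by simp
  qed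
  obtain n1 x1 where "x1 \<in> V n1" "x1 \<noteq> 0" using True by blast
  then have "\<exists>e n. e > 0 \<and> int e \<in> V n" using neg[of x1 n1]
    by (intro exI[of _ "nat \<bar>x1\<bar>"] exI[of _ n1]) (auto simp: abs_if)
  then obtain e where e: "e > 0" "\<exists>n. int e \<in> V n" and least: "\<And>e'. e' < e \<Longrightarrow> \<not> (e' > 0 \<and> (\<exists>n. int e' \<in> V n))"
    using exists_least_iff[of "\<lambda>e. e > 0 \<and> (\<exists>n. int e \<in> V n)"] by blast
  obtain n0 where n0: "int e \<in> V n0" using e by blast
  have mono: "i \<le> j \<Longrightarrow> V i \<subseteq> V j" for i j using lift_Suc_mono_le[of V, OF m] .
  have "V n \<subseteq> V n0" for n
  proof
    fix x assume x: "x \<in> V n"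
    have "x - int e * (x div int e) \<in> V (max n n0)"
      using d[of x "max n n0"] mult[of "int e" "max n n0"] x n0 mono[of n "max n n0"] mono[of n0 "max n n0"] by auto
    then have "x mod int e \<in> V (max n n0)" by (simp add: minus_mult_div_eq_mod)
    moreover have "0 \<le> x mod int e" "x mod int e < int e" using e(1) by auto
    ultimately have "x mod int e = 0" using least[of "nat (x mod int e)"] by force
    then have "x = int e * (x div int e)" by (metis add.right_neutral mult_div_mod_eq)
    then show "x \<in> V n0" using mult[OF n0] by metis
  qed
  then show ?thesis by blast
qed

text \<open>The group of integer vectors of length \<open>k\<close> is noetherian: the members with
  last coordinate zero and the last coordinates of all members are bounded separately, at
  \<open>n1\<close> and \<open>n2\<close>.\<close>

lemma int_vector_chain:
  fixes G :: "nat \<Rightarrow> (nat \<Rightarrow> int) set"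
  assumes "\<And>n. (\<lambda>_. 0) \<in> G n" "\<And>n f g. f \<in> G n \<Longrightarrow> g \<in> G n \<Longrightarrow> (\<lambda>i. f i - g i) \<in> G n" "\<And>n. G n \<subseteq> G (Suc n)"
    "\<And>n f i. f \<in> G n \<Longrightarrow> i \<ge> k \<Longrightarrow> f i = 0"
  shows "\<exists>n0. \<forall>n. G n \<subseteq> G n0"
  using assms
proof (induction k arbitrary: G)
  case 0
  then have "f = (\<lambda>_. 0)" if "f \<in> G n" for f n using that by blast
  then show ?case using 0(1) by blast
next
  case (Suc k)
  define H where "H n = {f \<in> G n. f k = 0}" for n
  have "\<exists>n1. \<forall>n. H n \<subseteq> H n1"
  proof (rule Suc.IH)
    show "(\<lambda>_. 0) \<in> H n" for n using Suc.prems(1) by (simp add: H_def)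
    show "(\<lambda>i. f i - g i) \<in> H n" if "f \<in> H n" "g \<in> H n" for n f g using that Suc.prems(2) by (simp add: H_def)
    show "H n \<subseteq> H (Suc n)" for n using Suc.prems(3)[of n] by (auto simp: H_def)
    fix n f i assume "f \<in> H n" "k \<le> i"
    then show "f i = 0" using Suc.prems(4)[of f n i] by (cases "i = k") (auto simp: H_def)
  qed
  then obtain n1 where n1: "\<And>n. H n \<subseteq> H n1" by blast
  have "\<exists>n2. \<forall>n. (\<lambda>f. f k) ` G n \<subseteq> (\<lambda>f. f k) ` G n2"
  proof (rule int_subgroup_chain)
    show "0 \<in> (\<lambda>f. f k) ` G n" for n using Suc.prems(1)[of n] by (metis (mono_tags) imageI)
    fix n x y assume "x \<in> (\<lambda>f. f k) ` G n" "y \<in> (\<lambda>f. f k) ` G n"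
    then obtain f g where "f \<in> G n" "g \<in> G n" "x = f k" "y = g k" by blast
    then show "x - y \<in> (\<lambda>f. f k) ` G n" using Suc.prems(2)[of f n g] by (intro image_eqI[of _ _ "\<lambda>i. f i - g i"]) auto
  next
    show "(\<lambda>f. f k) ` G n \<subseteq> (\<lambda>f. f k) ` G (Suc n)" for n using Suc.prems(3) by (intro image_mono)
  qed
  then obtain n2 where n2: "\<And>n. (\<lambda>f. f k) ` G n \<subseteq> (\<lambda>f. f k) ` G n2" by blast
  have mono: "i \<le> j \<Longrightarrow> G i \<subseteq> G j" for i j using lift_Suc_mono_le[of G, OF Suc.prems(3)] .
  have "G n \<subseteq> G (max n1 n2)" for n
  proof
    \<comment> \<open>Some \<open>g\<close> in \<open>G n2\<close> has the same last coordinate as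
      \<open>f\<close>; the difference lies in the part with last coordinate zero, hence in
      \<open>G n1\<close>.\<close>
    fix f assume f: "f \<in> G n"
    then have "f k \<in> (\<lambda>f. f k) ` G n2" using subsetD[OF n2[of n] imageI[OF f]] by simp
    then obtain g where g: "g \<in> G n2" "f k = g k" by auto
    let ?m = "max n n2"
    have "f \<in> G ?m" "g \<in> G ?m" using f g mono[of n ?m] mono[of n2 ?m] by auto
    then have "(\<lambda>i. f i - g i) \<in> H ?m" using Suc.prems(2)[of f ?m g] g by (simp add: H_def)
    then have "(\<lambda>i. f i - g i) \<in> H n1" by (rule subsetD[OF n1])
    then have "(\<lambda>i. f i - g i) \<in> G n1" by (simp add: H_def)
    then have fg: "(\<lambda>i. f i - g i) \<in> G (max n1 n2)" using mono[of n1 "max n1 n2"] by auto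
    have g': "g \<in> G (max n1 n2)" using g mono[of n2 "max n1 n2"] by auto
    have "(\<lambda>i. 0 - g i) \<in> G (max n1 n2)" using Suc.prems(2)[OF Suc.prems(1) g'] .
    then have "(\<lambda>i. (f i - g i) - (0 - g i)) \<in> G (max n1 n2)" using Suc.prems(2)[OF fg] by blast
    then show "f \<in> G (max n1 n2)" by simp
  qed
  then show ?case by blast
qed

section \<open>Finite length over a central subring\<close>

lemma left_module_subring:
  assumes "left_module R M" "subring Z R" shows "left_module (R\<lparr>carrier := Z\<rparr>) M"
proof -
  interpret left_module R M by fact
  interpret Z: ring "R\<lparr>carrier := Z\<rparr>" using R.subring_is_ring[OF assms(2)] .
  have "Z \<subseteq> carrier R" using subringE(1)[OF assms(2)] .
  then show ?thesis
    by (intro left_module.intro left_module_axioms.intro Z.ring_axioms M.abelian_group_axioms)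
       (auto simp: subset_iff smult_closed smult_l_distr smult_r_distr smult_assoc1 smult_one)
qed

lemma lin_maps_subring: "subring Z R \<Longrightarrow> f \<in> lin_maps R M N \<Longrightarrow> f \<in> lin_maps (R\<lparr>carrier := Z\<rparr>) M N"
  using subringE(1)[of Z R] by (auto simp: lin_maps_def)

lemma submodule_subring:
  assumes "left_module R M" "subring Z R" "submodule U R M" shows "submodule U (R\<lparr>carrier := Z\<rparr>) M"
  using assms(3) subringE(1)[OF assms(2)] left_module.submodule_iff[OF assms(1)]
    left_module.submodule_iff[OF left_module_subring[OF assms(1,2)]] by auto

lemma fin_length_subring:
  assumes "left_module R M" "subring Z R" "fin_length (R\<lparr>carrier := Z\<rparr>) M" shows "fin_length R M"
  using assms(3) submodule_subring[OF assms(1,2)] unfolding fin_length_def by metis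

text \<open>An Artin algebra with its base ring replaced by a subring \<open>Z\<close> of the
  centre. As a subset of \<open>R\<close> it acts on every \<open>R\<close>-module through the given
  scalar multiplication, so no second module structure has to be carried along.\<close>

locale artin_ring =
  fixes R :: "('r, 'x) ring_scheme" and Z :: "'r set"
  assumes ring: "ring R" and sub: "subring Z R"
    and central: "\<And>z r. z \<in> Z \<Longrightarrow> r \<in> carrier R \<Longrightarrow> z \<otimes>\<^bsub>R\<^esub> r = r \<otimes>\<^bsub>R\<^esub> z"
    and fl_Z: "fin_length (R\<lparr>carrier := Z\<rparr>) (self R)"

sublocale artin_ring \<subseteq> fl_ring R
  by (rule fl_ring.intro[OF ring fin_length_subring[OF self_left_module[OF ring] sub fl_Z]])

context artin_ring
begin

lemma fg_fin_length_Z: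
  assumes "fg_module R M" shows "fin_length (R\<lparr>carrier := Z\<rparr>) M"
proof -
  obtain n f where f: "f \<in> lin_maps R (free R n) M" "f ` carrier (free R n) = carrier M" using free_cover[OF assms] by metis
  have s: "left_module (R\<lparr>carrier := Z\<rparr>) (self R)" by (rule left_module_subring[OF self_left_module[OF ring] sub])
  show ?thesis
    by (rule fin_length_image[OF pow_left_module[OF s] left_module_subring[OF fg_lm[OF assms] sub] lin_maps_subring[OF sub f(1)] f(2)
          fin_length_pow[OF s fl_Z]])
qed

text \<open>A map is determined by its values on \<open>l\<close> generators of \<open>M\<close>.
  The value tuples of null maps of level \<open>n\<close> form submodules over \<open>Z\<close> of
  \<open>N^l\<close> that grow with \<open>n\<close>, and \<open>N^l\<close> has finite length over
  \<open>Z\<close>. This is where an Artin algebra offers more than a left artinian ring.\<close>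

lemma null_map_stable:
  fixes M N :: "'r fgmod"
  assumes M: "fg_module R M" and N: "fg_module R N"
  shows "\<exists>n0. \<forall>n h. null_map R n M N h \<longrightarrow> null_map R n0 M N h"
proof -
  have lm [simp]: "left_module R M" "left_module R N" using M N by auto
  obtain l g where g: "g \<in> lin_maps R (free R l) M" "g ` carrier (free R l) = carrier M" using free_cover[OF M] by metis
  define x where "x i = g (unit_vec R i)" for i
  have x: "x i \<in> carrier M" if "i < l" for i
    unfolding x_def using lin_closed[OF g(1) unit_vec_carrier[OF ring that]] .
  let ?RZ = "R\<lparr>carrier := Z\<rparr>"
  have Zs: "Z \<subseteq> carrier R" using subringE(1)[OF sub] .
  have NZ: "left_module ?RZ N" using left_module_subring[OF lm(2) sub] .
  define tup where "tup h i = (if i < l then h (x i) else \<zero>\<^bsub>N\<^esub>)" for h i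
  define T where "T n = {tup h | h. null_map R n M N h}" for n
  have Tsub: "submodule (T n) ?RZ (pow N l)" for n
    unfolding left_module.submodule_iff[OF pow_left_module[OF NZ]]
  proof (intro conjI ballI)
    have "h (x i) \<in> carrier N" if "null_map R n M N h" "i < l" for h i
      using lin_closed[OF null_map_lin[OF lm(1) that(1)] x[OF that(2)]] .
    then show "T n \<subseteq> carrier (pow N l)" by (auto simp: T_def tup_def carrier_pow)
    have "null_map R n M N (\<lambda>_. \<zero>\<^bsub>N\<^esub>)" by (rule null_map_zero[OF M N refl])
    moreover have "tup (\<lambda>_. \<zero>\<^bsub>N\<^esub>) = \<zero>\<^bsub>pow N l\<^esub>" by (rule ext) (simp add: tup_def)
    ultimately show "\<zero>\<^bsub>pow N l\<^esub> \<in> T n" unfolding T_def by (metis (mono_tags, lifting) mem_Collect_eq)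
  next
    fix u v assume "u \<in> T n" "v \<in> T n"
    then obtain h k where hk: "null_map R n M N h" "null_map R n M N k" "u = tup h" "v = tup k" unfolding T_def by blast
    have "u \<oplus>\<^bsub>pow N l\<^esub> v = tup (\<lambda>y. h y \<oplus>\<^bsub>N\<^esub> k y)" by (rule ext) (simp add: hk tup_def)
    then show "u \<oplus>\<^bsub>pow N l\<^esub> v \<in> T n" using null_map_add[OF hk(1,2) lm] unfolding T_def by blast
  next
    fix r u assume "r \<in> carrier ?RZ" "u \<in> T n"
    then obtain h where h: "r \<in> Z" "null_map R n M N h" "u = tup h" unfolding T_def by auto
    have r: "r \<in> carrier R" using h Zs by auto
    \<comment> \<open>Centrality of \<open>r\<close> makes multiplication by \<open>r\<close> linear
      over \<open>R\<close>, so that composing with it preserves null maps.\<close>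
    have "(\<lambda>y. r \<odot>\<^bsub>N\<^esub> y) \<in> lin_maps R N N"
    proof (rule linI)
      fix s y assume s: "s \<in> carrier R" "y \<in> carrier N"
      interpret N: left_module R N by fact
      show "r \<odot>\<^bsub>N\<^esub> (s \<odot>\<^bsub>N\<^esub> y) = s \<odot>\<^bsub>N\<^esub> (r \<odot>\<^bsub>N\<^esub> y)"
        using s r central[OF h(1) s(1)] by (simp flip: N.smult_assoc1)
    qed (use r in \<open>simp_all add: lm_distr\<close>)
    then have "null_map R n M N (\<lambda>y. r \<odot>\<^bsub>N\<^esub> h y)" by (rule null_map_left[OF h(2)])
    moreover have "r \<odot>\<^bsub>pow N l\<^esub> u = tup (\<lambda>y. r \<odot>\<^bsub>N\<^esub> h y)" using r by (intro ext) (simp add: h tup_def)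
    ultimately show "r \<odot>\<^bsub>pow N l\<^esub> u \<in> T n" unfolding T_def by blast
  qed
  have Tmono: "T n \<subseteq> T (Suc n)" for n unfolding T_def using null_map_mono[of n M N _ "Suc n"] by auto
  obtain n0 where n0: "\<forall>m\<ge>n0. T m = T n0"
    using fin_length_stable[where U = T, OF pow_left_module[OF NZ] fin_length_pow[OF NZ fg_fin_length_Z[OF N]] Tsub Tmono] by blast
  have "null_map R n0 M N h" if h: "null_map R n M N h" for n h
  proof -
    have "tup h \<in> T (max n n0)" using null_map_mono[OF h, of "max n n0"] unfolding T_def by auto
    also have "T (max n n0) = T n0" by (rule n0[rule_format]) simp
    finally have "tup h \<in> T n0" .
    then obtain k where k: "null_map R n0 M N k" "tup h = tup k" unfolding T_def by blast
    have hl: "h \<in> lin_maps R M N" "k \<in> lin_maps R M N" using null_map_lin[OF lm(1)] h k by auto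
    have eqx: "h (x i) = k (x i)" if "i < l" for i using fun_cong[OF k(2), of i] that by (simp add: tup_def)
    show ?thesis
    proof (rule null_map_cong[OF k(1)])
      fix y assume "y \<in> carrier M"
      then obtain z where z: "z \<in> carrier (free R l)" "y = g z" using g(2) by (metis imageE)
      have cong: "(\<And>i. i < m \<Longrightarrow> u i = v i) \<Longrightarrow> comb N u m z = comb N v m z" for u v m by (induction m) auto
      have "h (g z) = comb N (\<lambda>i. h (x i)) l z"
        unfolding x_def by (rule lin_free_eq_comb[OF ring lm(2) lin_comp[OF g(1) hl(1)] z(1)])
      also have "\<dots> = comb N (\<lambda>i. k (x i)) l z" by (rule cong) (rule eqx)
      also have "\<dots> = k (g z)"
        unfolding x_def by (rule lin_free_eq_comb[OF ring lm(2) lin_comp[OF g(1) hl(2)] z(1), symmetric])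
      finally show "h y = k y" by (simp add: z)
    qed
  qed
  then show ?thesis by blast
qed

end

section \<open>The finiteness theorem\<close>

text \<open>One presentation is chosen for each module once and for all, so that the iterated
  syzygies of a fixed family are again fixed families.\<close>

definition cover :: "('r, 'x) ring_scheme \<Rightarrow> 'r fgmod \<Rightarrow> 'r fgmod \<times> ((nat \<Rightarrow> 'r) set \<Rightarrow> (nat \<Rightarrow> 'r) set)" where
  "cover R M = (SOME c. projective R (fst c) \<and> epi R (fst c) M (snd c))"

definition syz :: "('r, 'x) ring_scheme \<Rightarrow> 'r fgmod \<Rightarrow> 'r fgmod" where
  "syz R M = kern (fst (cover R M)) M (snd (cover R M))"

context fl_ring
begin

lemma cover: "fg_module R M \<Longrightarrow> projective R (fst (cover R M)) \<and> epi R (fst (cover R M)) M (snd (cover R M))"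
proof -
  assume "fg_module R M"
  then obtain P :: "'r fgmod" and f where "projective R P" "epi R P M f" using projective_cover_exists by metis
  then have "\<exists>c. projective R (fst c) \<and> epi R (fst c) M (snd c)" by (intro exI[of _ "(P, f)"]) simp
  then show ?thesis unfolding cover_def by (rule someI_ex)
qed

lemma syz_fg: "fg_module R M \<Longrightarrow> fg_module R (syz R M)"
  unfolding syz_def using cover[of M] by (intro kern_fg projective_fg) (simp_all add: epi_def)

lemma syz_pow_fg: "fg_module R M \<Longrightarrow> fg_module R ((syz R ^^ n) M)"
  by (induction n) (auto intro: syz_fg)

lemma addp_syz:
  assumes X: "\<And>j. j \<in> I \<Longrightarrow> fg_module R (X j)" and M: "addp R I X u M"
  shows "\<exists>F f. projective R F \<and> epi R F M f \<and> addp R I (\<lambda>j. syz R (X j)) u (kern F M f)"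
  unfolding syz_def by (rule addp_cover[OF X _ _ M]) (use cover X in auto)

text \<open>The projective summand \<open>G\<close> that \<open>ses_rotate\<close> puts beside the
  syzygy of \<open>N\<close> is not counted by \<open>addp\<close>, so both multiplicity vectors
  survive. The last two clauses carry bounds on the third term down to the syzygy and back.\<close>

lemma ses_syz:
  fixes L N Y :: "'r fgmod"
  assumes X: "\<And>j. j \<in> I \<Longrightarrow> fg_module R (X j)" and s: "ses R L N Y f p"
    and L: "addp R I X u L" and N: "addp R I X v N"
  shows "\<exists>L' N' Y' f' p'. ses R L' N' Y' f' p' \<and> addp R I (\<lambda>j. syz R (X j)) u L' \<and> addp R I (\<lambda>j. syz R (X j)) v N' \<and>
    (\<forall>r. pd_le R r Y \<longrightarrow> pd_le R (r - 1) Y') \<and> (\<forall>d. pd_le R d Y' \<longrightarrow> pd_le R (Suc d) Y)"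
proof -
  obtain G a where G: "projective R G" "epi R G L a" "addp R I (\<lambda>j. syz R (X j)) u (kern G L a)"
    using addp_syz[OF X L] by blast
  obtain F b where F: "projective R F" "epi R F N b" "addp R I (\<lambda>j. syz R (X j)) v (kern F N b)"
    using addp_syz[OF X N] by blast
  obtain S :: "'r fgmod" and i1 i2 p1 p2 where S: "fg_module R S" "biprod R G (kern F N b) S i1 i2 p1 p2"
    using biprod_exists[OF projective_fg[OF G(1)] addp_fg[OF F(3)]] by metis
  let ?Y = "kern F Y (\<lambda>x. p (b x))"
  obtain f' p' where s': "ses R (kern G L a) S ?Y f' p'" using ses_rotate[OF s G(1,2) F(1,2) S] by blast
  have "addp R I (\<lambda>j. syz R (X j)) (\<lambda>i. 0 + v i) S"
    by (rule addp_sum[OF _ addp.proj[OF G(1)] F(3) S]) (rule syz_fg[OF X])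
  then have N': "addp R I (\<lambda>j. syz R (X j)) v S" by simp
  have e: "epi R F Y (\<lambda>x. p (b x))" by (rule epi_comp[OF F(2) sesD(6)[OF s]])
  have "pd_le R (r - 1) ?Y" if "pd_le R r Y" for r
  proof -
    \<comment> \<open>Raising the level to \<open>Suc (r - 1)\<close> includes the case
      \<open>r = 0\<close>, where the truncated difference is 0.\<close>
    have "pd_le R (Suc (r - 1)) Y" by (rule pd_le_mono[OF that]) simp
    then show ?thesis by (rule pd_le_SucD[OF _ F(1) e])
  qed
  moreover have "pd_le R (Suc d) Y" if "pd_le R d ?Y" for d by (rule pd_le_SucI[OF sesD(3)[OF s] F(1) e that])
  ultimately show ?thesis using s' G(3) N' by blast
qed

lemma ses_syz_pow:
  fixes L N Y :: "'r fgmod"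
  assumes X: "\<And>j. j \<in> I \<Longrightarrow> fg_module R (X j)" and s: "ses R L N Y f p"
    and L: "addp R I X u L" and N: "addp R I X v N"
  shows "\<exists>L' N' Y' f' p'. ses R L' N' Y' f' p' \<and> addp R I (\<lambda>j. (syz R ^^ n) (X j)) u L' \<and> addp R I (\<lambda>j. (syz R ^^ n) (X j)) v N' \<and>
    (\<forall>r. pd_le R r Y \<longrightarrow> pd_le R (r - n) Y') \<and> (\<forall>d. pd_le R d Y' \<longrightarrow> pd_le R (d + n) Y)"
proof (induction n)
  case 0
  show ?case using s L N by (intro exI[of _ L] exI[of _ N] exI[of _ Y] exI[of _ f] exI[of _ p]) simp
next
  case (Suc n)
  then obtain L1 N1 Y1 f1 p1 where 1: "ses R L1 N1 Y1 f1 p1" "addp R I (\<lambda>j. (syz R ^^ n) (X j)) u L1" "addp R I (\<lambda>j. (syz R ^^ n) (X j)) v N1"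
    "\<And>r. pd_le R r Y \<Longrightarrow> pd_le R (r - n) Y1" "\<And>d. pd_le R d Y1 \<Longrightarrow> pd_le R (d + n) Y" by blast
  obtain L2 N2 Y2 f2 p2 where 2: "ses R L2 N2 Y2 f2 p2" "addp R I (\<lambda>j. syz R ((syz R ^^ n) (X j))) u L2" "addp R I (\<lambda>j. syz R ((syz R ^^ n) (X j))) v N2"
    "\<And>r. pd_le R r Y1 \<Longrightarrow> pd_le R (r - 1) Y2" "\<And>d. pd_le R d Y2 \<Longrightarrow> pd_le R (Suc d) Y1"
    using ses_syz[OF syz_pow_fg[OF X] 1(1-3)] by blast
  have "pd_le R (r - Suc n) Y2" if "pd_le R r Y" for r using 2(4)[OF 1(4)[OF that]] by simp
  moreover have "pd_le R (d + Suc n) Y" if "pd_le R d Y2" for d using 1(5)[OF 2(5)[OF that]] by simp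
  ultimately show ?case using 2(1-3) by (intro exI[of _ L2] exI[of _ N2] exI[of _ Y2] exI[of _ f2] exI[of _ p2]) simp
qed

lemma ses_split:
  fixes L N Y :: "'r fgmod"
  assumes s: "ses R L N Y f p" and Y: "projective R Y"
  shows "\<exists>i1 i2 p1 p2. biprod R L Y N i1 i2 p1 p2"
proof -
  note D = sesD[OF s]
  obtain t where t: "t \<in> lin_maps R Y N" "\<And>x. x \<in> carrier Y \<Longrightarrow> p (t x) = x"
    using projective_split[OF Y D(2) D(6)] by metis
  obtain v where v: "v \<in> lin_maps R (N\<lparr>carrier := {x \<in> carrier N. p x = \<zero>\<^bsub>Y\<^esub>}\<rparr>) L" "\<And>x. x \<in> carrier L \<Longrightarrow> v (f x) = x"
    using ses_inv[OF s] by blast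
  have lm [simp]: "left_module R L" "left_module R N" "left_module R Y" using D by auto
  note R = lin_rules[OF lm(1,2) D(4)] lin_rules[OF lm(2,3) D(5)] lin_rules[OF lm(3,2) t(1)] t(2) D(7)
  let ?q = "\<lambda>x. x \<oplus>\<^bsub>N\<^esub> \<ominus>\<^bsub>N\<^esub> t (p x)"
  have q: "?q \<in> lin_maps R N (N\<lparr>carrier := {x \<in> carrier N. p x = \<zero>\<^bsub>Y\<^esub>}\<rparr>)"
    by (intro linI) (simp_all add: R lm_ac lm_distr)
  have vq: "(\<lambda>x. v (?q x)) \<in> lin_maps R N L" using lin_comp[OF q v(1)] .
  have fv: "f (v (?q x)) = ?q x" if x: "x \<in> carrier N" for x
  proof -
    have "?q x \<in> carrier N" "p (?q x) = \<zero>\<^bsub>Y\<^esub>" using x by (simp_all add: R)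
    then obtain y where "y \<in> carrier L" "f y = ?q x" using D(10) by blast
    then show ?thesis using v(2) by metis
  qed
  have v0: "v \<zero>\<^bsub>N\<^esub> = \<zero>\<^bsub>L\<^esub>" using v(2)[of "\<zero>\<^bsub>L\<^esub>"] by (simp add: R)
  have "biprod R L Y N f t (\<lambda>x. v (?q x)) p"
    unfolding biprod_def using D(4,5) t(1) vq by (simp add: R fv v(2) v0 lm_ac)
  then show ?thesis by blast
qed

text \<open>Two descriptions of one module yield two presentations with possibly different kernels.
  By Schanuel's lemma these kernels agree after adding projectives, which \<open>addp\<close> does
  not count; so a relation between two vectors, once visible, remains visible on all further
  syzygies.\<close>

lemma addp_common_syz:
  assumes X: "\<And>j. j \<in> I \<Longrightarrow> fg_module R (X j)" and u: "addp R I X u M" and v: "addp R I X v M"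
  shows "\<exists>E. addp R I (\<lambda>j. syz R (X j)) u E \<and> addp R I (\<lambda>j. syz R (X j)) v E"
proof -
  obtain F f where F: "projective R F" "epi R F M f" "addp R I (\<lambda>j. syz R (X j)) u (kern F M f)"
    using addp_syz[OF X u] by blast
  obtain G g where G: "projective R G" "epi R G M g" "addp R I (\<lambda>j. syz R (X j)) v (kern G M g)"
    using addp_syz[OF X v] by blast
  obtain E :: "'r fgmod" and i1 i2 p1 p2 k1 k2 q1 q2 where E: "fg_module R E"
    "biprod R (kern F M f) G E i1 i2 p1 p2" "biprod R (kern G M g) F E k1 k2 q1 q2"
    using schanuel[OF addp_fg[OF u] F(1,2) G(1,2)] by metis
  have "addp R I (\<lambda>j. syz R (X j)) (\<lambda>i. u i + 0) E"
    by (rule addp_sum[OF _ F(3) addp.proj[OF G(1)] E(1,2)]) (rule syz_fg[OF X])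
  moreover have "addp R I (\<lambda>j. syz R (X j)) (\<lambda>i. v i + 0) E"
    by (rule addp_sum[OF _ G(3) addp.proj[OF F(1)] E(1,3)]) (rule syz_fg[OF X])
  ultimately show ?thesis by auto
qed

lemma addp_support: "addp R I X u M \<Longrightarrow> i \<notin> I \<Longrightarrow> u i = 0"
  by (induction rule: addp.induct) auto

end

text \<open>One \<open>d\<close> serves all sequences over the family and all finite dimensions
  \<open>r\<close>. A sequence is looked at twice: at its \<open>r\<close>-th syzygy, to learn a
  relation between \<open>u\<close> and \<open>v\<close>, and at its \<open>n0\<close>-th, where
  this relation is already visible and the level no longer depends on \<open>r\<close>.\<close>

lemma (in artin_ring) finite_pd_bound:
  fixes X :: "nat \<Rightarrow> 'r fgmod"
  assumes X: "\<And>j. j < k \<Longrightarrow> fg_module R (X j)"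
  shows "\<exists>d. \<forall>u v L N Y f p r. ses R L N Y f p \<longrightarrow> addp R {..<k} X u L \<longrightarrow> addp R {..<k} X v N \<longrightarrow> pd_le R r Y \<longrightarrow> pd_le R d Y"
proof -
  let ?I = "{..<k}" and ?O = "\<lambda>n j. (syz R ^^ n) (X j)"
  have X': "\<And>j. j \<in> ?I \<Longrightarrow> fg_module R (X j)" using X by simp
  have O: "fg_module R (?O n j)" if "j \<in> ?I" for n j using syz_pow_fg[OF X'[OF that]] .
  \<comment> \<open>\<open>G n\<close> collects the relations visible at level \<open>n\<close>:
    differences of two vectors that describe the same module. It is a subgroup because a direct sum
    realises \<open>u + v'\<close> and \<open>v + u'\<close> at once.\<close>
  define G where "G n = {(\<lambda>i. int (u i) - int (v i)) | u v M. addp R ?I (?O n) u M \<and> addp R ?I (?O n) v M}" for n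
  have GI: "(\<lambda>i. int (u i) - int (v i)) \<in> G n" if "addp R ?I (?O n) u M" "addp R ?I (?O n) v M" for u v n M
    unfolding G_def using that by blast
  have "\<exists>n0. \<forall>n. G n \<subseteq> G n0"
  proof (rule int_vector_chain)
    fix n
    obtain P :: "'r fgmod" where "projective R P"
    proof -
      have fr: "fg_module R (free R 0)" using free_fg[OF ring] .
      obtain N :: "'r fgmod" and f g where N: "fg_module R N" "f \<in> lin_maps R (free R 0) N" "g \<in> lin_maps R N (free R 0)"
        "\<And>x. x \<in> carrier (free R 0) \<Longrightarrow> g (f x) = x" "\<And>x. x \<in> carrier N \<Longrightarrow> f (g x) = x" using represent[OF fr] by metis
      show ?thesis using that projective_free_retract[OF N(1,3,2,5)] by blast
    qed
    then show "(\<lambda>_. 0) \<in> G n" using GI[OF addp.proj addp.proj, of P] by simp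
    show "G n \<subseteq> G (Suc n)"
    proof
      fix w assume "w \<in> G n"
      then obtain u v M where w: "w = (\<lambda>i. int (u i) - int (v i))" "addp R ?I (?O n) u M" "addp R ?I (?O n) v M" unfolding G_def by blast
      then show "w \<in> G (Suc n)" using addp_common_syz[OF O w(2,3)] GI[of "Suc n" u _ v] by auto
    qed
    show "f i = 0" if "f \<in> G n" "k \<le> i" for f i
    proof -
      obtain u v M where f: "f = (\<lambda>i. int (u i) - int (v i))" "addp R ?I (?O n) u M" "addp R ?I (?O n) v M"
        using \<open>f \<in> G n\<close> unfolding G_def by blast
      have "i \<notin> ?I" using \<open>k \<le> i\<close> by simp
      then show ?thesis using addp_support[OF f(2)] addp_support[OF f(3)] by (simp add: f(1))
    qed
    fix f g assume "f \<in> G n" "g \<in> G n"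
    then obtain u v M u' v' M' where f: "f = (\<lambda>i. int (u i) - int (v i))" "addp R ?I (?O n) u M" "addp R ?I (?O n) v M"
      and g: "g = (\<lambda>i. int (u' i) - int (v' i))" "addp R ?I (?O n) u' M'" "addp R ?I (?O n) v' M'" unfolding G_def by blast
    obtain S :: "'r fgmod" and i1 i2 p1 p2 where S: "fg_module R S" "biprod R M M' S i1 i2 p1 p2"
      using biprod_exists[OF addp_fg[OF f(2)] addp_fg[OF g(2)]] by metis
    have "addp R ?I (?O n) (\<lambda>i. u i + v' i) S" "addp R ?I (?O n) (\<lambda>i. v i + u' i) S"
      by (rule addp_sum[OF O f(2) g(3) S], simp, rule addp_sum[OF O f(3) g(2) S], simp)
    from GI[OF this] show "(\<lambda>i. f i - g i) \<in> G n" by (simp add: f(1) g(1) algebra_simps)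
  qed
  then obtain n0 where n0: "\<And>n. G n \<subseteq> G n0" by blast
  have "\<exists>m. \<forall>n h. null_map R n (?O n0 i) (?O n0 j) h \<longrightarrow> null_map R m (?O n0 i) (?O n0 j) h" if "i < k" "j < k" for i j
    using null_map_stable[OF O[of i n0] O[of j n0]] that by simp
  then obtain m where m: "\<And>i j n h. i < k \<Longrightarrow> j < k \<Longrightarrow> null_map R n (?O n0 i) (?O n0 j) h \<Longrightarrow> null_map R (m i j) (?O n0 i) (?O n0 j) h"
    by metis
  \<comment> \<open>The inserted 0 keeps the maximum meaningful for an empty family.\<close>
  define n1 where "n1 = Max (insert 0 ((\<lambda>(i, j). m i j) ` (?I \<times> ?I)))"
  have "m i j \<le> n1" if "i < k" "j < k" for i j unfolding n1_def using that by (intro Max_ge) auto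
  then have U: "null_map R n1 (?O n0 i) (?O n0 j) h" if "i \<in> ?I" "j \<in> ?I" "null_map R n (?O n0 i) (?O n0 j) h" for i j n h
    using null_map_mono[OF m[of i j n h]] that by simp
  \<comment> \<open>In the bound \<open>Suc n1 + n0\<close>, the summand \<open>n0\<close> undoes
    the passage to syzygies, \<open>n1\<close> is the common level of null maps on the family there,
    and the successor comes from \<open>pd_le_of_quasi_inverse\<close>.\<close>
  show ?thesis
  proof (intro exI[of _ "Suc n1 + n0"] allI impI)
    fix u v :: "nat \<Rightarrow> nat" and L N Y :: "'r fgmod" and f p r
    assume s: "ses R L N Y f p" and L: "addp R ?I X u L" and N: "addp R ?I X v N" and Y: "pd_le R r Y"
    \<comment> \<open>After \<open>r\<close> steps the third term is projective and the sequence
      splits; so \<open>N1\<close> is described by \<open>u\<close> as well as by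
      \<open>v\<close>.\<close>
    obtain L1 N1 Y1 f1 p1 where 1: "ses R L1 N1 Y1 f1 p1" "addp R ?I (?O r) u L1" "addp R ?I (?O r) v N1" "pd_le R (r - r) Y1"
      using ses_syz_pow[OF X' s L N, of r] Y by blast
    have p1: "projective R Y1" using 1(4) by simp
    note D1 = sesD[OF 1(1)]
    have "\<exists>i1 i2 q1 q2. biprod R L1 Y1 N1 i1 i2 q1 q2"
      by (rule ses_split[OF 1(1) p1])
    then obtain i1 i2 q1 q2 where b: "biprod R L1 Y1 N1 i1 i2 q1 q2" by blast
    have "addp R ?I (?O r) (\<lambda>i. u i + 0) N1" by (rule addp_sum[OF O 1(2) addp.proj[OF p1] D1(2) b]) simp
    then have "(\<lambda>i. int (u i) - int (v i)) \<in> G r" using GI[of r u N1 v] 1(3) by simp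
    then have "(\<lambda>i. int (u i) - int (v i)) \<in> G n0" using n0 by blast
    then obtain u' v' M where M: "(\<lambda>i. int (u i) - int (v i)) = (\<lambda>i. int (u' i) - int (v' i))" "addp R ?I (?O n0) u' M" "addp R ?I (?O n0) v' M"
      unfolding G_def by blast
    have uv: "(\<lambda>i. u i + v' i) = (\<lambda>i. v i + u' i)"
    proof
      fix i show "u i + v' i = v i + u' i" using fun_cong[OF M(1), of i] by linarith
    qed
    obtain L2 N2 Y2 f2 p2 where 2: "ses R L2 N2 Y2 f2 p2" "addp R ?I (?O n0) u L2" "addp R ?I (?O n0) v N2" "pd_le R (r - n0) Y2"
      and bk: "\<And>d. pd_le R d Y2 \<Longrightarrow> pd_le R (d + n0) Y"
      using ses_syz_pow[OF X' s L N, of n0] Y by blast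
    note D2 = sesD[OF 2(1)]
    note fM = addp_fg[OF M(2)]
    obtain S :: "'r fgmod" and i1 i2 q1 q2 where S: "fg_module R S" "biprod R L2 M S i1 i2 q1 q2"
      using biprod_exists[OF D2(1) fM] by metis
    obtain S' :: "'r fgmod" and k1 k2 r1 r2 where S': "fg_module R S'" "biprod R N2 M S' k1 k2 r1 r2"
      using biprod_exists[OF D2(2) fM] by metis
    \<comment> \<open>\<open>M\<close> is counted with \<open>v'\<close> beside \<open>L2\<close>
      and with \<open>u'\<close> beside \<open>N2\<close>; since \<open>u + v' = v + u'\<close>,
      both sums have the same vector.\<close>
    have aS: "addp R ?I (?O n0) (\<lambda>i. u i + v' i) S" by (rule addp_sum[OF O 2(2) M(3) S]) simp
    have aS': "addp R ?I (?O n0) (\<lambda>i. u i + v' i) S'" unfolding uv by (rule addp_sum[OF O 2(3) M(2) S']) simp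
    have "pd_le R (Suc n1) Y2"
    proof (rule pd_le_of_stab_iso[OF ses_add[OF 2(1) fM S S'] 2(4)])
      show "stab_iso S' S" by (rule addp_stab_iso[OF O aS' aS])
      show "null_map R n1 S S h" if "null_map R m S S h" for m h by (rule addp_null_map[OF O U aS aS that])
      show "null_map R n1 S' S' h" if "null_map R m S' S' h" for m h by (rule addp_null_map[OF O U aS' aS' that])
    qed
    then show "pd_le R (Suc n1 + n0) Y" by (rule bk)
  qed
qed

section \<open>Projective resolutions\<close>

context fl_ring
begin

text \<open>Cutting off \<open>P 0\<close> leaves a shorter resolution of the kernel of
  \<open>d 0\<close>.\<close>

lemma proj_resolution_pd_le:
  fixes M :: "'r fgmod"
  assumes "fg_module R M" "proj_resolution R M n P d" shows "pd_le R n M"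
  using assms
proof (induction n arbitrary: M P d)
  case 0
  have P: "projective R (P 0)" "d 0 \<in> lin_maps R (P 0) M" "d 0 ` carrier (P 0) = carrier M" "inj_on (d 0) (carrier (P 0))"
    using 0(2) by (auto simp: proj_resolution_def)
  have lP: "left_module R (P 0)" using projective_fg[OF P(1)] by simp
  have "inv_into (carrier (P 0)) (d 0) \<in> lin_maps R (M\<lparr>carrier := carrier M\<rparr>) (P 0)"
    using lin_inv_into[OF lP P(2,4) refl] P(3) by simp
  then have i: "inv_into (carrier (P 0)) (d 0) \<in> lin_maps R M (P 0)" by (simp add: lin_maps_def)
  have "projective R M"
    by (rule projective_retract[OF P(1) 0(1) i P(2)]) (rule f_inv_into_f, simp add: P(3))
  then show ?case by simp
next
  case (Suc n)
  note r = Suc.prems(2)[unfolded proj_resolution_def]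
  have P: "projective R (P 0)" "epi R (P 0) M (d 0)" using r by (auto simp: epi_def)
  let ?K = "kern (P 0) M (d 0)"
  have K: "fg_module R ?K"
    using kern_fg[OF projective_fg[OF P(1)] fg_lm[OF Suc.prems(1)]] P(2) by (simp add: epi_def)
  have e: "d (Suc i) ` carrier (P (Suc i)) = {x \<in> carrier (P i). d i x = \<zero>\<^bsub>case_nat M P i\<^esub>}" if "i < Suc n" for i
    using r that by (auto simp: a_kernel_def')
  \<comment> \<open>\<open>a_kernel\<close> sees its target only through the zero element, which
    \<open>?K\<close> shares with \<open>P 0\<close>; this lets the shifted resolution end in
    \<open>?K\<close> without changing its kernels.\<close>
  have z: "\<zero>\<^bsub>case_nat ?K (P \<circ> Suc) i\<^esub> = \<zero>\<^bsub>case_nat M P (Suc i)\<^esub>" for i by (cases i) simp_all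
  have "proj_resolution R ?K n (P \<circ> Suc) (d \<circ> Suc)"
    unfolding proj_resolution_def
  proof (intro conjI allI impI)
    fix i assume i: "i \<le> n"
    show "projective R ((P \<circ> Suc) i)" using r i by simp
    have l: "d (Suc i) \<in> lin_maps R (P (Suc i)) (P i)" using r i by (metis Suc_le_mono old.nat.simps(5))
    show "(d \<circ> Suc) i \<in> lin_maps R ((P \<circ> Suc) i) (case_nat ?K (P \<circ> Suc) i)"
    proof (cases i)
      case 0
      have "d (Suc 0) ` carrier (P (Suc 0)) \<subseteq> carrier ?K" using e[of 0] by simp
      then show ?thesis using lin_corestrict[OF l, of "carrier ?K"] 0 by (simp add: kern_def)
    next
      case (Suc j)
      then show ?thesis using l by simp
    qed
  next
    show "(d \<circ> Suc) 0 ` carrier ((P \<circ> Suc) 0) = carrier ?K" using e[of 0] by simp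
    fix i assume "i < n"
    then show "(d \<circ> Suc) (Suc i) ` carrier ((P \<circ> Suc) (Suc i)) = a_kernel ((P \<circ> Suc) i) (case_nat ?K (P \<circ> Suc) i) ((d \<circ> Suc) i)"
      using e[of "Suc i"] by (simp add: a_kernel_def' z)
  next
    show "inj_on ((d \<circ> Suc) n) (carrier ((P \<circ> Suc) n))" using r by simp
  qed
  then have "pd_le R n ?K" by (rule Suc.IH[OF K])
  then show ?case by (rule pd_le_SucI[OF Suc.prems(1) P])
qed

lemma pd_le_proj_resolution:
  fixes M :: "'r fgmod"
  assumes "pd_le R n M" shows "\<exists>P d. proj_resolution R M n P d"
  using assms
proof (induction n arbitrary: M)
  case 0
  then show ?case using lin_id[of R M]
    by (intro exI[of _ "\<lambda>_. M"] exI[of _ "\<lambda>_ x. x"]) (simp add: proj_resolution_def id_def)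
next
  case (Suc n)
  obtain Q :: "'r fgmod" and f where Q: "projective R Q" "epi R Q M f" using projective_cover_exists[OF pd_le_fg[OF Suc.prems]] by metis
  let ?K = "kern Q M f"
  have lQ: "left_module R Q" using projective_fg[OF Q(1)] by simp
  obtain P d where r: "proj_resolution R ?K n P d" using Suc.IH[OF pd_le_SucD[OF Suc.prems Q]] by blast
  note r' = r[unfolded proj_resolution_def]
  have "proj_resolution R M (Suc n) (case_nat Q P) (case_nat f d)"
    unfolding proj_resolution_def
  proof (intro conjI allI impI)
    fix i assume i: "i \<le> Suc n"
    show "projective R (case_nat Q P i)" using r' Q i by (cases i) auto
    show "case_nat f d i \<in> lin_maps R (case_nat Q P i) (case_nat M (case_nat Q P) i)"
    proof (cases i)
      case 0 then show ?thesis using Q(2) by (simp add: epi_def)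
    next
      case (Suc j)
      then have l: "d j \<in> lin_maps R (P j) (case_nat ?K P j)" using r' i by simp
      show ?thesis
      proof (cases j)
        case 0
        then have "d 0 \<in> lin_maps R (P 0) Q" using l by (auto simp: lin_maps_def Pi_iff)
        then show ?thesis using Suc 0 by simp
      next
        case (Suc k) then show ?thesis using l \<open>i = Suc j\<close> by simp
      qed
    qed
  next
    show "case_nat f d 0 ` carrier (case_nat Q P 0) = carrier M" using Q(2) by (simp add: epi_def)
    fix i assume i: "i < Suc n"
    show "case_nat f d (Suc i) ` carrier (case_nat Q P (Suc i)) = a_kernel (case_nat Q P i) (case_nat M (case_nat Q P) i) (case_nat f d i)"
    proof (cases i)
      case 0 then show ?thesis using r' by (simp add: a_kernel_def')
    next
      case (Suc j)
      have z: "\<zero>\<^bsub>case_nat ?K P j\<^esub> = \<zero>\<^bsub>case_nat Q P j\<^esub>" by (cases j) simp_all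
      have "d (Suc j) ` carrier (P (Suc j)) = a_kernel (P j) (case_nat ?K P j) (d j)" using r' i Suc by simp
      then show ?thesis using Suc by (simp add: a_kernel_def' z)
    qed
  next
    show "inj_on (case_nat f d (Suc n)) (carrier (case_nat Q P (Suc n)))" using r' by simp
  qed
  then show ?case by blast
qed

lemma fin_dim_bound:
  assumes "\<And>(M :: 'r fgmod) r. pd_le R r M \<Longrightarrow> pd_le R d M"
  shows "fin_dim R < \<infinity>"
proof -
  have "proj_dim R M \<le> enat d" if M: "fg_module R M" "proj_dim R M < \<infinity>" for M :: "'r fgmod"
  proof -
    \<comment> \<open>The infimum of the empty set is infinite, so a finite value comes from an
      actual resolution.\<close>
    have "{enat n |n. \<exists>P d. proj_resolution R M n P d} \<noteq> {}"
    proof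
      assume "{enat n |n. \<exists>P d. proj_resolution R M n P d} = {}"
      then have "proj_dim R M = \<infinity>" unfolding proj_dim_def by (simp add: Inf_enat_def)
      then show False using M(2) by simp
    qed
    then obtain n P e where "proj_resolution R M n P e" by blast
    then have "pd_le R d M" by (rule assms[OF proj_resolution_pd_le[OF M(1)]])
    then have "enat d \<in> {enat n |n. \<exists>P d. proj_resolution R M n P d}" using pd_le_proj_resolution by blast
    then show ?thesis unfolding proj_dim_def by (rule Inf_lower)
  qed
  then have "fin_dim R \<le> enat d" unfolding fin_dim_def by (intro Sup_least) blast
  then show ?thesis by (rule le_less_trans) simp
qed

end

section \<open>Commutative artinian rings have finite length\<close>

text \<open>Links the chain condition in \<open>artinian_cring\<close>, stated for ideals, with
  \<open>fin_length\<close>, stated for submodules.\<close>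

lemma (in cring) submodule_self_iff: "submodule I R (self R) \<longleftrightarrow> ideal I R"
proof -
  interpret S: left_module R "self R" by (rule self_left_module[OF ring_axioms])
  show ?thesis
  proof
    assume s: "submodule I R (self R)"
    have neg: "\<ominus> x \<in> I" if "x \<in> I" for x
    proof -
      have "x \<in> carrier R" "(\<ominus> \<one>) \<otimes> x \<in> I" using s that by (auto simp: S.submodule_iff)
      then show ?thesis by (simp add: l_minus)
    qed
    show "ideal I R"
    proof (rule idealI[OF ring_axioms])
      show "subgroup I (add_monoid R)" using s neg unfolding S.submodule_iff
        by (intro subgroup.intro) (auto simp: a_inv_def)
    next
      fix a x assume "a \<in> I" "x \<in> carrier R"
      then have "a \<in> carrier R" "x \<otimes> a \<in> I" using s by (auto simp: S.submodule_iff)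
      then show "x \<otimes> a \<in> I" "a \<otimes> x \<in> I" using \<open>x \<in> carrier R\<close> by (simp_all add: m_comm[of a x])
    qed
  next
    assume "ideal I R"
    then interpret I: ideal I R .
    show "submodule I R (self R)" unfolding S.submodule_iff
      by (auto simp: I.I_l_closed I.a_Hcarr)
  qed
qed

lemma artinian_stable:
  assumes "artinian_cring K" "\<And>n::nat. ideal (I n) K" "\<And>n. I (Suc n) \<subseteq> I n"
  shows "\<exists>n. \<forall>m\<ge>n. I m = I n"
  using assms unfolding artinian_cring_def by blast

text \<open>If no member were minimal, dependent choice would produce a strictly descending sequence
  of ideals.\<close>

lemma artinian_minimal:
  assumes "artinian_cring K" "P I0" "\<And>I. P I \<Longrightarrow> ideal I K"
  shows "\<exists>I. P I \<and> (\<forall>J. P J \<longrightarrow> J \<subseteq> I \<longrightarrow> J = I)"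
proof (rule ccontr)
  assume c: "\<not> ?thesis"
  have "\<exists>f. \<forall>n::nat. P (f n) \<and> f (Suc n) \<subset> f n"
    using assms(2) c by (intro dependent_nat_choice) blast+
  then obtain f where f: "\<And>n::nat. P (f n)" "\<And>n. f (Suc n) \<subset> f n" by blast
  then have "\<forall>n. ideal (f n) K \<and> f (Suc n) \<subseteq> f n" using assms(3) by blast
  then obtain n where "\<forall>m\<ge>n. f m = f n" using assms(1) unfolding artinian_cring_def by blast
  then have "f (Suc n) = f n" by (meson le_SucI le_refl)
  then show False using f(2)[of n] by simp
qed

text \<open>A minimal ideal \<open>I\<close> of infinite length satisfies \<open>x I = I\<close> or \<open>x I = 0\<close> for every \<open>x\<close>, so that it is
  a vector space; a subspace maximal among those avoiding a given vector has codimension one.\<close>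

lemma artinian_fin_length:
  fixes K :: "('k, 'x) ring_scheme"
  assumes "artinian_cring K" shows "fin_length K (self K)"
proof (rule ccontr)
  assume nf: "\<not> fin_length K (self K)"
  interpret K: cring K using assms by (simp add: artinian_cring_def)
  interpret S: left_module K "self K" by (rule self_left_module[OF K.ring_axioms])
  let ?P = "\<lambda>I. submodule I K (self K) \<and> \<not> fin_length K (self K\<lparr>carrier := I\<rparr>)"
  have "self K\<lparr>carrier := carrier K\<rparr> = self K" by (simp add: self_def)
  then have "\<not> fin_length K (self K\<lparr>carrier := carrier K\<rparr>)" using nf by (simp only:) simp
  then have "?P (carrier K)" using S.submodule_carrier by simp
  then obtain I where I: "?P I" and min: "\<And>J. ?P J \<Longrightarrow> J \<subseteq> I \<Longrightarrow> J = I"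
    using artinian_minimal[OF assms, of ?P "carrier K"] K.submodule_self_iff by metis
  let ?M = "self K\<lparr>carrier := I\<rparr>"
  have Isub: "submodule I K (self K)" and Inf: "\<not> fin_length K ?M" using I by auto
  have Ic: "I \<subseteq> carrier K" using Isub by (simp add: S.submodule_iff)
  interpret M: left_module K ?M by (rule S.submodule_left_module[OF Isub])
  have fl: "fin_length K (?M\<lparr>carrier := U\<rparr>)" if "submodule U K ?M" "U \<noteq> I" for U
    using min[of U] that S.submodule_sub_iff[OF Isub] by auto
  \<comment> \<open>The image and the kernel of multiplication by \<open>x\<close> are submodules of
    \<open>I\<close>. If both were proper, they would have finite length by the minimality of
    \<open>I\<close>, and then so would \<open>I\<close>.\<close>
  have dich: "(\<lambda>u. x \<otimes>\<^bsub>K\<^esub> u) ` I = I \<or> (\<forall>u\<in>I. x \<otimes>\<^bsub>K\<^esub> u = \<zero>\<^bsub>K\<^esub>)" if x: "x \<in> carrier K" for x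
  proof (rule ccontr)
    assume n: "\<not> ?thesis"
    let ?x = "\<lambda>u. x \<otimes>\<^bsub>K\<^esub> u"
    have xI: "?x u \<in> I" if "u \<in> I" for u using Isub x that by (simp add: S.submodule_iff)
    have lin: "?x \<in> lin_maps K ?M ?M"
      using xI x Ic by (intro linI) (auto simp: K.r_distr K.m_lcomm subset_iff)
    have im: "submodule (?x ` I) K ?M"
      using lin_image_submodule[OF M.left_module_axioms M.left_module_axioms lin M.submodule_carrier] by simp
    have ker: "submodule {u \<in> carrier ?M. ?x u = \<zero>\<^bsub>?M\<^esub>} K ?M"
      by (rule lin_kernel_submodule[OF M.left_module_axioms M.left_module_axioms lin])
    have lin': "?x \<in> lin_maps K ?M (?M\<lparr>carrier := ?x ` I\<rparr>)" by (rule lin_corestrict[OF lin]) simp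
    have "fin_length K ?M"
    proof (rule fin_length_ext_map[OF M.left_module_axioms M.submodule_left_module[OF im] lin'])
      show "fin_length K (?M\<lparr>carrier := ?x ` I\<rparr>)" using fl[OF im] n by simp
      have "{u \<in> carrier ?M. ?x u = \<zero>\<^bsub>?M\<^esub>} \<noteq> I" using n by auto
      then show "fin_length K (?M\<lparr>carrier := {u \<in> carrier ?M. ?x u = \<zero>\<^bsub>?M\<lparr>carrier := ?x ` I\<rparr>\<^esub>}\<rparr>)"
        using fl[OF ker] by simp
    qed
    then show False using Inf by simp
  qed
  have "I \<noteq> {\<zero>\<^bsub>K\<^esub>}" using Inf trivial_fin_length[OF M.left_module_axioms] by auto
  then obtain v where v: "v \<in> I" "v \<noteq> \<zero>\<^bsub>K\<^esub>" using Isub by (auto simp: S.submodule_iff)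
  let ?A = "{L. submodule L K ?M \<and> v \<notin> L}"
  have "{\<zero>\<^bsub>?M\<^esub>} \<in> ?A" using v M.submodule_zero by simp
  then have "\<exists>L\<in>?A. \<forall>W\<in>?A. L \<subseteq> W \<longrightarrow> W = L"
  proof (intro subset_Zorn_nonempty)
    fix C assume C: "C \<noteq> {}" "subset.chain ?A C"
    then have s: "submodule L K ?M" "v \<notin> L" if "L \<in> C" for L using that by (auto simp: subset_chain_def)
    note s' = s(1)[unfolded M.submodule_iff]
    have "submodule (\<Union>C) K ?M" unfolding M.submodule_iff
    proof (intro conjI ballI)
      show "\<Union>C \<subseteq> carrier ?M" using s' by (intro Union_least) simp
      obtain L where "L \<in> C" using C(1) by blast
      then show "\<zero>\<^bsub>?M\<^esub> \<in> \<Union>C" using s'[of L] by (intro UnionI[of L]) simp_all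
    next
      fix x y assume "x \<in> \<Union>C" "y \<in> \<Union>C"
      then obtain L where "L \<in> C" "x \<in> L" "y \<in> L" using C(2) unfolding subset_chain_def by blast
      then show "x \<oplus>\<^bsub>?M\<^esub> y \<in> \<Union>C" using s'[of L] by (intro UnionI[of L]) simp_all
    next
      fix r x assume r: "r \<in> carrier K" and "x \<in> \<Union>C"
      then obtain L where "L \<in> C" "x \<in> L" by blast
      then show "r \<odot>\<^bsub>?M\<^esub> x \<in> \<Union>C" using s'[of L] r by (intro UnionI[of L]) simp_all
    qed
    then show "\<Union>C \<in> ?A" using s(2) by blast
  qed auto
  then obtain L where L: "submodule L K ?M" "v \<notin> L" and max: "\<And>W. submodule W K ?M \<Longrightarrow> v \<notin> W \<Longrightarrow> L \<subseteq> W \<Longrightarrow> W = L" by auto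
  \<comment> \<open>A submodule \<open>W\<close> properly above \<open>L\<close> contains
    \<open>v\<close>. For \<open>w\<close> outside \<open>L\<close>, maximality of \<open>L\<close>
    gives \<open>v = l + c w\<close>, so \<open>W\<close> contains \<open>c w\<close>; it remains to
    undo the multiplication by \<open>c\<close>.\<close>
  have top: "W = I" if W: "submodule W K ?M" "L \<subseteq> W" "W \<noteq> L" for W
  proof -
    have vW: "v \<in> W" using max[OF W(1)] W by blast
    have "w \<in> W" if w: "w \<in> I" for w
    proof (cases "w \<in> L")
      case False
      let ?G = "{c \<otimes>\<^bsub>K\<^esub> w | c. c \<in> carrier K}"
      have wc: "w \<in> carrier K" using w Ic by auto
      have G: "submodule ?G K ?M" unfolding M.submodule_iff
      proof (intro conjI ballI)
        show "?G \<subseteq> carrier ?M" using w Isub by (auto simp: S.submodule_iff)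
        show "\<zero>\<^bsub>?M\<^esub> \<in> ?G" using wc by (auto intro!: exI[of _ "\<zero>\<^bsub>K\<^esub>"])
        fix x y assume "x \<in> ?G" "y \<in> ?G"
        then obtain c d where "c \<in> carrier K" "d \<in> carrier K" "x = c \<otimes>\<^bsub>K\<^esub> w" "y = d \<otimes>\<^bsub>K\<^esub> w" by blast
        then show "x \<oplus>\<^bsub>?M\<^esub> y \<in> ?G" using wc by (auto simp: K.l_distr[symmetric] simp del: K.l_distr)
      next
        fix r x assume "r \<in> carrier K" "x \<in> ?G"
        then obtain c where "c \<in> carrier K" "x = c \<otimes>\<^bsub>K\<^esub> w" by blast
        then show "r \<odot>\<^bsub>?M\<^esub> x \<in> ?G" using wc \<open>r \<in> carrier K\<close> by (auto simp: K.m_assoc[symmetric] simp del: K.m_assoc)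
      qed
      note LG = M.submodule_sum[OF L(1) G] M.set_add_le[OF L(1) G]
      have "w \<in> ?G" using wc by (auto intro!: exI[of _ "\<one>\<^bsub>K\<^esub>"])
      then have "L <+>\<^bsub>?M\<^esub> ?G \<noteq> L" using LG(3) False by blast
      then have "v \<in> L <+>\<^bsub>?M\<^esub> ?G" using max[OF LG(1)] LG(2) by blast
      then obtain l c where lc: "l \<in> L" "c \<in> carrier K" "v = l \<oplus>\<^bsub>K\<^esub> c \<otimes>\<^bsub>K\<^esub> w" by (auto simp: set_add_def')
      have lcar: "l \<in> carrier K" using lc(1) L(1) Ic by (auto simp: M.submodule_iff)
      have "c \<otimes>\<^bsub>K\<^esub> w \<noteq> \<zero>\<^bsub>K\<^esub>"
      proof
        assume "c \<otimes>\<^bsub>K\<^esub> w = \<zero>\<^bsub>K\<^esub>"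
        then have "v = l" using lc(3) lcar by simp
        then show False using lc(1) L(2) by simp
      qed
      then have "\<not> (\<forall>u\<in>I. c \<otimes>\<^bsub>K\<^esub> u = \<zero>\<^bsub>K\<^esub>)" using w by blast
      then have cI: "(\<lambda>u. c \<otimes>\<^bsub>K\<^esub> u) ` I = I" using dich[OF lc(2)] by blast
      \<comment> \<open>The ideals generated by the powers of \<open>c\<close> become constant,
        which yields \<open>c^n = c^(n+1) y\<close>. As \<open>c I = I\<close>, the element
        \<open>w\<close> lies in \<open>c^n I\<close>, and therefore
        \<open>y c w = w\<close>.\<close>
      have pid: "ideal ((\<lambda>u. c [^]\<^bsub>K\<^esub> n \<otimes>\<^bsub>K\<^esub> u) ` carrier K) K" for n :: nat
      proof -
        have "(\<lambda>u. c [^]\<^bsub>K\<^esub> n \<otimes>\<^bsub>K\<^esub> u) \<in> lin_maps K (self K) (self K)"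
          using lc(2) by (intro linI) (auto simp: K.r_distr K.m_lcomm)
        from lin_image_submodule[OF S.left_module_axioms S.left_module_axioms this S.submodule_carrier]
        show ?thesis using K.submodule_self_iff by simp
      qed
      have pdec: "(\<lambda>u. c [^]\<^bsub>K\<^esub> Suc n \<otimes>\<^bsub>K\<^esub> u) ` carrier K \<subseteq> (\<lambda>u. c [^]\<^bsub>K\<^esub> n \<otimes>\<^bsub>K\<^esub> u) ` carrier K" for n :: nat
        using lc(2) by (auto simp: K.m_assoc)
      obtain n :: nat where "\<forall>m\<ge>n. (\<lambda>u. c [^]\<^bsub>K\<^esub> m \<otimes>\<^bsub>K\<^esub> u) ` carrier K = (\<lambda>u. c [^]\<^bsub>K\<^esub> n \<otimes>\<^bsub>K\<^esub> u) ` carrier K"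
        using artinian_stable[OF assms, where I = "\<lambda>n. (\<lambda>u. c [^]\<^bsub>K\<^esub> n \<otimes>\<^bsub>K\<^esub> u) ` carrier K", OF pid pdec] by blast
      then have eq: "(\<lambda>u. c [^]\<^bsub>K\<^esub> Suc n \<otimes>\<^bsub>K\<^esub> u) ` carrier K = (\<lambda>u. c [^]\<^bsub>K\<^esub> n \<otimes>\<^bsub>K\<^esub> u) ` carrier K"
        by (meson le_SucI le_refl)
      have "c [^]\<^bsub>K\<^esub> n \<otimes>\<^bsub>K\<^esub> \<one>\<^bsub>K\<^esub> \<in> (\<lambda>u. c [^]\<^bsub>K\<^esub> Suc n \<otimes>\<^bsub>K\<^esub> u) ` carrier K" unfolding eq by blast
      then obtain y where y: "y \<in> carrier K" "c [^]\<^bsub>K\<^esub> n = c [^]\<^bsub>K\<^esub> Suc n \<otimes>\<^bsub>K\<^esub> y" using lc(2) by auto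
      have cnI: "(\<lambda>u. c [^]\<^bsub>K\<^esub> m \<otimes>\<^bsub>K\<^esub> u) ` I = I" for m :: nat
      proof (induction m)
        case 0 then show ?case using Ic by (auto simp: subset_iff image_iff)
      next
        case (Suc m)
        have "(\<lambda>u. c [^]\<^bsub>K\<^esub> Suc m \<otimes>\<^bsub>K\<^esub> u) ` I = (\<lambda>u. c [^]\<^bsub>K\<^esub> m \<otimes>\<^bsub>K\<^esub> u) ` ((\<lambda>u. c \<otimes>\<^bsub>K\<^esub> u) ` I)"
          unfolding image_image using Ic lc(2) by (intro image_cong refl) (auto simp: K.m_assoc subset_iff)
        then show ?case using Suc cI by simp
      qed
      have "w \<in> (\<lambda>u. c [^]\<^bsub>K\<^esub> n \<otimes>\<^bsub>K\<^esub> u) ` I" using cnI[of n] w by simp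
      then obtain u where u: "u \<in> I" "w = c [^]\<^bsub>K\<^esub> n \<otimes>\<^bsub>K\<^esub> u" by blast
      have uc: "u \<in> carrier K" using u Ic by auto
      have cnc: "c [^]\<^bsub>K\<^esub> n \<in> carrier K" using lc(2) by simp
      have "y \<otimes>\<^bsub>K\<^esub> (c \<otimes>\<^bsub>K\<^esub> w) = (c [^]\<^bsub>K\<^esub> Suc n \<otimes>\<^bsub>K\<^esub> y) \<otimes>\<^bsub>K\<^esub> u"
        unfolding u(2) using lc(2) y(1) uc cnc by (simp add: K.m_ac)
      also have "\<dots> = w" using y(2) u(2) by simp
      finally have yw: "y \<otimes>\<^bsub>K\<^esub> (c \<otimes>\<^bsub>K\<^esub> w) = w" .
      have nl: "\<ominus>\<^bsub>K\<^esub> l \<in> W"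
      proof -
        have lI: "l \<in> I" using lc(1) L(1) by (auto simp: M.submodule_iff)
        have "(\<ominus>\<^bsub>K\<^esub> \<one>\<^bsub>K\<^esub>) \<odot>\<^bsub>?M\<^esub> l \<in> W" using W(1,2) lc(1) by (auto simp: M.submodule_iff)
        then show ?thesis using lcar by (simp add: K.l_minus)
      qed
      have "\<ominus>\<^bsub>K\<^esub> l \<oplus>\<^bsub>K\<^esub> v \<in> W" using W(1) nl vW by (auto simp: M.submodule_iff)
      moreover have "\<ominus>\<^bsub>K\<^esub> l \<oplus>\<^bsub>K\<^esub> v = c \<otimes>\<^bsub>K\<^esub> w" using lc lcar wc by (simp add: K.r_neg1)
      ultimately have "c \<otimes>\<^bsub>K\<^esub> w \<in> W" by simp
      then have "y \<otimes>\<^bsub>K\<^esub> (c \<otimes>\<^bsub>K\<^esub> w) \<in> W" using W(1) y(1) by (auto simp: M.submodule_iff)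
      then show ?thesis using yw by simp
    qed (use W in blast)
    moreover have "W \<subseteq> I" using W(1) by (simp add: M.submodule_iff)
    ultimately show ?thesis by blast
  qed
  \<comment> \<open>Only \<open>L\<close> and \<open>I\<close> lie above \<open>L\<close>, so a
    two-valued rank serves for the quotient.\<close>
  have "fin_length K ?M"
  proof (rule fin_length_ext[OF M.left_module_axioms L(1), of "\<lambda>W. if W = L then 0 else 1"])
    have "L \<noteq> I" using L(2) v by blast
    then show "fin_length K (?M\<lparr>carrier := L\<rparr>)" using fl[OF L(1)] by simp
    fix U V assume UV: "submodule U K ?M" "submodule V K ?M" "L \<subseteq> U" "U \<subset> V"
    then have "V \<noteq> L" "V = I" using top[of V] by auto
    moreover have "U = L" using top[of U] UV \<open>V = I\<close> by blast
    ultimately show "(if U = L then 0 else 1 :: nat) < (if V = L then 0 else 1)" by simp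
  qed
  then show False using Inf by simp
qed

section \<open>From the base ring of an Artin algebra to its image in the centre\<close>

lemma module_left_module: "module K M \<Longrightarrow> left_module K M"
  by (simp add: module_def left_module_def left_module_axioms_def module_axioms_def cring_def)

text \<open>Finite length passes from \<open>K\<close> to the finitely generated module
  \<open>R\<close>. Because \<open>(k 1) x = k x\<close>, a submodule over the image of
  \<open>K\<close> in \<open>R\<close> is also a submodule over \<open>K\<close>.\<close>

lemma artin_algebra_artin_ring:
  assumes "artin_algebra K R"
  shows "artin_ring R ((\<lambda>k. k \<odot>\<^bsub>R\<^esub> \<one>\<^bsub>R\<^esub>) ` carrier K)"
proof -
  have K: "artinian_cring K" and rR: "ring R" and mR: "module K R" and fg: "fin_gen K R"
    and comm: "\<And>k x y. k \<in> carrier K \<Longrightarrow> x \<in> carrier R \<Longrightarrow> y \<in> carrier R \<Longrightarrow>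
        (k \<odot>\<^bsub>R\<^esub> x) \<otimes>\<^bsub>R\<^esub> y = k \<odot>\<^bsub>R\<^esub> (x \<otimes>\<^bsub>R\<^esub> y) \<and> x \<otimes>\<^bsub>R\<^esub> (k \<odot>\<^bsub>R\<^esub> y) = k \<odot>\<^bsub>R\<^esub> (x \<otimes>\<^bsub>R\<^esub> y)"
    using assms by (auto simp: artin_algebra_def)
  interpret R: ring R by fact
  interpret m: module K R by fact
  interpret K: fl_ring K
    by (rule fl_ring.intro[OF _ artinian_fin_length[OF K]]) (use K in \<open>simp add: artinian_cring_def cring_def\<close>)
  let ?Z = "(\<lambda>k. k \<odot>\<^bsub>R\<^esub> \<one>\<^bsub>R\<^esub>) ` carrier K"
  have lR: "left_module K R" using module_left_module[OF mR] .
  have "fg_module K R" using lR fg by (simp add: fg_module_def)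
  then have flR: "fin_length K R" using K.fg_iff by blast
  have Zc: "?Z \<subseteq> carrier R" by auto
  have sub: "subring ?Z R"
  proof (rule R.subringI[OF Zc])
    have "\<one>\<^bsub>K\<^esub> \<odot>\<^bsub>R\<^esub> \<one>\<^bsub>R\<^esub> = \<one>\<^bsub>R\<^esub>" by simp
    then show "\<one>\<^bsub>R\<^esub> \<in> ?Z" by (metis imageI m.R.one_closed)
    fix x assume "x \<in> ?Z"
    then obtain k where k: "k \<in> carrier K" "x = k \<odot>\<^bsub>R\<^esub> \<one>\<^bsub>R\<^esub>" by blast
    then show "\<ominus>\<^bsub>R\<^esub> x \<in> ?Z" by (intro image_eqI[of _ _ "\<ominus>\<^bsub>K\<^esub> k"]) (auto simp: m.smult_l_minus)
    fix y assume "y \<in> ?Z"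
    then obtain l where l: "l \<in> carrier K" "y = l \<odot>\<^bsub>R\<^esub> \<one>\<^bsub>R\<^esub>" by blast
    have "x \<otimes>\<^bsub>R\<^esub> y = k \<odot>\<^bsub>R\<^esub> (\<one>\<^bsub>R\<^esub> \<otimes>\<^bsub>R\<^esub> y)" unfolding k(2) using comm k(1) l by blast
    also have "\<dots> = (k \<otimes>\<^bsub>K\<^esub> l) \<odot>\<^bsub>R\<^esub> \<one>\<^bsub>R\<^esub>" using k(1) l by (simp add: m.smult_assoc1)
    finally show "x \<otimes>\<^bsub>R\<^esub> y \<in> ?Z" using k(1) l(1) by blast
    show "x \<oplus>\<^bsub>R\<^esub> y \<in> ?Z" using k l by (intro image_eqI[of _ _ "k \<oplus>\<^bsub>K\<^esub> l"]) (auto simp: m.smult_l_distr)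
  qed
  have "left_module (R\<lparr>carrier := ?Z\<rparr>) (self R)" by (rule left_module_subring[OF self_left_module[OF rR] sub])
  then interpret S: left_module "R\<lparr>carrier := ?Z\<rparr>" "self R" .
  interpret lR: left_module K R by fact
  have "submodule U K R" if "submodule U (R\<lparr>carrier := ?Z\<rparr>) (self R)" for U
  proof -
    have U: "U \<subseteq> carrier R" "\<zero>\<^bsub>R\<^esub> \<in> U" "\<forall>x\<in>U. \<forall>y\<in>U. x \<oplus>\<^bsub>R\<^esub> y \<in> U" "\<forall>z\<in>?Z. \<forall>x\<in>U. z \<otimes>\<^bsub>R\<^esub> x \<in> U"
      using that unfolding S.submodule_iff by simp_all
    have "k \<odot>\<^bsub>R\<^esub> x \<in> U" if k: "k \<in> carrier K" and x: "x \<in> U" for k x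
    proof -
      have "(k \<odot>\<^bsub>R\<^esub> \<one>\<^bsub>R\<^esub>) \<otimes>\<^bsub>R\<^esub> x \<in> U" using U(4) k x by blast
      moreover have "(k \<odot>\<^bsub>R\<^esub> \<one>\<^bsub>R\<^esub>) \<otimes>\<^bsub>R\<^esub> x = k \<odot>\<^bsub>R\<^esub> x" using comm[of k "\<one>\<^bsub>R\<^esub>" x] k x U(1) by auto
      ultimately show ?thesis by simp
    qed
    then show ?thesis using U(1-3) unfolding lR.submodule_iff by blast
  qed
  then have "fin_length (R\<lparr>carrier := ?Z\<rparr>) (self R)"
    using flR unfolding fin_length_def by metis
  moreover have "z \<otimes>\<^bsub>R\<^esub> r = r \<otimes>\<^bsub>R\<^esub> z" if "z \<in> ?Z" "r \<in> carrier R" for z r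
    using that comm by auto
  ultimately show ?thesis by (intro artin_ring.intro rR sub)
qed

section \<open>Projective covers\<close>

declare pow_simps [simp del]

lemma (in left_module) in_set_add_diff:
  assumes "submodule N R M" "x \<in> U" "U \<subseteq> carrier M" "z \<in> carrier M" "z \<oplus>\<^bsub>M\<^esub> \<ominus>\<^bsub>M\<^esub> x \<in> N"
  shows "z \<in> U <+>\<^bsub>M\<^esub> N"
proof -
  have x: "x \<in> carrier M" using assms by auto
  then have "x \<oplus>\<^bsub>M\<^esub> (z \<oplus>\<^bsub>M\<^esub> \<ominus>\<^bsub>M\<^esub> x) = z" using assms(4) by (metis M.a_closed M.a_comm M.a_inv_closed M.r_neg2)
  then show ?thesis unfolding set_add_def' using assms(2,5) by force
qed

context fl_ring
begin

lemma free_fin_length: "fin_length R (free R n)"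
  by (rule fin_length_pow[OF self_left_module[OF ring] fl_self])

text \<open>The image of the idempotent \<open>q\<close> is a minimal submodule \<open>U\<close> with \<open>U + N = R\<^sup>n\<close>; it is a projective cover
  of \<open>R\<^sup>n / N\<close>.\<close>

lemma free_projective_cover:
  assumes N: "submodule N R (free R n)"
  obtains q where "q \<in> lin_maps R (free R n) (free R n)" "\<And>z. z \<in> carrier (free R n) \<Longrightarrow> q (q z) = q z"
    "\<And>z. z \<in> carrier (free R n) \<Longrightarrow> q z = \<zero>\<^bsub>free R n\<^esub> \<Longrightarrow> z \<in> N"
    "\<And>W. submodule W R (free R n) \<Longrightarrow> W \<subseteq> q ` carrier (free R n) \<Longrightarrow>
       q ` carrier (free R n) \<subseteq> W <+>\<^bsub>free R n\<^esub> N \<Longrightarrow> W = q ` carrier (free R n)"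
proof -
  let ?F = "free R n"
  interpret F: left_module R ?F by (rule free_left_module[OF ring])
  have lF [simp]: "left_module R ?F" by (rule F.left_module_axioms)
  let ?P = "\<lambda>U. submodule U R ?F \<and> U <+>\<^bsub>?F\<^esub> N = carrier ?F"
  have sumc: "U <+>\<^bsub>?F\<^esub> N = carrier ?F" if "submodule U R ?F" "carrier ?F \<subseteq> U <+>\<^bsub>?F\<^esub> N" for U
    using that F.submodule_sum[OF that(1) N] by (auto simp: F.submodule_iff)
  have "?P (carrier ?F)" using sumc[OF F.submodule_carrier] F.set_add_le(1)[OF F.submodule_carrier N] F.submodule_carrier by blast
  then obtain U where U: "?P U" and min: "\<And>V. ?P V \<Longrightarrow> V \<subseteq> U \<Longrightarrow> V = U"
    using fin_length_minimal[OF free_fin_length, of ?P "carrier ?F"] by metis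
  have Us: "submodule U R ?F" and UN: "U <+>\<^bsub>?F\<^esub> N = carrier ?F" using U by auto
  have Uc: "U \<subseteq> carrier ?F" and Nc: "N \<subseteq> carrier ?F" using Us N by (auto simp: F.submodule_iff)
  let ?L = "quot ?F N" and ?c = "mcoset ?F N" and ?U = "?F\<lparr>carrier := U\<rparr>"
  note Q = F.quot_proj[OF N]
  have lL: "left_module R ?L" by (rule F.quot_left_module[OF N])
  have lU [simp]: "left_module R ?U" by (rule F.submodule_left_module[OF Us])
  note Rc = lin_rules[OF lF lL Q(1)]
  have cN: "?c z = \<zero>\<^bsub>?L\<^esub> \<longleftrightarrow> z \<in> N" if "z \<in> carrier ?F" for z using Q(3) that by auto
  have cd: "z \<oplus>\<^bsub>?F\<^esub> \<ominus>\<^bsub>?F\<^esub> y \<in> N" if "z \<in> carrier ?F" "y \<in> carrier ?F" "?c y = ?c z" for z y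
    using lin_eq_diff[OF lF lL Q(1) that(1,2)] that(3) cN[of "z \<oplus>\<^bsub>?F\<^esub> \<ominus>\<^bsub>?F\<^esub> y"] that(1,2) by simp
  have cU: "?c \<in> lin_maps R ?U ?L" by (rule lin_restrict[OF Q(1) Uc])
  have "?c ` carrier ?F \<subseteq> ?c ` carrier ?U"
  proof
    fix y assume "y \<in> ?c ` carrier ?F"
    then obtain z where z: "z \<in> carrier ?F" "y = ?c z" by blast
    then have "z \<in> U <+>\<^bsub>?F\<^esub> N" using UN by simp
    then obtain u x where ux: "u \<in> U" "x \<in> N" "z = u \<oplus>\<^bsub>?F\<^esub> x" by (auto simp: set_add_def')
    have "u \<in> carrier ?F" using ux(1) Uc by blast
    then have "?c z = ?c u" unfolding ux(3) using F.mcoset_eqI[OF N _ ux(2), of u] by simp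
    then show "y \<in> ?c ` carrier ?U" using z(2) ux(1) by simp
  qed
  \<comment> \<open>\<open>h\<close> lifts the projection modulo \<open>N\<close> through
    \<open>U\<close>. The image of \<open>U\<close> under \<open>h\<close> still supplements
    \<open>N\<close>, so minimality makes \<open>h\<close> map \<open>U\<close> onto itself, and
    finite length makes it bijective there.\<close>
  then obtain h where h: "h \<in> lin_maps R ?F ?U" "\<And>z. z \<in> carrier ?F \<Longrightarrow> ?c (h z) = ?c z"
    by (rule free_lift[OF ring lU lL Q(1) cU]) blast
  have hU: "h z \<in> U" if "z \<in> carrier ?F" for z using lin_closed[OF h(1) that] by simp
  have hF: "h \<in> lin_maps R ?F ?F" using h(1) Uc by (auto simp: lin_maps_def Pi_iff)
  have hU': "h \<in> lin_maps R ?U ?U" using h(1) Uc by (auto simp: lin_maps_def Pi_iff subset_iff)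
  have "submodule (h ` U) R ?F" by (rule lin_image_submodule[OF lF lF hF Us])
  moreover have "carrier ?F \<subseteq> h ` U <+>\<^bsub>?F\<^esub> N"
  proof
    fix z assume z: "z \<in> carrier ?F"
    then have "z \<in> U <+>\<^bsub>?F\<^esub> N" using UN by simp
    then obtain u x where ux: "u \<in> U" "x \<in> N" "z = u \<oplus>\<^bsub>?F\<^esub> x" by (auto simp: set_add_def')
    have uc: "u \<in> carrier ?F" using ux(1) Uc by blast
    have "?c z = ?c u" unfolding ux(3) using F.mcoset_eqI[OF N _ ux(2), of u] uc by simp
    then have "?c (h u) = ?c z" using h(2)[OF uc] by simp
    then have "z \<oplus>\<^bsub>?F\<^esub> \<ominus>\<^bsub>?F\<^esub> h u \<in> N" using cd[OF z, of "h u"] hU[OF uc] Uc by blast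
    then show "z \<in> h ` U <+>\<^bsub>?F\<^esub> N"
      using hU Uc ux(1) by (intro F.in_set_add_diff[OF N _ _ z, of "h u"]) auto
  qed
  ultimately have "?P (h ` U)" using sumc by blast
  moreover have "h ` U \<subseteq> U" using hU Uc by blast
  ultimately have hUU: "h ` U = U" using min by blast
  have inj: "inj_on h U"
    using fin_length_surj_inj[OF lU fin_length_sub[OF lF free_fin_length Us] hU'] hUU by simp
  define v where "v = inv_into U h"
  have v: "v \<in> lin_maps R ?U ?U" using lin_inv_into[OF lU hU', of U] inj hUU by (simp add: v_def)
  have vU: "v u \<in> U" if "u \<in> U" for u using lin_closed[OF v] that by simp
  have hv: "h (v u) = u" if "u \<in> U" for u using f_inv_into_f[of u h U] that hUU by (simp add: v_def)
  have vh: "v (h u) = u" if "u \<in> U" for u unfolding v_def using inj that by simp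
  \<comment> \<open>Correcting \<open>h\<close> by the inverse of its restriction to
    \<open>U\<close> gives a map that is the identity on \<open>U\<close>, hence an
    idempotent.\<close>
  define q where "q z = v (h z)" for z
  have qU: "q z \<in> U" if "z \<in> carrier ?F" for z unfolding q_def using vU hU that by blast
  have "q \<in> lin_maps R ?F ?U" unfolding q_def by (rule lin_comp[OF h(1) v])
  then have ql: "q \<in> lin_maps R ?F ?F" using Uc by (auto simp: lin_maps_def Pi_iff)
  have qu: "q u = u" if "u \<in> U" for u unfolding q_def using vh[OF that] .
  have qim: "q ` carrier ?F = U" using qU qu Uc by (force simp: image_iff)
  show ?thesis
  proof (rule that[OF ql])
    show "q (q z) = q z" if "z \<in> carrier ?F" for z using qu qU that by blast
    show "z \<in> N" if z: "z \<in> carrier ?F" "q z = \<zero>\<^bsub>?F\<^esub>" for z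
    proof -
      have "h z = h (q z)" unfolding q_def using hv hU[OF z(1)] by simp
      also have "\<dots> = \<zero>\<^bsub>?F\<^esub>" using z(2) lin_zero[OF lF lF hF] by simp
      finally have "?c z = ?c \<zero>\<^bsub>?F\<^esub>" using h(2)[OF z(1)] by simp
      then have "?c z = \<zero>\<^bsub>?L\<^esub>" using Rc(4) by simp
      then show ?thesis using cN[OF z(1)] by simp
    qed
    fix W assume W: "submodule W R ?F" "W \<subseteq> q ` carrier ?F" "q ` carrier ?F \<subseteq> W <+>\<^bsub>?F\<^esub> N"
    have "U <+>\<^bsub>?F\<^esub> N \<subseteq> W <+>\<^bsub>?F\<^esub> N"
      by (rule F.set_add_least[OF F.submodule_sum[OF W(1) N] _ F.set_add_le(2)[OF W(1) N]]) (use W(3) qim in simp)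
    then have "?P W" using sumc[OF W(1)] W(1) UN by simp
    then show "W = q ` carrier ?F" using min W(2) qim by simp
  qed
qed

section \<open>The Jacobson radical\<close>

lemma left_ideal_iff: "left_ideal I R \<longleftrightarrow> submodule I R (self R)"
proof -
  interpret ring R by (rule ring)
  interpret S: left_module R "self R" by (rule self_left_module[OF ring])
  have neg: "\<ominus>\<^bsub>R\<^esub> x \<in> I" if s: "submodule I R (self R)" and "x \<in> I" for x
  proof -
    have "x \<in> carrier R" "(\<ominus>\<^bsub>R\<^esub> \<one>\<^bsub>R\<^esub>) \<otimes>\<^bsub>R\<^esub> x \<in> I" using s that by (auto simp: S.submodule_iff)
    then show ?thesis by (simp add: l_minus)
  qed
  show ?thesis
  proof
    assume "left_ideal I R"
    then show "submodule I R (self R)" unfolding left_ideal_def S.submodule_iff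
      using additive_subgroup.a_subset additive_subgroup.zero_closed additive_subgroup.a_closed by fastforce
  next
    assume s: "submodule I R (self R)"
    have "additive_subgroup I R"
      using s neg[OF s] unfolding S.submodule_iff
      by (intro additive_subgroupI subgroup.intro) (auto simp: a_inv_def)
    then show "left_ideal I R" using s unfolding left_ideal_def S.submodule_iff by simp
  qed
qed

text \<open>If a maximal left ideal \<open>I\<close> missed \<open>z i\<close>, every element of the
  image of \<open>q\<close> could be corrected by a multiple of \<open>z\<close>, which lies in
  \<open>N\<close>, so as to have its \<open>i\<close>-th coordinate in \<open>I\<close>. By the
  assumption \<open>sup\<close> such elements would then make up the whole image, although
  \<open>z\<close> is not among them.\<close>

lemma superfluous_in_radical:
  assumes N: "submodule N R (free R n)" and q: "q \<in> lin_maps R (free R n) (free R n)"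
    and idem: "\<And>z. z \<in> carrier (free R n) \<Longrightarrow> q (q z) = q z"
    and sup: "\<And>W. submodule W R (free R n) \<Longrightarrow> W \<subseteq> q ` carrier (free R n) \<Longrightarrow>
       q ` carrier (free R n) \<subseteq> W <+>\<^bsub>free R n\<^esub> N \<Longrightarrow> W = q ` carrier (free R n)"
    and z: "z \<in> N" "q z = z"
  shows "z i \<in> jacobson_radical R"
proof -
  let ?F = "free R n"
  interpret ring R by (rule ring)
  interpret S: left_module R "self R" by (rule self_left_module[OF ring])
  interpret F: left_module R ?F by (rule free_left_module[OF ring])
  have zF: "z \<in> carrier ?F" using N z by (auto simp: F.submodule_iff)
  have zi: "z i \<in> carrier R" using S.carrier_powD[OF zF] by simp
  have coord: "(\<lambda>u. u i) \<in> lin_maps R ?F (self R)"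
    by (intro linI) (simp_all add: S.carrier_powD[simplified] pow_simps)
  have "z i \<in> I" if I: "maximal_left_ideal I R" for I
  proof (rule ccontr)
    assume nz: "z i \<notin> I"
    have Is: "submodule I R (self R)" using I by (simp add: maximal_left_ideal_def left_ideal_iff)
    let ?G = "{b \<otimes>\<^bsub>R\<^esub> z i | b. b \<in> carrier R}"
    have mul: "(\<lambda>b. b \<otimes>\<^bsub>R\<^esub> z i) \<in> lin_maps R (self R) (self R)"
      using zi by (intro linI) (simp_all add: l_distr m_assoc)
    have G: "submodule ?G R (self R)"
      using lin_image_submodule[OF S.left_module_axioms S.left_module_axioms mul S.submodule_carrier] by (simp add: Setcompr_eq_image)
    have "\<one>\<^bsub>R\<^esub> \<otimes>\<^bsub>R\<^esub> z i \<in> ?G" by blast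
    then have zG: "z i \<in> ?G" using zi by simp
    have "I <+>\<^bsub>self R\<^esub> ?G \<noteq> I" using zG nz S.set_add_le(2)[OF Is G] by blast
    then have IG: "I <+>\<^bsub>self R\<^esub> ?G = carrier R"
      using I S.submodule_sum[OF Is G] S.set_add_le(1)[OF Is G] unfolding maximal_left_ideal_def left_ideal_iff by blast
    let ?U = "q ` carrier ?F"
    have Us: "submodule ?U R ?F" by (rule lin_image_submodule[OF F.left_module_axioms F.left_module_axioms q F.submodule_carrier])
    let ?W = "?U \<inter> {u \<in> carrier ?F. u i \<in> I}"
    have W: "submodule ?W R ?F"
      by (rule F.submodule_Int[OF Us lin_vimage_submodule[OF F.left_module_axioms S.left_module_axioms coord Is]])
    have zU: "z \<in> ?U" using z(2) zF by (metis imageI)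
    have "?U \<subseteq> ?W <+>\<^bsub>?F\<^esub> N"
    proof
      fix u assume u: "u \<in> ?U"
      then have uF: "u \<in> carrier ?F" using Us by (auto simp: F.submodule_iff)
      have ui: "u i \<in> carrier R" using S.carrier_powD[OF uF] by simp
      then have "u i \<in> I <+>\<^bsub>self R\<^esub> ?G" using IG by simp
      then obtain x b where xb: "x \<in> I" "b \<in> carrier R" "u i = x \<oplus>\<^bsub>R\<^esub> b \<otimes>\<^bsub>R\<^esub> z i" by (auto simp: set_add_def')
      have xc: "x \<in> carrier R" using xb(1) Is by (auto simp: S.submodule_iff)
      let ?y = "b \<odot>\<^bsub>?F\<^esub> z"
      have yN: "?y \<in> N" using N z(1) xb(2) unfolding F.submodule_iff by blast
      have yU: "?y \<in> ?U" using Us zU xb(2) unfolding F.submodule_iff by blast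
      have yF: "?y \<in> carrier ?F" using F.smult_closed[OF xb(2) zF] .
      let ?w = "u \<oplus>\<^bsub>?F\<^esub> (\<ominus>\<^bsub>R\<^esub> \<one>\<^bsub>R\<^esub>) \<odot>\<^bsub>?F\<^esub> ?y"
      have m1: "\<ominus>\<^bsub>R\<^esub> \<one>\<^bsub>R\<^esub> \<in> carrier R" by simp
      have "(\<ominus>\<^bsub>R\<^esub> \<one>\<^bsub>R\<^esub>) \<odot>\<^bsub>?F\<^esub> ?y \<in> ?U" using Us yU m1 unfolding F.submodule_iff by blast
      then have wU: "?w \<in> ?U" using Us u unfolding F.submodule_iff by blast
      have wi: "?w i = x"
        using xb xc zi by (simp add: l_minus a_assoc r_neg pow_simps)
      have wF: "?w \<in> carrier ?F" using F.smult_closed[OF m1 yF] uF F.M.a_closed by blast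
      have "?w \<in> ?W" using wU wi wF xb(1) by simp
      moreover have "?w \<oplus>\<^bsub>?F\<^esub> ?y = u"
        using F.smult_minus_one[OF yF] uF yF F.M.a_inv_closed[OF yF] by (simp add: F.M.a_assoc F.M.l_neg)
      ultimately show "u \<in> ?W <+>\<^bsub>?F\<^esub> N" unfolding set_add_def' using yN by blast
    qed
    then have "?W = ?U" using sup[OF W] by blast
    then show False using zU nz by blast
  qed
  then show ?thesis using zi by (auto simp: jacobson_radical_def)
qed

text \<open>The point is multiplication from the right. If \<open>b\<close> is not in the maximal
  left ideal \<open>I\<close>, the elements \<open>y\<close> with \<open>y b\<close> in
  \<open>I\<close> form the annihilator of a nonzero element of the simple module of cosets of
  \<open>I\<close>, which is again a maximal left ideal.\<close>

lemma jacobson_radical_ideal: "ideal (jacobson_radical R) R"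
proof -
  interpret ring R by (rule ring)
  interpret S: left_module R "self R" by (rule self_left_module[OF ring])
  let ?J = "jacobson_radical R"
  have sub: "submodule ?J R (self R)"
    unfolding S.submodule_iff jacobson_radical_def maximal_left_ideal_def left_ideal_iff by (auto simp: S.submodule_iff)
  then have add: "additive_subgroup ?J R" using left_ideal_iff left_ideal_def by blast
  have r: "x \<otimes>\<^bsub>R\<^esub> b \<in> I" if x: "x \<in> ?J" and b: "b \<in> carrier R" and I: "maximal_left_ideal I R" for x b I
  proof (cases "b \<in> I")
    case True
    then show ?thesis using I x by (auto simp: maximal_left_ideal_def left_ideal_def jacobson_radical_def)
  next
    case False
    have Is: "submodule I R (self R)" using I by (simp add: maximal_left_ideal_def left_ideal_iff)
    have mul: "(\<lambda>y. y \<otimes>\<^bsub>R\<^esub> b) \<in> lin_maps R (self R) (self R)"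
      using b by (intro linI) (simp_all add: l_distr m_assoc)
    let ?I = "{y \<in> carrier (self R). y \<otimes>\<^bsub>R\<^esub> b \<in> I}"
    have I': "submodule ?I R (self R)" by (rule lin_vimage_submodule[OF S.left_module_axioms S.left_module_axioms mul Is])
    have "maximal_left_ideal ?I R" unfolding maximal_left_ideal_def left_ideal_iff
    proof (intro conjI allI impI)
      have "\<one>\<^bsub>R\<^esub> \<notin> ?I" using False b by simp
      then show "?I \<noteq> carrier R" by blast
      fix L assume L: "submodule L R (self R) \<and> ?I \<subseteq> L"
      show "L = ?I \<or> L = carrier R"
      proof (cases "L \<subseteq> ?I")
        case True then show ?thesis using L by blast
      next
        case False
        then obtain l where l: "l \<in> L" "l \<otimes>\<^bsub>R\<^esub> b \<notin> I" using L by (auto simp: S.submodule_iff)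
        let ?G = "(\<lambda>y. y \<otimes>\<^bsub>R\<^esub> b) ` L"
        have G: "submodule ?G R (self R)"
          using lin_image_submodule[OF S.left_module_axioms S.left_module_axioms mul] L by blast
        have "I <+>\<^bsub>self R\<^esub> ?G \<noteq> I" using l S.set_add_le(2)[OF Is G] by blast
        then have IG: "I <+>\<^bsub>self R\<^esub> ?G = carrier R"
          using I S.submodule_sum[OF Is G] S.set_add_le(1)[OF Is G] unfolding maximal_left_ideal_def left_ideal_iff by blast
        then have "b \<in> I <+>\<^bsub>self R\<^esub> ?G" using b by simp
        then obtain x y where xy: "x \<in> I" "y \<in> L" "b = x \<oplus>\<^bsub>R\<^esub> y \<otimes>\<^bsub>R\<^esub> b" by (auto simp: set_add_def')
        have c: "x \<in> carrier R" "y \<in> carrier R" using xy Is L by (auto simp: S.submodule_iff)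
        have "(\<one>\<^bsub>R\<^esub> \<oplus>\<^bsub>R\<^esub> \<ominus>\<^bsub>R\<^esub> y) \<otimes>\<^bsub>R\<^esub> b = b \<oplus>\<^bsub>R\<^esub> \<ominus>\<^bsub>R\<^esub> (y \<otimes>\<^bsub>R\<^esub> b)" using c b by (simp add: l_distr l_minus)
        also have "\<dots> = x \<oplus>\<^bsub>R\<^esub> y \<otimes>\<^bsub>R\<^esub> b \<oplus>\<^bsub>R\<^esub> \<ominus>\<^bsub>R\<^esub> (y \<otimes>\<^bsub>R\<^esub> b)" using xy(3) by simp
        also have "\<dots> = x" using c b by (simp add: a_assoc r_neg)
        finally have "\<one>\<^bsub>R\<^esub> \<oplus>\<^bsub>R\<^esub> \<ominus>\<^bsub>R\<^esub> y \<in> ?I" using c xy(1) by simp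
        then have "\<one>\<^bsub>R\<^esub> \<oplus>\<^bsub>R\<^esub> \<ominus>\<^bsub>R\<^esub> y \<in> L" using L by blast
        then have "\<one>\<^bsub>R\<^esub> \<oplus>\<^bsub>R\<^esub> \<ominus>\<^bsub>R\<^esub> y \<oplus>\<^bsub>R\<^esub> y \<in> L" using L xy(2) by (auto simp: S.submodule_iff)
        then have one: "\<one>\<^bsub>R\<^esub> \<in> L" using c by (simp add: a_assoc l_neg)
        have "r \<in> L" if "r \<in> carrier R" for r
        proof -
          have "r \<otimes>\<^bsub>R\<^esub> \<one>\<^bsub>R\<^esub> \<in> L" using L one that by (auto simp: S.submodule_iff simp del: r_one)
          then show ?thesis using that by simp
        qed
        then show ?thesis using L by (auto simp: S.submodule_iff)
      qed
    qed (fact I')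
    then have "x \<in> ?I" using x by (auto simp: jacobson_radical_def)
    then show ?thesis by simp
  qed
  have Jc: "x \<in> carrier R" if "x \<in> ?J" for x using that by (simp add: jacobson_radical_def)
  show ?thesis
  proof (rule idealI[OF ring_axioms])
    show "subgroup ?J (add_monoid R)" using add by (simp add: additive_subgroup_def)
    fix a x assume "a \<in> ?J" "x \<in> carrier R"
    then show "a \<otimes>\<^bsub>R\<^esub> x \<in> ?J" using r Jc by (simp add: jacobson_radical_def)
    show "x \<otimes>\<^bsub>R\<^esub> a \<in> ?J" using sub \<open>a \<in> ?J\<close> \<open>x \<in> carrier R\<close> by (simp add: S.submodule_iff)
  qed
qed

lemma rad_power_ideal: "ideal (rad_power R t) R"
proof -
  interpret ring R by (rule ring)
  show ?thesis by (induction t) (auto intro: oneideal ideal_prod_is_ideal jacobson_radical_ideal)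
qed

text \<open>The recursion of \<open>rad_power\<close> adds factors on the left; associativity moves
  a factor given on the right to the inside.\<close>

lemma rad_power_mult:
  assumes "r \<in> rad_power R t" "x \<in> jacobson_radical R" shows "r \<otimes>\<^bsub>R\<^esub> x \<in> rad_power R (Suc t)"
  using assms(1)
proof (induction t arbitrary: r)
  interpret ring R by (rule ring)
  interpret J: ideal "jacobson_radical R" R by (rule jacobson_radical_ideal)
  case 0
  have "r \<otimes>\<^bsub>R\<^esub> x \<in> jacobson_radical R" using J.I_l_closed[OF assms(2)] 0 by simp
  then have "(r \<otimes>\<^bsub>R\<^esub> x) \<otimes>\<^bsub>R\<^esub> \<one>\<^bsub>R\<^esub> \<in> rad_power R (Suc 0)" by (simp add: ideal_prod.prod del: r_one)
  then show ?case using 0 J.Icarr[OF assms(2)] by simp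
next
  interpret ring R by (rule ring)
  interpret J: ideal "jacobson_radical R" R by (rule jacobson_radical_ideal)
  case (Suc t)
  interpret Rt: ideal "rad_power R t" R by (rule rad_power_ideal)
  have xc: "x \<in> carrier R" using J.Icarr[OF assms(2)] .
  have "r \<in> ideal_prod R (jacobson_radical R) (rad_power R t)" using Suc.prems by simp
  then have "r \<otimes>\<^bsub>R\<^esub> x \<in> rad_power R (Suc (Suc t)) \<and> r \<in> carrier R"
  proof (induction r rule: ideal_prod.induct)
    case (prod i j)
    have "i \<otimes>\<^bsub>R\<^esub> (j \<otimes>\<^bsub>R\<^esub> x) \<in> ideal_prod R (jacobson_radical R) (rad_power R (Suc t))"
      by (rule ideal_prod.prod[OF prod(1) Suc.IH[OF prod(2)]])
    moreover have "i \<otimes>\<^bsub>R\<^esub> j \<otimes>\<^bsub>R\<^esub> x = i \<otimes>\<^bsub>R\<^esub> (j \<otimes>\<^bsub>R\<^esub> x)"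
      using m_assoc[OF J.Icarr[OF prod(1)] Rt.Icarr[OF prod(2)] xc] .
    ultimately show ?case using J.Icarr[OF prod(1)] Rt.Icarr[OF prod(2)] by simp
  next
    case (sum a b)
    have "(a \<oplus>\<^bsub>R\<^esub> b) \<otimes>\<^bsub>R\<^esub> x = a \<otimes>\<^bsub>R\<^esub> x \<oplus>\<^bsub>R\<^esub> b \<otimes>\<^bsub>R\<^esub> x" using sum.IH xc by (simp add: l_distr)
    then show ?case using sum.IH by (simp add: ideal_prod.sum)
  qed
  then show ?case ..
qed

section \<open>Torsionless modules\<close>

lemma lin_image_mod_iso:
  assumes "left_module R M" "left_module R N" "f \<in> lin_maps R M N" "inj_on f (carrier M)" "submodule U R M"
  shows "mod_iso R (M\<lparr>carrier := U\<rparr>) (N\<lparr>carrier := f ` U\<rparr>)"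
proof -
  have "U \<subseteq> carrier M" using assms(5) by (simp add: left_module.submodule_iff[OF assms(1)])
  then have "bij_betw f U (f ` U)" using assms(4) by (meson inj_on_imp_bij_betw inj_on_subset)
  moreover have "f \<in> lin_maps R (M\<lparr>carrier := U\<rparr>) (N\<lparr>carrier := f ` U\<rparr>)"
    by (rule lin_corestrict[OF lin_restrict[OF assms(3) \<open>U \<subseteq> carrier M\<close>]]) simp
  ultimately show ?thesis unfolding mod_iso_def by auto
qed

text \<open>The free module is the direct sum of the image and the kernel of \<open>q\<close>, and
  the kernel lies in \<open>N\<close>. So \<open>N\<close> decomposes accordingly, and one part is
  zero. Either \<open>N\<close> is the kernel, a summand of a free module, or \<open>q\<close> is
  the identity and the projection modulo \<open>N\<close> is already a projective cover, with syzygy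
  \<open>N\<close>.\<close>

lemma torsionless_of_submodule_free:
  fixes M :: "'r fgmod"
  assumes N: "submodule N R (free R n)" and ind: "indecomposable R (free R n\<lparr>carrier := N\<rparr>)"
    and M: "fg_module R M" "mod_iso R (free R n\<lparr>carrier := N\<rparr>) M"
  shows "torsionless R M"
proof -
  let ?F = "free R n"
  interpret F: left_module R ?F by (rule free_left_module[OF ring])
  have lF [simp]: "left_module R ?F" by (rule F.left_module_axioms)
  have Nc: "N \<subseteq> carrier ?F" using N by (simp add: F.submodule_iff)
  have lN: "left_module R (?F\<lparr>carrier := N\<rparr>)" by (rule F.submodule_left_module[OF N])
  obtain q where q: "q \<in> lin_maps R ?F ?F" "\<And>z. z \<in> carrier ?F \<Longrightarrow> q (q z) = q z"
    "\<And>z. z \<in> carrier ?F \<Longrightarrow> q z = \<zero>\<^bsub>?F\<^esub> \<Longrightarrow> z \<in> N"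
    and sup: "\<And>W. submodule W R ?F \<Longrightarrow> W \<subseteq> q ` carrier ?F \<Longrightarrow> q ` carrier ?F \<subseteq> W <+>\<^bsub>?F\<^esub> N \<Longrightarrow> W = q ` carrier ?F"
    by (rule free_projective_cover[OF N]) blast
  note Rq = lin_rules[OF lF lF q(1)]
  define V where "V = {z \<in> carrier ?F. q z = \<zero>\<^bsub>?F\<^esub>}"
  define U where "U = N \<inter> q ` carrier ?F"
  have Vs: "submodule V R ?F" unfolding V_def by (rule lin_kernel_submodule[OF lF lF q(1)])
  have qs: "submodule (q ` carrier ?F) R ?F" by (rule lin_image_submodule[OF lF lF q(1) F.submodule_carrier])
  have Us: "submodule U R ?F" unfolding U_def by (rule F.submodule_Int[OF N qs])
  have VN: "V \<subseteq> N" unfolding V_def using q(3) by blast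
  let ?d = "\<lambda>z. z \<oplus>\<^bsub>?F\<^esub> \<ominus>\<^bsub>?F\<^esub> q z"
  have dV: "?d z \<in> V" if "z \<in> carrier ?F" for z
  proof -
    have "q (?d z) = \<zero>\<^bsub>?F\<^esub>" using that Rq(2)[of z "\<ominus>\<^bsub>?F\<^esub> q z"] Rq(5)[of "q z"] Rq(1)[of z] q(2) lm_simps[OF lF] by simp
    moreover have "?d z \<in> carrier ?F" using that Rq(1)[of z] lm_simps[OF lF] by simp
    ultimately show ?thesis by (simp add: V_def)
  qed
  have zd: "z = q z \<oplus>\<^bsub>?F\<^esub> ?d z" if z: "z \<in> carrier ?F" for z
    using z Rq(1)[OF z] lm_simps[OF lF] lm_ac[OF lF] by simp
  have "internal_direct_sum R (?F\<lparr>carrier := N\<rparr>) U V"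
    unfolding internal_direct_sum_def F.submodule_sub_iff[OF N]
  proof (intro conjI)
    show "U \<inter> V = {\<zero>\<^bsub>?F\<lparr>carrier := N\<rparr>\<^esub>}"
    proof
      have "z = \<zero>\<^bsub>?F\<^esub>" if "z \<in> U" "z \<in> V" for z
      proof -
        have "z \<in> q ` carrier ?F" using that(1) by (simp add: U_def)
        then obtain y where y: "y \<in> carrier ?F" "z = q y" by (rule imageE)
        have "q z = \<zero>\<^bsub>?F\<^esub>" using that(2) by (simp add: V_def)
        then show ?thesis using q(2)[OF y(1)] y(2) by simp
      qed
      then show "U \<inter> V \<subseteq> {\<zero>\<^bsub>?F\<lparr>carrier := N\<rparr>\<^esub>}" by (intro subsetI) simp
      show "{\<zero>\<^bsub>?F\<lparr>carrier := N\<rparr>\<^esub>} \<subseteq> U \<inter> V" using Us Vs by (simp add: F.submodule_iff)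
    qed
    have "N \<subseteq> U <+>\<^bsub>?F\<^esub> V"
    proof
      fix z assume z: "z \<in> N"
      then have zF: "z \<in> carrier ?F" using Nc by blast
      have "?d z \<in> N" using dV[OF zF] VN by blast
      then have "\<ominus>\<^bsub>?F\<^esub> ?d z \<in> N" by (rule F.submodule_minus[OF N])
      then have "z \<oplus>\<^bsub>?F\<^esub> \<ominus>\<^bsub>?F\<^esub> ?d z \<in> N" using N z unfolding F.submodule_iff by blast
      moreover have "z \<oplus>\<^bsub>?F\<^esub> \<ominus>\<^bsub>?F\<^esub> ?d z = q z"
        using zF Rq(1)[OF zF] lm_simps[OF lF] lm_distr[OF lF] by simp
      ultimately have "q z \<in> U" using zF unfolding U_def by simp
      then show "z \<in> U <+>\<^bsub>?F\<^esub> V" unfolding set_add_def' using zd[OF zF] dV[OF zF] by blast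
    qed
    moreover have "U <+>\<^bsub>?F\<^esub> V \<subseteq> N" by (rule F.set_add_least[OF N _ VN]) (simp add: U_def)
    ultimately show "U <+>\<^bsub>?F\<lparr>carrier := N\<rparr>\<^esub> V = carrier (?F\<lparr>carrier := N\<rparr>)"
      by (simp add: set_add_def')
    show "submodule U R ?F" "submodule V R ?F" "V \<subseteq> N" by (rule Us Vs VN)+
    show "U \<subseteq> N" by (simp add: U_def)
  qed
  then have "U = {\<zero>\<^bsub>?F\<^esub>} \<or> V = {\<zero>\<^bsub>?F\<^esub>}" using ind by (auto simp: indecomposable_def)
  then show ?thesis
  proof
    assume U0: "U = {\<zero>\<^bsub>?F\<^esub>}"
    have NV: "N \<subseteq> V"
    proof
      fix z assume z: "z \<in> N"
      then have zF: "z \<in> carrier ?F" using Nc by blast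
      have "?d z \<in> N" using dV[OF zF] VN by blast
      then have "\<ominus>\<^bsub>?F\<^esub> ?d z \<in> N" by (rule F.submodule_minus[OF N])
      then have "z \<oplus>\<^bsub>?F\<^esub> \<ominus>\<^bsub>?F\<^esub> ?d z \<in> N" using N z unfolding F.submodule_iff by blast
      moreover have "z \<oplus>\<^bsub>?F\<^esub> \<ominus>\<^bsub>?F\<^esub> ?d z = q z"
        using zF Rq(1)[OF zF] lm_simps[OF lF] lm_distr[OF lF] by simp
      ultimately have "q z \<in> U" using zF unfolding U_def by simp
      then show "z \<in> V" using U0 zF unfolding V_def by simp
    qed
    obtain f where f: "f \<in> lin_maps R (?F\<lparr>carrier := N\<rparr>) M" "bij_betw f N (carrier M)" using M(2) by (auto simp: mod_iso_def)
    define g' where "g' = inv_into N f"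
    have g': "g' \<in> lin_maps R M (?F\<lparr>carrier := N\<rparr>)"
    proof -
      have "g' \<in> lin_maps R (M\<lparr>carrier := carrier M\<rparr>) (?F\<lparr>carrier := N\<rparr>)"
        using lin_inv_into[OF lN f(1), of "carrier M"] f(2) by (simp add: g'_def bij_betw_def)
      then show ?thesis by (simp add: lin_maps_def)
    qed
    have fg': "f (g' x) = x" if "x \<in> carrier M" for x
      using f_inv_into_f[of x f N] that f(2) by (simp add: bij_betw_def g'_def)
    have i: "g' \<in> lin_maps R M ?F" using g' Nc by (auto simp: lin_maps_def Pi_iff)
    have dl: "?d \<in> lin_maps R ?F ?F" by (rule lin_padd[OF lF lF _ lin_neg[OF lF lF q(1)]]) (use lin_id in \<open>simp add: id_def\<close>)
    have "?d \<in> lin_maps R ?F (?F\<lparr>carrier := N\<rparr>)" by (rule lin_corestrict[OF dl]) (use dV VN in blast)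
    then have r: "(\<lambda>z. f (?d z)) \<in> lin_maps R ?F M" by (rule lin_comp[OF _ f(1)])
    have "projective R M"
    proof (rule projective_free_retract[OF M(1) i r])
      fix x assume x: "x \<in> carrier M"
      have gN: "g' x \<in> N" using lin_closed[OF g' x] by simp
      then have "q (g' x) = \<zero>\<^bsub>?F\<^esub>" using NV by (auto simp: V_def)
      then have "?d (g' x) = g' x" using gN Nc lm_simps[OF lF] by (simp add: subset_iff)
      then show "f (?d (g' x)) = x" using fg'[OF x] by simp
    qed
    then show ?thesis using M(1) by (simp add: torsionless_def)
  next
    assume V0: "V = {\<zero>\<^bsub>?F\<^esub>}"
    have qz: "q z = z" if z: "z \<in> carrier ?F" for z
    proof -
      have "?d z = \<zero>\<^bsub>?F\<^esub>" using dV[OF z] V0 by blast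
      then show ?thesis using zd[OF z] Rq(1)[OF z] lm_simps[OF lF] by simp
    qed
    then have qim: "q ` carrier ?F = carrier ?F" by force
    obtain P :: "'r fgmod" and a b where P: "fg_module R P" "a \<in> lin_maps R ?F P" "b \<in> lin_maps R P ?F"
      "\<And>x. x \<in> carrier ?F \<Longrightarrow> b (a x) = x" "\<And>x. x \<in> carrier P \<Longrightarrow> a (b x) = x"
      using represent[OF free_fg[OF ring]] by metis
    have lP [simp]: "left_module R P" using P(1) by simp
    note Ra = lin_rules[OF lF lP P(2)] and Rb = lin_rules[OF lP lF P(3)]
    note Q = F.quot_proj[OF N]
    have lL: "left_module R (quot ?F N)" by (rule F.quot_left_module[OF N])
    define f where "f = (\<lambda>x. mcoset ?F N (b x))"
    have fl: "f \<in> lin_maps R P (quot ?F N)" unfolding f_def by (rule lin_comp[OF P(3) Q(1)])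
    have fim: "f ` carrier P = carrier (quot ?F N)"
    proof -
      have "b ` carrier P = carrier ?F" using Rb(1) P(4) Ra(1) by (force simp: image_iff)
      then show ?thesis unfolding f_def Q(2)[symmetric] by (simp flip: image_image)
    qed
    have ker: "a_kernel P (quot ?F N) f = a ` N"
    proof -
      have "f x = \<zero>\<^bsub>quot ?F N\<^esub> \<longleftrightarrow> b x \<in> N" if "x \<in> carrier P" for x
        unfolding f_def using Q(3) Rb(1)[OF that] by auto
      moreover have "x \<in> a ` N \<longleftrightarrow> b x \<in> N" if "x \<in> carrier P" for x
      proof
        assume "x \<in> a ` N"
        then obtain y where "y \<in> N" "x = a y" by blast
        then show "b x \<in> N" using P(4)[of y] Nc by auto
      next
        assume "b x \<in> N"
        then show "x \<in> a ` N" using P(5)[OF that] by (intro image_eqI[of _ _ "b x"]) simp_all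
      qed
      moreover have "a ` N \<subseteq> carrier P" using Ra(1) Nc by blast
      ultimately show ?thesis unfolding a_kernel_def' by blast
    qed
    have aN: "submodule (a ` N) R P" by (rule lin_image_submodule[OF lF lP P(2) N])
    have "projective R P" by (rule projective_free_retract[OF P(1,3,2,5)])
    moreover have "W = carrier P" if W: "submodule W R P" "W <+>\<^bsub>P\<^esub> a ` N = carrier P" for W
    proof -
      have bW: "submodule (b ` W) R ?F" by (rule lin_image_submodule[OF lP lF P(3) W(1)])
      have Wc: "W \<subseteq> carrier P" using W(1) by (simp add: left_module.submodule_iff[OF lP])
      have "carrier ?F \<subseteq> b ` W <+>\<^bsub>?F\<^esub> N"
      proof
        fix z assume z: "z \<in> carrier ?F"
        then have "a z \<in> W <+>\<^bsub>P\<^esub> a ` N" using W(2) Ra(1) by simp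
        then obtain w x where wx: "w \<in> W" "x \<in> N" "a z = w \<oplus>\<^bsub>P\<^esub> a x" by (auto simp: set_add_def')
        have c: "w \<in> carrier P" "x \<in> carrier ?F" using wx Wc Nc by auto
        have "z = b (w \<oplus>\<^bsub>P\<^esub> a x)" using P(4)[OF z] wx(3) by simp
        also have "\<dots> = b w \<oplus>\<^bsub>?F\<^esub> x" using Rb(2)[OF c(1) Ra(1)[OF c(2)]] P(4)[OF c(2)] by simp
        finally show "z \<in> b ` W <+>\<^bsub>?F\<^esub> N" unfolding set_add_def' using wx by blast
      qed
      then have "b ` W = carrier ?F" using sup[OF bW] bW qim by (simp add: F.submodule_iff)
      then have bx: "b x \<in> b ` W" if "x \<in> carrier P" for x using Rb(1)[OF that] by simp
      have "x \<in> W" if x: "x \<in> carrier P" for x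
      proof -
        obtain w where w: "w \<in> W" "b x = b w" using bx[OF x] by blast
        then have "x = w" using P(5)[OF x] P(5)[of w] Wc by auto
        then show ?thesis using w(1) by simp
      qed
      then show ?thesis using Wc by blast
    qed
    ultimately have pc: "projective_cover R P f (quot ?F N)"
      unfolding projective_cover_def ker using fl fim by blast
    have fgL: "fg_module R (quot ?F N)" by (rule fg_image[OF P(1) lL fl fim])
    have "inj_on a (carrier ?F)" using P(4) by (metis inj_onI)
    then have "mod_iso R (?F\<lparr>carrier := N\<rparr>) (P\<lparr>carrier := a ` N\<rparr>)"
      by (rule lin_image_mod_iso[OF lF lP P(2) _ N])
    then have iso: "mod_iso R M (P\<lparr>carrier := a ` N\<rparr>)" using mod_iso_sym[OF lN M(2)] mod_iso_trans by metis
    have lK: "left_module R (P\<lparr>carrier := a ` N\<rparr>)" by (rule left_module.submodule_left_module[OF lP aN])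
    interpret K: left_module R "P\<lparr>carrier := a ` N\<rparr>" by (rule lK)
    have ds: "internal_direct_sum R (P\<lparr>carrier := a ` N\<rparr>) (a ` N) {\<zero>\<^bsub>P\<^esub>}"
      unfolding internal_direct_sum_def
    proof (intro conjI)
      show s1: "submodule (a ` N) R (P\<lparr>carrier := a ` N\<rparr>)" using K.submodule_carrier by simp
      show s2: "submodule {\<zero>\<^bsub>P\<^esub>} R (P\<lparr>carrier := a ` N\<rparr>)" using K.submodule_zero by simp
      show "a ` N \<inter> {\<zero>\<^bsub>P\<^esub>} = {\<zero>\<^bsub>P\<lparr>carrier := a ` N\<rparr>\<^esub>}" using aN left_module.submodule_iff[OF lP] by simp
      show "a ` N <+>\<^bsub>P\<lparr>carrier := a ` N\<rparr>\<^esub> {\<zero>\<^bsub>P\<^esub>} = carrier (P\<lparr>carrier := a ` N\<rparr>)"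
        using K.set_add_le(1)[OF s1 s2] K.submodule_sum[OF s1 s2] by (intro equalityI) (simp_all add: K.submodule_iff)
    qed
    show ?thesis unfolding torsionless_def
      by (intro conjI disjI2 exI[of _ "quot ?F N"] exI[of _ P] exI[of _ f] exI[of _ "a ` N"] exI[of _ "{\<zero>\<^bsub>P\<^esub>}"])
        (use M(1) fgL pc iso ds ker in simp_all)
  qed
qed

end

section \<open>Decomposition into indecomposable summands\<close>

lemma mod_isoI:
  assumes "f \<in> lin_maps R M N" "\<And>x. x \<in> carrier M \<Longrightarrow> g (f x) = x" "\<And>y. y \<in> carrier N \<Longrightarrow> g y \<in> carrier M"
    "\<And>y. y \<in> carrier N \<Longrightarrow> f (g y) = y"
  shows "mod_iso R M N"
  unfolding mod_iso_def using assms lin_closed[OF assms(1)]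
  by (intro bexI[of _ f] bij_betw_byWitness[where f' = g]) auto

lemma mod_isoE:
  assumes "left_module R M" "mod_iso R M N"
  obtains f g where "f \<in> lin_maps R M N" "g \<in> lin_maps R N M" "\<And>x. x \<in> carrier M \<Longrightarrow> g (f x) = x" "\<And>y. y \<in> carrier N \<Longrightarrow> f (g y) = y"
proof -
  obtain f where f: "f \<in> lin_maps R M N" "inj_on f (carrier M)" "f ` carrier M = carrier N"
    using assms(2) by (auto simp: mod_iso_def bij_betw_def)
  have "inv_into (carrier M) f \<in> lin_maps R (N\<lparr>carrier := carrier N\<rparr>) M"
    using lin_inv_into[OF assms(1) f(1,2)] f(3) by simp
  then have "inv_into (carrier M) f \<in> lin_maps R N M" by (simp add: lin_maps_def)
  moreover have "f (inv_into (carrier M) f y) = y" if "y \<in> carrier N" for y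
    using f_inv_into_f[of y f "carrier M"] f(3) that by simp
  ultimately show ?thesis using that f by simp
qed

lemma indecomposable_iso:
  assumes M: "left_module R M" and N: "left_module R N" and iso: "mod_iso R M N" and ind: "indecomposable R M"
  shows "indecomposable R N"
proof -
  interpret M: left_module R M by fact
  interpret N: left_module R N by fact
  obtain f g where f: "f \<in> lin_maps R M N" and g: "g \<in> lin_maps R N M"
    and gf: "\<And>x. x \<in> carrier M \<Longrightarrow> g (f x) = x" and fg: "\<And>y. y \<in> carrier N \<Longrightarrow> f (g y) = y"
    using mod_isoE[OF M iso] by metis
  have f0: "f \<zero>\<^bsub>M\<^esub> = \<zero>\<^bsub>N\<^esub>" and g0: "g \<zero>\<^bsub>N\<^esub> = \<zero>\<^bsub>M\<^esub>" using lin_zero[OF M N f] lin_zero[OF N M g] .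
  show ?thesis unfolding indecomposable_def
  proof (intro conjI allI impI)
    show "carrier N \<noteq> {\<zero>\<^bsub>N\<^esub>}"
    proof
      assume "carrier N = {\<zero>\<^bsub>N\<^esub>}"
      then have "f x = \<zero>\<^bsub>N\<^esub>" if "x \<in> carrier M" for x using lin_closed[OF f that] by simp
      then have "x = \<zero>\<^bsub>M\<^esub>" if "x \<in> carrier M" for x using gf[OF that] g0 that by simp
      then have "carrier M = {\<zero>\<^bsub>M\<^esub>}" using M.zero_closed by blast
      then show False using ind by (simp add: indecomposable_def)
    qed
    fix U V assume "internal_direct_sum R N U V"
    then have UV: "submodule U R N" "submodule V R N" "U \<inter> V = {\<zero>\<^bsub>N\<^esub>}" "U <+>\<^bsub>N\<^esub> V = carrier N"
      by (auto simp: internal_direct_sum_def)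
    have c: "U \<subseteq> carrier N" "V \<subseteq> carrier N" using UV by (auto simp: N.submodule_iff)
    have s: "submodule (g ` U) R M" "submodule (g ` V) R M" using lin_image_submodule[OF N M g] UV by auto
    have "internal_direct_sum R M (g ` U) (g ` V)" unfolding internal_direct_sum_def
    proof (intro conjI s)
      show "g ` U \<inter> g ` V = {\<zero>\<^bsub>M\<^esub>}"
      proof (intro equalityI subsetI)
        fix x assume "x \<in> g ` U \<inter> g ` V"
        then obtain u v where uv: "u \<in> U" "v \<in> V" "x = g u" "x = g v" by blast
        then have "u \<in> carrier N" "v \<in> carrier N" "f (g u) = f (g v)" using c by auto
        then have "u = v" using fg[of u] fg[of v] by simp
        then have "u \<in> U \<inter> V" using uv by simp
        then show "x \<in> {\<zero>\<^bsub>M\<^esub>}" using UV(3) uv(3) g0 by simp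
      next
        fix x assume "x \<in> {\<zero>\<^bsub>M\<^esub>}"
        then show "x \<in> g ` U \<inter> g ` V" using s by (simp add: M.submodule_iff)
      qed
      have "carrier M \<subseteq> g ` U <+>\<^bsub>M\<^esub> g ` V"
      proof
        fix x assume x: "x \<in> carrier M"
        then have "f x \<in> U <+>\<^bsub>N\<^esub> V" using UV(4) lin_closed[OF f] by simp
        then obtain u v where uv: "u \<in> U" "v \<in> V" "f x = u \<oplus>\<^bsub>N\<^esub> v" by (auto simp: set_add_def')
        then have "x = g u \<oplus>\<^bsub>M\<^esub> g v" using gf[OF x] lin_add[OF g, of u v] c by auto
        then show "x \<in> g ` U <+>\<^bsub>M\<^esub> g ` V" unfolding set_add_def' using uv by blast
      qed
      then show "g ` U <+>\<^bsub>M\<^esub> g ` V = carrier M" using M.submodule_sum[OF s] by (auto simp: M.submodule_iff)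
    qed
    then have "g ` U = {\<zero>\<^bsub>M\<^esub>} \<or> g ` V = {\<zero>\<^bsub>M\<^esub>}" using ind by (simp add: indecomposable_def)
    moreover have "W = {\<zero>\<^bsub>N\<^esub>}" if W: "submodule W R N" "g ` W = {\<zero>\<^bsub>M\<^esub>}" for W
    proof -
      have "w = \<zero>\<^bsub>N\<^esub>" if "w \<in> W" for w
      proof -
        have "g w = \<zero>\<^bsub>M\<^esub>" using W(2) that by blast
        moreover have "w \<in> carrier N" using W(1) that by (auto simp: N.submodule_iff)
        ultimately show ?thesis using fg[of w] f0 by simp
      qed
      moreover have "\<zero>\<^bsub>N\<^esub> \<in> W" using W(1) by (simp add: N.submodule_iff)
      ultimately show ?thesis by blast
    qed
    ultimately show "U = {\<zero>\<^bsub>N\<^esub>} \<or> V = {\<zero>\<^bsub>N\<^esub>}" using UV(1,2) by blast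
  qed
qed

context fl_ring
begin

text \<open>An isomorphic copy is a biproduct with the zero module, which is projective.\<close>

lemma addp_iso:
  fixes S N :: "'r fgmod"
  assumes X: "\<And>j. j \<in> I \<Longrightarrow> fg_module R (X j)" and S: "addp R I X u S" and N: "fg_module R N" "mod_iso R S N"
  shows "addp R I X u N"
proof -
  have lm [simp]: "left_module R S" "left_module R N" using addp_fg[OF S] N by auto
  obtain f g where f: "f \<in> lin_maps R S N" and g: "g \<in> lin_maps R N S"
    and gf: "\<And>x. x \<in> carrier S \<Longrightarrow> g (f x) = x" and fg: "\<And>y. y \<in> carrier N \<Longrightarrow> f (g y) = y"
    using mod_isoE[OF lm(1) N(2)] by metis
  let ?Z = "S\<lparr>carrier := {\<zero>\<^bsub>S\<^esub>}\<rparr>"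
  have lZ: "left_module R ?Z"
    using left_module.submodule_left_module[OF lm(1) left_module.submodule_zero[OF lm(1)]] .
  have Z: "projective R ?Z" using trivial_projective[OF lZ] by simp
  note R = lin_rules[OF lm f] lin_rules[OF lm(2,1) g]
  have b: "biprod R S ?Z N f (\<lambda>x. \<zero>\<^bsub>N\<^esub>) g (\<lambda>x. \<zero>\<^bsub>S\<^esub>)"
    unfolding biprod_def using f g by (auto intro!: linI simp: R gf fg)
  have "addp R I X (\<lambda>i. u i + 0) N" by (rule addp_sum[OF X S addp.proj[OF Z] N(1) b])
  then show ?thesis by simp
qed

lemma addp_single:
  assumes "j \<in> I" "fg_module R (X j)"
  shows "\<exists>u. addp R I X u (X j)"
proof -
  have lm [simp]: "left_module R (X j)" using assms by simp
  let ?Z = "X j\<lparr>carrier := {\<zero>\<^bsub>X j\<^esub>}\<rparr>"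
  have lZ: "left_module R ?Z"
    using left_module.submodule_left_module[OF lm left_module.submodule_zero[OF lm]] .
  have Z: "projective R ?Z" using trivial_projective[OF lZ] by simp
  have "biprod R ?Z (X j) (X j) (\<lambda>x. \<zero>\<^bsub>X j\<^esub>) (\<lambda>x. x) (\<lambda>x. \<zero>\<^bsub>X j\<^esub>) (\<lambda>x. x)"
    unfolding biprod_def by (auto intro!: linI)
  then show ?thesis using addp.step[OF addp.proj[OF Z] assms(1,2)] by blast
qed

lemma addp_reindex:
  assumes "addp R I X u M" "\<And>j. j \<in> I \<Longrightarrow> e j \<in> I' \<and> X' (e j) = X j"
  shows "\<exists>u'. addp R I' X' u' M"
  using assms(1)
proof (induction u M rule: addp.induct)
  case (proj M)
  then show ?case using addp.proj by blast
next
  case (step u N j M i1 i2 p1 p2)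
  then obtain u' where u': "addp R I' X' u' N" by blast
  have "biprod R N (X' (e j)) M i1 i2 p1 p2" using step.hyps(4) assms(2)[OF step.hyps(2)] by simp
  then show ?case using addp.step[OF u' _ step.hyps(3)] assms(2)[OF step.hyps(2)] by blast
qed

text \<open>Two rings act on one additive group: the decomposition is made over \<open>S\<close>,
  while the summands are recorded over \<open>R\<close>. A minimal submodule violating the claim is
  nonzero and decomposable, and minimality then provides both of its summands.\<close>

lemma addp_decompose:
  fixes M :: "('s, 'm, 'y) module_scheme" and M' :: "('r, 'm, 'z) module_scheme" and N :: "'r fgmod"
  assumes X: "\<And>j. j \<in> I \<Longrightarrow> fg_module R (X j)"
    and M: "left_module S M" "fin_length S M" and M': "fg_module R M'"
    and eq: "carrier M' = carrier M" "\<zero>\<^bsub>M'\<^esub> = \<zero>\<^bsub>M\<^esub>" "add M' = add M"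
    and sub: "\<And>U. submodule U S M \<Longrightarrow> submodule U R M'"
    and ind: "\<And>W. submodule W S M \<Longrightarrow> indecomposable S (M\<lparr>carrier := W\<rparr>) \<Longrightarrow> \<exists>j\<in>I. mod_iso R (M'\<lparr>carrier := W\<rparr>) (X j)"
    and N: "fg_module R N" "mod_iso R M' N"
  shows "\<exists>u. addp R I X u N"
proof -
  interpret M: left_module S M by fact
  have lM': "left_module R M'" using M' by simp
  let ?Q = "\<lambda>W. \<forall>N :: 'r fgmod. fg_module R N \<longrightarrow> mod_iso R (M'\<lparr>carrier := W\<rparr>) N \<longrightarrow> (\<exists>u. addp R I X u N)"
  have "?Q W" if "submodule W S M" for W
  proof (rule ccontr)
    assume nQ: "\<not> ?Q W"
    let ?P = "\<lambda>W. submodule W S M \<and> \<not> ?Q W"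
    have "?P W" using that nQ by blast
    then obtain W where W: "?P W" and min: "\<And>V. ?P V \<Longrightarrow> V \<subseteq> W \<Longrightarrow> V = W"
      using fin_length_minimal[OF M(2), of ?P W] by metis
    then obtain N :: "'r fgmod" where N: "fg_module R N" "mod_iso R (M'\<lparr>carrier := W\<rparr>) N" "\<not> (\<exists>u. addp R I X u N)"
      by blast
    have Ws: "submodule W S M" using W by blast
    let ?W = "M'\<lparr>carrier := W\<rparr>"
    have fW: "fg_module R ?W" by (rule fg_sub[OF M' sub[OF Ws]])
    have lW [simp]: "left_module R ?W" using fW by simp
    have lN [simp]: "left_module R N" using N by simp
    obtain f g where f: "f \<in> lin_maps R ?W N" and g: "g \<in> lin_maps R N ?W"
      and gf: "\<And>x. x \<in> carrier ?W \<Longrightarrow> g (f x) = x" and fg: "\<And>y. y \<in> carrier N \<Longrightarrow> f (g y) = y"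
      using mod_isoE[OF lW N(2)] by metis
    note Rf = lin_rules[OF lW lN f, simplified] and Rg = lin_rules[OF lN lW g, simplified]
    have n0: "W \<noteq> {\<zero>\<^bsub>M\<^esub>}"
    proof
      assume W0: "W = {\<zero>\<^bsub>M\<^esub>}"
      have "y = \<zero>\<^bsub>N\<^esub>" if "y \<in> carrier N" for y
      proof -
        have "g y = \<zero>\<^bsub>M'\<^esub>" using Rg(1)[OF that] W0 eq(2) by simp
        then show ?thesis using fg[OF that] Rf(4) by simp
      qed
      then have "carrier N = {\<zero>\<^bsub>N\<^esub>}" using lm_simps(1)[OF lN] by blast
      then show False using N(3) addp.proj[OF trivial_projective[OF lN]] by blast
    qed
    show False
    proof (cases "indecomposable S (M\<lparr>carrier := W\<rparr>)")
      case True
      then obtain j where j: "j \<in> I" "mod_iso R ?W (X j)" using ind[OF Ws] by blast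
      have iso: "mod_iso R (X j) N" by (rule mod_iso_trans[OF mod_iso_sym[OF lW j(2)] N(2)])
      obtain w where w: "addp R I X w (X j)" using addp_single[where X = X, OF j(1) X[OF j(1)]] by blast
      have "addp R I X w N" by (rule addp_iso[OF X w N(1) iso])
      then show False using N(3) by blast
    next
      case False
      then obtain U V where ds: "internal_direct_sum S (M\<lparr>carrier := W\<rparr>) U V" and UV0: "U \<noteq> {\<zero>\<^bsub>M\<^esub>}" "V \<noteq> {\<zero>\<^bsub>M\<^esub>}"
        using n0 by (auto simp: indecomposable_def)
      then have UV: "submodule U S M" "submodule V S M" "U \<subseteq> W" "V \<subseteq> W" "U \<inter> V = {\<zero>\<^bsub>M\<^esub>}"
        and UVW: "\<And>w. w \<in> W \<Longrightarrow> \<exists>u\<in>U. \<exists>v\<in>V. w = u \<oplus>\<^bsub>M\<^esub> v"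
        by (auto simp: internal_direct_sum_def M.submodule_sub_iff[OF Ws] set_add_def')
      \<comment> \<open>The intersection of \<open>U\<close> and \<open>V\<close> is zero, so if one
        of them were all of \<open>W\<close>, the other would be zero.\<close>
      have "U \<noteq> W" "V \<noteq> W" using UV UV0 by blast+
      then have Q: "?Q U" "?Q V" using min[of U] min[of V] UV by blast+
      let ?U = "M'\<lparr>carrier := U\<rparr>" and ?V = "M'\<lparr>carrier := V\<rparr>"
      have fUV: "fg_module R ?U" "fg_module R ?V" by (rule fg_sub[OF M' sub[OF UV(1)]], rule fg_sub[OF M' sub[OF UV(2)]])
      obtain NU :: "'r fgmod" and a b where NU: "fg_module R NU" "a \<in> lin_maps R ?U NU" "b \<in> lin_maps R NU ?U"
        "\<And>x. x \<in> carrier ?U \<Longrightarrow> b (a x) = x" "\<And>x. x \<in> carrier NU \<Longrightarrow> a (b x) = x"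
        using represent[OF fUV(1)] by metis
      obtain NV :: "'r fgmod" and c d where NV: "fg_module R NV" "c \<in> lin_maps R ?V NV" "d \<in> lin_maps R NV ?V"
        "\<And>x. x \<in> carrier ?V \<Longrightarrow> d (c x) = x" "\<And>x. x \<in> carrier NV \<Longrightarrow> c (d x) = x"
        using represent[OF fUV(2)] by metis
      have "mod_iso R ?U NU" by (rule mod_isoI[OF NU(2,4) lin_closed[OF NU(3)] NU(5)])
      then obtain u where u: "addp R I X u NU" using Q(1) NU(1) by blast
      have "mod_iso R ?V NV" by (rule mod_isoI[OF NV(2,4) lin_closed[OF NV(3)] NV(5)])
      then obtain v where v: "addp R I X v NV" using Q(2) NV(1) by blast
      obtain T :: "'r fgmod" and i1 i2 p1 p2 where T: "fg_module R T" "biprod R NU NV T i1 i2 p1 p2"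
        using biprod_exists[OF NU(1) NV(1)] by metis
      have aT: "addp R I X (\<lambda>i. u i + v i) T" by (rule addp_sum[OF X u v T])
      note m = biprod_maps[OF T(2)]
      have lm [simp]: "left_module R ?U" "left_module R ?V" "left_module R NU" "left_module R NV" "left_module R T"
        using fUV NU(1) NV(1) T(1) by auto
      note R = lin_rules[OF lm(1,3) NU(2), simplified] lin_rules[OF lm(3,1) NU(3), simplified]
        lin_rules[OF lm(2,4) NV(2), simplified] lin_rules[OF lm(4,2) NV(3), simplified]
        lin_rules[OF lm(3,5) m(1)] lin_rules[OF lm(4,5) m(2)] lin_rules[OF lm(5,3) m(3)] lin_rules[OF lm(5,4) m(4)]
        biprod_rules(1-4)[OF T(2)]
      have bU: "(\<lambda>s. b (p1 s)) \<in> lin_maps R T ?W"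
        using lin_comp[OF m(3) NU(3)] UV(3) by (auto simp: lin_maps_def Pi_iff)
      have dV: "(\<lambda>s. d (p2 s)) \<in> lin_maps R T ?W"
        using lin_comp[OF m(4) NV(3)] UV(4) by (auto simp: lin_maps_def Pi_iff)
      have "(\<lambda>s. b (p1 s) \<oplus>\<^bsub>?W\<^esub> d (p2 s)) \<in> lin_maps R T ?W" by (rule lin_padd[OF lm(5) lW bU dV])
      then have k: "(\<lambda>s. f (b (p1 s) \<oplus>\<^bsub>?W\<^esub> d (p2 s))) \<in> lin_maps R T N" by (rule lin_comp[OF _ f])
      have "inj_on (\<lambda>s. f (b (p1 s) \<oplus>\<^bsub>?W\<^esub> d (p2 s))) (carrier T)"
      proof (rule lin_injI[OF lm(5) lN k])
        fix s assume s: "s \<in> carrier T" "f (b (p1 s) \<oplus>\<^bsub>?W\<^esub> d (p2 s)) = \<zero>\<^bsub>N\<^esub>"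
        have bd: "b (p1 s) \<in> U" "d (p2 s) \<in> V" using s(1) by (simp_all add: R)
        then have bdW: "b (p1 s) \<in> carrier ?W" "d (p2 s) \<in> carrier ?W" using UV by auto
        have "g (f (b (p1 s) \<oplus>\<^bsub>?W\<^esub> d (p2 s))) = \<zero>\<^bsub>?W\<^esub>" unfolding s(2) using lin_zero[OF lN lW g] .
        then have "b (p1 s) \<oplus>\<^bsub>?W\<^esub> d (p2 s) = \<zero>\<^bsub>?W\<^esub>" using gf[OF lm_simps(2)[OF lW bdW]] by simp
        then have bd0: "b (p1 s) \<oplus>\<^bsub>M\<^esub> d (p2 s) = \<zero>\<^bsub>M\<^esub>" using eq by simp
        have cM: "b (p1 s) \<in> carrier M" "d (p2 s) \<in> carrier M" using bd UV by (auto simp: M.submodule_iff)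
        have "b (p1 s) = \<ominus>\<^bsub>M\<^esub> d (p2 s)" using bd0 cM M.minus_equality[of "b (p1 s)" "d (p2 s)"] by simp
        then have "b (p1 s) \<in> V" using M.submodule_minus[OF UV(2) bd(2)] by simp
        then have b0: "b (p1 s) = \<zero>\<^bsub>M\<^esub>" using bd(1) UV(5) by blast
        then have d0: "d (p2 s) = \<zero>\<^bsub>M\<^esub>" using bd0 cM by simp
        have "p1 s = a (b (p1 s))" "p2 s = c (d (p2 s))" using NU(5) NV(5) s(1) by (simp_all add: R)
        then have "p1 s = \<zero>\<^bsub>NU\<^esub>" "p2 s = \<zero>\<^bsub>NV\<^esub>" using b0 d0 R(4) R(14) eq(2) by simp_all
        then have "i1 (p1 s) \<oplus>\<^bsub>T\<^esub> i2 (p2 s) = \<zero>\<^bsub>T\<^esub>" by (simp add: R)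
        then show "s = \<zero>\<^bsub>T\<^esub>" using biprod_rules(5)[OF T(2) s(1)] by simp
      qed
      moreover have "(\<lambda>s. f (b (p1 s) \<oplus>\<^bsub>?W\<^esub> d (p2 s))) ` carrier T = carrier N"
      proof (intro equalityI subsetI)
        fix y assume "y \<in> (\<lambda>s. f (b (p1 s) \<oplus>\<^bsub>?W\<^esub> d (p2 s))) ` carrier T"
        then show "y \<in> carrier N" using lin_closed[OF k] by blast
      next
        fix y assume y: "y \<in> carrier N"
        obtain x z where xz: "x \<in> U" "z \<in> V" "g y = x \<oplus>\<^bsub>M\<^esub> z" using UVW[of "g y"] Rg(1)[OF y] by blast
        let ?s = "i1 (a x) \<oplus>\<^bsub>T\<^esub> i2 (c z)"
        have s: "?s \<in> carrier T" using xz by (simp add: R)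
        have "b (p1 ?s) = x" "d (p2 ?s) = z" using xz NU(4) NV(4) by (simp_all add: R)
        then have "f (b (p1 ?s) \<oplus>\<^bsub>?W\<^esub> d (p2 ?s)) = y" using xz(3) fg[OF y] eq(3) by simp
        then show "y \<in> (\<lambda>s. f (b (p1 s) \<oplus>\<^bsub>?W\<^esub> d (p2 s))) ` carrier T" using s by (metis (no_types, lifting) imageI)
      qed
      ultimately have iso: "mod_iso R T N" unfolding mod_iso_def bij_betw_def using k by blast
      have "addp R I X (\<lambda>i. u i + v i) N" by (rule addp_iso[OF X aT N(1) iso])
      then show False using N(3) by blast
    qed
  qed
  from this[OF M.submodule_carrier] have "?Q (carrier M)" .
  moreover have "mod_iso R (M'\<lparr>carrier := carrier M\<rparr>) N"
    using N(2) eq(1)[symmetric] by (simp add: mod_iso_def lin_maps_def)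
  ultimately show ?thesis using N(1) by blast
qed

text \<open>A lift \<open>l\<close> of \<open>q\<close> to \<open>B\<close> makes \<open>f\<close>
  and \<open>l\<close> together an epimorphism from the sum of \<open>A\<close> and \<open>F\<close>
  onto \<open>B\<close>. A pair lies in its kernel only if its component in \<open>F\<close> dies in
  \<open>C\<close>. Thus \<open>B\<close> moves to the third place, and \<open>C\<close> enters
  through its syzygy.\<close>

lemma ses_pull:
  fixes A B C F S :: "'r fgmod"
  assumes s: "ses R A B C f g" and F: "projective R F" "epi R F C q" and S: "fg_module R S" "biprod R A F S i1 i2 p1 p2"
  shows "\<exists>f' g'. ses R (kern F C q) S B f' g'"
proof -
  note D = sesD[OF s]
  have ql: "q \<in> lin_maps R F C" using F by (simp add: epi_def)
  obtain l where l: "l \<in> lin_maps R F B" "\<And>x. x \<in> carrier F \<Longrightarrow> g (l x) = q x"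
    using projective_lift[OF F(1) D(2,3) ql D(6)] by metis
  let ?K = "kern F C q"
  have lm [simp]: "left_module R A" "left_module R B" "left_module R C" "left_module R F" "left_module R S"
    using D S projective_fg[OF F(1)] by auto
  have K: "fg_module R ?K" by (rule kern_fg[OF projective_fg[OF F(1)] lm(3) ql])
  note m = biprod_maps[OF S(2)]
  note R = lin_rules[OF lm(1,2) D(4)] lin_rules[OF lm(2,3) D(5)] lin_rules[OF lm(4,3) ql] lin_rules[OF lm(4,2) l(1)]
    lin_rules[OF lm(1,5) m(1)] lin_rules[OF lm(4,5) m(2)] lin_rules[OF lm(5,1) m(3)] lin_rules[OF lm(5,4) m(4)] biprod_rules(1-4)[OF S(2)] l(2)
  obtain v where v: "v \<in> lin_maps R (B\<lparr>carrier := {x \<in> carrier B. g x = \<zero>\<^bsub>C\<^esub>}\<rparr>) A" "\<And>x. x \<in> carrier A \<Longrightarrow> v (f x) = x"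
    using ses_inv[OF s] by blast
  have fv: "f (v y) = y" if y: "y \<in> carrier B" "g y = \<zero>\<^bsub>C\<^esub>" for y
  proof -
    obtain x where "x \<in> carrier A" "f x = y" using D(10)[OF y] by blast
    then show ?thesis using v(2) by metis
  qed
  let ?h = "\<lambda>s. f (p1 s) \<oplus>\<^bsub>B\<^esub> l (p2 s)"
  have hl: "?h \<in> lin_maps R S B" by (intro linI) (simp_all add: R lm_ac lm_distr)
  have "(\<lambda>x. \<ominus>\<^bsub>B\<^esub> l x) \<in> lin_maps R ?K (B\<lparr>carrier := {x \<in> carrier B. g x = \<zero>\<^bsub>C\<^esub>}\<rparr>)"
    by (intro linI) (simp_all add: R lm_distr)
  then have vl: "(\<lambda>x. v (\<ominus>\<^bsub>B\<^esub> l x)) \<in> lin_maps R ?K A" using v(1) by (rule lin_comp)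
  let ?k = "\<lambda>x. i1 (v (\<ominus>\<^bsub>B\<^esub> l x)) \<oplus>\<^bsub>S\<^esub> i2 x"
  have i2K: "i2 \<in> lin_maps R ?K S" using m(2) by (simp add: lin_maps_def Pi_iff)
  have lK: "left_module R ?K" using K by simp
  have kl: "?k \<in> lin_maps R ?K S" by (rule lin_padd[OF lK lm(5) lin_comp[OF vl m(1)] i2K])
  have vc: "v (\<ominus>\<^bsub>B\<^esub> l x) \<in> carrier A" if "x \<in> carrier ?K" for x using lin_closed[OF vl that] .
  have pk: "p1 (?k x) = v (\<ominus>\<^bsub>B\<^esub> l x)" "p2 (?k x) = x" if "x \<in> carrier ?K" for x
    using vc[OF that] that by (simp_all add: R)
  have "ses R ?K S B ?k ?h" unfolding ses_def
  proof (intro conjI)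
    show "inj_on ?k (carrier ?K)" using pk(2) by (metis (no_types, lifting) inj_onI)
    show "epi R S B ?h"
    proof (rule epiI[OF hl])
      fix y assume y: "y \<in> carrier B"
      have "g y \<in> carrier C" using y by (simp add: R)
      then obtain x where x: "x \<in> carrier F" "q x = g y" using F(2) unfolding epi_def by (metis imageE)
      let ?d = "y \<oplus>\<^bsub>B\<^esub> \<ominus>\<^bsub>B\<^esub> l x"
      have "?d \<in> carrier B" "g ?d = \<zero>\<^bsub>C\<^esub>" using x y by (simp_all add: R)
      then obtain w where w: "w \<in> carrier A" "f w = ?d" using D(10) by blast
      have "?h (i1 w \<oplus>\<^bsub>S\<^esub> i2 x) = y" using w x y by (simp add: R lm_ac)
      then show "\<exists>s\<in>carrier S. ?h s = y" using w x by (intro bexI[of _ "i1 w \<oplus>\<^bsub>S\<^esub> i2 x"]) (simp_all add: R)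
    qed
    show "?k ` carrier ?K = {s \<in> carrier S. ?h s = \<zero>\<^bsub>B\<^esub>}"
    proof (intro equalityI subsetI)
      fix s assume "s \<in> ?k ` carrier ?K"
      then obtain x where x: "x \<in> carrier ?K" "s = ?k x" by blast
      have "f (v (\<ominus>\<^bsub>B\<^esub> l x)) = \<ominus>\<^bsub>B\<^esub> l x" using x(1) by (intro fv) (simp_all add: R)
      then have "?h (?k x) = \<zero>\<^bsub>B\<^esub>" using pk[OF x(1)] x(1) by (simp add: R)
      then show "s \<in> {s \<in> carrier S. ?h s = \<zero>\<^bsub>B\<^esub>}" using x(2) lin_closed[OF kl x(1)] by simp
    next
      fix s assume "s \<in> {s \<in> carrier S. ?h s = \<zero>\<^bsub>B\<^esub>}"
      then have s: "s \<in> carrier S" "?h s = \<zero>\<^bsub>B\<^esub>" by auto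
      have c: "p1 s \<in> carrier A" "p2 s \<in> carrier F" using s(1) by (simp_all add: R)
      have "g (?h s) = \<zero>\<^bsub>C\<^esub>" unfolding s(2) by (simp add: R)
      then have K: "p2 s \<in> carrier ?K" using c D(7) by (simp add: R)
      have "l (p2 s) = \<ominus>\<^bsub>B\<^esub> f (p1 s)" by (rule lm_move[OF lm(2) _ _ s(2)]) (use c in \<open>simp_all add: R\<close>)
      then have "v (\<ominus>\<^bsub>B\<^esub> l (p2 s)) = p1 s" using v(2)[OF c(1)] c by (simp add: R)
      then have "?k (p2 s) = s" using biprod_rules(5)[OF S(2) s(1)] by simp
      then show "s \<in> ?k ` carrier ?K" using K by (metis (no_types, lifting) imageI)
    qed
  qed (use K S D kl in auto)
  then show ?thesis by blast
qed

end

section \<open>Modules over quotient rings\<close>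

text \<open>Restriction of scalars along a ring homomorphism.\<close>

definition restr :: "('r \<Rightarrow> 's) \<Rightarrow> ('s, 'm, 'y) module_scheme \<Rightarrow> ('r, 'm) module" where
  "restr \<rho> M = \<lparr>carrier = carrier M, mult = mult M, one = one M, zero = zero M, add = add M, smult = (\<lambda>r. smult M (\<rho> r))\<rparr>"

lemma restr_simps [simp]: "carrier (restr \<rho> M) = carrier M" "zero (restr \<rho> M) = zero M" "add (restr \<rho> M) = add M"
  "smult (restr \<rho> M) = (\<lambda>r. smult M (\<rho> r))"
  by (simp_all add: restr_def)

lemma restr_left_module:
  assumes "ring R" "\<rho> \<in> ring_hom R S" "left_module S M" shows "left_module R (restr \<rho> M)"
proof -
  interpret left_module S M by fact
  interpret A: ring R by fact
  have "abelian_group (restr \<rho> M)"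
  proof (rule abelian_groupI)
    fix x assume "x \<in> carrier (restr \<rho> M)"
    then show "\<exists>y\<in>carrier (restr \<rho> M). y \<oplus>\<^bsub>restr \<rho> M\<^esub> x = \<zero>\<^bsub>restr \<rho> M\<^esub>"
      by (intro bexI[of _ "\<ominus>\<^bsub>M\<^esub> x"]) (simp_all add: M.l_neg)
  qed (auto simp: M.a_ac)
  then show ?thesis using assms(2)
    by (intro left_module.intro left_module_axioms.intro A.ring_axioms)
       (auto simp: ring_hom_closed ring_hom_add ring_hom_mult ring_hom_one smult_closed smult_l_distr smult_r_distr smult_assoc1 smult_one)
qed

lemma submodule_restr_iff:
  assumes "ring R" "\<rho> \<in> ring_hom R S" "\<rho> ` carrier R = carrier S" "left_module S M"
  shows "submodule U R (restr \<rho> M) \<longleftrightarrow> submodule U S M"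
  unfolding left_module.submodule_iff[OF restr_left_module[OF assms(1,2,4)]] left_module.submodule_iff[OF assms(4)] assms(3)[symmetric]
  by simp

lemma fin_length_restr:
  assumes "ring R" "\<rho> \<in> ring_hom R S" "\<rho> ` carrier R = carrier S" "left_module S M"
  shows "fin_length R (restr \<rho> M) \<longleftrightarrow> fin_length S M"
  unfolding fin_length_def submodule_restr_iff[OF assms] ..

lemma (in fl_ring) quotient_fl_ring:
  assumes "ring S" "\<rho> \<in> ring_hom R S" "\<rho> ` carrier R = carrier S"
  shows "fl_ring S"
proof -
  have lS: "left_module S (self S)" by (rule self_left_module[OF assms(1)])
  have "\<rho> \<in> lin_maps R (self R) (restr \<rho> (self S))"
    using assms(2) by (intro linI) (auto simp: ring_hom_closed ring_hom_add ring_hom_mult)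
  then have "fin_length R (restr \<rho> (self S))"
    by (rule fin_length_image[OF self_left_module[OF ring] restr_left_module[OF ring assms(2) lS] _ _ fl_self]) (simp add: assms(3))
  then show ?thesis using fin_length_restr[OF ring assms(2,3) lS] assms(1) by (simp add: fl_ring_def)
qed

lemma (in ideal) rcos_surj: "(\<lambda>r. I +> r) ` carrier R = carrier (R Quot I)"
  by (auto simp: FactRing_simps)

text \<open>Scalars are cosets and act through a chosen representative; on modules annihilated by
  \<open>I\<close> the choice does not matter, by \<open>factm_smult\<close>.\<close>

definition factm :: "('r, 'x) ring_scheme \<Rightarrow> 'r set \<Rightarrow> ('r, 'm, 'y) module_scheme \<Rightarrow> ('r set, 'm) module" where
  "factm R I M = \<lparr>carrier = carrier M, mult = mult M, one = one M, zero = zero M, add = add M,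
     smult = (\<lambda>c. smult M (SOME r. r \<in> carrier R \<and> c = I +>\<^bsub>R\<^esub> r))\<rparr>"

lemma factm_simps [simp]: "carrier (factm R I M) = carrier M" "zero (factm R I M) = zero M" "add (factm R I M) = add M"
  by (simp_all add: factm_def)

lemma factm_smult:
  assumes I: "ideal I R" and M: "left_module R M" and ann: "\<And>r x. r \<in> I \<Longrightarrow> x \<in> carrier M \<Longrightarrow> r \<odot>\<^bsub>M\<^esub> x = \<zero>\<^bsub>M\<^esub>"
    and r: "r \<in> carrier R" and x: "x \<in> carrier M"
  shows "(I +>\<^bsub>R\<^esub> r) \<odot>\<^bsub>factm R I M\<^esub> x = r \<odot>\<^bsub>M\<^esub> x"
proof -
  interpret ideal I R by fact
  interpret M: left_module R M by fact
  define t where "t = (SOME t. t \<in> carrier R \<and> I +>\<^bsub>R\<^esub> r = I +>\<^bsub>R\<^esub> t)"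
  have t: "t \<in> carrier R" "I +>\<^bsub>R\<^esub> r = I +>\<^bsub>R\<^esub> t"
    using someI[of "\<lambda>t. t \<in> carrier R \<and> I +>\<^bsub>R\<^esub> r = I +>\<^bsub>R\<^esub> t" r] r unfolding t_def by auto
  have "t \<in> I +>\<^bsub>R\<^esub> r" unfolding t(2) by (rule a_rcos_self[OF t(1)])
  then obtain h where h: "h \<in> I" "t = h \<oplus>\<^bsub>R\<^esub> r" by (auto simp: a_r_coset_def')
  have "h \<in> carrier R" using h(1) by (rule Icarr)
  then have "t \<odot>\<^bsub>M\<^esub> x = r \<odot>\<^bsub>M\<^esub> x" unfolding h(2) using r x ann[OF h(1) x] by (simp add: M.smult_l_distr M.smult_closed)
  then show ?thesis unfolding t_def by (simp add: factm_def)
qed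

lemma factm_left_module:
  assumes I: "ideal I R" and M: "left_module R M" and ann: "\<And>r x. r \<in> I \<Longrightarrow> x \<in> carrier M \<Longrightarrow> r \<odot>\<^bsub>M\<^esub> x = \<zero>\<^bsub>M\<^esub>"
  shows "left_module (R Quot I) (factm R I M)"
proof -
  interpret ideal I R by fact
  interpret M: left_module R M by fact
  interpret Q: ring "R Quot I" by (rule quotient_is_ring)
  note sm = factm_smult[OF I M ann]
  have hom: "(\<lambda>r. I +>\<^bsub>R\<^esub> r) \<in> ring_hom R (R Quot I)" by (rule rcos_ring_hom)
  have c: "\<exists>r\<in>carrier R. c = I +>\<^bsub>R\<^esub> r" if "c \<in> carrier (R Quot I)" for c using that rcos_surj by blast
  note h = ring_hom_add[OF hom, symmetric] ring_hom_mult[OF hom, symmetric]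
  have one: "\<one>\<^bsub>R Quot I\<^esub> = I +>\<^bsub>R\<^esub> \<one>\<^bsub>R\<^esub>" using ring_hom_one[OF hom] by simp
  have ab: "abelian_group (factm R I M)"
  proof (rule abelian_groupI)
    fix x assume "x \<in> carrier (factm R I M)"
    then show "\<exists>y\<in>carrier (factm R I M). y \<oplus>\<^bsub>factm R I M\<^esub> x = \<zero>\<^bsub>factm R I M\<^esub>"
      by (intro bexI[of _ "\<ominus>\<^bsub>M\<^esub> x"]) (simp_all add: M.M.l_neg)
  qed (auto simp: M.M.a_ac)
  show ?thesis
  proof (intro left_module.intro left_module_axioms.intro Q.ring_axioms ab)
    fix a x assume "a \<in> carrier (R Quot I)" "x \<in> carrier (factm R I M)"
    then show "a \<odot>\<^bsub>factm R I M\<^esub> x \<in> carrier (factm R I M)" using c[of a] by (auto simp: sm M.smult_closed)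
  next
    fix a b x assume "a \<in> carrier (R Quot I)" "b \<in> carrier (R Quot I)" and x: "x \<in> carrier (factm R I M)"
    then obtain r t where rt: "r \<in> carrier R" "t \<in> carrier R" "a = I +>\<^bsub>R\<^esub> r" "b = I +>\<^bsub>R\<^esub> t" using c by metis
    show "(a \<oplus>\<^bsub>R Quot I\<^esub> b) \<odot>\<^bsub>factm R I M\<^esub> x = a \<odot>\<^bsub>factm R I M\<^esub> x \<oplus>\<^bsub>factm R I M\<^esub> b \<odot>\<^bsub>factm R I M\<^esub> x"
      unfolding rt(3,4) h(1)[OF rt(1,2)] using rt(1,2) x by (simp add: sm M.smult_l_distr)
    show "(a \<otimes>\<^bsub>R Quot I\<^esub> b) \<odot>\<^bsub>factm R I M\<^esub> x = a \<odot>\<^bsub>factm R I M\<^esub> (b \<odot>\<^bsub>factm R I M\<^esub> x)"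
      unfolding rt(3,4) h(2)[OF rt(1,2)] using rt(1,2) x by (simp add: sm M.smult_assoc1 M.smult_closed)
  next
    fix a x y assume "a \<in> carrier (R Quot I)" "x \<in> carrier (factm R I M)" "y \<in> carrier (factm R I M)"
    then show "a \<odot>\<^bsub>factm R I M\<^esub> (x \<oplus>\<^bsub>factm R I M\<^esub> y) = a \<odot>\<^bsub>factm R I M\<^esub> x \<oplus>\<^bsub>factm R I M\<^esub> a \<odot>\<^bsub>factm R I M\<^esub> y"
      using c[of a] by (auto simp: sm M.smult_r_distr)
  next
    fix x assume "x \<in> carrier (factm R I M)"
    then show "\<one>\<^bsub>R Quot I\<^esub> \<odot>\<^bsub>factm R I M\<^esub> x = x" unfolding one by (simp add: sm M.smult_one)
  qed
qed

section \<open>The second syzygy\<close>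

context fl_ring
begin

text \<open>The projective cover of the first syzygy is the image of the idempotent \<open>q\<close> of \<open>R\<^sup>n\<close>, so that the second
  syzygy is cut out of the \<open>n\<close>-th power of the radical by maps between free modules.\<close>

lemma second_syzygy:
  fixes X :: "'r fgmod"
  assumes X: "fg_module R X"
  shows "\<exists>n m G q. \<exists>Y :: 'r fgmod. G \<in> lin_maps R (free R n) (free R m) \<and> q \<in> lin_maps R (free R n) (free R n) \<and>
    (\<forall>z\<in>carrier (free R n). \<forall>i. G z = \<zero>\<^bsub>free R m\<^esub> \<longrightarrow> q z = z \<longrightarrow> z i \<in> jacobson_radical R) \<and>
    fg_module R Y \<and> mod_iso R (free R n\<lparr>carrier := {z \<in> carrier (free R n). G z = \<zero>\<^bsub>free R m\<^esub> \<and> q z = z}\<rparr>) Y \<and>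
    (\<forall>r. pd_le R r X \<longrightarrow> pd_le R r Y) \<and> (\<forall>d. pd_le R d Y \<longrightarrow> pd_le R (Suc (Suc d)) X)"
proof -
  obtain m f0 where f0: "f0 \<in> lin_maps R (free R m) X" "f0 ` carrier (free R m) = carrier X"
    using free_cover[OF X] by metis
  let ?E = "free R m"
  have lE [simp]: "left_module R ?E" by (rule free_left_module[OF ring])
  have lX [simp]: "left_module R X" using X by simp
  obtain P0 :: "'r fgmod" and h k where P0: "fg_module R P0" "h \<in> lin_maps R ?E P0" "k \<in> lin_maps R P0 ?E"
    "\<And>x. x \<in> carrier ?E \<Longrightarrow> k (h x) = x" "\<And>x. x \<in> carrier P0 \<Longrightarrow> h (k x) = x"
    using represent[OF free_fg[OF ring]] by metis
  have lP0 [simp]: "left_module R P0" using P0(1) by simp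
  note Rk = lin_rules[OF lP0 lE P0(3)] and Rh = lin_rules[OF lE lP0 P0(2)]
  have prP0: "projective R P0" by (rule projective_free_retract[OF P0(1,3,2,5)])
  let ?e = "\<lambda>x. f0 (k x)"
  have el: "?e \<in> lin_maps R P0 X" by (rule lin_comp[OF P0(3) f0(1)])
  have e0: "epi R P0 X ?e"
  proof (rule epiI[OF el])
    fix y assume "y \<in> carrier X"
    then have "y \<in> f0 ` carrier ?E" using f0(2) by simp
    then obtain x where "x \<in> carrier ?E" "y = f0 x" by blast
    then show "\<exists>x\<in>carrier P0. ?e x = y" using P0(4) Rh(1) by (intro bexI[of _ "h x"]) auto
  qed
  let ?Y = "kern P0 X ?e"
  have fY: "fg_module R ?Y" by (rule kern_fg[OF P0(1) lX el])
  have lY [simp]: "left_module R ?Y" using fY by simp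
  obtain n g where g: "g \<in> lin_maps R (free R n) ?Y" "g ` carrier (free R n) = carrier ?Y"
    using free_cover[OF fY] by metis
  let ?F = "free R n"
  interpret F: left_module R ?F by (rule free_left_module[OF ring])
  have lF [simp]: "left_module R ?F" by (rule F.left_module_axioms)
  note Rg = lin_rules[OF lF lY g(1)]
  have gP: "g z \<in> carrier P0" if "z \<in> carrier ?F" for z using Rg(1)[OF that] by simp
  have gP0: "g \<in> lin_maps R ?F P0" using g(1) by (auto simp: lin_maps_def Pi_iff)
  \<comment> \<open>Composing with the injection \<open>k\<close> does not change the kernel of
    \<open>g\<close>, but it turns it into the kernel of a map between free modules, as
    \<open>free_subring_scale\<close> requires.\<close>
  define G where "G z = k (g z)" for z
  have Gl: "G \<in> lin_maps R ?F ?E" unfolding G_def by (rule lin_comp[OF gP0 P0(3)])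
  have G0: "G z = \<zero>\<^bsub>?E\<^esub> \<longleftrightarrow> g z = \<zero>\<^bsub>P0\<^esub>" if "z \<in> carrier ?F" for z
  proof
    assume "G z = \<zero>\<^bsub>?E\<^esub>"
    then have "h (k (g z)) = \<zero>\<^bsub>P0\<^esub>" using Rh(4) by (simp add: G_def)
    then show "g z = \<zero>\<^bsub>P0\<^esub>" using P0(5)[OF gP[OF that]] by simp
  qed (simp add: G_def Rk(4))
  let ?N = "{z \<in> carrier ?F. G z = \<zero>\<^bsub>?E\<^esub>}"
  have N: "submodule ?N R ?F" by (rule lin_kernel_submodule[OF lF lE Gl])
  obtain q where q: "q \<in> lin_maps R ?F ?F" "\<And>z. z \<in> carrier ?F \<Longrightarrow> q (q z) = q z"
    "\<And>z. z \<in> carrier ?F \<Longrightarrow> q z = \<zero>\<^bsub>?F\<^esub> \<Longrightarrow> z \<in> ?N"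
    and sup: "\<And>W. submodule W R ?F \<Longrightarrow> W \<subseteq> q ` carrier ?F \<Longrightarrow> q ` carrier ?F \<subseteq> W <+>\<^bsub>?F\<^esub> ?N \<Longrightarrow> W = q ` carrier ?F"
    by (rule free_projective_cover[OF N]) blast
  note Rq = lin_rules[OF lF lF q(1)]
  let ?U = "?F\<lparr>carrier := q ` carrier ?F\<rparr>"
  have Us: "submodule (q ` carrier ?F) R ?F" by (rule lin_image_submodule[OF lF lF q(1) F.submodule_carrier])
  have fU: "fg_module R ?U" by (rule fg_sub[OF free_fg[OF ring] Us])
  have lU [simp]: "left_module R ?U" using fU by simp
  have UF: "x \<in> carrier ?F" if "x \<in> carrier ?U" for x using that Rq(1) by auto
  have qU: "q x = x" if "x \<in> carrier ?U" for x using that q(2) by auto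
  obtain P1 :: "'r fgmod" and a b where P1: "fg_module R P1" "a \<in> lin_maps R ?U P1" "b \<in> lin_maps R P1 ?U"
    "\<And>x. x \<in> carrier ?U \<Longrightarrow> b (a x) = x" "\<And>x. x \<in> carrier P1 \<Longrightarrow> a (b x) = x"
    using represent[OF fU] by metis
  have lP1 [simp]: "left_module R P1" using P1(1) by simp
  note Ra = lin_rules[OF lU lP1 P1(2)] and Rb = lin_rules[OF lP1 lU P1(3)]
  have bF: "b \<in> lin_maps R P1 ?F" using P1(3) UF by (auto simp: lin_maps_def Pi_iff)
  have "q \<in> lin_maps R ?F ?U" by (rule lin_corestrict[OF q(1)]) simp
  then have aq: "(\<lambda>z. a (q z)) \<in> lin_maps R ?F P1" by (rule lin_comp[OF _ P1(2)])
  have prP1: "projective R P1"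
    by (rule projective_free_retract[OF P1(1) bF aq]) (use qU[OF Rb(1)] P1(5) in simp)
  \<comment> \<open>\<open>g\<close> kills the kernel of \<open>q\<close>, so it is determined by
    its values on the image of \<open>q\<close>; this image therefore still covers the first
    syzygy.\<close>
  have gq: "g (q z) = g z" if z: "z \<in> carrier ?F" for z
  proof -
    let ?d = "z \<oplus>\<^bsub>?F\<^esub> \<ominus>\<^bsub>?F\<^esub> q z"
    have d: "?d \<in> carrier ?F" "q ?d = \<zero>\<^bsub>?F\<^esub>" using z Rq q(2) by simp_all
    then have "G ?d = \<zero>\<^bsub>?E\<^esub>" using q(3) by blast
    then have "g ?d = \<zero>\<^bsub>P0\<^esub>" using G0[OF d(1)] by simp
    then have 0: "g z \<oplus>\<^bsub>P0\<^esub> \<ominus>\<^bsub>P0\<^esub> g (q z) = \<zero>\<^bsub>P0\<^esub>"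
      using z lin_rules[OF lF lP0 gP0] Rq by simp
    have c: "g z \<in> carrier P0" "g (q z) \<in> carrier P0" using z gP Rq(1) by auto
    have "\<ominus>\<^bsub>P0\<^esub> g (q z) = \<ominus>\<^bsub>P0\<^esub> g z" by (rule lm_move[OF lP0 c(1) _ 0]) (use c in simp)
    then have "\<ominus>\<^bsub>P0\<^esub> (\<ominus>\<^bsub>P0\<^esub> g (q z)) = \<ominus>\<^bsub>P0\<^esub> (\<ominus>\<^bsub>P0\<^esub> g z)" by simp
    then show ?thesis using c by simp
  qed
  let ?ee = "\<lambda>x. g (b x)"
  have e1l: "?ee \<in> lin_maps R P1 ?Y" by (rule lin_comp[OF bF g(1)])
  have e1: "epi R P1 ?Y ?ee"
  proof (rule epiI[OF e1l])
    fix y assume "y \<in> carrier ?Y"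
    then have "y \<in> g ` carrier ?F" using g(2) by simp
    then obtain z where z: "z \<in> carrier ?F" "y = g z" by blast
    have "q z \<in> carrier ?U" using z by simp
    then show "\<exists>x\<in>carrier P1. ?ee x = y" using P1(4) Ra(1) gq z by (intro bexI[of _ "a (q z)"]) auto
  qed
  let ?Z = "kern P1 ?Y ?ee" and ?Zo = "{z \<in> carrier ?F. G z = \<zero>\<^bsub>?E\<^esub> \<and> q z = z}"
  have fZ: "fg_module R ?Z" by (rule kern_fg[OF P1(1) lY e1l])
  have Z0U: "z \<in> carrier ?U" if "z \<in> ?Zo" for z
  proof -
    have "z \<in> carrier ?F" "q z = z" using that by auto
    then show ?thesis by (metis (no_types, lifting) imageI partial_object.select_convs(1) partial_object.update_convs(1) partial_object.surjective)
  qed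
  have "mod_iso R (?F\<lparr>carrier := ?Zo\<rparr>) ?Z"
  proof (rule mod_isoI[where g = b])
    have "g (b (a z)) = \<zero>\<^bsub>P0\<^esub>" if "z \<in> ?Zo" for z using P1(4)[OF Z0U[OF that]] G0[of z] that by simp
    then show "a \<in> lin_maps R (?F\<lparr>carrier := ?Zo\<rparr>) ?Z"
      using Ra Z0U by (intro linI) (simp_all add: lin_add[OF P1(2), simplified] lin_smult[OF P1(2), simplified])
    show "b (a z) = z" if "z \<in> carrier (?F\<lparr>carrier := ?Zo\<rparr>)" for z using P1(4)[OF Z0U] that by simp
    show "a (b y) = y" if "y \<in> carrier ?Z" for y using P1(5) that by simp
    show "b y \<in> carrier (?F\<lparr>carrier := ?Zo\<rparr>)" if "y \<in> carrier ?Z" for y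
    proof -
      have y: "y \<in> carrier P1" "g (b y) = \<zero>\<^bsub>P0\<^esub>" using that by auto
      then show ?thesis using UF[OF Rb(1)] qU[OF Rb(1)] G0 by simp
    qed
  qed
  \<comment> \<open>Raising the level before each passage to a kernel keeps the bound
    \<open>r\<close> and spares a separate treatment of \<open>r = 0\<close>.\<close>
  moreover have "pd_le R r ?Z" if "pd_le R r X" for r
  proof -
    have "pd_le R (Suc r) X" by (rule pd_le_Suc[OF that])
    then have "pd_le R r ?Y" by (rule pd_le_SucD[OF _ prP0 e0])
    then have "pd_le R (Suc r) ?Y" by (rule pd_le_Suc)
    then show ?thesis by (rule pd_le_SucD[OF _ prP1 e1])
  qed
  moreover have "pd_le R (Suc (Suc d)) X" if "pd_le R d ?Z" for d
    by (rule pd_le_SucI[OF X prP0 e0 pd_le_SucI[OF fY prP1 e1 that]])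
  moreover have "z i \<in> jacobson_radical R" if "z \<in> carrier ?F" "G z = \<zero>\<^bsub>?E\<^esub>" "q z = z" for z i
    by (rule superfluous_in_radical[OF N q(1,2) sup]) (use that in auto)
  ultimately show ?thesis using Gl q(1) fZ
    by (intro exI[of _ n] exI[of _ m] exI[of _ G] exI[of _ q] exI[of _ ?Z]) auto
qed

end

section \<open>Extensions of Artin algebras\<close>

text \<open>A linear map between free modules over \<open>B\<close> is right multiplication by a
  matrix over \<open>B\<close>, which commutes with left multiplication by any \<open>a\<close> in
  \<open>A\<close>. The premise \<open>az\<close> keeps the product among the vectors over
  \<open>B\<close>, where \<open>f\<close> is known.\<close>

lemma free_subring_scale:
  assumes A: "ring A" and B: "subring B A" and f: "f \<in> lin_maps (A\<lparr>carrier := B\<rparr>) (free (A\<lparr>carrier := B\<rparr>) n) (free (A\<lparr>carrier := B\<rparr>) m)"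
    and z: "z \<in> carrier (free (A\<lparr>carrier := B\<rparr>) n)" and a: "a \<in> carrier A"
    and az: "(\<lambda>i. a \<otimes>\<^bsub>A\<^esub> z i) \<in> carrier (free (A\<lparr>carrier := B\<rparr>) n)"
  shows "f (\<lambda>i. a \<otimes>\<^bsub>A\<^esub> z i) = (\<lambda>i. a \<otimes>\<^bsub>A\<^esub> f z i)"
proof -
  let ?R = "A\<lparr>carrier := B\<rparr>"
  interpret A: ring A by fact
  have rR: "ring ?R" by (rule A.subring_is_ring[OF B])
  have Bc: "B \<subseteq> carrier A" by (rule subringE(1)[OF B])
  interpret FA: left_module A "free A m" by (rule free_left_module[OF A])
  let ?x = "\<lambda>i. f (unit_vec ?R i)"
  have x: "?x i \<in> carrier (free A m)" if "i < n" for i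
    using lin_closed[OF f unit_vec_carrier[OF rR that]] Bc by (auto simp: carrier_pow)
  have comb: "comb (free ?R m) y k w = comb (free A m) y k w" for y k w
    by (induction k) (simp_all add: pow_simps)
  have zc: "z i \<in> carrier A" for i
    using left_module.carrier_powD[OF self_left_module[OF rR] z, of i] Bc by auto
  have "f (\<lambda>i. a \<otimes>\<^bsub>A\<^esub> z i) = comb (free A m) ?x n (\<lambda>i. a \<otimes>\<^bsub>A\<^esub> z i)"
    using lin_free_eq_comb[OF rR free_left_module[OF rR] f az] comb by simp
  also have "\<dots> = a \<odot>\<^bsub>free A m\<^esub> comb (free A m) ?x n z"
    by (rule FA.comb_smult) (use x zc a in auto)
  also have "comb (free A m) ?x n z = f z"
    using lin_free_eq_comb[OF rR free_left_module[OF rR] f z] comb by simp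
  finally show ?thesis by (simp add: pow_simps)
qed

theorem corollary1p4:
  fixes K :: "'k ring" and A :: "('k, 'a) module" and B :: "'a set" and s :: nat
  assumes "artin_extension K B A"
    and "s \<ge> 1"
    and "left_ideal (rad_power (A\<lparr>carrier := B\<rparr>) s) A"
    and "representation_finite ((A\<lparr>carrier := B\<rparr>) Quot (rad_power (A\<lparr>carrier := B\<rparr>) (s - 1)))"
    and "torsionless_finite A"
  shows "fin_dim (A\<lparr>carrier := B\<rparr>) < \<infinity>"
proof -
  define R where "R = A\<lparr>carrier := B\<rparr>"
  define J where "J = rad_power R s"
  define I where "I = rad_power R (s - 1)"
  define S where "S = R Quot I"
  let ?Z = "(\<lambda>k. k \<odot>\<^bsub>A\<^esub> \<one>\<^bsub>A\<^esub>) ` carrier K"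
  have ext: "artin_algebra K A" "subring B A" "submodule B K A" "artin_algebra K R"
    using assms(1) by (auto simp: artin_extension_def R_def)
  have Bc: "B \<subseteq> carrier A" by (rule subringE(1)[OF ext(2)])
  have cR: "carrier R = B" and RZ: "R\<lparr>carrier := ?Z\<rparr> = A\<lparr>carrier := ?Z\<rparr>"
    and oR: "\<one>\<^bsub>R\<^esub> = \<one>\<^bsub>A\<^esub>" "\<zero>\<^bsub>R\<^esub> = \<zero>\<^bsub>A\<^esub>" "mult R = mult A" "add R = add A" by (simp_all add: R_def)
  interpret A: artin_ring A ?Z by (rule artin_algebra_artin_ring[OF ext(1)])
  interpret R: artin_ring R ?Z using artin_algebra_artin_ring[OF ext(4)] by (simp add: R_def)
  have idI: "ideal I R" and idJ: "ideal J R" unfolding I_def J_def by (rule R.rad_power_ideal)+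
  interpret I: ideal I R by (rule idI)
  interpret J: ideal J R by (rule idJ)
  have hom: "(\<lambda>r. I +>\<^bsub>R\<^esub> r) \<in> ring_hom R S" unfolding S_def by (rule I.rcos_ring_hom)
  have surj: "(\<lambda>r. I +>\<^bsub>R\<^esub> r) ` carrier R = carrier S" unfolding S_def by (rule I.rcos_surj)
  have rS: "ring S" unfolding S_def by (rule I.quotient_is_ring)
  interpret S: fl_ring S by (rule R.quotient_fl_ring[OF rS hom surj])
  \<comment> \<open>\<open>A\<close> and \<open>R\<close> share the central subring
    \<open>?Z\<close>, the image of \<open>K\<close>; a finitely generated \<open>A\<close>-module
    has finite length over it, hence over \<open>R\<close>.\<close>
  have restrict: "fg_module R N" if "fg_module A N" for N :: "'a fgmod"
  proof -
    have lA: "left_module A N" using that by (simp add: fg_module_def)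
    have lR: "left_module R N" unfolding R_def by (rule left_module_subring[OF lA ext(2)])
    have "fin_length R N"
      by (rule fin_length_subring[OF lR R.sub]) (simp add: RZ A.fg_fin_length_Z[OF that])
    then show ?thesis using lR R.fg_iff by blast
  qed
  obtain C1 where C1: "C1 \<subseteq> {M :: 'a fgmod. torsionless A M \<and> indecomposable A M}" "finite C1"
    "\<And>M. torsionless A M \<Longrightarrow> indecomposable A M \<Longrightarrow> \<exists>N\<in>C1. mod_iso A M N"
    using assms(5) unfolding torsionless_finite_def finite_upto_iso_def by blast
  have "finite_upto_iso S {M. fg_module S M \<and> indecomposable S M}"
    using assms(4) unfolding representation_finite_def S_def I_def R_def .
  then obtain C2 where C2: "C2 \<subseteq> {M :: 'a set fgmod. fg_module S M \<and> indecomposable S M}" "finite C2"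
    "\<forall>M\<in>{M :: 'a set fgmod. fg_module S M \<and> indecomposable S M}. \<exists>N\<in>C2. mod_iso S M N"
    unfolding finite_upto_iso_def by blast
  obtain k1 :: nat and X1 where X1: "C1 = X1 ` {i. i < k1}" using C1(2) finite_imp_nat_seg_image_inj_on by metis
  obtain k2 :: nat and Y where Y: "C2 = Y ` {i. i < k2}" using C2(2) finite_imp_nat_seg_image_inj_on by metis
  have fX1: "fg_module R (X1 j)" if "j < k1" for j
    by (rule restrict) (use C1(1) X1 that in \<open>auto simp: torsionless_def\<close>)
  define \<rho> where "\<rho> = (\<lambda>r. I +>\<^bsub>R\<^esub> r)"
  note hom = hom[folded \<rho>_def] and surj = surj[folded \<rho>_def]
  have fY: "fg_module S (Y j)" if "j < k2" for j using C2(1) Y that by auto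
  have fYr: "fg_module R (restr \<rho> (Y j))" if "j < k2" for j
  proof -
    have "left_module S (Y j)" "fin_length S (Y j)" using fY[OF that] S.fg_iff by blast+
    then show ?thesis using restr_left_module[OF R.ring hom] fin_length_restr[OF R.ring hom surj] R.fg_iff by blast
  qed
  have "\<exists>N :: 'a fgmod. j < k2 \<longrightarrow> fg_module R N \<and> mod_iso R (restr \<rho> (Y j)) N" for j
    using fg_module_represented[OF fYr] by blast
  then obtain X2 :: "nat \<Rightarrow> 'a fgmod" where X2: "\<And>j. j < k2 \<Longrightarrow> fg_module R (X2 j)"
    "\<And>j. j < k2 \<Longrightarrow> mod_iso R (restr \<rho> (Y j)) (X2 j)" by metis
  \<comment> \<open>One family for both sources: torsionless indecomposables over \<open>A\<close>,
    followed by the syzygies of the indecomposables over \<open>S\<close>. Syzygies are taken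
    because \<open>ses_pull\<close> lets the quotient \<open>Q\<close> enter only in this
    way.\<close>
  define X where "X j = (if j < k1 then X1 j else syz R (X2 (j - k1)))" for j
  have fX: "fg_module R (X j)" if "j < k1 + k2" for j
    using that fX1 R.syz_fg[OF X2(1)] by (simp add: X_def)
  obtain d where d: "\<And>u v L N Y f p r. ses R L N Y f p \<Longrightarrow> addp R {..<k1 + k2} X u L \<Longrightarrow> addp R {..<k1 + k2} X v N \<Longrightarrow>
      pd_le R r Y \<Longrightarrow> pd_le R d Y"
    using R.finite_pd_bound[of "k1 + k2" X, OF fX] by blast
  \<comment> \<open>The two extra steps lead back from the second syzygy to
    \<open>M\<close>.\<close>
  have "pd_le R (Suc (Suc d)) M" if M: "pd_le R r M" for M :: "'a fgmod" and r
  proof -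
    obtain n m G q and N :: "'a fgmod" where G: "G \<in> lin_maps R (free R n) (free R m)" and q: "q \<in> lin_maps R (free R n) (free R n)"
      and rad: "\<forall>z\<in>carrier (free R n). \<forall>i. G z = \<zero>\<^bsub>free R m\<^esub> \<longrightarrow> q z = z \<longrightarrow> z i \<in> jacobson_radical R"
      and N: "fg_module R N" "mod_iso R (free R n\<lparr>carrier := {z \<in> carrier (free R n). G z = \<zero>\<^bsub>free R m\<^esub> \<and> q z = z}\<rparr>) N"
      and pdN: "\<forall>r. pd_le R r M \<longrightarrow> pd_le R r N" "\<forall>d. pd_le R d N \<longrightarrow> pd_le R (Suc (Suc d)) M"
      using R.second_syzygy[OF R.pd_le_fg[OF M]] by blast
    let ?F = "free R n" and ?E = "free R m" and ?FA = "free A n"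
    define Z0 where "Z0 = {z \<in> carrier ?F. G z = \<zero>\<^bsub>?E\<^esub> \<and> q z = z}"
    define Z1 where "Z1 = {z \<in> Z0. \<forall>i. z i \<in> J}"
    interpret F: left_module R ?F by (rule free_left_module[OF R.ring])
    interpret E: left_module R ?E by (rule free_left_module[OF R.ring])
    interpret FA: left_module A ?FA by (rule free_left_module[OF A.ring])
    note RG = R.lin_rules[OF F.left_module_axioms E.left_module_axioms G] and Rq = R.lin_rules[OF F.left_module_axioms F.left_module_axioms q]
    have Z0: "submodule Z0 R ?F" unfolding F.submodule_iff Z0_def
      by (auto simp: RG Rq F.smult_closed)
    have Z0c: "z \<in> carrier ?F" if "z \<in> Z0" for z using that by (simp add: Z0_def)
    have Z1': "submodule Z1 R ?F" unfolding F.submodule_iff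
    proof (intro conjI ballI)
      show "Z1 \<subseteq> carrier ?F" using Z0c by (auto simp: Z1_def)
      show "\<zero>\<^bsub>?F\<^esub> \<in> Z1" using Z0 by (simp add: Z1_def F.submodule_iff) (simp add: pow_simps)
      show "x \<oplus>\<^bsub>?F\<^esub> y \<in> Z1" if "x \<in> Z1" "y \<in> Z1" for x y
        using Z0 that by (simp add: Z1_def F.submodule_iff) (simp add: pow_simps)
      show "r \<odot>\<^bsub>?F\<^esub> x \<in> Z1" if "r \<in> carrier R" "x \<in> Z1" for r x
        using Z0 that by (simp add: Z1_def F.submodule_iff) (simp add: pow_simps J.I_l_closed)
    qed
    have Z1Z0: "Z1 \<subseteq> Z0" by (simp add: Z1_def)
    have zz: "\<zero>\<^bsub>?E\<^esub> = (\<lambda>_. \<zero>\<^bsub>A\<^esub>)" "\<zero>\<^bsub>?F\<^esub> = (\<lambda>_. \<zero>\<^bsub>A\<^esub>)" by (simp_all add: pow_simps oR)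
    have Z1A: "submodule Z1 A ?FA" unfolding FA.submodule_iff
    proof (intro conjI ballI)
      show "Z1 \<subseteq> carrier ?FA" using Z0c Bc by (auto simp: Z1_def carrier_pow cR oR)
      have "\<zero>\<^bsub>?FA\<^esub> = \<zero>\<^bsub>?F\<^esub>" by (simp add: pow_simps oR)
      then show "\<zero>\<^bsub>?FA\<^esub> \<in> Z1" using Z1' by (simp add: F.submodule_iff)
      have "x \<oplus>\<^bsub>?FA\<^esub> y = x \<oplus>\<^bsub>?F\<^esub> y" for x y by (simp add: pow_simps oR)
      then show "x \<oplus>\<^bsub>?FA\<^esub> y \<in> Z1" if "x \<in> Z1" "y \<in> Z1" for x y using Z1' that by (simp add: F.submodule_iff)
      fix a z assume a: "a \<in> carrier A" and z: "z \<in> Z1"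
      let ?az = "\<lambda>i. a \<otimes>\<^bsub>A\<^esub> z i"
      have zF: "z \<in> carrier ?F" and zq: "G z = \<zero>\<^bsub>?E\<^esub>" "q z = z" and zJ: "z i \<in> J" for i
        using z by (auto simp: Z1_def Z0_def)
      \<comment> \<open>Multiplication by \<open>a\<close> leaves the vectors over \<open>B\<close>
        in general. On \<open>Z1\<close> it does not, since \<open>J\<close> is a left ideal of
        \<open>A\<close>; this is the premise needed for \<open>free_subring_scale\<close>.\<close>
      have azJ: "?az i \<in> J" for i using assms(3) a zJ by (simp add: left_ideal_def J_def R_def)
      have azF: "?az \<in> carrier ?F" using azJ J.Icarr zF a by (simp add: carrier_pow oR)
      have "G ?az = (\<lambda>i. a \<otimes>\<^bsub>A\<^esub> G z i)" "q ?az = (\<lambda>i. a \<otimes>\<^bsub>A\<^esub> q z i)"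
        using free_subring_scale[OF A.ring ext(2) G[unfolded R_def] zF[unfolded R_def] a azF[unfolded R_def]]
          free_subring_scale[OF A.ring ext(2) q[unfolded R_def] zF[unfolded R_def] a azF[unfolded R_def]] by auto
      then have "?az \<in> Z1" using azF azJ zq a by (simp add: Z1_def Z0_def zz)
      then show "a \<odot>\<^bsub>?FA\<^esub> z \<in> Z1" by (simp add: pow_simps)
    qed
    let ?Mz = "?F\<lparr>carrier := Z0\<rparr>" and ?Mj = "?F\<lparr>carrier := Z1\<rparr>"
    \<comment> \<open>Once the carrier is overwritten, the free modules over \<open>A\<close> and
      over \<open>R\<close> are equal as records; only the ring of scalars in the predicates tells
      them apart.\<close>
    have FA1: "?FA\<lparr>carrier := W\<rparr> = ?F\<lparr>carrier := W\<rparr>" for W by (simp add: pow_def self_def oR)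
    have fF: "fg_module R ?F" by (rule free_fg[OF R.ring])
    have fM0: "fg_module R ?Mz" and fM1: "fg_module R ?Mj" by (rule R.fg_sub[OF fF Z0], rule R.fg_sub[OF fF Z1'])
    interpret M0: left_module R ?Mz using fM0 by (simp add: fg_module_def)
    have Z1s: "submodule Z1 R ?Mz" using F.submodule_sub_iff[OF Z0] Z1' Z1Z0 by blast
    define Q where "Q = quot ?Mz Z1"
    have lQ: "left_module R Q" unfolding Q_def by (rule M0.quot_left_module[OF Z1s])
    note Qp = M0.quot_proj[OF Z1s, folded Q_def]
    have fQ: "fg_module R Q" by (rule R.fg_image[OF fM0 lQ Qp(1,2)])
    interpret Q: left_module R Q by (rule lQ)
    \<comment> \<open>A scalar from the power \<open>s - 1\<close> of the radical times coordinates
      from the radical falls into the power \<open>Suc (s - 1)\<close>, which is \<open>J\<close>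
      because \<open>s\<close> is positive.\<close>
    have ann: "r \<odot>\<^bsub>Q\<^esub> x = \<zero>\<^bsub>Q\<^esub>" if r: "r \<in> I" and x: "x \<in> carrier Q" for r x
    proof -
      have "x \<in> mcoset ?Mz Z1 ` carrier ?Mz" using x Qp(2) by simp
      then obtain z where z: "z \<in> Z0" "x = mcoset ?Mz Z1 z" by auto
      have rc: "r \<in> carrier R" by (rule I.Icarr[OF r])
      have "z i \<in> jacobson_radical R" for i using rad z(1) by (simp add: Z0_def)
      then have "r \<otimes>\<^bsub>R\<^esub> z i \<in> rad_power R (Suc (s - 1))" for i by (rule R.rad_power_mult[OF r[unfolded I_def]])
      then have "r \<otimes>\<^bsub>R\<^esub> z i \<in> J" for i using assms(2) by (simp add: J_def)
      moreover have "r \<odot>\<^bsub>?F\<^esub> z \<in> Z0" using Z0 rc z(1) by (simp add: F.submodule_iff)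
      ultimately have "r \<odot>\<^bsub>?Mz\<^esub> z \<in> Z1" by (simp add: Z1_def) (simp add: pow_simps)
      then have "mcoset ?Mz Z1 (r \<odot>\<^bsub>?Mz\<^esub> z) = \<zero>\<^bsub>Q\<^esub>" using Qp(3) by blast
      then show ?thesis using lin_smult[OF Qp(1) rc, of z] z by simp
    qed
    \<comment> \<open>The group of \<open>Q\<close> regarded over the quotient ring. Its submodules
      are submodules over \<open>R\<close>, so finite length carries over and its indecomposable
      summands can be recorded over \<open>R\<close>.\<close>
    define QS where "QS = factm R I Q"
    have lQS: "left_module S QS" unfolding QS_def S_def by (rule factm_left_module[OF idI lQ ann])
    have sm: "\<rho> r \<odot>\<^bsub>QS\<^esub> x = r \<odot>\<^bsub>Q\<^esub> x" if "r \<in> carrier R" "x \<in> carrier Q" for r x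
      unfolding QS_def \<rho>_def by (rule factm_smult[OF idI lQ ann that])
    have cQS: "carrier QS = carrier Q" "\<zero>\<^bsub>QS\<^esub> = \<zero>\<^bsub>Q\<^esub>" "add QS = add Q" by (simp_all add: QS_def)
    have subQ: "submodule U R Q" if "submodule U S QS" for U
    proof -
      have U: "U \<subseteq> carrier Q" "\<zero>\<^bsub>Q\<^esub> \<in> U" "\<forall>x\<in>U. \<forall>y\<in>U. x \<oplus>\<^bsub>Q\<^esub> y \<in> U" "\<forall>c\<in>carrier S. \<forall>x\<in>U. c \<odot>\<^bsub>QS\<^esub> x \<in> U"
        using that unfolding left_module.submodule_iff[OF lQS] cQS by blast+
      have "r \<odot>\<^bsub>Q\<^esub> x \<in> U" if "r \<in> carrier R" "x \<in> U" for r x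
        using U(1,4) sm[of r x] that ring_hom_closed[OF hom] by (metis subsetD)
      then show ?thesis using U unfolding Q.submodule_iff by blast
    qed
    have flQS: "fin_length S QS"
    proof -
      obtain l where "\<And>U V. submodule U R Q \<Longrightarrow> submodule V R Q \<Longrightarrow> U \<subset> V \<Longrightarrow> (l U :: nat) < l V"
        using fQ R.fg_iff unfolding fin_length_def by blast
      then show ?thesis unfolding fin_length_def using subQ by (intro exI[of _ l]) blast
    qed
    have "\<exists>v. addp R {..<k2} X2 v Q"
    proof (rule R.addp_decompose[OF _ lQS flQS fQ _ _ _ subQ _ fQ mod_iso_refl])
      fix W assume W: "submodule W S QS" and ind: "indecomposable S (QS\<lparr>carrier := W\<rparr>)"
      let ?W = "QS\<lparr>carrier := W\<rparr>"
      have lW: "left_module S ?W" by (rule left_module.submodule_left_module[OF lQS W])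
      have fW: "fg_module S ?W" using S.fg_iff lW fin_length_sub[OF lQS flQS W] by blast
      obtain N' :: "'a set fgmod" where N': "fg_module S N'" "mod_iso S ?W N'" using fg_module_represented[OF fW] by blast
      have "indecomposable S N'" by (rule indecomposable_iso[OF lW _ N'(2) ind]) (use N'(1) in \<open>simp add: fg_module_def\<close>)
      then obtain L where "L \<in> C2" "mod_iso S N' L" using C2(3) N'(1) by blast
      then obtain j where j: "j < k2" "mod_iso S N' (Y j)" using Y by blast
      have "mod_iso S ?W (Y j)" by (rule mod_iso_trans[OF N'(2) j(2)])
      then obtain f where f: "f \<in> lin_maps S ?W (Y j)" "bij_betw f W (carrier (Y j))" by (auto simp: mod_iso_def)
      have Wc: "W \<subseteq> carrier Q" using W unfolding left_module.submodule_iff[OF lQS] cQS by blast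
      have "f \<in> lin_maps R (Q\<lparr>carrier := W\<rparr>) (restr \<rho> (Y j))"
      proof (rule linI)
        fix r x assume rx: "r \<in> carrier R" "x \<in> carrier (Q\<lparr>carrier := W\<rparr>)"
        have "f (\<rho> r \<odot>\<^bsub>QS\<^esub> x) = \<rho> r \<odot>\<^bsub>Y j\<^esub> f x" using lin_smult[OF f(1) ring_hom_closed[OF hom rx(1)]] rx(2) by simp
        then show "f (r \<odot>\<^bsub>Q\<lparr>carrier := W\<rparr>\<^esub> x) = r \<odot>\<^bsub>restr \<rho> (Y j)\<^esub> f x" using sm[of r x] rx Wc by auto
      qed (use lin_closed[OF f(1)] lin_add[OF f(1)] in \<open>simp_all add: cQS\<close>)
      then have "mod_iso R (Q\<lparr>carrier := W\<rparr>) (restr \<rho> (Y j))" using f(2) by (auto simp: mod_iso_def)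
      then have "mod_iso R (Q\<lparr>carrier := W\<rparr>) (X2 j)" using mod_iso_trans X2(2)[OF j(1)] by blast
      then show "\<exists>j\<in>{..<k2}. mod_iso R (Q\<lparr>carrier := W\<rparr>) (X2 j)" using j(1) by blast
    qed (use X2(1) cQS in auto)
    then obtain v where v: "addp R {..<k2} X2 v Q" by blast
    obtain F2 q2 where F2: "projective R F2" "epi R F2 Q q2" "addp R {..<k2} (\<lambda>j. syz R (X2 j)) v (kern F2 Q q2)"
      using R.addp_syz[OF _ v] X2(1) by blast
    obtain N1 :: "'a fgmod" and \<alpha> \<beta> where N1: "fg_module R N1" "\<alpha> \<in> lin_maps R ?Mj N1" "\<beta> \<in> lin_maps R N1 ?Mj"
      "\<And>x. x \<in> carrier ?Mj \<Longrightarrow> \<beta> (\<alpha> x) = x" "\<And>x. x \<in> carrier N1 \<Longrightarrow> \<alpha> (\<beta> x) = x"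
      using R.represent[OF fM1] by metis
    have isoN1: "mod_iso R ?Mj N1" by (rule mod_isoI[where g = \<beta>, OF N1(2,4) lin_closed[OF N1(3)] N1(5)])
    have lM1A: "left_module A ?Mj" using FA.submodule_left_module[OF Z1A] by (simp add: FA1)
    have flM1A: "fin_length A ?Mj" using fin_length_sub[OF FA.left_module_axioms A.free_fin_length Z1A] by (simp add: FA1)
    \<comment> \<open>Here the decomposition takes place over \<open>A\<close>: the indecomposable
      summands are submodules of a free \<open>A\<close>-module, hence torsionless, and are then
      read as \<open>R\<close>-modules.\<close>
    have "\<exists>u. addp R {..<k1} X1 u N1"
    proof (rule R.addp_decompose[OF _ lM1A flM1A fM1 refl refl refl _ _ N1(1) isoN1])
      fix U assume U: "submodule U A ?Mj"
      show "submodule U R ?Mj" using submodule_subring[OF lM1A ext(2) U] by (simp add: R_def)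
      assume ind: "indecomposable A (?Mj\<lparr>carrier := U\<rparr>)"
      have U': "submodule U A ?FA" using U FA.submodule_sub_iff[OF Z1A] by (simp add: FA1)
      have lU: "left_module A (?FA\<lparr>carrier := U\<rparr>)" by (rule FA.submodule_left_module[OF U'])
      have ind': "indecomposable A (?FA\<lparr>carrier := U\<rparr>)" using ind by (simp add: FA1)
      have fU: "fg_module A (?FA\<lparr>carrier := U\<rparr>)" by (rule A.fg_sub[OF free_fg[OF A.ring] U'])
      obtain N' :: "'a fgmod" where N': "fg_module A N'" "mod_iso A (?FA\<lparr>carrier := U\<rparr>) N'" using fg_module_represented[OF fU] by blast
      have "indecomposable A N'" by (rule indecomposable_iso[OF lU _ N'(2) ind']) (use N'(1) in \<open>simp add: fg_module_def\<close>)
      moreover have "torsionless A N'" by (rule A.torsionless_of_submodule_free[OF U' ind' N'])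
      ultimately obtain L where "L \<in> C1" "mod_iso A N' L" using C1(3) by blast
      then obtain j where j: "j < k1" "mod_iso A N' (X1 j)" using X1 by blast
      have "mod_iso A (?FA\<lparr>carrier := U\<rparr>) (X1 j)" by (rule mod_iso_trans[OF N'(2) j(2)])
      then obtain f where f: "f \<in> lin_maps A (?FA\<lparr>carrier := U\<rparr>) (X1 j)" "bij_betw f U (carrier (X1 j))" by (auto simp: mod_iso_def)
      have "f \<in> lin_maps R (?FA\<lparr>carrier := U\<rparr>) (X1 j)" using lin_maps_subring[OF ext(2) f(1)] by (simp add: R_def)
      then have "mod_iso R (?Mj\<lparr>carrier := U\<rparr>) (X1 j)" using f(2) by (auto simp: mod_iso_def FA1)
      then show "\<exists>j\<in>{..<k1}. mod_iso R (?Mj\<lparr>carrier := U\<rparr>) (X1 j)" using j(1) by blast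
    qed (use fX1 in auto)
    then obtain u where u: "addp R {..<k1} X1 u N1" by blast
    obtain f g where f: "f \<in> lin_maps R ?Mz N" and g: "g \<in> lin_maps R N ?Mz"
      and gf: "\<And>x. x \<in> carrier ?Mz \<Longrightarrow> g (f x) = x" and fg: "\<And>y. y \<in> carrier N \<Longrightarrow> f (g y) = y"
      using mod_isoE[OF M0.left_module_axioms N(2)[folded Z0_def]] by metis
    have lN: "left_module R N" and lN1: "left_module R N1" using N(1) N1(1) by (auto simp: fg_module_def)
    have \<beta>': "\<beta> \<in> lin_maps R N1 ?Mz" using N1(3) Z1Z0 by (auto simp: lin_maps_def Pi_iff)
    have \<beta>Z: "\<beta> x \<in> Z1" if "x \<in> carrier N1" for x using lin_closed[OF N1(3) that] by simp
    let ?i = "\<lambda>x. f (\<beta> x)" and ?p = "\<lambda>y. mcoset ?Mz Z1 (g y)"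
    have il: "?i \<in> lin_maps R N1 N" by (rule lin_comp[OF \<beta>' f])
    have pl: "?p \<in> lin_maps R N Q" by (rule lin_comp[OF g Qp(1)])
    have ses: "ses R N1 N Q ?i ?p" unfolding ses_def
    proof (intro conjI)
      show "inj_on ?i (carrier N1)"
      proof (rule inj_onI)
        fix x y assume xy: "x \<in> carrier N1" "y \<in> carrier N1" "?i x = ?i y"
        have b: "\<beta> x \<in> carrier ?Mz" "\<beta> y \<in> carrier ?Mz" using \<beta>Z[OF xy(1)] \<beta>Z[OF xy(2)] Z1Z0 by auto
        have "\<beta> x = g (f (\<beta> x))" by (rule gf[OF b(1), symmetric])
        also have "\<dots> = g (f (\<beta> y))" using xy(3) by (rule arg_cong)
        also have "\<dots> = \<beta> y" by (rule gf[OF b(2)])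
        finally have "\<beta> x = \<beta> y" .
        then have "\<alpha> (\<beta> x) = \<alpha> (\<beta> y)" by (rule arg_cong)
        then show "x = y" unfolding N1(5)[OF xy(1)] N1(5)[OF xy(2)] .
      qed
      show "epi R N Q ?p"
      proof (rule R.epiI[OF pl])
        fix y assume "y \<in> carrier Q"
        then have "y \<in> mcoset ?Mz Z1 ` carrier ?Mz" using Qp(2) by simp
        then obtain z where z: "z \<in> carrier ?Mz" "y = mcoset ?Mz Z1 z" by blast
        then show "\<exists>x\<in>carrier N. ?p x = y" using gf[OF z(1)] lin_closed[OF f z(1)] by (intro bexI[of _ "f z"]) auto
      qed
      have p0: "?p y = \<zero>\<^bsub>Q\<^esub> \<longleftrightarrow> g y \<in> Z1" if "y \<in> carrier N" for y
        using Qp(3) lin_closed[OF g that] by blast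
      show "?i ` carrier N1 = {x \<in> carrier N. ?p x = \<zero>\<^bsub>Q\<^esub>}"
      proof (intro equalityI subsetI)
        fix y assume "y \<in> ?i ` carrier N1"
        then obtain x where x: "x \<in> carrier N1" "y = ?i x" by blast
        have "y \<in> carrier N" using lin_closed[OF il x(1)] x(2) by simp
        moreover have "g y \<in> Z1" using gf[of "\<beta> x"] \<beta>Z[OF x(1)] Z1Z0 x(2) by auto
        ultimately show "y \<in> {x \<in> carrier N. ?p x = \<zero>\<^bsub>Q\<^esub>}" using p0 by simp
      next
        fix y assume "y \<in> {x \<in> carrier N. ?p x = \<zero>\<^bsub>Q\<^esub>}"
        then have y: "y \<in> carrier N" "g y \<in> Z1" using p0 by auto
        then have "y = ?i (\<alpha> (g y))" using N1(4)[of "g y"] fg[OF y(1)] by simp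
        then show "y \<in> ?i ` carrier N1" using lin_closed[OF N1(2), of "g y"] y(2) by auto
      qed
    qed (use N N1 fQ il in auto)
    obtain T :: "'a fgmod" and i1 i2 p1 p2 where T: "fg_module R T" "biprod R N1 F2 T i1 i2 p1 p2"
      using R.biprod_exists[OF N1(1) R.projective_fg[OF F2(1)]] by metis
    \<comment> \<open>This brings \<open>N\<close> to the third place, where \<open>d\<close> bounds
      it, with the syzygy of \<open>Q\<close> as first term and \<open>N1\<close> together with a
      projective summand in the middle.\<close>
    obtain f' g' where s': "ses R (kern F2 Q q2) T N f' g'" using R.ses_pull[OF ses F2(1,2) T] by blast
    have "addp R {..<k1} X1 (\<lambda>i. u i + 0) T" by (rule R.addp_sum[OF _ u addp.proj[OF F2(1)] T]) (use fX1 in simp)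
    then obtain u' where "addp R {..<k1 + k2} X u' T"
      using R.addp_reindex[of "{..<k1}" X1 _ T "\<lambda>j. j" "{..<k1 + k2}" X] by (auto simp: X_def)
    moreover obtain v' where "addp R {..<k1 + k2} X v' (kern F2 Q q2)"
      using R.addp_reindex[OF F2(3), of "\<lambda>j. k1 + j" "{..<k1 + k2}" X] by (auto simp: X_def)
    moreover have "pd_le R r N" using pdN(1) M by blast
    ultimately have "pd_le R d N" using d[OF s'] by blast
    then show ?thesis using pdN(2) by blast
  qed
  then have "fin_dim R < \<infinity>" by (rule R.fin_dim_bound)
  then show ?thesis by (simp add: R_def)
qed

end
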